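(* Let $(R,\mathfrak{m},F)$ be a commutative local ring with residue field $F=R/\mathfrak{m}\neq \mathbb{F}_2$. Then the Grothendieck-Witt ring $GW(R)$ of inner product spaces over $R$ is, via the ring homomorphism $\pi:\mathbb{Z}[R^*]\to GW(R)$, $\langle a\rangle\mapsto\langle a\rangle$, the quotient ring of the integral group ring $\mathbb{Z}[R^*]$ of the group $R^*$ of units of $R$ modulo the following relations (that is, $\pi$ is surjective and its kernel is the ideal generated by the left-hand sides of these relations): (1) for all $a\in R^*$: $\langle\!\langle a^2\rangle\!\rangle=0$; (2) for all $a\in R^*$: $\langle\!\langle a\rangle\!\rangle\cdot h=0$; (3) (Steinberg relation) for all $a\in R^*$ with $1-a\in R^*$: $\langle\!\langle a\rangle\!\rangle\cdot\langle\!\langle 1-a\rangle\!\rangle=0$.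
   Context: An inner product space over a commutative ring $R$ is a finitely generated projective $R$-module $V$ equipped with a non-degenerate symmetric $R$-bilinear form $\mathfrak{b}:V\times V\to R$. $GW(R)$ is the Grothendieck group of the abelian monoid of isometry classes of inner product spaces over $R$ under orthogonal sum, with ring structure induced by tensor product. For $a\in R^*$, $\langle a\rangle$ denotes, in $\mathbb{Z}[R^*]$, the $\mathbb{Z}$-basis element corresponding to $a$, and, in $GW(R)$, the class of the rank one inner product space $R$ with form $\mathfrak{b}(x,y)=axy$. In $\mathbb{Z}[R^*]$ put $\langle\!\langle a\rangle\!\rangle=1-\langle a\rangle$ and $h=\langle 1\rangle+\langle -1\rangle$. *)

theory Defs
  imports "HOL-Algebra.Module" "HOL-Algebra.IntRing" "HOL-Library.Poly_Mapping"
begin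

locale local_ring = cring R + maximalideal \<mm> R for \<mm> and R (structure) +
  assumes maximalideal_unique: "maximalideal J R \<Longrightarrow> J = \<mm>"

text \<open>Modules are records of the library type; their \<open>mult\<close> and \<open>one\<close> fields carry no meaning.\<close>

definition module_hom ::
  "('a, 'r) ring_scheme \<Rightarrow> ('a, 'b, 'm) module_scheme \<Rightarrow> ('a, 'c, 'n) module_scheme \<Rightarrow> ('b \<Rightarrow> 'c) set"
  where "module_hom R M N = {h \<in> carrier M \<rightarrow> carrier N.
    (\<forall>x\<in>carrier M. \<forall>y\<in>carrier M. h (x \<oplus>\<^bsub>M\<^esub> y) = h x \<oplus>\<^bsub>N\<^esub> h y) \<and>
    (\<forall>r\<in>carrier R. \<forall>x\<in>carrier M. h (r \<odot>\<^bsub>M\<^esub> x) = r \<odot>\<^bsub>N\<^esub> h x)}"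

definition gen_submodule ::
  "('a, 'r) ring_scheme \<Rightarrow> ('a, 'b, 'm) module_scheme \<Rightarrow> 'b set \<Rightarrow> 'b set"
  where "gen_submodule R M S = \<Inter>{N. submodule N R M \<and> S \<subseteq> N}"

definition regular_module :: "('a, 'r) ring_scheme \<Rightarrow> ('a, 'a) module"
  where "regular_module R = \<lparr>carrier = carrier R, monoid.mult = monoid.mult R, one = one R,
    zero = zero R, add = add R, smult = monoid.mult R\<rparr>"

text \<open>The free module on the set \<open>X\<close>: finitely supported functions \<open>X \<rightarrow> R\<close>, extended by zero.\<close>

definition free_module :: "('a, 'r) ring_scheme \<Rightarrow> 'x set \<Rightarrow> ('a, 'x \<Rightarrow> 'a) module"
  where "free_module R X = \<lparr>
    carrier = {f. range f \<subseteq> carrier R \<and> finite {x. f x \<noteq> \<zero>\<^bsub>R\<^esub>} \<and> (\<forall>x. x \<notin> X \<longrightarrow> f x = \<zero>\<^bsub>R\<^esub>)},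
    monoid.mult = undefined, one = undefined,
    zero = (\<lambda>_. \<zero>\<^bsub>R\<^esub>), add = (\<lambda>f g x. f x \<oplus>\<^bsub>R\<^esub> g x), smult = (\<lambda>r f x. r \<otimes>\<^bsub>R\<^esub> f x)\<rparr>"

definition free_basis :: "('a, 'r) ring_scheme \<Rightarrow> 'x \<Rightarrow> 'x \<Rightarrow> 'a"
  where "free_basis R x = (\<lambda>y. if y = x then \<one>\<^bsub>R\<^esub> else \<zero>\<^bsub>R\<^esub>)"

definition quotient_module ::
  "('a, 'r) ring_scheme \<Rightarrow> ('a, 'b, 'm) module_scheme \<Rightarrow> 'b set \<Rightarrow> ('a, 'b set) module"
  where "quotient_module R M N = \<lparr>carrier = a_rcosets\<^bsub>M\<^esub> N, monoid.mult = undefined, one = undefined,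
    zero = N, add = (\<lambda>C D. C <+>\<^bsub>M\<^esub> D), smult = (\<lambda>r C. \<Union>x\<in>C. N +>\<^bsub>M\<^esub> (r \<odot>\<^bsub>M\<^esub> x))\<rparr>"

definition finitely_generated :: "('a, 'r) ring_scheme \<Rightarrow> ('a, 'b, 'm) module_scheme \<Rightarrow> bool"
  where "finitely_generated R M \<longleftrightarrow>
    (\<exists>S. finite S \<and> S \<subseteq> carrier M \<and> gen_submodule R M S = carrier M)"

text \<open>Projective means: direct summand of a free module. The index set \<open>X\<close> can be taken in the
  type of the elements of \<open>M\<close>, since \<open>X = carrier M\<close> already works when any \<open>X\<close> does.\<close>

definition projective :: "('a, 'r) ring_scheme \<Rightarrow> ('a, 'b, 'm) module_scheme \<Rightarrow> bool"
  where "projective R M \<longleftrightarrow> (\<exists>(X :: 'b set) i p.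
    i \<in> module_hom R M (free_module R X) \<and> p \<in> module_hom R (free_module R X) M \<and>
    (\<forall>x\<in>carrier M. p (i x) = x))"

text \<open>The dual module, with functionals normalised to be \<open>undefined\<close> off the carrier.\<close>

definition dual :: "('a, 'r) ring_scheme \<Rightarrow> ('a, 'b, 'm) module_scheme \<Rightarrow> ('b \<Rightarrow> 'a) set"
  where "dual R M = module_hom R M (regular_module R) \<inter> extensional (carrier M)"

record ('a, 'b) form_module = "('a, 'b) module" +
  form :: "'b \<Rightarrow> 'b \<Rightarrow> 'a"

definition symmetric_bilinear :: "('a, 'r) ring_scheme \<Rightarrow> ('a, 'b, 'm) form_module_scheme \<Rightarrow> bool"
  where "symmetric_bilinear R V \<longleftrightarrow>
    (\<forall>x\<in>carrier V. form V x \<in> module_hom R V (regular_module R)) \<and>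
    (\<forall>x\<in>carrier V. \<forall>y\<in>carrier V. form V x y = form V y x)"

definition nondegenerate :: "('a, 'r) ring_scheme \<Rightarrow> ('a, 'b, 'm) form_module_scheme \<Rightarrow> bool"
  where "nondegenerate R V \<longleftrightarrow>
    bij_betw (\<lambda>x. restrict (form V x) (carrier V)) (carrier V) (dual R V)"

definition inner_product_space :: "('a, 'r) ring_scheme \<Rightarrow> ('a, 'b) form_module \<Rightarrow> bool"
  where "inner_product_space R V \<longleftrightarrow> module R V \<and> finitely_generated R V \<and> projective R V \<and>
    symmetric_bilinear R V \<and> nondegenerate R V"

definition isometric :: "('a, 'r) ring_scheme \<Rightarrow> ('a, 'b) form_module \<Rightarrow> ('a, 'c) form_module \<Rightarrow> bool"
  where "isometric R V W \<longleftrightarrow> (\<exists>h \<in> module_hom R V W. bij_betw h (carrier V) (carrier W) \<and>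
    (\<forall>x\<in>carrier V. \<forall>y\<in>carrier V. form W (h x) (h y) = form V x y))"

definition rank_one_space :: "('a, 'r) ring_scheme \<Rightarrow> 'a \<Rightarrow> ('a, 'a) form_module"
  where "rank_one_space R a = \<lparr>carrier = carrier R, monoid.mult = monoid.mult R, one = one R,
    zero = zero R, add = add R, smult = monoid.mult R, form = (\<lambda>x y. a \<otimes>\<^bsub>R\<^esub> x \<otimes>\<^bsub>R\<^esub> y)\<rparr>"

definition zero_space :: "('a, 'r) ring_scheme \<Rightarrow> ('a, 'a) form_module"
  where "zero_space R = \<lparr>carrier = {\<zero>\<^bsub>R\<^esub>}, monoid.mult = monoid.mult R, one = one R,
    zero = zero R, add = add R, smult = monoid.mult R, form = (\<lambda>_ _. \<zero>\<^bsub>R\<^esub>)\<rparr>"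

definition orthogonal_sum ::
  "('a, 'r) ring_scheme \<Rightarrow> ('a, 'b) form_module \<Rightarrow> ('a, 'c) form_module \<Rightarrow> ('a, 'b \<times> 'c) form_module"
  where "orthogonal_sum R V W = \<lparr>carrier = carrier V \<times> carrier W, monoid.mult = undefined, one = undefined,
    zero = (\<zero>\<^bsub>V\<^esub>, \<zero>\<^bsub>W\<^esub>),
    add = (\<lambda>x y. (fst x \<oplus>\<^bsub>V\<^esub> fst y, snd x \<oplus>\<^bsub>W\<^esub> snd y)),
    smult = (\<lambda>r x. (r \<odot>\<^bsub>V\<^esub> fst x, r \<odot>\<^bsub>W\<^esub> snd x)),
    form = (\<lambda>x y. form V (fst x) (fst y) \<oplus>\<^bsub>R\<^esub> form W (snd x) (snd y))\<rparr>"

text \<open>The tensor product is the free module on \<open>V \<times> W\<close> modulo the bilinearity relations, with the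
  form determined by \<open>\<bb>(v \<otimes> w, v' \<otimes> w') = \<bb>\<^sub>V(v, v') \<bb>\<^sub>W(w, w')\<close>.\<close>

definition tensor_relations ::
  "('a, 'r) ring_scheme \<Rightarrow> ('a, 'b, 'm) module_scheme \<Rightarrow> ('a, 'c, 'n) module_scheme
    \<Rightarrow> ('b \<times> 'c \<Rightarrow> 'a) set"
  where "tensor_relations R V W =
    (let L = free_module R (carrier V \<times> carrier W); \<delta> = (\<lambda>v w. free_basis R (v, w)) in
      {\<delta> (v \<oplus>\<^bsub>V\<^esub> v') w \<ominus>\<^bsub>L\<^esub> (\<delta> v w \<oplus>\<^bsub>L\<^esub> \<delta> v' w) | v v' w.
        v \<in> carrier V \<and> v' \<in> carrier V \<and> w \<in> carrier W} \<union>
      {\<delta> v (w \<oplus>\<^bsub>W\<^esub> w') \<ominus>\<^bsub>L\<^esub> (\<delta> v w \<oplus>\<^bsub>L\<^esub> \<delta> v w') | v w w'.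
        v \<in> carrier V \<and> w \<in> carrier W \<and> w' \<in> carrier W} \<union>
      {\<delta> (r \<odot>\<^bsub>V\<^esub> v) w \<ominus>\<^bsub>L\<^esub> r \<odot>\<^bsub>L\<^esub> \<delta> v w | r v w.
        r \<in> carrier R \<and> v \<in> carrier V \<and> w \<in> carrier W} \<union>
      {\<delta> v (r \<odot>\<^bsub>W\<^esub> w) \<ominus>\<^bsub>L\<^esub> r \<odot>\<^bsub>L\<^esub> \<delta> v w | r v w.
        r \<in> carrier R \<and> v \<in> carrier V \<and> w \<in> carrier W})"

definition tensor_module ::
  "('a, 'r) ring_scheme \<Rightarrow> ('a, 'b, 'm) module_scheme \<Rightarrow> ('a, 'c, 'n) module_scheme
    \<Rightarrow> ('a, ('b \<times> 'c \<Rightarrow> 'a) set) module"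
  where "tensor_module R V W =
    (let L = free_module R (carrier V \<times> carrier W)
     in quotient_module R L (gen_submodule R L (tensor_relations R V W)))"

definition tensor_free_form ::
  "('a, 'r) ring_scheme \<Rightarrow> ('a, 'b) form_module \<Rightarrow> ('a, 'c) form_module
    \<Rightarrow> ('b \<times> 'c \<Rightarrow> 'a) \<Rightarrow> ('b \<times> 'c \<Rightarrow> 'a) \<Rightarrow> 'a"
  where "tensor_free_form R V W f g =
    (\<Oplus>\<^bsub>R\<^esub>p\<in>{p. f p \<noteq> \<zero>\<^bsub>R\<^esub>}. \<Oplus>\<^bsub>R\<^esub>q\<in>{q. g q \<noteq> \<zero>\<^bsub>R\<^esub>}.
      f p \<otimes>\<^bsub>R\<^esub> g q \<otimes>\<^bsub>R\<^esub> (form V (fst p) (fst q) \<otimes>\<^bsub>R\<^esub> form W (snd p) (snd q)))"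

definition tensor_space ::
  "('a, 'r) ring_scheme \<Rightarrow> ('a, 'b) form_module \<Rightarrow> ('a, 'c) form_module
    \<Rightarrow> ('a, ('b \<times> 'c \<Rightarrow> 'a) set) form_module"
  where "tensor_space R V W = (let T = tensor_module R V W in
    \<lparr>carrier = carrier T, monoid.mult = undefined, one = undefined, zero = zero T, add = add T,
     smult = smult T,
     form = (\<lambda>C D. THE c. \<forall>f\<in>C. \<forall>g\<in>D. c = tensor_free_form R V W f g)\<rparr>)"

text \<open>Isometry classes have to live in one type, so their members are the inner product spaces whose
  elements have type \<open>nat \<Rightarrow> 'a\<close>. This loses nothing: every finitely generated module over \<open>R\<close>
  has a copy of that kind (lemma \<open>inner_product_space_small\<close> below). The argument of
  \<open>isometry_class\<close> may have elements of any type.\<close>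

type_synonym 'a small_space = "('a, nat \<Rightarrow> 'a) form_module"

definition isometry_class :: "('a, 'r) ring_scheme \<Rightarrow> ('a, 'b) form_module \<Rightarrow> 'a small_space set"
  where "isometry_class R V = {W. inner_product_space R W \<and> isometric R W V}"

lemma projective_finite_support:
  assumes M: "module R M" and fg: "finitely_generated R M"
    and i: "i \<in> module_hom R M (free_module R X)"
  obtains X' where "finite X'" "X' \<subseteq> X" "i \<in> module_hom R M (free_module R X')"
proof -
  interpret module R M by (rule M)
  obtain S where S: "finite S" "S \<subseteq> carrier M" "gen_submodule R M S = carrier M"
    using fg unfolding finitely_generated_def by blast
  have i_in: "i x \<in> carrier (free_module R X)" if "x \<in> carrier M" for x
    using i that unfolding module_hom_def by auto
  have i_add: "i (x \<oplus>\<^bsub>M\<^esub> y) = (\<lambda>u. i x u \<oplus>\<^bsub>R\<^esub> i y u)" if "x \<in> carrier M" "y \<in> carrier M" for x y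
    using i that unfolding module_hom_def free_module_def by auto
  have i_smult: "i (r \<odot>\<^bsub>M\<^esub> x) = (\<lambda>u. r \<otimes>\<^bsub>R\<^esub> i x u)" if "r \<in> carrier R" "x \<in> carrier M" for r x
    using i that unfolding module_hom_def free_module_def by auto
  define X' where "X' = (\<Union>s\<in>S. {u. i s u \<noteq> \<zero>\<^bsub>R\<^esub>})"
  have fin: "finite X'"
    using S i_in unfolding X'_def free_module_def by auto
  have sub: "X' \<subseteq> X"
    using S i_in unfolding X'_def free_module_def by auto
  define N where "N = {x \<in> carrier M. \<forall>u. u \<notin> X' \<longrightarrow> i x u = \<zero>\<^bsub>R\<^esub>}"
  have zero: "i \<zero>\<^bsub>M\<^esub> u = \<zero>\<^bsub>R\<^esub>" for u
  proof -
    have "i (\<zero>\<^bsub>R\<^esub> \<odot>\<^bsub>M\<^esub> \<zero>\<^bsub>M\<^esub>) u = \<zero>\<^bsub>R\<^esub> \<otimes>\<^bsub>R\<^esub> i \<zero>\<^bsub>M\<^esub> u" by (rule fun_cong[OF i_smult]) auto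
    moreover have "i \<zero>\<^bsub>M\<^esub> u \<in> carrier R" using i_in[of "\<zero>\<^bsub>M\<^esub>"] by (auto simp: free_module_def)
    ultimately show ?thesis by simp
  qed
  have "submodule N R M"
  proof (rule submoduleI)
    show "\<ominus>\<^bsub>M\<^esub> a \<in> N" if "a \<in> N" for a
    proof -
      have a: "a \<in> carrier M" using that by (simp add: N_def)
      have "\<ominus>\<^bsub>M\<^esub> a = (\<ominus>\<^bsub>R\<^esub> \<one>\<^bsub>R\<^esub>) \<odot>\<^bsub>M\<^esub> a" using a by (simp add: smult_l_minus)
      then show ?thesis using that a by (simp add: N_def i_smult)
    qed
  qed (auto simp: N_def zero i_add i_smult)
  moreover have "S \<subseteq> N" using S(2) by (auto simp: N_def X'_def)
  ultimately have "carrier M \<subseteq> N" using S(3) unfolding gen_submodule_def by blast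
  then have "i \<in> module_hom R M (free_module R X')"
    using i unfolding N_def module_hom_def free_module_def
    by (auto simp: Pi_iff subset_iff image_subset_iff)
  then show ?thesis using that fin sub by blast
qed

lemma inner_product_space_small:
  fixes R :: "('a, 'r) ring_scheme" and V :: "('a, 'b) form_module"
  assumes V: "inner_product_space R V"
  shows "\<exists>W :: 'a small_space. inner_product_space R W \<and> isometric R W V"
proof -
  interpret module R V using V unfolding inner_product_space_def by blast
  obtain X :: "'b set" and i p where ip: "i \<in> module_hom R V (free_module R X)"
    "p \<in> module_hom R (free_module R X) V" "\<And>x. x \<in> carrier V \<Longrightarrow> p (i x) = x"
    using V unfolding inner_product_space_def projective_def by blast
  obtain B where B: "finite B" "B \<subseteq> X" "i \<in> module_hom R V (free_module R B)"
    using projective_finite_support[OF module_axioms _ ip(1)] V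
    unfolding inner_product_space_def by blast
  have pB: "p \<in> module_hom R (free_module R B) V"
  proof -
    have "carrier (free_module R B) \<subseteq> carrier (free_module R X)"
      using B(2) by (auto simp: free_module_def)
    moreover have "add (free_module R B) = add (free_module R X)"
      "smult (free_module R B) = smult (free_module R X)" by (auto simp: free_module_def)
    ultimately show ?thesis using ip(2) unfolding module_hom_def by (auto simp: subset_iff)
  qed
  obtain e :: "nat \<Rightarrow> 'b" where e: "bij_betw e {0..<card B} B"
    using ex_bij_betw_nat_finite[OF B(1)] by blast
  define \<iota> where "\<iota> = (\<lambda>x k. if k < card B then i x (e k) else \<zero>\<^bsub>R\<^esub>)"
  have inj: "inj_on \<iota> (carrier V)"
  proof (rule inj_onI)
    fix x y assume x: "x \<in> carrier V" and y: "y \<in> carrier V" and eq: "\<iota> x = \<iota> y"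
    have "i x u = i y u" for u
    proof (cases "u \<in> B")
      case True
      then obtain k where "k < card B" "u = e k" using e unfolding bij_betw_def by (metis atLeastLessThan_iff imageE)
      then show ?thesis using fun_cong[OF eq, of k] by (simp add: \<iota>_def)
    next
      case False
      then show ?thesis using B(3) x y unfolding module_hom_def free_module_def by (auto simp: Pi_iff)
    qed
    then have "i x = i y" by blast
    then show "x = y" using ip(3) x y by metis
  qed
  define j where "j = inv_into (carrier V) \<iota>"
  have j: "j (\<iota> x) = x" if "x \<in> carrier V" for x
    using inj that by (simp add: j_def)
  define W :: "'a small_space" where "W = \<lparr>carrier = \<iota> ` carrier V, monoid.mult = undefined,
    one = undefined, zero = \<iota> \<zero>\<^bsub>V\<^esub>, add = (\<lambda>x y. \<iota> (j x \<oplus>\<^bsub>V\<^esub> j y)),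
    smult = (\<lambda>r x. \<iota> (r \<odot>\<^bsub>V\<^esub> j x)), form = (\<lambda>x y. form V (j x) (j y))\<rparr>"
  note W = W_def
  have modW: "module R W"
  proof (rule moduleI)
    show "cring R" ..
    show "abelian_group W"
    proof (rule abelian_groupI)
      fix x assume "x \<in> carrier W"
      then obtain v where v: "v \<in> carrier V" "x = \<iota> v" by (auto simp: W)
      then have "\<iota> (\<ominus>\<^bsub>V\<^esub> v) \<in> carrier W" "\<iota> (\<ominus>\<^bsub>V\<^esub> v) \<oplus>\<^bsub>W\<^esub> x = \<zero>\<^bsub>W\<^esub>"
        by (auto simp: W j M.l_neg)
      then show "\<exists>y\<in>carrier W. y \<oplus>\<^bsub>W\<^esub> x = \<zero>\<^bsub>W\<^esub>" by blast
    qed (auto simp: W j M.a_ac)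
  qed (auto simp: W j smult_l_distr smult_r_distr smult_assoc1)
  interpret W: module R W by (rule modW)
  have homW: "\<iota> \<in> module_hom R V W" "j \<in> module_hom R W V"
    by (auto simp: module_hom_def W j)
  have iso: "isometric R W V"
    unfolding isometric_def
  proof (intro bexI[of _ j] conjI)
    show "bij_betw j (carrier W) (carrier V)"
      unfolding j_def W by (simp add: bij_betw_inv_into inj inj_on_imp_bij_betw)
  qed (use homW in \<open>auto simp: W\<close>)
  have fgW: "finitely_generated R W"
  proof -
    obtain S where S: "finite S" "S \<subseteq> carrier V" "gen_submodule R V S = carrier V"
      using V unfolding inner_product_space_def finitely_generated_def by blast
    have "carrier W \<subseteq> N" if N: "submodule N R W" "\<iota> ` S \<subseteq> N" for N
    proof -
      note E = W.submoduleE[OF N(1)]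
      have sub: "submodule {x \<in> carrier V. \<iota> x \<in> N} R V"
      proof (rule submoduleI)
        fix a assume a: "a \<in> {x \<in> carrier V. \<iota> x \<in> N}"
        have "(\<ominus>\<^bsub>R\<^esub> \<one>\<^bsub>R\<^esub>) \<odot>\<^bsub>W\<^esub> \<iota> a \<in> N" using E(4) a by auto
        moreover have "(\<ominus>\<^bsub>R\<^esub> \<one>\<^bsub>R\<^esub>) \<odot>\<^bsub>W\<^esub> \<iota> a = \<iota> (\<ominus>\<^bsub>V\<^esub> a)"
          using a by (simp add: W j smult_l_minus)
        ultimately show "\<ominus>\<^bsub>V\<^esub> a \<in> {x \<in> carrier V. \<iota> x \<in> N}" using a by simp
      next
        have "\<zero>\<^bsub>W\<^esub> \<in> N"
          using N(1) unfolding submodule_def by (metis subgroup.one_closed monoid.select_convs(2))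
        then show "\<zero>\<^bsub>V\<^esub> \<in> {x \<in> carrier V. \<iota> x \<in> N}" by (simp add: W)
      next
        fix a b assume "a \<in> {x \<in> carrier V. \<iota> x \<in> N}" "b \<in> {x \<in> carrier V. \<iota> x \<in> N}"
        then show "a \<oplus>\<^bsub>V\<^esub> b \<in> {x \<in> carrier V. \<iota> x \<in> N}"
          using E(5)[of "\<iota> a" "\<iota> b"] by (simp add: W j)
      next
        fix a x assume "a \<in> carrier R" "x \<in> {x \<in> carrier V. \<iota> x \<in> N}"
        then show "a \<odot>\<^bsub>V\<^esub> x \<in> {x \<in> carrier V. \<iota> x \<in> N}"
          using E(4)[of a "\<iota> x"] by (simp add: W j)
      qed auto
      have "carrier V \<subseteq> {x \<in> carrier V. \<iota> x \<in> N}"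
        using S(2,3) sub N(2) unfolding gen_submodule_def by blast
      then show ?thesis by (auto simp: W)
    qed
    moreover have "\<iota> ` S \<subseteq> carrier W" using S(2) by (auto simp: W)
    ultimately have "gen_submodule R W (\<iota> ` S) = carrier W"
      using W.carrier_is_submodule unfolding gen_submodule_def by blast
    then show ?thesis
      using S(1) \<open>\<iota> ` S \<subseteq> carrier W\<close> unfolding finitely_generated_def by blast
  qed
  have projW: "projective R W"
  proof -
    show ?thesis
    proof (cases "\<one>\<^bsub>R\<^esub> = \<zero>\<^bsub>R\<^esub>")
      case True
      have "x = \<zero>\<^bsub>V\<^esub>" if "x \<in> carrier V" for x
        using smult_one[OF that] smult_l_null[OF that] True by simp
      then have "carrier V = {\<zero>\<^bsub>V\<^esub>}" by auto
      then have cW: "carrier W = {\<zero>\<^bsub>W\<^esub>}" by (auto simp: W)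
      show ?thesis unfolding projective_def
        by (rule exI[of _ "{}"], rule exI[of _ "\<lambda>_ _. \<zero>\<^bsub>R\<^esub>"], rule exI[of _ "\<lambda>_. \<zero>\<^bsub>W\<^esub>"])
          (auto simp: module_hom_def cW free_module_def)
    next
      case False
      obtain f where f: "inj_on f B" "f ` B \<subseteq> (UNIV :: nat set)"
        using finite_imp_inj_to_nat_seg[OF B(1)] by blast
      define g where "g = (\<lambda>b (k :: nat). if k = f b then \<one>\<^bsub>R\<^esub> else \<zero>\<^bsub>R\<^esub>)"
      have g: "inj_on g B"
      proof (rule inj_onI)
        fix b c assume b: "b \<in> B" and c: "c \<in> B" and "g b = g c"
        then have "g c (f b) = \<one>\<^bsub>R\<^esub>" by (metis g_def)
        then have "f b = f c" using False by (auto simp: g_def split: if_splits)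
        then show "b = c" using f(1) b c by (auto dest: inj_onD)
      qed
      define h where "h = inv_into B g"
      have h: "h (g b) = b" if "b \<in> B" for b using g that by (simp add: h_def)
      define i' where "i' = (\<lambda>x u. if u \<in> g ` B then i (j x) (h u) else \<zero>\<^bsub>R\<^esub>)"
      define q where "q = (\<lambda>(f :: (nat \<Rightarrow> 'a) \<Rightarrow> 'a) b. if b \<in> B then f (g b) else \<zero>\<^bsub>R\<^esub>)"
      have jV: "j x \<in> carrier V" if "x \<in> carrier W" for x
        using that by (auto simp: W j)
      have iB: "i x \<in> carrier (free_module R B)" if "x \<in> carrier V" for x
        using B(3) that unfolding module_hom_def by auto
      have icl: "i x u \<in> carrier R" if "x \<in> carrier V" for x u
        using iB[OF that] by (auto simp: free_module_def)
      have i_add: "i (x \<oplus>\<^bsub>V\<^esub> y) = (\<lambda>u. i x u \<oplus>\<^bsub>R\<^esub> i y u)" if "x \<in> carrier V" "y \<in> carrier V" for x y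
        using B(3) that unfolding module_hom_def free_module_def by auto
      have i_smult: "i (r \<odot>\<^bsub>V\<^esub> x) = (\<lambda>u. r \<otimes>\<^bsub>R\<^esub> i x u)"
        if "r \<in> carrier R" "x \<in> carrier V" for r x
        using B(3) that unfolding module_hom_def free_module_def by auto
      have j_add: "j (x \<oplus>\<^bsub>W\<^esub> y) = j x \<oplus>\<^bsub>V\<^esub> j y" if "x \<in> carrier W" "y \<in> carrier W" for x y
        using homW(2) that unfolding module_hom_def by blast
      have j_smult: "j (r \<odot>\<^bsub>W\<^esub> x) = r \<odot>\<^bsub>V\<^esub> j x" if "r \<in> carrier R" "x \<in> carrier W" for r x
        using homW(2) that unfolding module_hom_def by blast
      have "finite {u. i' x u \<noteq> \<zero>\<^bsub>R\<^esub>}" for x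
        by (rule finite_subset[of _ "g ` B"]) (auto simp: i'_def B(1))
      then have i': "i' \<in> module_hom R W (free_module R (g ` B))"
        unfolding module_hom_def free_module_def
        by (auto simp: i'_def fun_eq_iff jV icl i_add i_smult j_add j_smult)
      have "finite {b. q f b \<noteq> \<zero>\<^bsub>R\<^esub>}" for f
        by (rule finite_subset[of _ B]) (auto simp: q_def B(1))
      then have q: "q \<in> module_hom R (free_module R (g ` B)) (free_module R B)"
        unfolding module_hom_def free_module_def
        by (auto simp: q_def fun_eq_iff image_subset_iff)
      have qi: "q (i' x) = i (j x)" if "x \<in> carrier W" for x
        using iB[OF jV[OF that]] by (auto simp: q_def i'_def h fun_eq_iff free_module_def)
      have pq: "(\<lambda>f. p (q f)) \<in> module_hom R (free_module R (g ` B)) V"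
        using q pB unfolding module_hom_def by (auto simp: Pi_iff)
      have p': "(\<lambda>f. \<iota> (p (q f))) \<in> module_hom R (free_module R (g ` B)) W"
        using pq homW(1) unfolding module_hom_def by (auto simp: Pi_iff)
      have "\<iota> (p (q (i' x))) = x" if "x \<in> carrier W" for x
        using that ip(3) by (auto simp: qi W j)
      then show ?thesis unfolding projective_def using i' p' by blast
    qed
  qed
  have symW: "symmetric_bilinear R W"
    using V unfolding inner_product_space_def symmetric_bilinear_def
    by (auto simp: module_hom_def W j regular_module_def Pi_iff)
  have "nondegenerate R W"
  proof -
    have nd: "bij_betw (\<lambda>x. restrict (form V x) (carrier V)) (carrier V) (dual R V)"
      using V unfolding inner_product_space_def nondegenerate_def by blast
    have 1: "bij_betw j (carrier W) (carrier V)"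
      unfolding j_def W by (simp add: bij_betw_inv_into inj inj_on_imp_bij_betw)
    have d1: "restrict (\<phi> \<circ> j) (carrier W) \<in> dual R W" if "\<phi> \<in> dual R V" for \<phi>
      using that unfolding dual_def module_hom_def by (auto simp: W j Pi_iff)
    have d2: "restrict (\<psi> \<circ> \<iota>) (carrier V) \<in> dual R V" if "\<psi> \<in> dual R W" for \<psi>
    proof -
      have "\<psi> (\<iota> (x \<oplus>\<^bsub>V\<^esub> y)) = \<psi> (\<iota> x) \<oplus>\<^bsub>R\<^esub> \<psi> (\<iota> y)" if "x \<in> carrier V" "y \<in> carrier V" for x y
        using \<open>\<psi> \<in> dual R W\<close> that unfolding dual_def module_hom_def
        by (auto simp: W j regular_module_def)
      moreover have "\<psi> (\<iota> (r \<odot>\<^bsub>V\<^esub> x)) = r \<otimes>\<^bsub>R\<^esub> \<psi> (\<iota> x)" if "r \<in> carrier R" "x \<in> carrier V" for r x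
        using \<open>\<psi> \<in> dual R W\<close> that unfolding dual_def module_hom_def
        by (auto simp: W j regular_module_def)
      moreover have "\<psi> (\<iota> x) \<in> carrier R" if "x \<in> carrier V" for x
        using \<open>\<psi> \<in> dual R W\<close> that unfolding dual_def module_hom_def
        by (auto simp: W j regular_module_def Pi_iff)
      ultimately show ?thesis unfolding dual_def module_hom_def
        by (auto simp: regular_module_def)
    qed
    have 2: "bij_betw (\<lambda>\<phi>. restrict (\<phi> \<circ> j) (carrier W)) (dual R V) (dual R W)"
    proof (rule bij_betwI[where g = "\<lambda>\<psi>. restrict (\<psi> \<circ> \<iota>) (carrier V)"])
      fix \<phi> assume "\<phi> \<in> dual R V"
      then have "\<phi> \<in> extensional (carrier V)" by (simp add: dual_def)
      then show "restrict (restrict (\<phi> \<circ> j) (carrier W) \<circ> \<iota>) (carrier V) = \<phi>"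
        by (auto simp: fun_eq_iff W j restrict_def extensional_def)
    next
      fix \<psi> assume "\<psi> \<in> dual R W"
      then have "\<psi> \<in> extensional (carrier W)" by (simp add: dual_def)
      then show "restrict (restrict (\<psi> \<circ> \<iota>) (carrier V) \<circ> j) (carrier W) = \<psi>"
        by (auto simp: fun_eq_iff W j restrict_def extensional_def)
    qed (use d1 d2 in auto)
    have "bij_betw ((\<lambda>\<phi>. restrict (\<phi> \<circ> j) (carrier W)) \<circ>
        ((\<lambda>x. restrict (form V x) (carrier V)) \<circ> j)) (carrier W) (dual R W)"
      using bij_betw_trans[OF bij_betw_trans[OF 1 nd] 2] by (simp add: comp_def)
    moreover have "((\<lambda>\<phi>. restrict (\<phi> \<circ> j) (carrier W)) \<circ>
        ((\<lambda>x. restrict (form V x) (carrier V)) \<circ> j)) x = restrict (form W x) (carrier W)"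
      if "x \<in> carrier W" for x
      by (auto simp: fun_eq_iff W j restrict_def)
    ultimately show ?thesis
      unfolding nondegenerate_def by (rule bij_betw_cong[THEN iffD1, rotated])
  qed
  then have "inner_product_space R W"
    using modW fgW projW symW unfolding inner_product_space_def by blast
  then show ?thesis using iso by blast
qed

text \<open>The semiring of isometry classes; sum and product are the classes of \<open>V \<bottom> W\<close> and
  \<open>V \<otimes> W\<close> for arbitrary representatives \<open>V \<in> X\<close>, \<open>W \<in> Y\<close>.\<close>

definition isometry_classes :: "('a, 'r) ring_scheme \<Rightarrow> 'a small_space set ring"
  where "isometry_classes R = \<lparr>
    carrier = {isometry_class R V | V :: 'a small_space. inner_product_space R V},
    monoid.mult = (\<lambda>X Y. \<Union>V\<in>X. \<Union>W\<in>Y. isometry_class R (tensor_space R V W)),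
    one = isometry_class R (rank_one_space R \<one>\<^bsub>R\<^esub>),
    zero = isometry_class R (zero_space R),
    add = (\<lambda>X Y. \<Union>V\<in>X. \<Union>W\<in>Y. isometry_class R (orthogonal_sum R V W))\<rparr>"

text \<open>The Grothendieck ring of a commutative semiring \<open>S\<close>: pairs \<open>(a, b)\<close>, standing for
  \<open>a - b\<close>, up to the usual equivalence.\<close>

definition grothendieck_rel :: "('s, 'r) ring_scheme \<Rightarrow> (('s \<times> 's) \<times> ('s \<times> 's)) set"
  where "grothendieck_rel S = {((a, b), (c, d)) | a b c d.
    a \<in> carrier S \<and> b \<in> carrier S \<and> c \<in> carrier S \<and> d \<in> carrier S \<and>
    (\<exists>e\<in>carrier S. a \<oplus>\<^bsub>S\<^esub> d \<oplus>\<^bsub>S\<^esub> e = c \<oplus>\<^bsub>S\<^esub> b \<oplus>\<^bsub>S\<^esub> e)}"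

definition grothendieck_ring :: "('s, 'r) ring_scheme \<Rightarrow> ('s \<times> 's) set ring"
  where "grothendieck_ring S = \<lparr>
    carrier = (carrier S \<times> carrier S) // grothendieck_rel S,
    monoid.mult = (\<lambda>X Y. \<Union>(a, b)\<in>X. \<Union>(c, d)\<in>Y. grothendieck_rel S ``
      {(a \<otimes>\<^bsub>S\<^esub> c \<oplus>\<^bsub>S\<^esub> b \<otimes>\<^bsub>S\<^esub> d, a \<otimes>\<^bsub>S\<^esub> d \<oplus>\<^bsub>S\<^esub> b \<otimes>\<^bsub>S\<^esub> c)}),
    one = grothendieck_rel S `` {(\<one>\<^bsub>S\<^esub>, \<zero>\<^bsub>S\<^esub>)},
    zero = grothendieck_rel S `` {(\<zero>\<^bsub>S\<^esub>, \<zero>\<^bsub>S\<^esub>)},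
    add = (\<lambda>X Y. \<Union>(a, b)\<in>X. \<Union>(c, d)\<in>Y. grothendieck_rel S ``
      {(a \<oplus>\<^bsub>S\<^esub> c, b \<oplus>\<^bsub>S\<^esub> d)})\<rparr>"

definition GW :: "('a, 'r) ring_scheme \<Rightarrow> ('a small_space set \<times> 'a small_space set) set ring"
  where "GW R = grothendieck_ring (isometry_classes R)"

definition GW_class :: "('a, 'r) ring_scheme \<Rightarrow> ('a, 'b) form_module
    \<Rightarrow> ('a small_space set \<times> 'a small_space set) set"
  where "GW_class R V =
    grothendieck_rel (isometry_classes R) `` {(isometry_class R V, \<zero>\<^bsub>isometry_classes R\<^esub>)}"

definition group_ring :: "('g, 'm) monoid_scheme \<Rightarrow> ('g \<Rightarrow>\<^sub>0 int) ring"
  where "group_ring G = \<lparr>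
    carrier = {f. Poly_Mapping.keys f \<subseteq> carrier G},
    monoid.mult = (\<lambda>f g. frag_extend (\<lambda>x. frag_extend (\<lambda>y. frag_of (x \<otimes>\<^bsub>G\<^esub> y)) g) f),
    one = frag_of \<one>\<^bsub>G\<^esub>, zero = 0, add = (+)\<rparr>"

definition unit_group_ring :: "('a, 'r) ring_scheme \<Rightarrow> ('a \<Rightarrow>\<^sub>0 int) ring"
  where "unit_group_ring R = group_ring (units_of R)"

definition pfister :: "('a, 'r) ring_scheme \<Rightarrow> 'a \<Rightarrow> ('a \<Rightarrow>\<^sub>0 int)"
  where "pfister R a = \<one>\<^bsub>unit_group_ring R\<^esub> \<ominus>\<^bsub>unit_group_ring R\<^esub> frag_of a"

definition hyperbolic :: "('a, 'r) ring_scheme \<Rightarrow> ('a \<Rightarrow>\<^sub>0 int)"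
  where "hyperbolic R = frag_of \<one>\<^bsub>R\<^esub> \<oplus>\<^bsub>unit_group_ring R\<^esub> frag_of (\<ominus>\<^bsub>R\<^esub> \<one>\<^bsub>R\<^esub>)"

text \<open>The additive extension of \<open>\<langle>a\<rangle> \<mapsto> \<langle>a\<rangle>\<close>.\<close>

definition GW_map :: "('a, 'r) ring_scheme \<Rightarrow> ('a \<Rightarrow>\<^sub>0 int)
    \<Rightarrow> ('a small_space set \<times> 'a small_space set) set"
  where "GW_map R f = (\<Oplus>\<^bsub>GW R\<^esub>a\<in>Poly_Mapping.keys f.
    [Poly_Mapping.lookup f a] \<cdot>\<^bsub>GW R\<^esub> GW_class R (rank_one_space R a))"

end

theory Submission
  imports Defs
begin

text \<open>Once a vector of norm one is added, every inner product space over \<open>R\<close> has an orthogonal basis. This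
  gives surjectivity, and it reduces the computation of the kernel to the following claim about an
  ideal \<open>J\<close> containing the square and Steinberg relations: orthogonal bases \<open>E\<close> and \<open>F\<close> of the same space
  satisfy \<open>\<Sum>e\<in>E. \<langle>q e\<rangle> \<equiv> \<Sum>f\<in>F. \<langle>q f\<rangle>\<close> modulo \<open>J\<close>, where \<open>q\<close> is the norm.

  Modulo \<open>J\<close> one has \<open>\<langle>a\<rangle> + \<langle>b\<rangle> \<equiv> \<langle>c\<rangle> + \<langle>abc\<rangle>\<close> whenever \<open>c = ax\<^sup>2 + by\<^sup>2\<close> is a unit, and
  the relations \<open>(1 - \<langle>a\<rangle>) h\<close> follow from the other two; both use a unit \<open>s\<close> with \<open>1 - s\<close> a unit, which exists
  as \<open>F \<noteq> \<bool>F\<^sub>2\<close>. So one may change two members of \<open>E\<close> at a time. Fix \<open>f \<in> F\<close>. Its norm is the sum of the contributions \<open>b(f,e)\<^sup>2 / q e\<close>, and two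
  members of \<open>E\<close> whose contributions add up to a unit can be rotated so that one of them becomes orthogonal
  to \<open>f\<close>. If no such pair is left although several members of \<open>E\<close> are not orthogonal to \<open>f\<close>, then
  \<open>2\<close> lies in the maximal ideal and all contributions are congruent units. Either some member of \<open>E\<close>
  is orthogonal to \<open>f\<close>, and rotating it into the others gets things moving again, or another \<open>g \<in> F\<close>
  would have \<open>0 = b(f,g)\<^sup>2 \<equiv> c \<cdot> q g\<close> for a unit \<open>c\<close> because squaring is additive modulo \<open>2\<close>. In the end
  \<open>f\<close> is orthogonal to all but one \<open>e \<in> E\<close>, both are split off, and induction applies.\<close>

section \<open>Local rings\<close>

text \<open>Orthogonal bases need not exist: if 2 lies in the maximal ideal, a plane whose basis
  vectors have norms in that ideal contains no vector of unit norm. A summand of norm one repairs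
  this, and it can be added to both sides of an equality and subtracted again, since equality in the
  Grothendieck ring is equality after adding a common summand. Bases themselves come from a descent
  on the number of generators of the part not yet split off, closed by Nakayama's argument. The
  ideal \<open>J\<close> is left open because the claim serves both inclusions. For the kernel of
  \<pi>, square and Steinberg relations are verified by explicit rotations, and the hyperbolic
  relations follow. For the ideal generated by the relations, it bounds the kernel from above. That
  two orthogonal sets span the same space is expressed by equal orthogonal complements: rotations
  preserve them, and they behave well when a vector is removed from each set. Isometry classes are
  computed from Gram matrices over arbitrary finite index types, so that the laws of the semiring
  become bijections of index sets.\<close>

context cring
begin

lemma ideal_chain_union:
  assumes C: "\<And>I. I \<in> C \<Longrightarrow> ideal I R" "C \<noteq> {}" "\<And>I J. I \<in> C \<Longrightarrow> J \<in> C \<Longrightarrow> I \<subseteq> J \<or> J \<subseteq> I"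
  shows "ideal (\<Union>C) R"
proof (rule idealI)
  show "subgroup (\<Union>C) (add_monoid R)"
  proof (rule add.subgroupI)
    show "\<Union>C \<subseteq> carrier R" using C(1) ideal.Icarr by fastforce
    show "\<Union>C \<noteq> {}"
      using C(1,2) additive_subgroup.zero_closed ideal.axioms(1) by blast
    show "\<ominus> a \<in> \<Union>C" if a: "a \<in> \<Union>C" for a
    proof -
      obtain I where I: "I \<in> C" "a \<in> I" using a by blast
      then have "\<ominus> a \<in> I" using additive_subgroup.a_inv_closed[OF ideal.axioms(1)[OF C(1)]] by blast
      then show ?thesis using I by blast
    qed
    show "a \<oplus> b \<in> \<Union>C" if ab: "a \<in> \<Union>C" "b \<in> \<Union>C" for a b
    proof -
      obtain I J where IJ: "I \<in> C" "a \<in> I" "J \<in> C" "b \<in> J" using ab by blast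
      then obtain K where K: "K \<in> C" "a \<in> K" "b \<in> K" using C(3)[OF IJ(1,3)] by blast
      then have "a \<oplus> b \<in> K" using additive_subgroup.a_closed[OF ideal.axioms(1)[OF C(1)]] by blast
      then show ?thesis using K by blast
    qed
  qed
qed (auto intro: ring_axioms dest: ideal.I_l_closed[OF C(1)] ideal.I_r_closed[OF C(1)])

text \<open>Zorn's lemma for the ideals that contain \<open>x\<close> but not one: an ideal above a
  maximal member either contains one or belongs to the family again. The locale
  \<open>local_ring\<close> only says that there is a single maximal ideal; this turns it into the
  dichotomy \<open>unit_iff\<close>.\<close>

lemma nonunit_in_maximalideal:
  assumes x: "x \<in> carrier R" "x \<notin> Units R"
  obtains M where "maximalideal M R" "x \<in> M"
proof -
  define \<A> where "\<A> = {I. ideal I R \<and> x \<in> I \<and> \<one> \<notin> I}"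
  have P: "PIdl x \<in> \<A>"
  proof -
    have "\<one> \<notin> PIdl x" using x by (auto simp: cgenideal_def Units_def) (metis m_comm)
    then show ?thesis
      unfolding \<A>_def using cgenideal_ideal[OF x(1)] cgenideal_self[OF x(1)] by blast
  qed
  have "\<exists>M\<in>\<A>. \<forall>X\<in>\<A>. M \<subseteq> X \<longrightarrow> X = M"
  proof (rule subset_Zorn_nonempty)
    show "\<A> \<noteq> {}" using P by blast
    fix C assume C: "C \<noteq> {}" "subset.chain \<A> C"
    then have "ideal (\<Union>C) R"
      by (intro ideal_chain_union) (auto simp: subset.chain_def \<A>_def)
    then show "\<Union>C \<in> \<A>" using C by (auto simp: subset.chain_def \<A>_def)
  qed
  then obtain M where M: "M \<in> \<A>" "\<And>X. X \<in> \<A> \<Longrightarrow> M \<subseteq> X \<Longrightarrow> X = M" by blast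
  have "maximalideal M R"
  proof (rule maximalidealI)
    show "ideal M R" using M(1) by (simp add: \<A>_def)
    show "carrier R \<noteq> M" using M(1) by (auto simp: \<A>_def)
    fix J assume J: "ideal J R" "M \<subseteq> J" "J \<subseteq> carrier R"
    show "J = M \<or> J = carrier R"
    proof (cases "\<one> \<in> J")
      case True
      then show ?thesis using ideal.one_imp_carrier[OF J(1)] by blast
    next
      case False
      then show ?thesis using J M by (auto simp: \<A>_def)
    qed
  qed
  then show ?thesis using M(1) that by (auto simp: \<A>_def)
qed

end

text \<open>Two elements leave no choice for addition: 1 + 1 = 1 would force 1 = 0, so 1 + 1 = 0 in
  both rings. This is how the residue field gets compared with \<open>ZFact 2\<close>.\<close>

lemma two_element_rings_iso:
  assumes "ring A" "ring B"
    and A: "carrier A = {\<zero>\<^bsub>A\<^esub>, \<one>\<^bsub>A\<^esub>}" "\<one>\<^bsub>A\<^esub> \<noteq> \<zero>\<^bsub>A\<^esub>"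
    and B: "carrier B = {\<zero>\<^bsub>B\<^esub>, \<one>\<^bsub>B\<^esub>}" "\<one>\<^bsub>B\<^esub> \<noteq> \<zero>\<^bsub>B\<^esub>"
  shows "A \<simeq> B"
proof -
  interpret A: ring A by fact
  interpret B: ring B by fact
  have two: "\<one>\<^bsub>A\<^esub> \<oplus>\<^bsub>A\<^esub> \<one>\<^bsub>A\<^esub> = \<zero>\<^bsub>A\<^esub>" "\<one>\<^bsub>B\<^esub> \<oplus>\<^bsub>B\<^esub> \<one>\<^bsub>B\<^esub> = \<zero>\<^bsub>B\<^esub>"
    using A B A.a_closed[of "\<one>\<^bsub>A\<^esub>" "\<one>\<^bsub>A\<^esub>"] B.a_closed[of "\<one>\<^bsub>B\<^esub>" "\<one>\<^bsub>B\<^esub>"]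
    by (metis A.add.r_cancel_one' A.one_closed B.add.r_cancel_one' B.one_closed empty_iff insertE)+
  define h where "h = (\<lambda>x. if x = \<zero>\<^bsub>A\<^esub> then \<zero>\<^bsub>B\<^esub> else \<one>\<^bsub>B\<^esub>)"
  have "h \<in> ring_iso A B"
    by (rule ring_iso_memI) (use A B two in \<open>auto simp: h_def bij_betw_def inj_on_def\<close>)
  then show ?thesis by (auto simp: is_ring_iso_def)
qed

lemma ZFact_2_carrier: "carrier (ZFact 2) = {\<zero>\<^bsub>ZFact 2\<^esub>, \<one>\<^bsub>ZFact 2\<^esub>}"
  and ZFact_2_nontrivial: "\<one>\<^bsub>ZFact 2\<^esub> \<noteq> \<zero>\<^bsub>ZFact 2\<^esub>"
proof -
  interpret ideal "Idl\<^bsub>\<Z>\<^esub> {2}" \<Z> by (rule int.genideal_ideal) simp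
  have z: "\<zero>\<^bsub>ZFact 2\<^esub> = ZMod 2 0"
    using a_rcos_const[of 0] additive_subgroup.zero_closed[OF is_additive_subgroup]
    by (simp add: ZMod_def ZFact_def FactRing_def)
  have o: "\<one>\<^bsub>ZFact 2\<^esub> = ZMod 2 1"
    by (simp add: ZMod_def ZFact_def FactRing_def)
  have "carrier (ZFact 2) = range (ZMod 2)"
    by (auto simp: ZMod_def ZFact_def FactRing_def A_RCOSETS_def' a_r_coset_def image_iff)
  also have "\<dots> = {ZMod 2 0, ZMod 2 1}"
  proof -
    have "ZMod 2 a \<in> {ZMod 2 0, ZMod 2 1}" for a
      using ZMod_mod[of 2 a] by (metis insertCI not_mod_2_eq_1_eq_0)
    then show ?thesis by auto
  qed
  finally show "carrier (ZFact 2) = {\<zero>\<^bsub>ZFact 2\<^esub>, \<one>\<^bsub>ZFact 2\<^esub>}" by (simp add: z o)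
  show "\<one>\<^bsub>ZFact 2\<^esub> \<noteq> \<zero>\<^bsub>ZFact 2\<^esub>" by (simp add: z o ZMod_eq_mod)
qed

context local_ring
begin

lemma unit_iff: "x \<in> Units R \<longleftrightarrow> x \<in> carrier R \<and> x \<notin> \<mm>"
proof
  assume x: "x \<in> Units R"
  have "x \<notin> \<mm>"
  proof
    assume "x \<in> \<mm>"
    then have "inv x \<otimes> x \<in> \<mm>" using x by (intro I_l_closed) auto
    then have "\<one> \<in> \<mm>" using x by simp
    then show False using one_imp_carrier I_notcarr by blast
  qed
  then show "x \<in> carrier R \<and> x \<notin> \<mm>" using x by blast
next
  assume x: "x \<in> carrier R \<and> x \<notin> \<mm>"
  then show "x \<in> Units R"
    using nonunit_in_maximalideal[of x] maximalideal_unique by blast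
qed

lemma unit_not_in_max: "x \<in> Units R \<Longrightarrow> x \<notin> \<mm>"
  by (simp add: unit_iff)

lemma not_in_max_unit: "x \<in> carrier R \<Longrightarrow> x \<notin> \<mm> \<Longrightarrow> x \<in> Units R"
  by (simp add: unit_iff)

lemma max_carrier: "x \<in> \<mm> \<Longrightarrow> x \<in> carrier R"
  by (rule Icarr)

lemma max_add_cancel:
  assumes "u \<oplus> x \<in> \<mm>" "x \<in> \<mm>" "u \<in> carrier R"
  shows "u \<in> \<mm>"
proof -
  have "(u \<oplus> x) \<ominus> x \<in> \<mm>"
    unfolding a_minus_def using assms is_additive_subgroup
    by (blast intro: additive_subgroup.a_closed additive_subgroup.a_inv_closed)
  moreover have "(u \<oplus> x) \<ominus> x = u" using assms(3) Icarr[OF assms(2)] by algebra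
  ultimately show ?thesis by (simp only:)
qed

lemma unit_add_max: "u \<in> Units R \<Longrightarrow> x \<in> \<mm> \<Longrightarrow> u \<oplus> x \<in> Units R"
  using max_add_cancel[of u x] unit_not_in_max[of u] not_in_max_unit[of "u \<oplus> x"] Icarr[of x] Units_closed[of u] by auto

text \<open>Contrapositive: if \<open>s\<close> or 1 - s lay in \<open>\<mm>\<close> for every
  \<open>s\<close>, each coset would be that of 0 or of 1. The rest of the proof uses the residue
  field only through this unit.\<close>

lemma residue_field_unit:
  assumes "\<not> (R Quot \<mm> \<simeq> ZFact 2)"
  shows "\<exists>s\<in>Units R. \<one> \<ominus> s \<in> Units R"
proof (rule ccontr)
  assume *: "\<not> ?thesis"
  have *: "s \<in> \<mm> \<or> \<one> \<ominus> s \<in> \<mm>" if s: "s \<in> carrier R" for s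
    using * s by (meson minus_closed not_in_max_unit one_closed)
  have z: "\<zero>\<^bsub>R Quot \<mm>\<^esub> = \<mm>" and o: "\<one>\<^bsub>R Quot \<mm>\<^esub> = \<mm> +> \<one>"
    by (simp_all add: FactRing_def)
  have c: "carrier (R Quot \<mm>) = {\<mm>, \<mm> +> \<one>}"
  proof -
    have "\<mm> +> s \<in> {\<mm>, \<mm> +> \<one>}" if s: "s \<in> carrier R" for s
    proof (cases "s \<in> \<mm>")
      case True
      then show ?thesis using a_rcos_const by simp
    next
      case False
      then have "\<one> \<ominus> s \<in> \<mm>" using * s by blast
      then have "\<mm> +> \<one> = \<mm> +> s" using s by (simp add: quotient_eq_iff_same_a_r_cos[OF is_ideal])
      then show ?thesis by simp
    qed
    moreover have "\<mm> +> \<zero> = \<mm>"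
      using a_rcos_const additive_subgroup.zero_closed[OF is_additive_subgroup] by blast
    moreover have "carrier (R Quot \<mm>) = (\<lambda>s. \<mm> +> s) ` carrier R"
      by (auto simp: FactRing_def A_RCOSETS_def')
    moreover have "\<mm> +> \<zero> \<in> (\<lambda>s. \<mm> +> s) ` carrier R" "\<mm> +> \<one> \<in> (\<lambda>s. \<mm> +> s) ` carrier R"
      by (rule imageI, simp)+
    ultimately show ?thesis by (simp only:) blast
  qed
  have "\<mm> +> \<one> \<noteq> \<mm>"
    using a_rcos_self[of \<one>] one_imp_carrier I_notcarr by auto
  then have "R Quot \<mm> \<simeq> ZFact 2"
    using two_element_rings_iso[OF quotient_is_ring cring.axioms(1)[OF ZFact_is_cring]
          _ _ ZFact_2_carrier ZFact_2_nontrivial] c by (simp only: z o simp_thms)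
  then show False using assms by blast
qed

end

section \<open>Symmetric bilinear spaces\<close>

lemma (in abelian_monoid) finsum_swap:
  assumes "finite A" "finite B" "\<And>a b. a \<in> A \<Longrightarrow> b \<in> B \<Longrightarrow> f a b \<in> carrier G"
  shows "(\<Oplus>a\<in>A. \<Oplus>b\<in>B. f a b) = (\<Oplus>b\<in>B. \<Oplus>a\<in>A. f a b)"
  using assms(1,3)
proof (induction A rule: finite_induct)
  case empty
  then show ?case by simp
next
  case (insert x F)
  have "(\<Oplus>b\<in>B. \<Oplus>a\<in>insert x F. f a b) = (\<Oplus>b\<in>B. f x b \<oplus> (\<Oplus>a\<in>F. f a b))"
    by (rule finsum_cong') (use insert in \<open>auto intro!: finsum_closed\<close>)
  also have "\<dots> = (\<Oplus>b\<in>B. f x b) \<oplus> (\<Oplus>b\<in>B. \<Oplus>a\<in>F. f a b)"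
    by (rule finsum_addf) (use insert in \<open>auto intro!: finsum_closed\<close>)
  finally show ?case using insert by (subst finsum_insert) (auto intro!: finsum_closed)
qed

lemma (in abelian_monoid) finsum_product:
  assumes "finite A" "finite B" "\<And>a b. a \<in> A \<Longrightarrow> b \<in> B \<Longrightarrow> f (a, b) \<in> carrier G"
  shows "(\<Oplus>p\<in>A \<times> B. f p) = (\<Oplus>a\<in>A. \<Oplus>b\<in>B. f (a, b))"
  using assms(1,3)
proof (induction A rule: finite_induct)
  case empty
  then show ?case by simp
next
  case (insert x F)
  have "insert x F \<times> B = Pair x ` B \<union> F \<times> B" by auto
  then have "(\<Oplus>p\<in>insert x F \<times> B. f p) = (\<Oplus>p\<in>Pair x ` B. f p) \<oplus> (\<Oplus>p\<in>F \<times> B. f p)"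
    using insert.prems insert.hyps assms(2) by (simp only:) (intro finsum_Un_disjoint; fastforce)
  also have "(\<Oplus>p\<in>Pair x ` B. f p) = (\<Oplus>b\<in>B. f (x, b))"
    using insert by (intro finsum_reindex) (auto simp: inj_on_def)
  also have "(\<Oplus>p\<in>F \<times> B. f p) = (\<Oplus>a\<in>F. \<Oplus>b\<in>B. f (a, b))"
    using insert by auto
  finally show ?case using insert by (subst finsum_insert) (auto intro!: finsum_closed)
qed

lemma (in abelian_monoid) finsum_delta:
  assumes "finite A" "i \<in> A" "f i \<in> carrier G"
  shows "(\<Oplus>j\<in>A. if j = i then f j else \<zero>) = f i"
    and "(\<Oplus>j\<in>A. if i = j then f j else \<zero>) = f i"
proof -
  have *: "(\<Oplus>j\<in>A. if i = j then f i else \<zero>) = f i"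
    using add.finprod_singleton[of i A "\<lambda>_. f i"] assms by simp
  have "(\<Oplus>j\<in>A. if j = i then f j else \<zero>) = (\<Oplus>j\<in>A. if i = j then f i else \<zero>)"
    by (rule finsum_cong') (use assms in auto)
  then show "(\<Oplus>j\<in>A. if j = i then f j else \<zero>) = f i" using * by simp
  have "(\<Oplus>j\<in>A. if i = j then f j else \<zero>) = (\<Oplus>j\<in>A. if i = j then f i else \<zero>)"
    by (rule finsum_cong') (use assms in auto)
  then show "(\<Oplus>j\<in>A. if i = j then f j else \<zero>) = f i" using * by simp
qed

lemma (in abelian_monoid) finsum_mono_neutral:
  assumes "finite B" "A \<subseteq> B" "\<And>x. x \<in> B - A \<Longrightarrow> f x = \<zero>" "f \<in> B \<rightarrow> carrier G"
  shows "(\<Oplus>x\<in>A. f x) = (\<Oplus>x\<in>B. f x)"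
  using assms add.finprod_mono_neutral_cong_left[of B A f f] by auto

section \<open>Bilinear forms, orthogonal complements and linear combinations\<close>

locale bilinear_space = module R V for R (structure) and V :: "('a, 'b) form_module" +
  assumes form_closed [simp, intro]: "x \<in> carrier V \<Longrightarrow> y \<in> carrier V \<Longrightarrow> form V x y \<in> carrier R"
    and form_sym: "x \<in> carrier V \<Longrightarrow> y \<in> carrier V \<Longrightarrow> form V x y = form V y x"
    and form_add_right: "x \<in> carrier V \<Longrightarrow> y \<in> carrier V \<Longrightarrow> z \<in> carrier V \<Longrightarrow>
      form V x (y \<oplus>\<^bsub>V\<^esub> z) = form V x y \<oplus> form V x z"
    and form_smult_right: "r \<in> carrier R \<Longrightarrow> x \<in> carrier V \<Longrightarrow> y \<in> carrier V \<Longrightarrow>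
      form V x (r \<odot>\<^bsub>V\<^esub> y) = r \<otimes> form V x y"
begin

lemma form_add_left: "x \<in> carrier V \<Longrightarrow> y \<in> carrier V \<Longrightarrow> z \<in> carrier V \<Longrightarrow>
    form V (x \<oplus>\<^bsub>V\<^esub> y) z = form V x z \<oplus> form V y z"
  using form_add_right[of z x y] by (simp add: form_sym[of _ z])

lemma form_smult_left: "r \<in> carrier R \<Longrightarrow> x \<in> carrier V \<Longrightarrow> y \<in> carrier V \<Longrightarrow>
    form V (r \<odot>\<^bsub>V\<^esub> x) y = r \<otimes> form V x y"
  using form_smult_right[of r y x] by (simp add: form_sym[of _ y])

lemma form_zero_right [simp]: "x \<in> carrier V \<Longrightarrow> form V x \<zero>\<^bsub>V\<^esub> = \<zero>"
  using form_smult_right[of \<zero> x "\<zero>\<^bsub>V\<^esub>"] by simp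

lemma form_zero_left [simp]: "x \<in> carrier V \<Longrightarrow> form V \<zero>\<^bsub>V\<^esub> x = \<zero>"
  using form_sym[of x "\<zero>\<^bsub>V\<^esub>"] by simp

lemma form_minus_right: "x \<in> carrier V \<Longrightarrow> y \<in> carrier V \<Longrightarrow> form V x (\<ominus>\<^bsub>V\<^esub> y) = \<ominus> form V x y"
  using form_smult_right[of "\<ominus> \<one>" x y] by (simp add: smult_l_minus l_minus)

lemma form_minus_left: "x \<in> carrier V \<Longrightarrow> y \<in> carrier V \<Longrightarrow> form V (\<ominus>\<^bsub>V\<^esub> x) y = \<ominus> form V x y"
  using form_minus_right[of y x] by (simp add: form_sym[of _ y])

lemma form_finsum_left:
  "finite S \<Longrightarrow> f \<in> S \<rightarrow> carrier V \<Longrightarrow> x \<in> carrier V \<Longrightarrow>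
    form V (\<Oplus>\<^bsub>V\<^esub>s\<in>S. f s) x = (\<Oplus>s\<in>S. form V (f s) x)"
  by (induction S rule: finite_induct) (simp_all add: form_add_left Pi_def M.finsum_closed)

lemmas form_simps = form_add_left form_add_right form_smult_left form_smult_right
  form_minus_left form_minus_right

definition perp :: "'b set \<Rightarrow> 'b set"
  where "perp S = {v \<in> carrier V. \<forall>s\<in>S. form V v s = \<zero>}"

definition lincomb :: "'b set \<Rightarrow> ('b \<Rightarrow> 'a) \<Rightarrow> 'b"
  where "lincomb S x = (\<Oplus>\<^bsub>V\<^esub>s\<in>S. x s \<odot>\<^bsub>V\<^esub> s)"

lemma lincomb_closed [simp]:
  "S \<subseteq> carrier V \<Longrightarrow> x \<in> S \<rightarrow> carrier R \<Longrightarrow> lincomb S x \<in> carrier V"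
  unfolding lincomb_def by (rule M.finsum_closed) auto

lemma form_lincomb_left:
  "finite S \<Longrightarrow> S \<subseteq> carrier V \<Longrightarrow> x \<in> S \<rightarrow> carrier R \<Longrightarrow> v \<in> carrier V \<Longrightarrow>
    form V (lincomb S x) v = (\<Oplus>s\<in>S. x s \<otimes> form V s v)"
  unfolding lincomb_def
  by (subst form_finsum_left) (auto simp: form_smult_left Pi_def subset_iff intro!: R.finsum_cong')

lemma perp_submodule: "S \<subseteq> carrier V \<Longrightarrow> submodule (perp S) R V"
  by (rule submoduleI) (auto simp: perp_def form_simps subset_iff)

lemma submodule_lincomb:
  assumes N: "submodule N R V" and "finite S" "S \<subseteq> N" "x \<in> S \<rightarrow> carrier R"
  shows "lincomb S x \<in> N"
proof -
  have sub: "N \<subseteq> carrier V" using submoduleE(1)[OF N] .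
  have "\<zero>\<^bsub>V\<^esub> \<in> N" using N unfolding submodule_def by (metis subgroup.one_closed monoid.select_convs(2))
  with assms(2-) show ?thesis unfolding lincomb_def
    by (induction S rule: finite_induct)
      (use sub in \<open>auto simp: Pi_def subset_iff intro!: submoduleE(4,5)[OF N]\<close>)
qed

end

lemma bilinear_spaceI:
  assumes "module R V" "symmetric_bilinear R V"
  shows "bilinear_space R V"
proof -
  interpret module R V by fact
  have "form V x \<in> module_hom R V (regular_module R)" if "x \<in> carrier V" for x
    using assms(2) that by (simp add: symmetric_bilinear_def)
  note h = this[unfolded module_hom_def regular_module_def, simplified]
  show ?thesis
  proof
    fix x y assume "x \<in> carrier V" "y \<in> carrier V"
    then show "form V x y = form V y x"
      using assms(2) by (simp add: symmetric_bilinear_def)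
  qed (use h in \<open>auto simp: Pi_iff\<close>)
qed

lemma (in bilinear_space) symmetric_bilinear: "symmetric_bilinear R V"
  unfolding symmetric_bilinear_def module_hom_def regular_module_def
  by (auto simp: form_add_right form_smult_right intro: form_sym)

section \<open>Isometry as an equivalence\<close>

lemma isometric_trans:
  assumes "isometric R U V" "isometric R V W"
  shows "isometric R U W"
proof -
  obtain g h where "g \<in> module_hom R U V" "bij_betw g (carrier U) (carrier V)"
      "\<forall>x\<in>carrier U. \<forall>y\<in>carrier U. form V (g x) (g y) = form U x y"
    "h \<in> module_hom R V W" "bij_betw h (carrier V) (carrier W)"
      "\<forall>x\<in>carrier V. \<forall>y\<in>carrier V. form W (h x) (h y) = form V x y"
    using assms unfolding isometric_def by blast
  then show ?thesis
    unfolding isometric_def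
    by (intro bexI[of _ "h \<circ> g"]) (auto simp: module_hom_def Pi_iff intro: bij_betw_trans)
qed

lemma isometric_refl: "isometric R V V"
  unfolding isometric_def by (intro bexI[of _ "\<lambda>x. x"]) (auto simp: module_hom_def bij_betw_def)

lemma isometric_sym:
  assumes V: "module R V" and iso: "isometric R V W"
  shows "isometric R W V"
proof -
  interpret module R V by fact
  obtain h where h: "h \<in> module_hom R V W" "bij_betw h (carrier V) (carrier W)"
      "\<forall>x\<in>carrier V. \<forall>y\<in>carrier V. form W (h x) (h y) = form V x y"
    using iso unfolding isometric_def by blast
  define g where "g = inv_into (carrier V) h"
  have g: "bij_betw g (carrier W) (carrier V)"
    using h(2) by (simp add: g_def bij_betw_inv_into)
  have gc: "g x \<in> carrier V" if "x \<in> carrier W" for x using g that by (auto simp: bij_betw_def)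
  have hg: "h (g x) = x" if "x \<in> carrier W" for x
    using h(2) that by (simp add: g_def bij_betw_inv_into_right)
  have gh: "g (h x) = x" if "x \<in> carrier V" for x
    using h(2) that by (simp add: g_def bij_betw_inv_into_left)
  have "g \<in> module_hom R W V"
    unfolding module_hom_def
  proof (intro CollectI conjI ballI)
    show "g \<in> carrier W \<rightarrow> carrier V" using gc by auto
    fix x y assume xy: "x \<in> carrier W" "y \<in> carrier W"
    have "h (g x \<oplus>\<^bsub>V\<^esub> g y) = x \<oplus>\<^bsub>W\<^esub> y"
      using h(1) xy by (simp add: module_hom_def gc hg)
    then show "g (x \<oplus>\<^bsub>W\<^esub> y) = g x \<oplus>\<^bsub>V\<^esub> g y"
      using gh[of "g x \<oplus>\<^bsub>V\<^esub> g y"] xy gc by simp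
  next
    fix r x assume rx: "r \<in> carrier R" "x \<in> carrier W"
    have "h (r \<odot>\<^bsub>V\<^esub> g x) = r \<odot>\<^bsub>W\<^esub> x"
      using h(1) rx by (simp add: module_hom_def gc hg)
    then show "g (r \<odot>\<^bsub>W\<^esub> x) = r \<odot>\<^bsub>V\<^esub> g x"
      using gh[of "r \<odot>\<^bsub>V\<^esub> g x"] rx gc by simp
  qed
  moreover have "form V (g x) (g y) = form W x y" if "x \<in> carrier W" "y \<in> carrier W" for x y
    using h(3) gc hg that by metis
  ultimately show ?thesis unfolding isometric_def using g by blast
qed

lemma isometryI:
  assumes "\<And>x. x \<in> carrier V \<Longrightarrow> h x \<in> carrier W"
    "\<And>x. x \<in> carrier W \<Longrightarrow> g x \<in> carrier V"
    "\<And>x. x \<in> carrier V \<Longrightarrow> g (h x) = x" "\<And>x. x \<in> carrier W \<Longrightarrow> h (g x) = x"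
    "\<And>x y. x \<in> carrier V \<Longrightarrow> y \<in> carrier V \<Longrightarrow> h (x \<oplus>\<^bsub>V\<^esub> y) = h x \<oplus>\<^bsub>W\<^esub> h y"
    "\<And>r x. r \<in> carrier R \<Longrightarrow> x \<in> carrier V \<Longrightarrow> h (r \<odot>\<^bsub>V\<^esub> x) = r \<odot>\<^bsub>W\<^esub> h x"
    "\<And>x y. x \<in> carrier V \<Longrightarrow> y \<in> carrier V \<Longrightarrow> form W (h x) (h y) = form V x y"
  shows "isometric R V W"
proof -
  have "bij_betw h (carrier V) (carrier W)"
    by (rule bij_betwI[where g = g]) (use assms in auto)
  moreover have "h \<in> module_hom R V W" using assms by (auto simp: module_hom_def)
  ultimately show ?thesis unfolding isometric_def using assms(7) by blast
qed

section \<open>Gram matrices\<close>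

text \<open>The form is x^T A y. The index type is left open so that sums and products of spaces can
  be indexed by sum and product types.\<close>

definition mspace :: "('a, 'r) ring_scheme \<Rightarrow> 'x set \<Rightarrow> ('x \<Rightarrow> 'x \<Rightarrow> 'a) \<Rightarrow> ('a, 'x \<Rightarrow> 'a) form_module"
  where "mspace R I A = \<lparr>carrier = carrier (free_module R I), monoid.mult = undefined, one = undefined,
    zero = zero (free_module R I), add = add (free_module R I), smult = smult (free_module R I),
    form = (\<lambda>x y. \<Oplus>\<^bsub>R\<^esub>i\<in>I. x i \<otimes>\<^bsub>R\<^esub> (\<Oplus>\<^bsub>R\<^esub>j\<in>I. A i j \<otimes>\<^bsub>R\<^esub> y j))\<rparr>"

text \<open>Invertibility of a symmetric matrix without determinants: by symmetry the transpose of a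
  right inverse is a left inverse.\<close>

definition unimodular :: "('a, 'r) ring_scheme \<Rightarrow> 'x set \<Rightarrow> ('x \<Rightarrow> 'x \<Rightarrow> 'a) \<Rightarrow> bool"
  where "unimodular R I A \<longleftrightarrow> finite I \<and>
    (\<forall>i\<in>I. \<forall>j\<in>I. A i j \<in> carrier R \<and> A i j = A j i) \<and>
    (\<exists>B. (\<forall>i\<in>I. \<forall>j\<in>I. B i j \<in> carrier R) \<and>
      (\<forall>i\<in>I. \<forall>k\<in>I. (\<Oplus>\<^bsub>R\<^esub>j\<in>I. A i j \<otimes>\<^bsub>R\<^esub> B j k) = (if i = k then \<one>\<^bsub>R\<^esub> else \<zero>\<^bsub>R\<^esub>)))"

lemma unimodular_finite: "unimodular R I A \<Longrightarrow> finite I"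
  and unimodular_closed: "unimodular R I A \<Longrightarrow> i \<in> I \<Longrightarrow> j \<in> I \<Longrightarrow> A i j \<in> carrier R"
  and unimodular_sym: "unimodular R I A \<Longrightarrow> i \<in> I \<Longrightarrow> j \<in> I \<Longrightarrow> A i j = A j i"
  by (auto simp: unimodular_def)

lemma free_module_simps:
  "zero (free_module R X) = (\<lambda>_. \<zero>\<^bsub>R\<^esub>)"
  "add (free_module R X) = (\<lambda>f g x. f x \<oplus>\<^bsub>R\<^esub> g x)"
  "smult (free_module R X) = (\<lambda>r f x. r \<otimes>\<^bsub>R\<^esub> f x)"
  by (simp_all add: free_module_def)

lemma mspace_simps [simp]:
  "carrier (mspace R I A) = carrier (free_module R I)"
  "zero (mspace R I A) = (\<lambda>_. \<zero>\<^bsub>R\<^esub>)"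
  "add (mspace R I A) = (\<lambda>f g x. f x \<oplus>\<^bsub>R\<^esub> g x)"
  "smult (mspace R I A) = (\<lambda>r f x. r \<otimes>\<^bsub>R\<^esub> f x)"
  "form (mspace R I A) x y = (\<Oplus>\<^bsub>R\<^esub>i\<in>I. x i \<otimes>\<^bsub>R\<^esub> (\<Oplus>\<^bsub>R\<^esub>j\<in>I. A i j \<otimes>\<^bsub>R\<^esub> y j))"
  by (simp_all add: mspace_def free_module_simps)

context cring
begin

lemma free_module_closed: "x \<in> carrier (free_module R X) \<Longrightarrow> x i \<in> carrier R"
  by (auto simp: free_module_def)

lemma free_module_outside: "x \<in> carrier (free_module R X) \<Longrightarrow> i \<notin> X \<Longrightarrow> x i = \<zero>"
  by (auto simp: free_module_def)

lemma free_module_carrier_finite: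
  "finite I \<Longrightarrow> x \<in> carrier (free_module R I) \<longleftrightarrow> (\<forall>i. x i \<in> carrier R) \<and> (\<forall>i. i \<notin> I \<longrightarrow> x i = \<zero>)"
  by (auto simp: free_module_def intro: finite_subset[of _ I])

lemma free_module_add_closed:
  assumes "x \<in> carrier (free_module R X)" "y \<in> carrier (free_module R X)"
  shows "(\<lambda>i. x i \<oplus> y i) \<in> carrier (free_module R X)"
proof -
  have "finite ({i. x i \<noteq> \<zero>} \<union> {i. y i \<noteq> \<zero>})" using assms by (auto simp: free_module_def)
  then have "finite {i. x i \<oplus> y i \<noteq> \<zero>}" by (rule rev_finite_subset) auto
  then show ?thesis using assms by (auto simp: free_module_def)
qed

lemma free_module_smult_closed:
  assumes "r \<in> carrier R" "x \<in> carrier (free_module R X)"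
  shows "(\<lambda>i. r \<otimes> x i) \<in> carrier (free_module R X)"
proof -
  have "finite {i. x i \<noteq> \<zero>}" using assms by (auto simp: free_module_def)
  then have "finite {i. r \<otimes> x i \<noteq> \<zero>}" by (rule rev_finite_subset) (use assms in auto)
  then show ?thesis using assms by (auto simp: free_module_def)
qed

lemma free_basis_closed: "i \<in> X \<Longrightarrow> free_basis R i \<in> carrier (free_module R X)"
  by (auto simp: free_module_def free_basis_def)

text \<open>Stated for any record with pointwise operations, since \<open>free_module\<close> and
  \<open>mspace\<close> are different record types over the same functions.\<close>

lemma module_of_functions:
  assumes "carrier M = carrier (free_module R X)" "zero M = (\<lambda>_. \<zero>)"
    "add M = (\<lambda>f g x. f x \<oplus> g x)" "smult M = (\<lambda>r f x. r \<otimes> f x)"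
  shows "module R M"
proof (rule moduleI)
  have c: "x i \<in> carrier R" if "x \<in> carrier M" for x i
    using that by (simp add: assms(1) free_module_closed)
  show "abelian_group M"
  proof (rule abelian_groupI)
    fix x assume x: "x \<in> carrier M"
    have "(\<lambda>i. \<ominus> x i) = (\<lambda>i. \<ominus> \<one> \<otimes> x i)" using c[OF x] by (auto simp: l_minus)
    then have "(\<lambda>i. \<ominus> x i) \<in> carrier M"
      using free_module_smult_closed[of "\<ominus> \<one>" x X] x by (simp add: assms(1))
    moreover have "(\<lambda>i. \<ominus> x i) \<oplus>\<^bsub>M\<^esub> x = \<zero>\<^bsub>M\<^esub>" using c[OF x] by (auto simp: assms l_neg)
    ultimately show "\<exists>y\<in>carrier M. y \<oplus>\<^bsub>M\<^esub> x = \<zero>\<^bsub>M\<^esub>" by blast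
  next
    show "\<zero>\<^bsub>M\<^esub> \<in> carrier M" by (auto simp: assms(1,2) free_module_def)
    show "x \<oplus>\<^bsub>M\<^esub> y \<in> carrier M" if "x \<in> carrier M" "y \<in> carrier M" for x y
      using that free_module_add_closed by (simp add: assms(1,3))
  qed (simp_all add: assms(2,3) c a_ac)
  show "cring R" by (rule is_cring)
qed (auto simp: assms free_module_smult_closed free_module_closed l_distr r_distr m_assoc)

lemma free_module_module: "module R (free_module R X)"
  by (rule module_of_functions) (simp_all add: free_module_simps)

lemma mspace_module: "module R (mspace R I A)"
  by (rule module_of_functions) simp_all

lemma bilinear_space_mspace:
  assumes I: "finite I" and A: "\<And>i j. i \<in> I \<Longrightarrow> j \<in> I \<Longrightarrow> A i j \<in> carrier R \<and> A i j = A j i"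
  shows "bilinear_space R (mspace R I A)"
proof -
  interpret M: module R "mspace R I A" by (rule mspace_module)
  have F: "form (mspace R I A) x y = (\<Oplus>i\<in>I. \<Oplus>j\<in>I. x i \<otimes> (A i j \<otimes> y j))"
    if "\<And>i. x i \<in> carrier R" "\<And>i. y i \<in> carrier R" for x y
    using that A I by (auto intro!: finsum_cong' finsum_rdistr finsum_closed)
  show ?thesis
  proof
    fix x y z assume xyz: "x \<in> carrier (mspace R I A)" "y \<in> carrier (mspace R I A)" "z \<in> carrier (mspace R I A)"
    then have c: "x i \<in> carrier R" "y i \<in> carrier R" "z i \<in> carrier R" for i
      by (auto simp: free_module_closed)
    have 1: "(\<Oplus>j\<in>I. A i j \<otimes> (y j \<oplus> z j)) = (\<Oplus>j\<in>I. A i j \<otimes> y j) \<oplus> (\<Oplus>j\<in>I. A i j \<otimes> z j)" if "i \<in> I" for i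
    proof -
      have "(\<Oplus>j\<in>I. A i j \<otimes> (y j \<oplus> z j)) = (\<Oplus>j\<in>I. A i j \<otimes> y j \<oplus> A i j \<otimes> z j)"
        using that A c by (intro finsum_cong') (auto simp: r_distr)
      also have "\<dots> = (\<Oplus>j\<in>I. A i j \<otimes> y j) \<oplus> (\<Oplus>j\<in>I. A i j \<otimes> z j)"
        using that A c by (intro finsum_addf) auto
      finally show ?thesis .
    qed
    have "(\<Oplus>i\<in>I. x i \<otimes> (\<Oplus>j\<in>I. A i j \<otimes> (y j \<oplus> z j))) =
      (\<Oplus>i\<in>I. x i \<otimes> (\<Oplus>j\<in>I. A i j \<otimes> y j) \<oplus> x i \<otimes> (\<Oplus>j\<in>I. A i j \<otimes> z j))"
      using A c by (intro finsum_cong') (auto simp: 1 r_distr intro!: finsum_closed)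
    also have "\<dots> = (\<Oplus>i\<in>I. x i \<otimes> (\<Oplus>j\<in>I. A i j \<otimes> y j)) \<oplus> (\<Oplus>i\<in>I. x i \<otimes> (\<Oplus>j\<in>I. A i j \<otimes> z j))"
      using A c by (intro finsum_addf) (auto intro!: finsum_closed)
    finally show "form (mspace R I A) x (y \<oplus>\<^bsub>mspace R I A\<^esub> z) =
        form (mspace R I A) x y \<oplus> form (mspace R I A) x z" by simp
  next
    fix r x y assume rxy: "r \<in> carrier R" "x \<in> carrier (mspace R I A)" "y \<in> carrier (mspace R I A)"
    then have c: "x i \<in> carrier R" "y i \<in> carrier R" for i
      by (auto simp: free_module_closed)
    have 1: "(\<Oplus>j\<in>I. A i j \<otimes> (r \<otimes> y j)) = r \<otimes> (\<Oplus>j\<in>I. A i j \<otimes> y j)" if "i \<in> I" for i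
      using that A c rxy I by (subst finsum_rdistr) (auto simp: m_lcomm intro!: finsum_cong')
    have "(\<Oplus>i\<in>I. x i \<otimes> (\<Oplus>j\<in>I. A i j \<otimes> (r \<otimes> y j))) = (\<Oplus>i\<in>I. r \<otimes> (x i \<otimes> (\<Oplus>j\<in>I. A i j \<otimes> y j)))"
      using A c rxy by (intro finsum_cong') (auto simp: 1 m_lcomm intro!: finsum_closed)
    also have "\<dots> = r \<otimes> (\<Oplus>i\<in>I. x i \<otimes> (\<Oplus>j\<in>I. A i j \<otimes> y j))"
      using A c rxy I by (intro finsum_rdistr[symmetric]) (auto intro!: finsum_closed)
    finally show "form (mspace R I A) x (r \<odot>\<^bsub>mspace R I A\<^esub> y) = r \<otimes> form (mspace R I A) x y" by simp
  next
    fix x y assume "x \<in> carrier (mspace R I A)" "y \<in> carrier (mspace R I A)"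
    then have c: "x i \<in> carrier R" "y i \<in> carrier R" for i
      by (auto simp: free_module_closed)
    show "form (mspace R I A) x y \<in> carrier R" using c A by (auto intro!: finsum_closed)
    have "form (mspace R I A) x y = (\<Oplus>i\<in>I. \<Oplus>j\<in>I. x i \<otimes> (A i j \<otimes> y j))" using c by (rule F)
    also have "\<dots> = (\<Oplus>j\<in>I. \<Oplus>i\<in>I. x i \<otimes> (A i j \<otimes> y j))" using c A I by (intro finsum_swap) auto
    also have "\<dots> = (\<Oplus>j\<in>I. \<Oplus>i\<in>I. y j \<otimes> (A j i \<otimes> x i))"
      using c A by (intro finsum_cong') (auto intro!: finsum_closed finsum_cong' simp: m_ac)
    also have "\<dots> = form (mspace R I A) y x" using c by (intro F[symmetric])
    finally show "form (mspace R I A) x y = form (mspace R I A) y x" .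
  qed
qed

text \<open>Multiply A x = 0 from the left by the transpose of the right inverse \<open>B\<close>:
  as \<open>A\<close> is symmetric, B^T A is the transpose of A B, the identity.\<close>

lemma unimodular_kernel:
  assumes A: "unimodular R I A" and x: "\<And>i. i \<in> I \<Longrightarrow> x i \<in> carrier R"
    and 0: "\<And>i. i \<in> I \<Longrightarrow> (\<Oplus>j\<in>I. A i j \<otimes> x j) = \<zero>" and k: "k \<in> I"
  shows "x k = \<zero>"
proof -
  obtain B where B: "\<And>i j. i \<in> I \<Longrightarrow> j \<in> I \<Longrightarrow> B i j \<in> carrier R"
    "\<And>i k. i \<in> I \<Longrightarrow> k \<in> I \<Longrightarrow> (\<Oplus>j\<in>I. A i j \<otimes> B j k) = (if i = k then \<one> else \<zero>)"
    using A unfolding unimodular_def by blast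
  note Ac = unimodular_closed[OF A] and I = unimodular_finite[OF A]
  have "(\<Oplus>i\<in>I. B i k \<otimes> (\<Oplus>j\<in>I. A i j \<otimes> x j)) = (\<Oplus>i\<in>I. \<zero>)"
    using B(1) k by (intro finsum_cong') (auto simp: 0)
  then have "\<zero> = (\<Oplus>i\<in>I. B i k \<otimes> (\<Oplus>j\<in>I. A i j \<otimes> x j))" by simp
  also have "\<dots> = (\<Oplus>i\<in>I. \<Oplus>j\<in>I. B i k \<otimes> (A i j \<otimes> x j))"
    using B(1) k x Ac I by (intro finsum_cong' finsum_rdistr) (auto intro!: finsum_closed)
  also have "\<dots> = (\<Oplus>j\<in>I. \<Oplus>i\<in>I. B i k \<otimes> (A i j \<otimes> x j))"
    using B(1) k x Ac I by (intro finsum_swap) auto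
  also have "\<dots> = (\<Oplus>j\<in>I. if j = k then x j else \<zero>)"
  proof (rule finsum_cong')
    fix j assume j: "j \<in> I"
    have "(\<Oplus>i\<in>I. B i k \<otimes> (A i j \<otimes> x j)) = (\<Oplus>i\<in>I. (A j i \<otimes> B i k) \<otimes> x j)"
      using B(1) k x Ac j unimodular_sym[OF A] by (intro finsum_cong') (auto simp: m_ac)
    also have "\<dots> = (\<Oplus>i\<in>I. A j i \<otimes> B i k) \<otimes> x j"
      using B(1) k x Ac j I by (intro finsum_ldistr[symmetric]) auto
    finally show "(\<Oplus>i\<in>I. B i k \<otimes> (A i j \<otimes> x j)) = (if j = k then x j else \<zero>)"
      using j k x by (simp add: B(2))
  qed (use x in auto)
  also have "\<dots> = x k" using finsum_delta(1)[OF I k] x k by simp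
  finally show ?thesis by simp
qed

lemma unimodular_solve:
  assumes A: "unimodular R I A" and c: "\<And>i. i \<in> I \<Longrightarrow> c i \<in> carrier R"
  obtains x where "x \<in> carrier (free_module R I)" "\<And>i. i \<in> I \<Longrightarrow> (\<Oplus>j\<in>I. A i j \<otimes> x j) = c i"
proof -
  obtain B where B: "\<And>i j. i \<in> I \<Longrightarrow> j \<in> I \<Longrightarrow> B i j \<in> carrier R"
    "\<And>i k. i \<in> I \<Longrightarrow> k \<in> I \<Longrightarrow> (\<Oplus>j\<in>I. A i j \<otimes> B j k) = (if i = k then \<one> else \<zero>)"
    using A unfolding unimodular_def by blast
  note Ac = unimodular_closed[OF A] and I = unimodular_finite[OF A]
  define x where "x = (\<lambda>j. if j \<in> I then (\<Oplus>k\<in>I. B j k \<otimes> c k) else \<zero>)"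
  have "x \<in> carrier (free_module R I)"
    using B(1) c by (auto simp: free_module_carrier_finite[OF I] x_def intro!: finsum_closed)
  moreover have "(\<Oplus>j\<in>I. A i j \<otimes> x j) = c i" if i: "i \<in> I" for i
  proof -
    have "(\<Oplus>j\<in>I. A i j \<otimes> x j) = (\<Oplus>j\<in>I. \<Oplus>k\<in>I. A i j \<otimes> (B j k \<otimes> c k))"
      using B(1) c Ac I i by (intro finsum_cong') (auto simp: x_def intro!: finsum_closed finsum_rdistr)
    also have "\<dots> = (\<Oplus>k\<in>I. \<Oplus>j\<in>I. A i j \<otimes> (B j k \<otimes> c k))"
      using B(1) c Ac I i by (intro finsum_swap) auto
    also have "\<dots> = (\<Oplus>k\<in>I. if i = k then c k else \<zero>)"
    proof (rule finsum_cong')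
      fix k assume k: "k \<in> I"
      have "(\<Oplus>j\<in>I. A i j \<otimes> (B j k \<otimes> c k)) = (\<Oplus>j\<in>I. (A i j \<otimes> B j k) \<otimes> c k)"
        using B(1) k c Ac i by (intro finsum_cong') (auto simp: m_assoc)
      also have "\<dots> = (\<Oplus>j\<in>I. A i j \<otimes> B j k) \<otimes> c k"
        using B(1) k c Ac i I by (intro finsum_ldistr[symmetric]) auto
      finally show "(\<Oplus>j\<in>I. A i j \<otimes> (B j k \<otimes> c k)) = (if i = k then c k else \<zero>)"
        using i k c by (simp add: B(2))
    qed (use c in auto)
    also have "\<dots> = c i" using finsum_delta(2)[OF I i] c i by simp
    finally show ?thesis .
  qed
  ultimately show ?thesis using that by blast
qed

text \<open>Every identity between sums and products of classes is proved through this: it suffices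
  to give a bijection of index sets that matches the Gram matrices.\<close>

lemma mspace_reindex:
  assumes \<pi>: "bij_betw \<pi> I J" and I: "finite I"
    and A: "\<And>i i'. i \<in> I \<Longrightarrow> i' \<in> I \<Longrightarrow> A i i' = B (\<pi> i) (\<pi> i')"
    and B: "\<And>j j'. j \<in> J \<Longrightarrow> j' \<in> J \<Longrightarrow> B j j' \<in> carrier R"
  shows "isometric R (mspace R I A) (mspace R J B)"
proof -
  have J: "finite J" using \<pi> I bij_betw_finite by blast
  have J': "J = \<pi> ` I" and inj: "inj_on \<pi> I" using \<pi> by (auto simp: bij_betw_def)
  have re: "(\<Oplus>j\<in>J. f j) = (\<Oplus>i\<in>I. f (\<pi> i))" if "f \<in> J \<rightarrow> carrier R" for f
    unfolding J' by (rule finsum_reindex) (use that inj J' in auto)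
  \<comment> \<open>In this direction the map is composition with \<pi>, extended by zero; the claim
    is its inverse.\<close>
  have "isometric R (mspace R J B) (mspace R I A)"
  proof (rule isometryI[where h = "\<lambda>y i. if i \<in> I then y (\<pi> i) else \<zero>"
        and g = "\<lambda>x j. if j \<in> J then x (inv_into I \<pi> j) else \<zero>"])
    fix x y assume "x \<in> carrier (mspace R J B)" "y \<in> carrier (mspace R J B)"
    then have c: "x j \<in> carrier R" "y j \<in> carrier R" for j
      by (auto simp: free_module_closed)
    have 1: "(\<Oplus>j\<in>I. A i j \<otimes> (if j \<in> I then y (\<pi> j) else \<zero>)) = (\<Oplus>j\<in>J. B (\<pi> i) j \<otimes> y j)"
      if "i \<in> I" for i
      using that c B by (subst re) (auto simp: A J' intro!: finsum_cong')
    have "form (mspace R I A) (\<lambda>i. if i \<in> I then x (\<pi> i) else \<zero>) (\<lambda>i. if i \<in> I then y (\<pi> i) else \<zero>) =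
        (\<Oplus>i\<in>I. x (\<pi> i) \<otimes> (\<Oplus>j\<in>J. B (\<pi> i) j \<otimes> y j))"
      using c B unfolding mspace_simps by (intro finsum_cong') (auto simp: 1 J' intro!: finsum_closed)
    also have "\<dots> = form (mspace R J B) x y"
      using c B unfolding mspace_simps by (intro re[symmetric]) (auto intro!: finsum_closed)
    finally show "form (mspace R I A) (\<lambda>i. if i \<in> I then x (\<pi> i) else \<zero>) (\<lambda>i. if i \<in> I then y (\<pi> i) else \<zero>) =
        form (mspace R J B) x y" .
  qed (use inj in \<open>auto simp: free_module_carrier_finite I J J' fun_eq_iff\<close>)
  then show ?thesis by (rule isometric_sym[OF mspace_module])
qed

end

lemma submodule_zero: "submodule N R M \<Longrightarrow> \<zero>\<^bsub>M\<^esub> \<in> N"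
  using subgroup.one_closed[OF submodule.axioms(1)] by fastforce

context cring
begin

text \<open>Induction on a finite set that carries the support, clearing one coordinate at a time. A
  property closed under the module operations therefore only has to be checked on the basis
  vectors.\<close>

lemma free_module_generated:
  assumes X: "finite X" and N: "submodule N R (free_module R X)" and gen: "\<And>i. i \<in> X \<Longrightarrow> free_basis R i \<in> N"
  shows "N = carrier (free_module R X)"
proof
  interpret F: module R "free_module R X" by (rule free_module_module)
  show "N \<subseteq> carrier (free_module R X)" by (rule F.submoduleE(1)[OF N])
  have zero: "(\<lambda>_. \<zero>) \<in> N"
    using submodule_zero[OF N] by (simp add: free_module_simps)
  have *: "x \<in> N" if "finite Y" "Y \<subseteq> X" "x \<in> carrier (free_module R X)" "\<forall>i. i \<notin> Y \<longrightarrow> x i = \<zero>" for Y x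
    using that
  proof (induction Y arbitrary: x rule: finite_induct)
    case empty
    then have "x = (\<lambda>_. \<zero>)" by auto
    then show ?case using zero by simp
  next
    case (insert k Y)
    have c: "x i \<in> carrier R" for i using free_module_closed[OF insert.prems(2)] .
    define y where "y = x(k := \<zero>)"
    have "y \<in> N"
    proof (rule insert.IH)
      show "y \<in> carrier (free_module R X)"
        using insert.prems(2) by (auto simp: free_module_carrier_finite[OF X] y_def)
    qed (use insert.prems in \<open>auto simp: y_def\<close>)
    moreover have "x k \<odot>\<^bsub>free_module R X\<^esub> free_basis R k \<in> N"
      using F.submoduleE(4)[OF N] c gen insert.prems by auto
    ultimately have "y \<oplus>\<^bsub>free_module R X\<^esub> (x k \<odot>\<^bsub>free_module R X\<^esub> free_basis R k) \<in> N"
      by (rule F.submoduleE(5)[OF N])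
    moreover have "y \<oplus>\<^bsub>free_module R X\<^esub> (x k \<odot>\<^bsub>free_module R X\<^esub> free_basis R k) = x"
      using c by (auto simp: free_module_simps y_def free_basis_def)
    ultimately show ?case by simp
  qed
  show "carrier (free_module R X) \<subseteq> N"
    using *[OF X] by (auto simp: free_module_carrier_finite[OF X])
qed

lemma minus_eq_zero_iff: "x \<in> carrier R \<Longrightarrow> y \<in> carrier R \<Longrightarrow> x \<ominus> y = \<zero> \<longleftrightarrow> x = y"
  by (metis a_minus_def add.inv_closed add.r_inv_ex minus_equality minus_minus r_neg)

lemma free_basis_inj: "\<one> \<noteq> \<zero> \<Longrightarrow> free_basis R i = free_basis R j \<longleftrightarrow> i = j"
  by (auto simp: free_basis_def fun_eq_iff)

lemma form_free_basis_left:
  assumes "finite I" "i \<in> I" "y \<in> carrier (free_module R I)"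
    and "\<And>i j. i \<in> I \<Longrightarrow> j \<in> I \<Longrightarrow> A i j \<in> carrier R"
  shows "form (mspace R I A) (free_basis R i) y = (\<Oplus>j\<in>I. A i j \<otimes> y j)"
proof -
  have y: "y j \<in> carrier R" for j using free_module_closed[OF assms(3)] .
  have "form (mspace R I A) (free_basis R i) y = (\<Oplus>k\<in>I. if k = i then \<Oplus>j\<in>I. A k j \<otimes> y j else \<zero>)"
    unfolding mspace_simps using assms(4) y
    by (intro finsum_cong') (auto simp: free_basis_def intro!: finsum_closed)
  also have "\<dots> = (\<Oplus>j\<in>I. A i j \<otimes> y j)"
    using assms y by (intro finsum_delta(1)) (auto intro!: finsum_closed)
  finally show ?thesis .
qed

lemma form_free_basis:
  assumes "finite I" "i \<in> I" "j \<in> I" and A: "\<And>i j. i \<in> I \<Longrightarrow> j \<in> I \<Longrightarrow> A i j \<in> carrier R"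
  shows "form (mspace R I A) (free_basis R i) (free_basis R j) = A i j"
proof -
  have "form (mspace R I A) (free_basis R i) (free_basis R j) = (\<Oplus>k\<in>I. A i k \<otimes> free_basis R j k)"
    using assms by (intro form_free_basis_left) (auto simp: free_basis_closed)
  also have "\<dots> = (\<Oplus>k\<in>I. if k = j then A i k else \<zero>)"
    using assms by (intro finsum_cong') (auto simp: free_basis_def)
  also have "\<dots> = A i j" using assms by (intro finsum_delta(1)) auto
  finally show ?thesis .
qed

lemma inner_product_space_mspace:
  fixes I :: "'x set"
  assumes A: "unimodular R I A" and nontriv: "\<one> \<noteq> \<zero>"
  shows "inner_product_space R (mspace R I A)"
proof -
  let ?M = "mspace R I A"
  note I = unimodular_finite[OF A] and Ac = unimodular_closed[OF A] and As = unimodular_sym[OF A]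
  interpret M: bilinear_space R ?M by (rule bilinear_space_mspace) (use I Ac As in auto)
  have gen: "N = carrier ?M" if "submodule N R ?M" "\<And>i. i \<in> I \<Longrightarrow> free_basis R i \<in> N" for N
  proof -
    have "submodule N R (free_module R I)"
      using that(1) by (simp add: submodule_def submodule_axioms_def subgroup_def free_module_simps
          a_inv_def m_inv_def)
    then show ?thesis using free_module_generated[OF I _ that(2)] by simp
  qed
  have fg: "finitely_generated R ?M"
  proof -
    have "gen_submodule R ?M (free_basis R ` I) = carrier ?M"
    proof
      show "gen_submodule R ?M (free_basis R ` I) \<subseteq> carrier ?M"
        using M.carrier_is_submodule free_basis_closed
        unfolding gen_submodule_def by (intro Inter_lower) auto
      show "carrier ?M \<subseteq> gen_submodule R ?M (free_basis R ` I)"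
        unfolding gen_submodule_def using gen by (intro Inter_greatest) (auto simp: image_subset_iff)
    qed
    then show ?thesis unfolding finitely_generated_def using I free_basis_closed by (intro exI[of _ "free_basis R ` I"]) auto
  qed
  have proj: "projective R ?M"
  proof -
    \<comment> \<open>\<open>projective\<close> asks for a free module whose index set consists of
      elements of the module itself, so the basis vectors serve as indices. They are pairwise
      distinct because 1 and 0 differ.\<close>
    let ?g = "free_basis R :: 'x \<Rightarrow> 'x \<Rightarrow> 'a"
    define i where "i = (\<lambda>x u. if u \<in> ?g ` I then x (inv_into UNIV ?g u) else \<zero>)"
    define p where "p = (\<lambda>f k. if k \<in> I then f (?g k) else \<zero>)"
    have inj: "inj ?g" by (simp add: inj_def free_basis_inj[OF nontriv])
    have fin: "finite (?g ` I)" using I by simp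
    have "i \<in> module_hom R ?M (free_module R (?g ` I))"
      unfolding module_hom_def
      by (auto simp: i_def free_module_carrier_finite[OF I] free_module_carrier_finite[OF fin] free_module_simps inj fun_eq_iff)
    moreover have "p \<in> module_hom R (free_module R (?g ` I)) ?M"
      unfolding module_hom_def
      by (auto simp: p_def free_module_carrier_finite[OF I] free_module_carrier_finite[OF fin] free_module_simps fun_eq_iff)
    moreover have "p (i x) = x" if "x \<in> carrier ?M" for x
      using that inj by (auto simp: i_def p_def free_module_carrier_finite[OF I] fun_eq_iff)
    ultimately show ?thesis unfolding projective_def by blast
  qed
  have nd: "nondegenerate R ?M"
    unfolding nondegenerate_def
  proof (intro bij_betw_imageI inj_onI)
    fix x y assume x: "x \<in> carrier ?M" and y: "y \<in> carrier ?M"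
      and eq: "restrict (form ?M x) (carrier ?M) = restrict (form ?M y) (carrier ?M)"
    have xc: "x i \<in> carrier R" "y i \<in> carrier R" for i using x y by (auto simp: free_module_closed)
    let ?z = "x \<ominus>\<^bsub>?M\<^esub> y"
    have z: "?z \<in> carrier ?M" using x y by blast
    have "?z k = \<zero>" if k: "k \<in> I" for k
    proof (rule unimodular_kernel[OF A _ _ k])
      show "?z i \<in> carrier R" for i using z by (simp add: free_module_closed)
      fix i assume i: "i \<in> I"
      have b: "free_basis R i \<in> carrier ?M" using i by (simp add: free_basis_closed)
      have "(\<Oplus>j\<in>I. A i j \<otimes> ?z j) = form ?M (free_basis R i) ?z"
        using I i z Ac by (intro form_free_basis_left[symmetric]) auto
      also have "\<dots> = form ?M x (free_basis R i) \<ominus> form ?M y (free_basis R i)"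
        using b x y z unfolding a_minus_def
        by (simp add: M.form_add_right M.form_minus_right M.form_sym[of "free_basis R i"] del: mspace_simps)
      also have "\<dots> = \<zero>"
        using fun_cong[OF eq, of "free_basis R i"] b x y M.form_closed[of y "free_basis R i"]
        by (simp del: mspace_simps add: a_minus_def r_neg)
      finally show "(\<Oplus>j\<in>I. A i j \<otimes> ?z j) = \<zero>" .
    qed
    then have "?z = \<zero>\<^bsub>?M\<^esub>" using z by (auto simp: free_module_carrier_finite[OF I] fun_eq_iff)
    then have "x \<ominus>\<^bsub>?M\<^esub> y \<oplus>\<^bsub>?M\<^esub> y = \<zero>\<^bsub>?M\<^esub> \<oplus>\<^bsub>?M\<^esub> y" by (simp only:)
    then show "x = y" using x y M.M.a_assoc[of x "\<ominus>\<^bsub>?M\<^esub> y" y] M.M.l_neg[of y] M.M.r_zero[of x]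
        M.M.l_zero[of y] M.M.a_inv_closed[of y] by (simp only: a_minus_def)
  next
    show "(\<lambda>x. restrict (form ?M x) (carrier ?M)) ` carrier ?M = dual R ?M"
    proof
      show "(\<lambda>x. restrict (form ?M x) (carrier ?M)) ` carrier ?M \<subseteq> dual R ?M"
      proof (rule image_subsetI)
        fix x assume x: "x \<in> carrier ?M"
        then show "restrict (form ?M x) (carrier ?M) \<in> dual R ?M"
          unfolding dual_def module_hom_def regular_module_def
          using M.form_add_right[of x] M.form_smult_right[of _ x] M.form_closed[of x] M.M.a_closed M.smult_closed
          by (simp del: mspace_simps)
      qed
      show "dual R ?M \<subseteq> (\<lambda>x. restrict (form ?M x) (carrier ?M)) ` carrier ?M"
      proof
        fix \<phi> assume \<phi>: "\<phi> \<in> dual R ?M"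
        have \<phi>c: "\<phi> x \<in> carrier R" if "x \<in> carrier ?M" for x
          using \<phi> that unfolding dual_def module_hom_def regular_module_def by (auto simp: Pi_iff)
        have \<phi>l: "\<phi> (x \<oplus>\<^bsub>?M\<^esub> y) = \<phi> x \<oplus> \<phi> y" if "x \<in> carrier ?M" "y \<in> carrier ?M" for x y
          using \<phi> that unfolding dual_def module_hom_def regular_module_def by simp
        have \<phi>s: "\<phi> (r \<odot>\<^bsub>?M\<^esub> x) = r \<otimes> \<phi> x" if "r \<in> carrier R" "x \<in> carrier ?M" for x r
          using \<phi> that unfolding dual_def module_hom_def regular_module_def by simp
        \<comment> \<open>Pairing with \<open>z\<close> agrees with \<phi> on the basis vectors. The
          set \<open>N\<close> below, where the two functionals agree, is a submodule and therefore
          everything.\<close>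
        obtain z where z: "z \<in> carrier (free_module R I)" "\<And>i. i \<in> I \<Longrightarrow> (\<Oplus>j\<in>I. A i j \<otimes> z j) = \<phi> (free_basis R i)"
          by (rule unimodular_solve[OF A, of "\<lambda>i. \<phi> (free_basis R i)"]) (simp_all add: \<phi>c free_basis_closed)
        have zM: "z \<in> carrier ?M" using z by simp
        define N where "N = {x \<in> carrier ?M. \<phi> x = form ?M z x}"
        have "submodule N R ?M"
        proof (rule M.submoduleI)
          show "\<zero>\<^bsub>?M\<^esub> \<in> N"
            using \<phi>s[of \<zero> "\<zero>\<^bsub>?M\<^esub>"] zM M.form_zero_right[OF zM] \<phi>c by (simp add: N_def del: mspace_simps)
          show "\<ominus>\<^bsub>?M\<^esub> a \<in> N" if "a \<in> N" for a
          proof -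
            have a: "a \<in> carrier ?M" "\<phi> a = form ?M z a" using that by (auto simp: N_def)
            have "\<ominus>\<^bsub>?M\<^esub> a = (\<ominus> \<one>) \<odot>\<^bsub>?M\<^esub> a" using M.smult_l_minus[of \<one> a] M.smult_one[OF a(1)] a(1) by (simp del: mspace_simps)
            then show ?thesis
              using a zM \<phi>s[of "\<ominus> \<one>" a] M.form_smult_right[of "\<ominus> \<one>" z a] M.smult_closed[of "\<ominus> \<one>" a]
              by (simp add: N_def del: mspace_simps)
          qed
        qed (use \<phi>l \<phi>s zM M.form_add_right[of z] M.form_smult_right[of _ z] M.M.a_closed M.smult_closed
              in \<open>auto simp: N_def simp del: mspace_simps\<close>)
        moreover have "free_basis R i \<in> N" if i: "i \<in> I" for i
          using form_free_basis_left[OF I i z(1) Ac] z(2)[OF i] free_basis_closed[OF i] zM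
            M.form_sym[of "free_basis R i" z] by (simp add: N_def del: mspace_simps(5))
        ultimately have "N = carrier ?M" by (rule gen)
        then have "\<phi> = restrict (form ?M z) (carrier ?M)"
          using \<phi> unfolding N_def dual_def by (auto simp: extensional_def fun_eq_iff restrict_def)
        then show "\<phi> \<in> (\<lambda>x. restrict (form ?M x) (carrier ?M)) ` carrier ?M" using zM by blast
      qed
    qed
  qed
  show ?thesis unfolding inner_product_space_def
    using fg proj nd M.symmetric_bilinear M.module_axioms by blast
qed

end

section \<open>Subsets with invertible Gram matrix\<close>

context bilinear_space
begin

lemma lincomb_add:
  "S \<subseteq> carrier V \<Longrightarrow> x \<in> S \<rightarrow> carrier R \<Longrightarrow> y \<in> S \<rightarrow> carrier R \<Longrightarrow>
    lincomb S (\<lambda>s. x s \<oplus> y s) = lincomb S x \<oplus>\<^bsub>V\<^esub> lincomb S y"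
  unfolding lincomb_def
  by (rule trans[OF M.finsum_cong' M.finsum_addf]) (auto simp: smult_l_distr Pi_iff subset_iff)

lemma lincomb_smult:
  "finite S \<Longrightarrow> S \<subseteq> carrier V \<Longrightarrow> r \<in> carrier R \<Longrightarrow> x \<in> S \<rightarrow> carrier R \<Longrightarrow>
    lincomb S (\<lambda>s. r \<otimes> x s) = r \<odot>\<^bsub>V\<^esub> lincomb S x"
  unfolding lincomb_def
  by (subst finsum_smult_ldistr) (auto simp: smult_assoc1 Pi_iff subset_iff intro!: M.finsum_cong')

lemma form_lincomb_lincomb:
  assumes "finite S" "S \<subseteq> carrier V" "x \<in> carrier (free_module R S)" "y \<in> carrier (free_module R S)"
  shows "form V (lincomb S x) (lincomb S y) = form (mspace R S (form V)) x y"
proof -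
  have c: "x i \<in> carrier R" "y i \<in> carrier R" for i using assms by (auto simp: R.free_module_closed)
  have 1: "form V s (lincomb S y) = (\<Oplus>t\<in>S. form V s t \<otimes> y t)" if "s \<in> S" for s
  proof -
    have "form V s (lincomb S y) = (\<Oplus>t\<in>S. y t \<otimes> form V t s)"
      using that assms c by (subst form_sym) (auto intro!: form_lincomb_left)
    also have "\<dots> = (\<Oplus>t\<in>S. form V s t \<otimes> y t)"
      using that assms c by (intro R.finsum_cong') (auto simp: R.m_comm form_sym[of _ s] subset_iff)
    finally show ?thesis .
  qed
  have "form V (lincomb S x) (lincomb S y) = (\<Oplus>s\<in>S. x s \<otimes> form V s (lincomb S y))"
    using assms c by (intro form_lincomb_left) auto
  also have "\<dots> = form (mspace R S (form V)) x y"
    unfolding mspace_simps using assms c by (intro R.finsum_cong') (auto simp: 1 subset_iff intro!: R.finsum_closed)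
  finally show ?thesis .
qed

lemma form_left_lincomb:
  assumes "finite S" "S \<subseteq> carrier V" "x \<in> carrier (free_module R S)" "s \<in> S"
  shows "form V (lincomb S x) s = (\<Oplus>t\<in>S. form V s t \<otimes> x t)"
proof -
  have c: "x i \<in> carrier R" for i using assms by (auto simp: R.free_module_closed)
  have "form V (lincomb S x) s = (\<Oplus>t\<in>S. x t \<otimes> form V t s)"
    using assms c by (intro form_lincomb_left) auto
  also have "\<dots> = (\<Oplus>t\<in>S. form V s t \<otimes> x t)"
    using assms c by (intro R.finsum_cong') (auto simp: R.m_comm form_sym[of _ s] subset_iff)
  finally show ?thesis .
qed

text \<open>The coefficients solve the linear system which says that the remainder is orthogonal to
  every member of \<open>S\<close>.\<close>

lemma unimodular_decomposition:
  assumes S: "S \<subseteq> carrier V" "unimodular R S (form V)" and v: "v \<in> carrier V"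
  obtains x w where "x \<in> carrier (free_module R S)" "w \<in> perp S" "v = lincomb S x \<oplus>\<^bsub>V\<^esub> w"
proof -
  note fin = unimodular_finite[OF S(2)]
  obtain x where x: "x \<in> carrier (free_module R S)" "\<And>s. s \<in> S \<Longrightarrow> (\<Oplus>t\<in>S. form V s t \<otimes> x t) = form V v s"
    using R.unimodular_solve[OF S(2), of "form V v"] S v by (auto simp: subset_iff)
  have l: "lincomb S x \<in> carrier V" using S(1) x(1) by (auto simp: R.free_module_closed)
  have "v \<ominus>\<^bsub>V\<^esub> lincomb S x \<in> perp S"
    using S v l x form_left_lincomb[OF fin S(1) x(1)]
    by (auto simp: perp_def a_minus_def form_simps R.r_neg subset_iff)
  moreover have "v = lincomb S x \<oplus>\<^bsub>V\<^esub> (v \<ominus>\<^bsub>V\<^esub> lincomb S x)"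
    using v l by (simp add: a_minus_def M.a_ac M.r_neg M.a_lcomm)
  ultimately show ?thesis using that x(1) by blast
qed

lemma unimodular_independent:
  assumes S: "S \<subseteq> carrier V" "unimodular R S (form V)" and x: "x \<in> carrier (free_module R S)"
    and 0: "lincomb S x \<in> perp S"
  shows "x = (\<lambda>_. \<zero>)"
proof -
  note fin = unimodular_finite[OF S(2)]
  have "x k = \<zero>" if k: "k \<in> S" for k
    by (rule R.unimodular_kernel[OF S(2) _ _ k])
      (use 0 x form_left_lincomb[OF fin S(1) x] in \<open>auto simp: perp_def R.free_module_closed\<close>)
  then show ?thesis using x by (auto simp: R.free_module_carrier_finite[OF fin])
qed

text \<open>Spanning is encoded as a trivial complement: by \<open>unimodular_decomposition\<close>
  the remainder of every vector then vanishes. Independence is part of unimodularity.\<close>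

definition unimodular_basis :: "'b set \<Rightarrow> bool"
  where "unimodular_basis S \<longleftrightarrow> S \<subseteq> carrier V \<and> unimodular R S (form V) \<and> perp S = {\<zero>\<^bsub>V\<^esub>}"

lemma unimodular_basis_lincomb:
  assumes "unimodular_basis S" "v \<in> carrier V"
  obtains x where "x \<in> carrier (free_module R S)" "v = lincomb S x"
proof -
  obtain x w where "x \<in> carrier (free_module R S)" "w \<in> perp S" "v = lincomb S x \<oplus>\<^bsub>V\<^esub> w"
    using unimodular_decomposition assms unfolding unimodular_basis_def by blast
  then show ?thesis using that[of x] assms by (auto simp: unimodular_basis_def R.free_module_closed)
qed

lemma unimodular_basis_isometric:
  assumes "unimodular_basis S"
  shows "isometric R (mspace R S (form V)) V"
proof -
  have S: "S \<subseteq> carrier V" "unimodular R S (form V)" "perp S = {\<zero>\<^bsub>V\<^esub>}"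
    using assms by (auto simp: unimodular_basis_def)
  note fin = unimodular_finite[OF S(2)]
  interpret F: module R "free_module R S" by (rule R.free_module_module)
  have c: "x \<in> S \<rightarrow> carrier R" if "x \<in> carrier (free_module R S)" for x
    using that by (auto simp: R.free_module_closed)
  have "\<exists>x. x \<in> carrier (free_module R S) \<and> lincomb S x = v" if "v \<in> carrier V" for v
    using unimodular_basis_lincomb[OF assms that] by metis
  then obtain g where g: "\<And>v. v \<in> carrier V \<Longrightarrow> g v \<in> carrier (free_module R S) \<and> lincomb S (g v) = v"
    by metis
  have inj: "x = y" if xy: "x \<in> carrier (free_module R S)" "y \<in> carrier (free_module R S)"
    and eq: "lincomb S x = lincomb S y" for x y
  proof -
    have xyc: "x i \<in> carrier R" "y i \<in> carrier R" for i using xy by (auto simp: R.free_module_closed)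
    define z where "z = (\<lambda>s. x s \<oplus> \<ominus> \<one> \<otimes> y s)"
    have m: "(\<lambda>s. \<ominus> \<one> \<otimes> y s) \<in> carrier (free_module R S)"
      using xy by (intro R.free_module_smult_closed) auto
    have z: "z \<in> carrier (free_module R S)"
      unfolding z_def using xy m by (intro R.free_module_add_closed)
    have "lincomb S z = lincomb S x \<oplus>\<^bsub>V\<^esub> (\<ominus> \<one>) \<odot>\<^bsub>V\<^esub> lincomb S y"
      unfolding z_def using S(1) xy m c fin by (simp add: lincomb_add lincomb_smult)
    also have "\<dots> = \<zero>\<^bsub>V\<^esub>" using S(1) c xy eq by (simp add: smult_l_minus M.r_neg)
    finally have "z = (\<lambda>_. \<zero>)" using unimodular_independent[OF S(1,2) z] S(3) by simp
    then show ?thesis using xyc by (auto simp: z_def fun_eq_iff R.l_minus R.minus_eq[symmetric] R.minus_eq_zero_iff)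
  qed
  show ?thesis
  proof (rule isometryI[where h = "lincomb S" and g = g])
    show "g (lincomb S x) = x" if "x \<in> carrier (mspace R S (form V))" for x
    proof (rule inj)
      have "lincomb S x \<in> carrier V" using that S(1) c by simp
      then show "g (lincomb S x) \<in> carrier (free_module R S)" "lincomb S (g (lincomb S x)) = lincomb S x"
        using g by auto
    qed (use that in simp)
    show "form V (lincomb S x) (lincomb S y) = form (mspace R S (form V)) x y"
      if "x \<in> carrier (mspace R S (form V))" "y \<in> carrier (mspace R S (form V))" for x y
      using form_lincomb_lincomb[OF fin S(1)] that by simp
  qed (use S(1) c fin g in \<open>auto simp: lincomb_add lincomb_smult\<close>)
qed

end

text \<open>The dual basis lemma for finitely generated projective modules. The coordinate
  functionals of the section \<open>i\<close> are represented by vectors \<open>y b\<close> through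
  nondegeneracy, and \<open>p b\<close> is the image of a basis vector of the free module. Later it
  is the only access to projectivity and nondegeneracy.\<close>

lemma inner_product_space_dual_basis:
  fixes R :: "('a, 'r) ring_scheme" and V :: "('a, 'b) form_module"
  assumes V: "inner_product_space R V"
  shows "\<exists>(X :: 'b set) y p. finite X \<and> (\<forall>b\<in>X. y b \<in> carrier V) \<and> (\<forall>b\<in>X. p b \<in> carrier V) \<and>
    (\<forall>v\<in>carrier V. v = (\<Oplus>\<^bsub>V\<^esub>b\<in>X. form V (y b) v \<odot>\<^bsub>V\<^esub> p b))"
proof -
  interpret module R V using V by (simp add: inner_product_space_def)
  obtain X :: "'b set" and i p where i: "i \<in> module_hom R V (free_module R X)" and p: "p \<in> module_hom R (free_module R X) V"
    and pi: "\<And>x. x \<in> carrier V \<Longrightarrow> p (i x) = x"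
    using V unfolding inner_product_space_def projective_def by blast
  obtain X' where X': "finite X'" "X' \<subseteq> X" "i \<in> module_hom R V (free_module R X')"
    using projective_finite_support[OF module_axioms _ i] V unfolding inner_product_space_def by blast
  interpret F: module R "free_module R X'" by (rule R.free_module_module)
  have sub: "carrier (free_module R X') \<subseteq> carrier (free_module R X)"
    using X'(2) by (auto simp: free_module_def)
  have pc: "p x \<in> carrier V" if "x \<in> carrier (free_module R X')" for x
    using p sub that by (auto simp: module_hom_def)
  have pa: "p (\<lambda>b. x b \<oplus>\<^bsub>R\<^esub> y b) = p x \<oplus>\<^bsub>V\<^esub> p y"
    if "x \<in> carrier (free_module R X')" "y \<in> carrier (free_module R X')" for x y
    using p sub that by (auto simp: module_hom_def free_module_simps subset_iff)
  have ps: "p (\<lambda>b. r \<otimes>\<^bsub>R\<^esub> x b) = r \<odot>\<^bsub>V\<^esub> p x" if "r \<in> carrier R" "x \<in> carrier (free_module R X')" for r x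
    using p sub that by (auto simp: module_hom_def free_module_simps subset_iff)
  have ic: "i v b \<in> carrier R" if "v \<in> carrier V" for v b
  proof -
    have "i v \<in> carrier (free_module R X')" using X'(3) that by (auto simp: module_hom_def)
    then show ?thesis by (rule R.free_module_closed)
  qed
  have "\<exists>y\<in>carrier V. \<forall>v\<in>carrier V. form V y v = i v b" if b: "b \<in> X'" for b
  proof -
    have "restrict (\<lambda>v. i v b) (carrier V) \<in> dual R V"
      unfolding dual_def module_hom_def regular_module_def
      using X'(3) ic by (auto simp: module_hom_def free_module_simps)
    moreover have "dual R V = (\<lambda>x. restrict (form V x) (carrier V)) ` carrier V"
      using V unfolding inner_product_space_def nondegenerate_def bij_betw_def by blast
    ultimately obtain y where y: "y \<in> carrier V" "restrict (\<lambda>v. i v b) (carrier V) = restrict (form V y) (carrier V)"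
      by auto
    have "form V y v = i v b" if "v \<in> carrier V" for v
      using fun_cong[OF y(2), of v] that by simp
    then show ?thesis using y(1) by blast
  qed
  then obtain y where y: "\<And>b. b \<in> X' \<Longrightarrow> y b \<in> carrier V \<and> (\<forall>v\<in>carrier V. form V (y b) v = i v b)"
    by metis
  define q where "q = (\<lambda>b. p (free_basis R b))"
  have qc: "q b \<in> carrier V" if "b \<in> X'" for b
    using that pc by (simp add: q_def R.free_basis_closed)
  define S where "S = (\<lambda>x. \<Oplus>\<^bsub>V\<^esub>b\<in>X'. x b \<odot>\<^bsub>V\<^esub> q b)"
  \<comment> \<open>\<open>p\<close> and its expansion \<open>S\<close> in basis vectors are both
    linear, so the place where they agree is a submodule containing the basis.\<close>
  define N where "N = {x \<in> carrier (free_module R X'). p x = S x}"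
  have c: "x b \<in> carrier R" if "x \<in> carrier (free_module R X')" for x b
    using R.free_module_closed[OF that] .
  have Sa: "S (\<lambda>b. x b \<oplus>\<^bsub>R\<^esub> y b) = S x \<oplus>\<^bsub>V\<^esub> S y"
    if "x \<in> carrier (free_module R X')" "y \<in> carrier (free_module R X')" for x y
    unfolding S_def using c[OF that(1)] c[OF that(2)] qc
    by (intro trans[OF M.finsum_cong' M.finsum_addf]) (auto simp: smult_l_distr)
  have Ss: "S (\<lambda>b. r \<otimes>\<^bsub>R\<^esub> x b) = r \<odot>\<^bsub>V\<^esub> S x" if "r \<in> carrier R" "x \<in> carrier (free_module R X')" for r x
    unfolding S_def using c[OF that(2)] that(1) qc X'(1)
    by (subst finsum_smult_ldistr) (auto simp: smult_assoc1 intro!: M.finsum_cong')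
  have "submodule N R (free_module R X')"
  proof (rule F.submoduleI)
    have z: "(\<lambda>_. \<zero>\<^bsub>R\<^esub>) \<in> carrier (free_module R X')" using F.zero_closed by (simp add: free_module_simps)
    have "p (\<lambda>_. \<zero>\<^bsub>R\<^esub>) = \<zero>\<^bsub>V\<^esub>" using ps[OF R.zero_closed z] pc[OF z] by simp
    moreover have "S (\<lambda>_. \<zero>\<^bsub>R\<^esub>) = \<zero>\<^bsub>V\<^esub>" using qc by (auto simp: S_def intro!: M.add.finprod_one_eqI)
    ultimately show "\<zero>\<^bsub>free_module R X'\<^esub> \<in> N" using z by (simp add: N_def free_module_simps)
    show "\<ominus>\<^bsub>free_module R X'\<^esub> a \<in> N" if "a \<in> N" for a
    proof -
      have a: "a \<in> carrier (free_module R X')" "p a = S a" using that by (auto simp: N_def)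
      have "\<ominus>\<^bsub>free_module R X'\<^esub> a = (\<lambda>b. \<ominus>\<^bsub>R\<^esub> \<one>\<^bsub>R\<^esub> \<otimes>\<^bsub>R\<^esub> a b)"
        using F.smult_l_minus[of "\<one>\<^bsub>R\<^esub>" a] F.smult_one[OF a(1)] a(1) by (simp add: free_module_simps)
      then show ?thesis
        using a ps[of "\<ominus>\<^bsub>R\<^esub> \<one>\<^bsub>R\<^esub>" a] Ss[of "\<ominus>\<^bsub>R\<^esub> \<one>\<^bsub>R\<^esub>" a] F.smult_closed[of "\<ominus>\<^bsub>R\<^esub> \<one>\<^bsub>R\<^esub>" a]
        by (simp add: N_def free_module_simps)
    qed
  qed (auto simp: N_def free_module_simps pa Sa ps Ss R.free_module_add_closed R.free_module_smult_closed)
  moreover have "free_basis R b \<in> N" if b: "b \<in> X'" for b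
  proof -
    have "S (free_basis R b) = (\<Oplus>\<^bsub>V\<^esub>k\<in>X'. if k = b then q k else \<zero>\<^bsub>V\<^esub>)"
      unfolding S_def using qc by (intro M.finsum_cong') (auto simp: free_basis_def)
    also have "\<dots> = q b" using X'(1) b qc by (intro M.finsum_delta(1)) auto
    finally show ?thesis using b by (simp add: N_def q_def R.free_basis_closed)
  qed
  ultimately have N: "N = carrier (free_module R X')" by (rule R.free_module_generated[OF X'(1)])
  have "v = (\<Oplus>\<^bsub>V\<^esub>b\<in>X'. form V (y b) v \<odot>\<^bsub>V\<^esub> q b)" if v: "v \<in> carrier V" for v
  proof -
    have "i v \<in> N" using X'(3) v by (auto simp: N module_hom_def)
    then have "v = S (i v)" using pi[OF v] by (simp add: N_def)
    also have "\<dots> = (\<Oplus>\<^bsub>V\<^esub>b\<in>X'. form V (y b) v \<odot>\<^bsub>V\<^esub> q b)"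
      unfolding S_def using y v qc ic by (intro M.finsum_cong') auto
    finally show ?thesis .
  qed
  then have "finite X' \<and> (\<forall>b\<in>X'. y b \<in> carrier V) \<and> (\<forall>b\<in>X'. q b \<in> carrier V) \<and>
    (\<forall>v\<in>carrier V. v = (\<Oplus>\<^bsub>V\<^esub>b\<in>X'. form V (y b) v \<odot>\<^bsub>V\<^esub> q b))"
    using X'(1) y qc by blast
  then show ?thesis by blast
qed

section \<open>Orthogonal bases\<close>

context bilinear_space
begin

definition span :: "'b set \<Rightarrow> 'b set"
  where "span T = {lincomb T x | x. x \<in> T \<rightarrow> carrier R}"

lemma lincomb_uminus:
  assumes "finite S" "S \<subseteq> carrier V" "x \<in> S \<rightarrow> carrier R"
  shows "lincomb S (\<lambda>s. \<ominus> \<one> \<otimes> x s) = \<ominus>\<^bsub>V\<^esub> lincomb S x"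
  using assms by (simp add: lincomb_smult smult_l_minus)

text \<open>Stated for an ideal of coefficients because two cases occur: the unit ideal gives
  \<open>span\<close>, and the maximal ideal gives the multiple of the span used in the Nakayama
  argument.\<close>

lemma lincomb_ideal_submodule:
  assumes "finite T" "T \<subseteq> carrier V" "ideal I R"
  shows "submodule {lincomb T x | x. x \<in> T \<rightarrow> I} R V"
proof -
  interpret I: ideal I R by fact
  have c: "x \<in> T \<rightarrow> carrier R" if "x \<in> T \<rightarrow> I" for x using that by (auto simp: Pi_iff intro: I.Icarr)
  show ?thesis
  proof (rule submoduleI)
    show "{lincomb T x | x. x \<in> T \<rightarrow> I} \<subseteq> carrier V" using c assms by auto
    have z: "\<zero> \<in> I" using I.is_additive_subgroup additive_subgroup.zero_closed by blast
    have "lincomb T (\<lambda>_. \<zero>) = \<zero>\<^bsub>V\<^esub>"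
      unfolding lincomb_def using assms(2) by (intro M.add.finprod_one_eqI) auto
    then show "\<zero>\<^bsub>V\<^esub> \<in> {lincomb T x | x. x \<in> T \<rightarrow> I}"
      using z by (intro CollectI exI[of _ "\<lambda>_. \<zero>"]) simp
  next
    fix a assume "a \<in> {lincomb T x | x. x \<in> T \<rightarrow> I}"
    then obtain x where x: "a = lincomb T x" "x \<in> T \<rightarrow> I" by blast
    have "(\<lambda>s. \<ominus> \<one> \<otimes> x s) \<in> T \<rightarrow> I" using x(2) by (simp add: Pi_iff I.I_l_closed)
    then show "\<ominus>\<^bsub>V\<^esub> a \<in> {lincomb T x | x. x \<in> T \<rightarrow> I}"
      using lincomb_uminus[OF assms(1,2) c[OF x(2)]] x(1) by (intro CollectI exI[of _ "\<lambda>s. \<ominus> \<one> \<otimes> x s"] conjI) simp_all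
  next
    fix a b assume "a \<in> {lincomb T x | x. x \<in> T \<rightarrow> I}" "b \<in> {lincomb T x | x. x \<in> T \<rightarrow> I}"
    then obtain x y where x: "a = lincomb T x" "x \<in> T \<rightarrow> I" "b = lincomb T y" "y \<in> T \<rightarrow> I" by blast
    have "(\<lambda>s. x s \<oplus> y s) \<in> T \<rightarrow> I"
      using x additive_subgroup.a_closed[OF I.is_additive_subgroup] by (simp add: Pi_iff)
    then show "a \<oplus>\<^bsub>V\<^esub> b \<in> {lincomb T x | x. x \<in> T \<rightarrow> I}"
      using lincomb_add[OF assms(2) c[OF x(2)] c[OF x(4)]] x(1,3) by (intro CollectI exI[of _ "\<lambda>s. x s \<oplus> y s"] conjI) simp_all
  next
    fix r a assume r: "r \<in> carrier R" "a \<in> {lincomb T x | x. x \<in> T \<rightarrow> I}"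
    then obtain x where x: "a = lincomb T x" "x \<in> T \<rightarrow> I" by blast
    have "(\<lambda>s. r \<otimes> x s) \<in> T \<rightarrow> I" using x(2) r(1) by (simp add: Pi_iff I.I_l_closed)
    then show "r \<odot>\<^bsub>V\<^esub> a \<in> {lincomb T x | x. x \<in> T \<rightarrow> I}"
      using lincomb_smult[OF assms(1,2) r(1) c[OF x(2)]] x(1) by (intro CollectI exI[of _ "\<lambda>s. r \<otimes> x s"] conjI) simp_all
  qed
qed

lemma span_submodule: "finite T \<Longrightarrow> T \<subseteq> carrier V \<Longrightarrow> submodule (span T) R V"
  unfolding span_def by (rule lincomb_ideal_submodule) (auto intro: R.oneideal)

lemma lincomb_free_basis:
  assumes "finite T" "T \<subseteq> carrier V" "t \<in> T"
  shows "lincomb T (free_basis R t) = t"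
proof -
  have "lincomb T (free_basis R t) = (\<Oplus>\<^bsub>V\<^esub>s\<in>T. if s = t then s else \<zero>\<^bsub>V\<^esub>)"
    unfolding lincomb_def using assms by (intro M.finsum_cong') (auto simp: free_basis_def)
  also have "\<dots> = t" using assms by (intro M.finsum_delta(1)[where f = "\<lambda>s. s"]) auto
  finally show ?thesis .
qed

lemma span_superset:
  assumes "finite T" "T \<subseteq> carrier V"
  shows "T \<subseteq> span T"
proof
  fix t assume "t \<in> T"
  moreover have "free_basis R t \<in> T \<rightarrow> carrier R" by (auto simp: free_basis_def)
  ultimately show "t \<in> span T"
    using lincomb_free_basis[OF assms] unfolding span_def by (metis (mono_tags, lifting) mem_Collect_eq)
qed

lemma span_minimal: "finite T \<Longrightarrow> submodule N R V \<Longrightarrow> T \<subseteq> N \<Longrightarrow> span T \<subseteq> N"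
  unfolding span_def using submodule_lincomb by blast

lemma perp_closed: "v \<in> perp S \<Longrightarrow> v \<in> carrier V"
  by (simp add: perp_def)

lemma perp_Un: "perp (S \<union> T) = perp S \<inter> perp T"
  by (auto simp: perp_def)

lemma form_perp_lincomb:
  assumes "finite C" "C \<subseteq> carrier V" "x \<in> C \<rightarrow> carrier R" "w \<in> perp C"
  shows "form V (lincomb C x) w = \<zero>"
proof -
  have "form V (lincomb C x) w = (\<Oplus>s\<in>C. x s \<otimes> form V s w)"
    using assms by (intro form_lincomb_left) (auto simp: perp_def)
  also have "\<dots> = (\<Oplus>s\<in>C. \<zero>)"
    using assms form_sym[of _ w] by (intro R.finsum_cong') (auto simp: perp_def Pi_iff subset_iff)
  finally show ?thesis by simp
qed

section \<open>Orthogonal projection along a unimodular set\<close>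

definition proj :: "'b set \<Rightarrow> 'b \<Rightarrow> 'b"
  where "proj C v = (THE w. w \<in> perp C \<and> (\<exists>x\<in>carrier (free_module R C). v = lincomb C x \<oplus>\<^bsub>V\<^esub> w))"

context
  fixes C assumes C: "C \<subseteq> carrier V" "unimodular R C (form V)"
begin

lemma finC: "finite C"
  using C unimodular_finite by blast

lemma lincomb_freeC: "x \<in> carrier (free_module R C) \<Longrightarrow> lincomb C x \<in> carrier V"
  using C(1) by (auto simp: R.free_module_closed)

text \<open>Uniqueness behind the definite description in \<open>proj\<close>: the difference of two
  decompositions exhibits a combination of \<open>C\<close> that lies in \<open>perp C\<close>, and
  \<open>unimodular_independent\<close> makes it vanish.\<close>

lemma proj_eqI:
  assumes w: "w \<in> perp C" and x: "x \<in> carrier (free_module R C)"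
  shows "proj C (lincomb C x \<oplus>\<^bsub>V\<^esub> w) = w"
  unfolding proj_def
proof (rule the_equality)
  show "w \<in> perp C \<and> (\<exists>xa\<in>carrier (free_module R C). lincomb C x \<oplus>\<^bsub>V\<^esub> w = lincomb C xa \<oplus>\<^bsub>V\<^esub> w)"
    using w x by blast
  fix w' assume "w' \<in> perp C \<and> (\<exists>xa\<in>carrier (free_module R C). lincomb C x \<oplus>\<^bsub>V\<^esub> w = lincomb C xa \<oplus>\<^bsub>V\<^esub> w')"
  then obtain y where y: "w' \<in> perp C" "y \<in> carrier (free_module R C)"
    "lincomb C x \<oplus>\<^bsub>V\<^esub> w = lincomb C y \<oplus>\<^bsub>V\<^esub> w'" by blast
  have c: "x i \<in> carrier R" "y i \<in> carrier R" for i using x y(2) by (auto simp: R.free_module_closed)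
  have wc: "w \<in> carrier V" "w' \<in> carrier V" using w y(1) perp_closed by auto
  note lc = lincomb_freeC[OF x] lincomb_freeC[OF y(2)]
  define z where "z = (\<lambda>s. x s \<oplus> \<ominus> \<one> \<otimes> y s)"
  have my: "(\<lambda>s. \<ominus> \<one> \<otimes> y s) \<in> carrier (free_module R C)"
    using y(2) by (intro R.free_module_smult_closed) auto
  have z: "z \<in> carrier (free_module R C)"
    unfolding z_def using x my by (intro R.free_module_add_closed)
  have "lincomb C z = lincomb C x \<oplus>\<^bsub>V\<^esub> \<ominus>\<^bsub>V\<^esub> lincomb C y"
    unfolding z_def using C(1) c by (simp add: lincomb_add lincomb_uminus finC)
  also have "\<dots> = (lincomb C x \<oplus>\<^bsub>V\<^esub> w) \<oplus>\<^bsub>V\<^esub> (\<ominus>\<^bsub>V\<^esub> lincomb C y \<oplus>\<^bsub>V\<^esub> \<ominus>\<^bsub>V\<^esub> w)"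
    using lc wc M.minus_add by (simp add: M.a_ac M.r_neg1 M.r_neg2 M.r_neg)
  also have "\<dots> = w' \<oplus>\<^bsub>V\<^esub> \<ominus>\<^bsub>V\<^esub> w"
    unfolding y(3) using lc wc by (simp add: M.a_ac M.r_neg1 M.r_neg2 M.r_neg)
  also have "\<dots> \<in> perp C"
    using submoduleE(3,5)[OF perp_submodule[OF C(1)]] w y(1) by blast
  finally have "z = (\<lambda>_. \<zero>)" using unimodular_independent[OF C z] by simp
  then have "x i = y i" for i
    using c[of i] R.minus_eq_zero_iff[of "x i" "y i"] by (metis R.l_minus R.l_one R.minus_eq R.one_closed z_def)
  then have "x = y" by auto
  then show "w' = w" using y(3) lc wc by simp
qed

lemma proj_decomposition:
  assumes v: "v \<in> carrier V"
  obtains x where "x \<in> carrier (free_module R C)" "proj C v \<in> perp C" "v = lincomb C x \<oplus>\<^bsub>V\<^esub> proj C v"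
  using unimodular_decomposition[OF C v] proj_eqI by metis

lemma proj_perp [simp]: "v \<in> carrier V \<Longrightarrow> proj C v \<in> perp C"
  using proj_decomposition by metis

lemma proj_closed [simp]: "v \<in> carrier V \<Longrightarrow> proj C v \<in> carrier V"
  using proj_perp perp_closed by blast

lemma zero_free_module: "(\<lambda>_. \<zero>) \<in> carrier (free_module R C)"
  by (auto simp: free_module_def)

lemma proj_id: "w \<in> perp C \<Longrightarrow> proj C w = w"
  using proj_eqI[OF _ zero_free_module, of w] perp_closed[of w C] C(1)
  by (simp add: lincomb_def M.add.finprod_one_eqI subset_iff)

lemma proj_add:
  assumes "u \<in> carrier V" "v \<in> carrier V"
  shows "proj C (u \<oplus>\<^bsub>V\<^esub> v) = proj C u \<oplus>\<^bsub>V\<^esub> proj C v"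
proof -
  obtain x where x: "x \<in> carrier (free_module R C)" "u = lincomb C x \<oplus>\<^bsub>V\<^esub> proj C u"
    using proj_decomposition[OF assms(1)] .
  obtain y where y: "y \<in> carrier (free_module R C)" "v = lincomb C y \<oplus>\<^bsub>V\<^esub> proj C v"
    using proj_decomposition[OF assms(2)] .
  have c: "x i \<in> carrier R" "y i \<in> carrier R" for i using x(1) y(1) by (auto simp: R.free_module_closed)
  have "lincomb C (\<lambda>s. x s \<oplus> y s) \<oplus>\<^bsub>V\<^esub> (proj C u \<oplus>\<^bsub>V\<^esub> proj C v) =
      (lincomb C x \<oplus>\<^bsub>V\<^esub> proj C u) \<oplus>\<^bsub>V\<^esub> (lincomb C y \<oplus>\<^bsub>V\<^esub> proj C v)"
    using assms lincomb_freeC x(1) y(1) C(1) c by (simp add: lincomb_add M.a_ac)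
  also have "\<dots> = u \<oplus>\<^bsub>V\<^esub> v" using x(2) y(2) by simp
  finally show ?thesis
    using proj_eqI[OF submoduleE(5)[OF perp_submodule[OF C(1)]] R.free_module_add_closed[OF x(1) y(1)]] assms
    by (metis proj_perp)
qed

lemma proj_smult:
  assumes "r \<in> carrier R" "v \<in> carrier V"
  shows "proj C (r \<odot>\<^bsub>V\<^esub> v) = r \<odot>\<^bsub>V\<^esub> proj C v"
proof -
  obtain y where y: "y \<in> carrier (free_module R C)" "v = lincomb C y \<oplus>\<^bsub>V\<^esub> proj C v"
    using proj_decomposition[OF assms(2)] .
  have c: "y i \<in> carrier R" for i using y(1) by (auto simp: R.free_module_closed)
  have "lincomb C (\<lambda>s. r \<otimes> y s) \<oplus>\<^bsub>V\<^esub> r \<odot>\<^bsub>V\<^esub> proj C v = r \<odot>\<^bsub>V\<^esub> (lincomb C y \<oplus>\<^bsub>V\<^esub> proj C v)"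
    using assms lincomb_freeC y(1) C(1) c by (simp add: lincomb_smult smult_r_distr finC)
  also have "\<dots> = r \<odot>\<^bsub>V\<^esub> v" using y(2) by simp
  finally show ?thesis
    using proj_eqI[OF submoduleE(4)[OF perp_submodule[OF C(1)]] R.free_module_smult_closed[OF assms(1) y(1)]] assms
    by (metis proj_perp)
qed

lemma proj_finsum:
  "finite X \<Longrightarrow> f \<in> X \<rightarrow> carrier V \<Longrightarrow> proj C (\<Oplus>\<^bsub>V\<^esub>b\<in>X. f b) = (\<Oplus>\<^bsub>V\<^esub>b\<in>X. proj C (f b))"
  by (induction X rule: finite_induct)
    (auto simp: proj_add Pi_iff M.finsum_closed proj_id submodule_zero[OF perp_submodule[OF C(1)]])

lemma proj_in: "c \<in> C \<Longrightarrow> proj C c = \<zero>\<^bsub>V\<^esub>"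
  using proj_eqI[OF submodule_zero[OF perp_submodule[OF C(1)]] R.free_basis_closed, of c]
    lincomb_free_basis[OF finC C(1), of c] C(1) by auto

lemma form_proj:
  assumes "v \<in> carrier V" "w \<in> perp C"
  shows "form V (proj C v) w = form V v w"
proof -
  obtain y where y: "y \<in> carrier (free_module R C)" "v = lincomb C y \<oplus>\<^bsub>V\<^esub> proj C v"
    using proj_decomposition[OF assms(1)] .
  have "form V v w = form V (lincomb C y) w \<oplus> form V (proj C v) w"
    using y(2) form_add_left[OF lincomb_freeC[OF y(1)] proj_closed[OF assms(1)] perp_closed[OF assms(2)]] by simp
  moreover have "form V (lincomb C y) w = \<zero>"
    using y(1) by (intro form_perp_lincomb[OF finC C(1) _ assms(2)]) (auto simp: R.free_module_closed)
  moreover have "form V (proj C v) w \<in> carrier R" using assms perp_closed by simp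
  ultimately show ?thesis by simp
qed

text \<open>Projection kills \<open>C\<close> and fixes \<open>perp C\<close>, so generators in
  \<open>C\<close> may be dropped when passing to the smaller complement. This loss of generators
  drives the descent in \<open>exhaust_by_splitting\<close>.\<close>

lemma span_proj:
  assumes T: "finite T" "T \<subseteq> carrier V" "span T = perp K" "C \<subseteq> T" and K: "K \<subseteq> carrier V"
  shows "span (proj C ` (T - C)) = perp (K \<union> C)"
proof
  let ?S = "proj C ` (T - C)"
  have S: "finite ?S" "?S \<subseteq> carrier V" using T by auto
  have CK: "C \<subseteq> perp K" using span_superset[OF T(1,2)] T(3,4) by blast
  have "proj C t \<in> perp (K \<union> C)" if t: "t \<in> T" for t
  proof -
    have tc: "t \<in> carrier V" using t T(2) by blast
    obtain y where y: "y \<in> carrier (free_module R C)" "t = lincomb C y \<oplus>\<^bsub>V\<^esub> proj C t"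
      using proj_decomposition[OF tc] .
    have l: "lincomb C y \<in> perp K"
      using y(1) by (intro submodule_lincomb[OF perp_submodule[OF K] finC CK]) (auto simp: R.free_module_closed)
    have "proj C t = t \<oplus>\<^bsub>V\<^esub> \<ominus>\<^bsub>V\<^esub> lincomb C y"
      using y(2) lincomb_freeC[OF y(1)] proj_closed[OF tc]
      by (metis M.a_comm M.a_inv_closed M.r_neg1 tc)
    also have "\<dots> \<in> perp K"
      using t span_superset[OF T(1,2)] T(3) l submoduleE(3,5)[OF perp_submodule[OF K]] by blast
    finally show ?thesis using proj_perp[OF tc] by (simp add: perp_Un)
  qed
  then show "span ?S \<subseteq> perp (K \<union> C)"
    using K C(1) by (intro span_minimal S perp_submodule) auto
  show "perp (K \<union> C) \<subseteq> span ?S"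
  proof
    fix v assume v: "v \<in> perp (K \<union> C)"
    note sub = span_submodule[OF S]
    \<comment> \<open>The preimage of the claimed span under the projection. It contains
      \<open>T\<close>, hence all of \<open>perp K\<close>, and vectors orthogonal to
      \<open>C\<close> are their own projections.\<close>
    define N where "N = {v \<in> carrier V. proj C v \<in> span ?S}"
    have "submodule N R V"
    proof (rule submoduleI)
      show "\<zero>\<^bsub>V\<^esub> \<in> N"
        using submodule_zero[OF sub] proj_id[OF submodule_zero[OF perp_submodule[OF C(1)]]] by (simp add: N_def)
      show "\<ominus>\<^bsub>V\<^esub> a \<in> N" if "a \<in> N" for a
      proof -
        have a: "a \<in> carrier V" "proj C a \<in> span ?S" using that by (auto simp: N_def)
        have "\<ominus>\<^bsub>V\<^esub> a = (\<ominus> \<one>) \<odot>\<^bsub>V\<^esub> a" using a by (simp add: smult_l_minus)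
        then show ?thesis using a submoduleE(4)[OF sub] by (simp add: N_def proj_smult)
      qed
    qed (auto simp: N_def proj_add proj_smult intro: submoduleE(4,5)[OF sub])
    moreover have "T \<subseteq> N"
    proof
      fix t assume t: "t \<in> T"
      show "t \<in> N"
      proof (cases "t \<in> C")
        case True
        then show ?thesis using C(1) submodule_zero[OF sub] by (auto simp: N_def proj_in)
      next
        case False
        then show ?thesis using t T(2) span_superset[OF S] by (auto simp: N_def)
      qed
    qed
    ultimately have "span T \<subseteq> N" by (rule span_minimal[OF T(1)])
    then have "v \<in> N" using v T(3) by (auto simp: perp_Un)
    then show "v \<in> span ?S" using v by (simp add: N_def proj_id perp_Un)
  qed
qed

end

lemma unimodular_singleton:
  assumes "t \<in> carrier V" "form V t t \<in> Units R"
  shows "unimodular R {t} (form V)"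
  unfolding unimodular_def
  using assms by (auto intro!: exI[of _ "\<lambda>_ _. inv form V t t"])

lemma unimodular_pair:
  assumes t: "t \<in> carrier V" "t' \<in> carrier V" and neq: "t \<noteq> t'"
    and u: "form V t t \<otimes> form V t' t' \<ominus> form V t t' \<otimes> form V t t' \<in> Units R" (is "?\<delta> \<in> _")
  shows "unimodular R {t, t'} (form V)"
proof -
  define p q r d where "p = form V t t" "q = form V t' t'" "r = form V t t'" "d = inv ?\<delta>"
  note pqr = p_q_r_d_def
  have c: "p \<in> carrier R" "q \<in> carrier R" "r \<in> carrier R" "d \<in> carrier R"
    using t u by (auto simp: pqr)
  have d: "(p \<otimes> q \<ominus> r \<otimes> r) \<otimes> d = \<one>" using u by (simp add: pqr)
  have r': "form V t' t = r" using t form_sym by (simp add: pqr)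
  \<comment> \<open>The adjugate of the 2 by 2 Gram matrix, divided by its determinant.\<close>
  define B where "B = (\<lambda>x y. if x = y then if x = t then q \<otimes> d else p \<otimes> d else \<ominus> r \<otimes> d)"
  have 1: "p \<otimes> (q \<otimes> d) \<oplus> r \<otimes> (\<ominus> r \<otimes> d) = (p \<otimes> q \<ominus> r \<otimes> r) \<otimes> d"
    "r \<otimes> (\<ominus> r \<otimes> d) \<oplus> q \<otimes> (p \<otimes> d) = (p \<otimes> q \<ominus> r \<otimes> r) \<otimes> d"
    "p \<otimes> (\<ominus> r \<otimes> d) \<oplus> r \<otimes> (p \<otimes> d) = \<zero>" "r \<otimes> (q \<otimes> d) \<oplus> q \<otimes> (\<ominus> r \<otimes> d) = \<zero>"
    using c by algebra+
  have 2: "(\<Oplus>j\<in>{t, t'}. f j) = f t \<oplus> f t'" if "f t \<in> carrier R" "f t' \<in> carrier R" for f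
    using neq that by simp
  have "(\<Oplus>j\<in>{t, t'}. form V i j \<otimes> B j k) = (if i = k then \<one> else \<zero>)"
    if "i \<in> {t, t'}" "k \<in> {t, t'}" for i k
    using that neq c by (subst 2) (auto simp: B_def r' 1 d pqr(1-3)[symmetric])
  moreover have "B i j \<in> carrier R" for i j using c by (simp add: B_def)
  moreover have "form V i j \<in> carrier R \<and> form V i j = form V j i" if "i \<in> {t, t'}" "j \<in> {t, t'}" for i j
    using that t form_sym[of i j] by auto
  ultimately show ?thesis unfolding unimodular_def by blast
qed

lemma unimodular_Un:
  assumes C: "C \<subseteq> carrier V" "unimodular R C (form V)" and D: "D \<subseteq> perp C" "unimodular R D (form V)"
    and disj: "C \<inter> D = {}"
  shows "unimodular R (C \<union> D) (form V)"
proof -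
  obtain B where B: "\<And>i j. i \<in> C \<Longrightarrow> j \<in> C \<Longrightarrow> B i j \<in> carrier R"
    "\<And>i k. i \<in> C \<Longrightarrow> k \<in> C \<Longrightarrow> (\<Oplus>j\<in>C. form V i j \<otimes> B j k) = (if i = k then \<one> else \<zero>)"
    using C(2) unfolding unimodular_def by blast
  obtain B' where B': "\<And>i j. i \<in> D \<Longrightarrow> j \<in> D \<Longrightarrow> B' i j \<in> carrier R"
    "\<And>i k. i \<in> D \<Longrightarrow> k \<in> D \<Longrightarrow> (\<Oplus>j\<in>D. form V i j \<otimes> B' j k) = (if i = k then \<one> else \<zero>)"
    using D(2) unfolding unimodular_def by blast
  \<comment> \<open>The two inverses as diagonal blocks. The mixed entries of the Gram matrix vanish
    because \<open>D\<close> lies in \<open>perp C\<close>.\<close>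
  define E where "E = (\<lambda>i j. if i \<in> C \<and> j \<in> C then B i j else if i \<in> D \<and> j \<in> D then B' i j else \<zero>)"
  have Dc: "D \<subseteq> carrier V" using D(1) perp_closed by blast
  have fin: "finite C" "finite D" using C(2) D(2) unimodular_finite by auto
  have Ec: "E i j \<in> carrier R" for i j using B(1) B'(1) by (auto simp: E_def)
  have orth: "form V x y = \<zero>" "form V y x = \<zero>" if "x \<in> C" "y \<in> D" for x y
    using that D(1) C(1) form_sym[of x y] by (auto simp: perp_def subset_iff)
  have "(\<Oplus>j\<in>C \<union> D. form V i j \<otimes> E j k) = (if i = k then \<one> else \<zero>)"
    if ik: "i \<in> C \<union> D" "k \<in> C \<union> D" for i k
  proof -
    have ic: "form V i j \<in> carrier R" if "j \<in> C \<union> D" for j using ik that C(1) Dc by auto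
    have "(\<Oplus>j\<in>C \<union> D. form V i j \<otimes> E j k) = (\<Oplus>j\<in>C. form V i j \<otimes> E j k) \<oplus> (\<Oplus>j\<in>D. form V i j \<otimes> E j k)"
      using ic Ec fin disj by (intro R.finsum_Un_disjoint) auto
    also have "(\<Oplus>j\<in>C. form V i j \<otimes> E j k) = (if i \<in> C \<and> k \<in> C then if i = k then \<one> else \<zero> else \<zero>)"
    proof (cases "i \<in> C \<and> k \<in> C")
      case True
      then have "(\<Oplus>j\<in>C. form V i j \<otimes> E j k) = (\<Oplus>j\<in>C. form V i j \<otimes> B j k)"
        using ic B(1) by (intro R.finsum_cong') (auto simp: E_def)
      then show ?thesis using B(2) True by simp
    next
      case False
      then have "(\<Oplus>j\<in>C. form V i j \<otimes> E j k) = (\<Oplus>j\<in>C. \<zero>)"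
        using ic Ec B(1) ik disj orth(2)[of _ i] by (intro R.finsum_cong') (auto simp: E_def)
      then show ?thesis using False by auto
    qed
    also have "(\<Oplus>j\<in>D. form V i j \<otimes> E j k) = (if i \<in> D \<and> k \<in> D then if i = k then \<one> else \<zero> else \<zero>)"
    proof (cases "i \<in> D \<and> k \<in> D")
      case True
      then have "(\<Oplus>j\<in>D. form V i j \<otimes> E j k) = (\<Oplus>j\<in>D. form V i j \<otimes> B' j k)"
        using ic B'(1) disj by (intro R.finsum_cong') (auto simp: E_def)
      then show ?thesis using B'(2) True by simp
    next
      case False
      then have "(\<Oplus>j\<in>D. form V i j \<otimes> E j k) = (\<Oplus>j\<in>D. \<zero>)"
        using ic Ec B'(1) ik disj orth(1)[of i] by (intro R.finsum_cong') (auto simp: E_def)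
      then show ?thesis using False by auto
    qed
    finally show ?thesis using ik disj by auto
  qed
  moreover have "form V i j \<in> carrier R \<and> form V i j = form V j i" if "i \<in> C \<union> D" "j \<in> C \<union> D" for i j
    using that C(1) Dc form_sym[of i j] by auto
  ultimately show ?thesis unfolding unimodular_def using fin Ec by blast
qed

definition orth_set :: "'b set \<Rightarrow> bool"
  where "orth_set E \<longleftrightarrow> finite E \<and> E \<subseteq> carrier V \<and> (\<forall>e\<in>E. form V e e \<in> Units R) \<and>
    (\<forall>e\<in>E. \<forall>f\<in>E. e \<noteq> f \<longrightarrow> form V e f = \<zero>)"

lemma orth_set_unimodular:
  assumes E: "orth_set E"
  shows "unimodular R E (form V)"
proof -
  define B where "B = (\<lambda>e f. if e = f then inv (form V e e) else \<zero>)"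
  have "(\<Oplus>j\<in>E. form V i j \<otimes> B j k) = (if i = k then \<one> else \<zero>)" if ik: "i \<in> E" "k \<in> E" for i k
  proof -
    have "(\<Oplus>j\<in>E. form V i j \<otimes> B j k) = (\<Oplus>j\<in>E. if j = k then if i = k then \<one> else \<zero> else \<zero>)"
      using E ik by (intro R.finsum_cong') (auto simp: orth_set_def B_def subset_iff)
    also have "\<dots> = (if i = k then \<one> else \<zero>)"
      using E ik by (intro R.finsum_delta(1)) (auto simp: orth_set_def)
    finally show ?thesis .
  qed
  then show ?thesis
    using E form_sym unfolding unimodular_def orth_set_def
    by (auto intro!: exI[of _ B] simp: B_def subset_iff)
qed

end

section \<open>Splitting off vectors over a local ring\<close>

locale local_bilinear_space = bilinear_space R V + local_ring \<mm> R
  for \<mm> and R (structure) and V :: "('a, 'b) form_module"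
begin

lemma one_not_zero: "\<one> \<noteq> \<zero>"
  using one_imp_carrier I_notcarr additive_subgroup.zero_closed[OF is_additive_subgroup] by force

lemma zero_nonunit: "\<zero> \<notin> Units R"
  using unit_not_in_max additive_subgroup.zero_closed[OF is_additive_subgroup] by blast

lemma max_add: "x \<in> \<mm> \<Longrightarrow> y \<in> \<mm> \<Longrightarrow> x \<oplus> y \<in> \<mm>"
  by (rule additive_subgroup.a_closed[OF is_additive_subgroup])

lemma max_uminus: "x \<in> \<mm> \<Longrightarrow> \<ominus> x \<in> \<mm>"
  by (rule additive_subgroup.a_inv_closed[OF is_additive_subgroup])

lemma max_zero: "\<zero> \<in> \<mm>"
  by (rule additive_subgroup.zero_closed[OF is_additive_subgroup])

lemma max_finsum: "finite A \<Longrightarrow> f \<in> A \<rightarrow> \<mm> \<Longrightarrow> (\<Oplus>a\<in>A. f a) \<in> \<mm>"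
proof (induction A rule: finite_induct)
  case (insert a A)
  then have "f a \<in> carrier R" "f \<in> A \<rightarrow> carrier R" by (auto intro: max_carrier)
  then show ?case using insert by (simp add: max_add)
qed (simp add: max_zero)

text \<open>If 2 lies in \<open>\<mm>\<close>, the plane on \<open>t\<close> and \<open>t'\<close>
  contains no vector of unit norm, but together with \<open>e\<close> it has an orthogonal basis.
  The vector \<open>f\<close> = e + t has unit norm a + p; Gram-Schmidt then produces
  \<open>g\<close> from \<open>t'\<close> and \<open>h\<close> from \<open>e\<close>. The norms stay
  units because \<open>p\<close> and \<open>q\<close> lie in \<open>\<mm>\<close> while
  \<open>r\<close> is a unit.\<close>

lemma orth_set_extend_pair:
  assumes E: "orth_set E" "e \<in> E" and t: "t \<in> perp E" "t' \<in> perp E"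
    and m: "form V t t \<in> \<mm>" "form V t' t' \<in> \<mm>" and r: "form V t t' \<in> Units R"
  obtains E' where "orth_set E'" "E' \<noteq> {}" "perp E' = perp (E \<union> {t, t'})"
proof -
  have c: "e \<in> carrier V" "t \<in> carrier V" "t' \<in> carrier V"
    using E t by (auto simp: orth_set_def perp_def)
  have et: "form V e t = \<zero>" "form V e t' = \<zero>" "form V t e = \<zero>" "form V t' e = \<zero>"
    using E(2) t c form_sym[of e t] form_sym[of e t'] by (auto simp: perp_def)
  define a p q r where "a = form V e e" "p = form V t t" "q = form V t' t'" "r = form V t t'"
  note defs = a_p_q_r_def
  have aU: "a \<in> Units R" and rU: "r \<in> Units R" and pq: "p \<in> \<mm>" "q \<in> \<mm>"
    using E r m by (auto simp: defs orth_set_def)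
  have rc: "a \<in> carrier R" "p \<in> carrier R" "q \<in> carrier R" "r \<in> carrier R"
    using c by (auto simp: defs)
  have r': "form V t' t = r" using c form_sym by (simp add: defs)
  define \<alpha> where "\<alpha> = a \<oplus> p"
  have \<alpha>U: "\<alpha> \<in> Units R" unfolding \<alpha>_def by (rule unit_add_max) fact+
  define i where "i = inv \<alpha>"
  have i: "i \<in> Units R" "i \<in> carrier R" "i \<otimes> \<alpha> = \<one>" using \<alpha>U by (auto simp: i_def)
  \<comment> \<open>The norm of \<open>g\<close>: that of \<open>t'\<close> minus r^2 over the norm
    of \<open>f\<close>.\<close>
  define \<beta> where "\<beta> = \<ominus> (r \<otimes> r \<otimes> i) \<oplus> q"
  have "\<ominus> (r \<otimes> r \<otimes> i) = (\<ominus> \<one>) \<otimes> (r \<otimes> r \<otimes> i)" using rc i by (simp add: l_minus)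
  then have "\<ominus> (r \<otimes> r \<otimes> i) \<in> Units R" using rU i Units_minus_one_closed by auto
  then have \<beta>U: "\<beta> \<in> Units R" unfolding \<beta>_def by (rule unit_add_max) fact
  define j where "j = inv \<beta>"
  have j: "j \<in> Units R" "j \<in> carrier R" "j \<otimes> \<beta> = \<one>" using \<beta>U by (auto simp: j_def)
  define f where "f = e \<oplus>\<^bsub>V\<^esub> t"
  have fc: "f \<in> carrier V" using c by (simp add: f_def)
  have vf: "form V v f = form V v e \<oplus> form V v t" if "v \<in> carrier V" for v
    using that c by (simp add: f_def form_simps)
  define g where "g = t' \<oplus>\<^bsub>V\<^esub> (\<ominus> (r \<otimes> i)) \<odot>\<^bsub>V\<^esub> f"
  have gc: "g \<in> carrier V" using c fc rc i by (simp add: g_def)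
  have vg: "form V v g = form V v t' \<ominus> (r \<otimes> i) \<otimes> form V v f" if "v \<in> carrier V" for v
    using that c fc rc i by (simp add: g_def form_simps a_minus_def l_minus)
  \<comment> \<open>Makes \<open>h\<close> orthogonal to \<open>g\<close>: \<open>k\<close> times
    the norm \<beta> of \<open>g\<close> cancels the product of \<open>e\<close> and
    \<open>g\<close>.\<close>
  define k where "k = r \<otimes> i \<otimes> a \<otimes> j"
  have kc: "k \<in> carrier R" using rc i j by (simp add: k_def)
  define h where "h = e \<oplus>\<^bsub>V\<^esub> (\<ominus> (a \<otimes> i)) \<odot>\<^bsub>V\<^esub> f \<oplus>\<^bsub>V\<^esub> k \<odot>\<^bsub>V\<^esub> g"
  have hc: "h \<in> carrier V" using c fc gc rc i kc by (simp add: h_def)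
  have vh: "form V v h = form V v e \<ominus> (a \<otimes> i) \<otimes> form V v f \<oplus> k \<otimes> form V v g" if "v \<in> carrier V" for v
    using that c fc gc rc i kc by (simp add: h_def form_simps a_minus_def l_minus)
  have fe: "form V f e = a" "form V f t = p" "form V f t' = r"
    using c et rc by (auto simp: f_def form_simps defs)
  have ff: "form V f f = \<alpha>" using vf[OF fc] fe by (simp add: \<alpha>_def)
  have fg: "form V f g = \<zero>"
  proof -
    have "form V f g = r \<ominus> r \<otimes> (i \<otimes> \<alpha>)" using vg[OF fc] fe ff rc i Units_closed[OF \<alpha>U] by (simp add: m_assoc)
    then show ?thesis using i rc by (simp add: a_minus_def R.r_neg)
  qed
  have gf: "form V g f = \<zero>" using fg form_sym fc gc by simp
  have fh: "form V f h = \<zero>"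
  proof -
    have "form V f h = a \<ominus> a \<otimes> (i \<otimes> \<alpha>)" using vh[OF fc] fe ff fg rc i Units_closed[OF \<alpha>U] kc by (simp add: m_assoc)
    then show ?thesis using i rc by (simp add: a_minus_def R.r_neg)
  qed
  have t'g: "form V g t' = \<beta>"
    using vg[OF c(3)] form_sym[OF gc c(3)] fe form_sym[OF fc c(3)] rc i
    by (simp add: defs(3)[symmetric] \<beta>_def a_minus_def R.a_comm m_ac l_minus)
  have gg: "form V g g = \<beta>" using vg[OF gc] gf t'g rc i Units_closed[OF \<beta>U] by (simp add: a_minus_def)
  have eg: "form V e g = \<ominus> (r \<otimes> i \<otimes> a)"
    using vg[OF c(1)] et form_sym[OF fc c(1)] fe rc i by (simp add: a_minus_def)
  have gh: "form V g h = \<zero>"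
  proof -
    have "form V g h = \<ominus> (r \<otimes> i \<otimes> a) \<oplus> k \<otimes> \<beta>"
      using vh[OF gc] gf gg eg form_sym[OF gc c(1)] rc i Units_closed[OF \<beta>U] kc by (simp add: a_minus_def)
    also have "k \<otimes> \<beta> = r \<otimes> i \<otimes> a \<otimes> (j \<otimes> \<beta>)" using rc i j Units_closed[OF \<beta>U] by (simp add: k_def m_assoc)
    finally show ?thesis using rc i j by (simp add: R.l_neg)
  qed
  have hh: "form V h h = \<ominus> (k \<otimes> (r \<otimes> i \<otimes> a)) \<oplus> a \<otimes> p \<otimes> i"
  proof -
    have "form V h h = form V h e"
      using vh[OF hc] fh gh form_sym[OF fc hc] form_sym[OF gc hc] rc i kc hc c by (simp add: a_minus_def)
    also have "\<dots> = a \<ominus> (a \<otimes> i) \<otimes> a \<oplus> k \<otimes> \<ominus> (r \<otimes> i \<otimes> a)"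
      using vh[OF c(1)] form_sym[OF hc c(1)] form_sym[OF fc c(1)] fe eg by (simp add: defs(1)[symmetric])
    also have "\<dots> = a \<otimes> \<one> \<ominus> (a \<otimes> i) \<otimes> a \<oplus> \<ominus> (k \<otimes> (r \<otimes> i \<otimes> a))"
      using rc i kc by (simp add: r_minus)
    also have "a \<otimes> \<one> \<ominus> (a \<otimes> i) \<otimes> a = a \<otimes> p \<otimes> i"
      unfolding i(3)[symmetric] \<alpha>_def using rc i(2) by algebra
    finally show ?thesis using rc i kc by (simp add: R.a_comm)
  qed
  \<comment> \<open>One term of the norm of \<open>h\<close> is a product of units, up to sign; the
    other contains the factor \<open>p\<close> and lies in \<open>\<mm>\<close>.\<close>
  have hU: "form V h h \<in> Units R"
    unfolding hh
  proof (rule unit_add_max)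
    have "\<ominus> (k \<otimes> (r \<otimes> i \<otimes> a)) = (\<ominus> \<one>) \<otimes> (k \<otimes> (r \<otimes> i \<otimes> a))" using rc i kc by (simp add: l_minus)
    then show "\<ominus> (k \<otimes> (r \<otimes> i \<otimes> a)) \<in> Units R"
      using rU i(1) aU j(1) Units_minus_one_closed unfolding k_def by auto
    show "a \<otimes> p \<otimes> i \<in> \<mm>" using pq(1) rc i by (auto intro: I_l_closed I_r_closed)
  qed
  define E' where "E' = (E - {e}) \<union> {f, g, h}"
  have o: "form V v f = \<zero>" "form V v g = \<zero>" "form V v h = \<zero>" if "v \<in> E - {e}" for v
  proof -
    have v: "v \<in> carrier V" "form V v e = \<zero>" using that E by (auto simp: orth_set_def)
    have "form V v t = \<zero>" "form V v t' = \<zero>"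
      using that t c v form_sym[of v t] form_sym[of v t'] by (auto simp: perp_def)
    then show "form V v f = \<zero>" "form V v g = \<zero>" "form V v h = \<zero>"
      using v vf vg vh rc i kc by (simp_all add: a_minus_def)
  qed
  have o': "form V f v = \<zero>" "form V g v = \<zero>" "form V h v = \<zero>" if "v \<in> E - {e}" for v
    using o[OF that] that E(1) fc gc hc by (auto simp: orth_set_def form_sym[of v] subset_iff)
  have "orth_set E'"
    unfolding orth_set_def E'_def
    using E(1) fc gc hc o o' ff gg hU \<alpha>U \<beta>U fg gf fh gh form_sym[OF fc hc] form_sym[OF gc hc]
    by (auto simp: orth_set_def)
  moreover have "perp E' = perp (E \<union> {t, t'})"
  proof -
    \<comment> \<open>The base change is undone in the order \<open>t'\<close>, \<open>e\<close>,
      \<open>t\<close>: each of \<open>g\<close>, \<open>h\<close>, \<open>f\<close> isolates one of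
      them once the previous ones are known to be orthogonal to \<open>v\<close>.\<close>
    have "(form V v f = \<zero> \<and> form V v g = \<zero> \<and> form V v h = \<zero>) \<longleftrightarrow>
        (form V v e = \<zero> \<and> form V v t = \<zero> \<and> form V v t' = \<zero>)" (is "?L = ?R") if v: "v \<in> carrier V" for v
    proof
      assume ?R
      then show ?L using v vf vg vh rc i kc by (simp add: a_minus_def)
    next
      assume L: ?L
      have vc: "form V v e \<in> carrier R" "form V v t \<in> carrier R" "form V v t' \<in> carrier R" using v c by auto
      have "form V v t' = \<zero>" using vg[OF v] L rc i vc by (simp add: a_minus_def)
      moreover have "form V v e = \<zero>" using vh[OF v] L rc i kc vc by (simp add: a_minus_def)
      moreover have "form V v t = \<zero>" using vf[OF v] L \<open>form V v e = \<zero>\<close> vc by simp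
      ultimately show ?R by blast
    qed
    then show ?thesis unfolding perp_def E'_def using E(2) by blast
  qed
  ultimately show ?thesis using that[of E'] by (auto simp: E'_def)
qed

lemma exhaust_by_splitting:
  fixes \<C> :: "'b set set" and X :: "'x set"
  assumes X: "finite X" "\<And>b. b \<in> X \<Longrightarrow> y b \<in> carrier V" "\<And>b. b \<in> X \<Longrightarrow> p b \<in> carrier V"
    and dual_basis: "\<And>v. v \<in> carrier V \<Longrightarrow> v = (\<Oplus>\<^bsub>V\<^esub>b\<in>X. form V (y b) v \<odot>\<^bsub>V\<^esub> p b)"
    and S: "finite S" "S \<subseteq> carrier V" "span S = carrier V"
    and \<C>: "\<And>C. C \<in> \<C> \<Longrightarrow> C \<subseteq> carrier V" "\<And>C. C \<in> \<C> \<Longrightarrow> unimodular R C (form V)"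
    and C0: "C\<^sub>0 \<in> \<C>"
    and split1: "\<And>C t. C \<in> \<C> \<Longrightarrow> t \<in> perp C \<Longrightarrow> form V t t \<in> Units R \<Longrightarrow> \<exists>C'\<in>\<C>. perp C' = perp (C \<union> {t})"
    and split2: "\<And>C t t'. C \<in> \<C> \<Longrightarrow> t \<in> perp C \<Longrightarrow> t' \<in> perp C \<Longrightarrow> form V t t \<in> \<mm> \<Longrightarrow>
      form V t' t' \<in> \<mm> \<Longrightarrow> form V t t' \<in> Units R \<Longrightarrow> \<exists>C'\<in>\<C>. perp C' = perp (C \<union> {t, t'})"
  obtains C where "C \<in> \<C>" "perp C = {\<zero>\<^bsub>V\<^esub>}"
proof -
  define P where "P = (\<lambda>n. \<exists>C\<in>\<C>. \<exists>T. finite T \<and> T \<subseteq> carrier V \<and> span T = perp C \<and> card T = n)"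
  have "\<exists>n. P n"
  proof -
    have C0': "C\<^sub>0 \<subseteq> carrier V" "unimodular R C\<^sub>0 (form V)" using \<C> C0 by auto
    have "finite (S \<union> C\<^sub>0)" "S \<union> C\<^sub>0 \<subseteq> carrier V" using S C0' unimodular_finite by auto
    \<comment> \<open>The whole space is \<open>perp {}\<close>, and \<open>C\<^sub>0\<close> is
      adjoined to the generators because \<open>span_proj\<close> wants the split set among
      them.\<close>
    moreover have "span (S \<union> C\<^sub>0) = perp {}"
    proof
      show "span (S \<union> C\<^sub>0) \<subseteq> perp {}"
        using submoduleE(1)[OF span_submodule[OF calculation]] by (auto simp: perp_def)
      show "perp {} \<subseteq> span (S \<union> C\<^sub>0)"
        using span_minimal[OF S(1) span_submodule[OF calculation]] span_superset[OF calculation] S(3)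
        by (auto simp: perp_def)
    qed
    ultimately have "span (proj C\<^sub>0 ` (S \<union> C\<^sub>0 - C\<^sub>0)) = perp C\<^sub>0"
      using span_proj[OF C0', of "S \<union> C\<^sub>0" "{}"] by simp
    moreover have "finite (proj C\<^sub>0 ` (S \<union> C\<^sub>0 - C\<^sub>0))" "proj C\<^sub>0 ` (S \<union> C\<^sub>0 - C\<^sub>0) \<subseteq> carrier V"
      using S proj_closed[OF C0'] unimodular_finite[OF C0'(2)] by (simp_all, blast)
    ultimately have "P (card (proj C\<^sub>0 ` (S \<union> C\<^sub>0 - C\<^sub>0)))" unfolding P_def using C0 by blast
    then show ?thesis by blast
  qed
  then have "P (LEAST n. P n)" by (rule LeastI_ex)
  then obtain C T where CT: "C \<in> \<C>" "finite T" "T \<subseteq> carrier V" "span T = perp C" "card T = (LEAST n. P n)"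
    unfolding P_def by blast
  have least: "card T \<le> card T'" if "C' \<in> \<C>" "finite T'" "T' \<subseteq> carrier V" "span T' = perp C'" for C' T'
    unfolding CT(5) by (rule Least_le) (use that in \<open>auto simp: P_def\<close>)
  note C = \<C>(1)[OF CT(1)] \<C>(2)[OF CT(1)]
  have TC: "T \<subseteq> perp C" using span_superset CT by blast
  \<comment> \<open>Minimality of \<open>T\<close>: after splitting off \<open>D\<close>, the
    projections of the other members generate the new complement.\<close>
  have no_split: False
    if D: "D \<subseteq> T" "D \<noteq> {}" "unimodular R D (form V)" and C': "C' \<in> \<C>" "perp C' = perp (C \<union> D)" for D C'
  proof -
    have "D \<subseteq> carrier V" using D(1) CT(3) by blast
    note D' = this D(3)
    have "span (proj D ` (T - D)) = perp C'"
      using span_proj[OF D' CT(2-4) D(1) C(1)] C'(2) by simp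
    then have "card T \<le> card (proj D ` (T - D))"
      using CT(2,3) proj_closed[OF D'] by (intro least[OF C'(1)]) auto
    also have "\<dots> \<le> card (T - D)" using CT(2) by (intro card_image_le) auto
    also have "\<dots> < card T" using D(1,2) CT(2) by (intro psubset_card_mono) auto
    finally show False by simp
  qed
  have in_m: "form V t t' \<in> \<mm>" if t: "t \<in> T" "t' \<in> T" for t t'
  proof (rule ccontr)
    assume "form V t t' \<notin> \<mm>"
    then have u: "form V t t' \<in> Units R" using t CT(3) by (intro not_in_max_unit form_closed) auto
    \<comment> \<open>A member of unit norm could be split off alone. With all norms in
      \<open>\<mm>\<close>, the pair \<open>t\<close>, \<open>t'\<close> has determinant minus a
      unit square up to \<open>\<mm>\<close>, so it can be split off together.\<close>
    have m: "form V s s \<in> \<mm>" if s: "s \<in> T" for s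
    proof (rule ccontr)
      assume "form V s s \<notin> \<mm>"
      then have su: "form V s s \<in> Units R" using s CT(3) by (intro not_in_max_unit form_closed) auto
      obtain C' where "C' \<in> \<C>" "perp C' = perp (C \<union> {s})" using split1[OF CT(1) _ su] s TC by blast
      then show False using no_split[of "{s}"] unimodular_singleton[OF _ su] s CT(3) by blast
    qed
    obtain C' where C': "C' \<in> \<C>" "perp C' = perp (C \<union> {t, t'})"
      using split2[OF CT(1) _ _ m[OF t(1)] m[OF t(2)] u] t TC by blast
    have tc: "t \<in> carrier V" "t' \<in> carrier V" using t CT(3) by auto
    have "form V t t \<otimes> form V t' t' \<ominus> form V t t' \<otimes> form V t t' =
        (\<ominus> \<one>) \<otimes> (form V t t' \<otimes> form V t t') \<oplus> form V t t \<otimes> form V t' t'"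
      using tc by (simp add: a_minus_def R.a_comm l_minus)
    also have "\<dots> \<in> Units R"
    proof (rule unit_add_max)
      show "(\<ominus> \<one>) \<otimes> (form V t t' \<otimes> form V t t') \<in> Units R" using u Units_minus_one_closed by blast
      show "form V t t \<otimes> form V t' t' \<in> \<mm>" using m[OF t(1)] tc by (intro I_r_closed) auto
    qed
    finally have "unimodular R {t, t'} (form V)" using m[OF t(1)] unit_not_in_max[OF u] by (intro unimodular_pair[OF tc]) auto
    then show False using no_split[of "{t, t'}"] C' t by blast
  qed
  have "T = {}"
  proof (rule ccontr)
    assume "T \<noteq> {}"
    then obtain t where t: "t \<in> T" by blast
    have tc: "t \<in> carrier V" using t CT(3) by blast
    define N where "N = {lincomb T x | x. x \<in> T \<rightarrow> \<mm>}"
    have N: "submodule N R V" unfolding N_def using CT(2,3) is_ideal by (rule lincomb_ideal_submodule)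
    \<comment> \<open>Only the projection of \<open>y b\<close> matters against \<open>t\<close>,
      and it is a combination of \<open>T\<close>, where all form values lie in
      \<open>\<mm>\<close>.\<close>
    have yt: "form V (y b) t \<in> \<mm>" if b: "b \<in> X" for b
    proof -
      have "proj C (y b) \<in> span T" using proj_perp[OF C] X(2)[OF b] CT(4) by blast
      then obtain x where x: "proj C (y b) = lincomb T x" "x \<in> T \<rightarrow> carrier R" unfolding span_def by blast
      have "form V (y b) t = form V (lincomb T x) t"
        using form_proj[OF C X(2)[OF b], of t] t TC x(1) by auto
      also have "\<dots> = (\<Oplus>s\<in>T. x s \<otimes> form V s t)"
        using CT(2,3) x(2) tc by (intro form_lincomb_left) auto
      also have "\<dots> \<in> \<mm>" using x(2) in_m t CT(2) by (intro max_finsum) (auto simp: Pi_iff intro: I_l_closed)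
      finally show ?thesis .
    qed
    have scale: "r \<odot>\<^bsub>V\<^esub> v \<in> N" if r: "r \<in> \<mm>" and v: "v \<in> span T" for r v
    proof -
      obtain x where x: "v = lincomb T x" "x \<in> T \<rightarrow> carrier R" using v unfolding span_def by blast
      have "r \<odot>\<^bsub>V\<^esub> v = lincomb T (\<lambda>s. r \<otimes> x s)"
        using x CT(2,3) r max_carrier by (simp add: lincomb_smult)
      moreover have "(\<lambda>s. r \<otimes> x s) \<in> T \<rightarrow> \<mm>" using x(2) r by (auto simp: Pi_iff intro: I_r_closed)
      ultimately show ?thesis unfolding N_def by blast
    qed
    have fc: "(\<lambda>b. form V (y b) t \<odot>\<^bsub>V\<^esub> p b) \<in> X \<rightarrow> carrier V" using X tc by auto
    have "t = proj C (\<Oplus>\<^bsub>V\<^esub>b\<in>X. form V (y b) t \<odot>\<^bsub>V\<^esub> p b)"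
      using dual_basis[OF tc] proj_id[OF C, of t] t TC by auto
    also have "\<dots> = (\<Oplus>\<^bsub>V\<^esub>b\<in>X. proj C (form V (y b) t \<odot>\<^bsub>V\<^esub> p b))" by (rule proj_finsum[OF C X(1) fc])
    also have "\<dots> = (\<Oplus>\<^bsub>V\<^esub>b\<in>X. form V (y b) t \<odot>\<^bsub>V\<^esub> proj C (p b))"
      using X tc proj_closed[OF C] by (intro M.finsum_cong') (auto simp: proj_smult[OF C])
    also have "\<dots> \<in> N"
    proof -
      have *: "form V (y b) t \<odot>\<^bsub>V\<^esub> proj C (p b) \<in> N" if b: "b \<in> X" for b
        using scale[OF yt[OF b]] proj_perp[OF C] X(3)[OF b] CT(4) by blast
      have "(\<Oplus>\<^bsub>V\<^esub>b\<in>Y. form V (y b) t \<odot>\<^bsub>V\<^esub> proj C (p b)) \<in> N" if "finite Y" "Y \<subseteq> X" for Y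
        using that
      proof (induction Y rule: finite_induct)
        case (insert b Y)
        then show ?case using * submoduleE(1,5)[OF N] by (subst M.finsum_insert) blast+
      qed (simp add: submodule_zero[OF N])
      then show ?thesis using X(1) by blast
    qed
    finally obtain x where x: "t = lincomb T x" "x \<in> T \<rightarrow> \<mm>" unfolding N_def by blast
    have xc: "x s \<in> carrier R" if "s \<in> T" for s using x(2) that max_carrier by blast
    have T': "finite (T - {t})" "T - {t} \<subseteq> carrier V" using CT(2,3) by auto
    have sub: "submodule (span (T - {t})) R V" by (rule span_submodule[OF T'])
    define w where "w = lincomb (T - {t}) x"
    have w: "w \<in> span (T - {t})" "w \<in> carrier V" using xc T' by (auto simp: w_def span_def)
    have "t = x t \<odot>\<^bsub>V\<^esub> t \<oplus>\<^bsub>V\<^esub> w"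
    proof -
      have "t = lincomb (insert t (T - {t})) x" using x(1) t by (simp add: insert_absorb)
      also have "\<dots> = x t \<odot>\<^bsub>V\<^esub> t \<oplus>\<^bsub>V\<^esub> w"
        unfolding lincomb_def w_def using CT(2,3) xc t tc by (intro M.finsum_insert) auto
      finally show ?thesis .
    qed
    \<comment> \<open>Nakayama: the coefficient of \<open>t\<close> in its own expansion lies in
      \<open>\<mm>\<close>, so one minus it is a unit and \<open>t\<close> is a combination of the
      other generators.\<close>
    then have "(\<one> \<oplus> \<ominus> x t) \<odot>\<^bsub>V\<^esub> t = w"
      using tc w(2) xc[OF t] by (simp add: smult_l_distr smult_l_minus) (metis M.a_inv_closed M.a_lcomm M.l_neg M.r_neg1 M.a_comm smult_closed M.a_closed)
    moreover have u: "\<one> \<oplus> \<ominus> x t \<in> Units R"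
      using x(2) t by (intro unit_add_max max_uminus) auto
    ultimately have "inv (\<one> \<oplus> \<ominus> x t) \<odot>\<^bsub>V\<^esub> w = t"
      using tc xc[OF t] by (metis Units_closed Units_inv_closed Units_l_inv smult_assoc1 smult_one)
    then have "t \<in> span (T - {t})" using submoduleE(4)[OF sub _ w(1)] u by (metis Units_inv_closed)
    then have "T \<subseteq> span (T - {t})" using span_superset[OF T'] by blast
    then have "span T \<subseteq> span (T - {t})" by (rule span_minimal[OF CT(2) sub])
    moreover have "span (T - {t}) \<subseteq> span T"
      using span_superset[OF CT(2,3)] by (intro span_minimal[OF T'(1) span_submodule[OF CT(2,3)]]) auto
    ultimately have "card T \<le> card (T - {t})" using CT(4) T' by (intro least[OF CT(1)]) auto
    then show False using t CT(2) by (metis card_Diff1_less not_less)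
  qed
  then have "perp C = span {}" using CT(4) by simp
  also have "\<dots> = {\<zero>\<^bsub>V\<^esub>}" by (auto simp: span_def lincomb_def)
  finally show ?thesis using that CT(1) by blast
qed

end

lemma inner_product_space_bilinear: "inner_product_space R V \<Longrightarrow> bilinear_space R V"
  by (simp add: inner_product_space_def bilinear_spaceI)

lemma unimodularI:
  assumes "finite I" "\<And>i j. i \<in> I \<Longrightarrow> j \<in> I \<Longrightarrow> A i j \<in> carrier R \<and> A i j = A j i"
    "\<And>i j. i \<in> I \<Longrightarrow> j \<in> I \<Longrightarrow> B i j \<in> carrier R"
    "\<And>i k. i \<in> I \<Longrightarrow> k \<in> I \<Longrightarrow> (\<Oplus>\<^bsub>R\<^esub>j\<in>I. A i j \<otimes>\<^bsub>R\<^esub> B j k) = (if i = k then \<one>\<^bsub>R\<^esub> else \<zero>\<^bsub>R\<^esub>)"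
  shows "unimodular R I A"
  unfolding unimodular_def using assms by blast

context local_bilinear_space
begin

lemma finitely_generated_span:
  assumes "finitely_generated R V"
  obtains S where "finite S" "S \<subseteq> carrier V" "span S = carrier V"
proof -
  obtain S where S: "finite S" "S \<subseteq> carrier V" "gen_submodule R V S = carrier V"
    using assms unfolding finitely_generated_def by blast
  have sub: "submodule (span S) R V" by (rule span_submodule) fact+
  then have "gen_submodule R V S \<subseteq> span S"
    unfolding gen_submodule_def using span_superset[OF S(1,2)] by blast
  then have "span S = carrier V" using S(3) submoduleE(1)[OF sub] by blast
  then show ?thesis using that S by blast
qed

lemma unimodular_perp_disjoint:
  assumes C: "C \<subseteq> carrier V" "unimodular R C (form V)" and "c \<in> C" "c \<in> perp C"
  shows False
proof -
  have "lincomb C (free_basis R c) = c"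
    using assms unimodular_finite by (intro lincomb_free_basis) auto
  then have "free_basis R c = (\<lambda>_. \<zero>)"
    using unimodular_independent[OF C R.free_basis_closed[OF assms(3)]] assms(4) by simp
  then show False using one_not_zero by (metis free_basis_def)
qed

text \<open>The family consists of all unimodular sets, starting from the empty one, and splitting
  adjoins \<open>t\<close> or the pair unchanged. In particular the module is free, as finitely
  generated projective modules over a local ring are.\<close>

lemma exists_unimodular_basis:
  assumes V: "inner_product_space R V"
  obtains S where "unimodular_basis S"
proof -
  obtain X :: "'b set" and y p where X: "finite X" "\<And>b. b \<in> X \<Longrightarrow> y b \<in> carrier V" "\<And>b. b \<in> X \<Longrightarrow> p b \<in> carrier V"
    "\<And>v. v \<in> carrier V \<Longrightarrow> v = (\<Oplus>\<^bsub>V\<^esub>b\<in>X. form V (y b) v \<odot>\<^bsub>V\<^esub> p b)"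
    using inner_product_space_dual_basis[OF V] by blast
  obtain S where S: "finite S" "S \<subseteq> carrier V" "span S = carrier V"
    using finitely_generated_span V unfolding inner_product_space_def by blast
  define \<C> where "\<C> = {C. C \<subseteq> carrier V \<and> unimodular R C (form V)}"
  have ext: "\<exists>C'\<in>\<C>. perp C' = perp (C \<union> D)"
    if C: "C \<in> \<C>" and D: "D \<subseteq> perp C" "unimodular R D (form V)" for C D
  proof -
    have C': "C \<subseteq> carrier V" "unimodular R C (form V)" using C by (auto simp: \<C>_def)
    have "C \<inter> D = {}" using unimodular_perp_disjoint[OF C'] D by blast
    then have "unimodular R (C \<union> D) (form V)" by (rule unimodular_Un[OF C' D])
    then have "C \<union> D \<in> \<C>" using C' D(1) perp_closed by (auto simp: \<C>_def)
    then show ?thesis by blast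
  qed
  obtain C where "C \<in> \<C>" "perp C = {\<zero>\<^bsub>V\<^esub>}"
  proof (rule exhaust_by_splitting[OF X S, of \<C> "{}"])
    show "{} \<in> \<C>" by (auto simp: \<C>_def unimodular_def)
    show "\<exists>C'\<in>\<C>. perp C' = perp (C \<union> {t})"
      if "C \<in> \<C>" "t \<in> perp C" "form V t t \<in> Units R" for C t
      using ext[OF that(1), of "{t}"] unimodular_singleton[OF _ that(3)] that(2) perp_closed by auto
    fix C t t' assume C: "C \<in> \<C>" and t: "t \<in> perp C" "t' \<in> perp C"
      and m: "form V t t \<in> \<mm>" "form V t' t' \<in> \<mm>" and u: "form V t t' \<in> Units R"
    have tc: "t \<in> carrier V" "t' \<in> carrier V" using t perp_closed by auto
    have "form V t t \<otimes> form V t' t' \<ominus> form V t t' \<otimes> form V t t' =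
        (\<ominus> \<one>) \<otimes> (form V t t' \<otimes> form V t t') \<oplus> form V t t \<otimes> form V t' t'"
      using tc by (simp add: a_minus_def R.a_comm l_minus)
    also have "\<dots> \<in> Units R"
    proof (rule unit_add_max)
      show "(\<ominus> \<one>) \<otimes> (form V t t' \<otimes> form V t t') \<in> Units R" using u Units_minus_one_closed by blast
      show "form V t t \<otimes> form V t' t' \<in> \<mm>" using m tc by (intro I_r_closed) auto
    qed
    finally have "unimodular R {t, t'} (form V)"
      using m(1) unit_not_in_max[OF u] by (intro unimodular_pair[OF tc]) auto
    then show "\<exists>C'\<in>\<C>. perp C' = perp (C \<union> {t, t'})" using ext[OF C, of "{t, t'}"] t by simp
  qed (auto simp: \<C>_def)
  then show ?thesis using that by (auto simp: \<C>_def unimodular_basis_def)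
qed

text \<open>The family must exclude the empty set, since \<open>orth_set_extend_pair\<close> trades
  a member already present; the given \<open>e\<close> provides the start.\<close>

lemma exists_orth_basis:
  assumes V: "inner_product_space R V" and e: "e \<in> carrier V" "form V e e \<in> Units R"
  obtains E where "orth_set E" "unimodular_basis E"
proof -
  obtain X :: "'b set" and y p where X: "finite X" "\<And>b. b \<in> X \<Longrightarrow> y b \<in> carrier V" "\<And>b. b \<in> X \<Longrightarrow> p b \<in> carrier V"
    "\<And>v. v \<in> carrier V \<Longrightarrow> v = (\<Oplus>\<^bsub>V\<^esub>b\<in>X. form V (y b) v \<odot>\<^bsub>V\<^esub> p b)"
    using inner_product_space_dual_basis[OF V] by blast
  obtain S where S: "finite S" "S \<subseteq> carrier V" "span S = carrier V"
    using finitely_generated_span V unfolding inner_product_space_def by blast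
  define \<C> where "\<C> = {C. orth_set C \<and> C \<noteq> {}}"
  obtain C where "C \<in> \<C>" "perp C = {\<zero>\<^bsub>V\<^esub>}"
  proof (rule exhaust_by_splitting[OF X S, of \<C> "{e}"])
    show "{e} \<in> \<C>" using e by (auto simp: \<C>_def orth_set_def)
    show "\<exists>C'\<in>\<C>. perp C' = perp (C \<union> {t})"
      if "C \<in> \<C>" "t \<in> perp C" "form V t t \<in> Units R" for C t
    proof -
      have t: "t \<in> carrier V" "form V t c = \<zero>" "form V c t = \<zero>" if "c \<in> C" for c
        using \<open>C \<in> \<C>\<close> \<open>t \<in> perp C\<close> that form_sym[of c t] by (auto simp: \<C>_def orth_set_def perp_def)
      then have "orth_set (C \<union> {t})"
        using that perp_closed by (auto simp: \<C>_def orth_set_def)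
      then have "C \<union> {t} \<in> \<C>" by (simp add: \<C>_def)
      then show ?thesis by blast
    qed
    show "\<exists>C'\<in>\<C>. perp C' = perp (C \<union> {t, t'})"
      if tt: "C \<in> \<C>" "t \<in> perp C" "t' \<in> perp C" "form V t t \<in> \<mm>" "form V t' t' \<in> \<mm>" "form V t t' \<in> Units R" for C t t'
    proof -
      obtain c where c: "orth_set C" "c \<in> C" using tt(1) by (auto simp: \<C>_def)
      obtain C' where "orth_set C'" "C' \<noteq> {}" "perp C' = perp (C \<union> {t, t'})"
        using orth_set_extend_pair[OF c tt(2-)] .
      then have "C' \<in> \<C>" "perp C' = perp (C \<union> {t, t'})" by (simp_all add: \<C>_def)
      then show ?thesis by blast
    qed
    show "C \<subseteq> carrier V" "unimodular R C (form V)" if "C \<in> \<C>" for C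
      using that orth_set_unimodular[of C] by (simp_all add: \<C>_def orth_set_def)
  qed
  then show ?thesis
    using that[of C] orth_set_unimodular[of C] by (simp add: \<C>_def unimodular_basis_def orth_set_def)
qed

end

section \<open>Gram matrices of sums and products\<close>

definition block_matrix :: "('a, 'r) ring_scheme \<Rightarrow> ('x \<Rightarrow> 'x \<Rightarrow> 'a) \<Rightarrow> ('y \<Rightarrow> 'y \<Rightarrow> 'a) \<Rightarrow> 'x + 'y \<Rightarrow> 'x + 'y \<Rightarrow> 'a"
  where "block_matrix R A B x y =
    (case (x, y) of (Inl i, Inl i') \<Rightarrow> A i i' | (Inr j, Inr j') \<Rightarrow> B j j' | _ \<Rightarrow> \<zero>\<^bsub>R\<^esub>)"

lemma block_matrix_simps [simp]:
  "block_matrix R A B (Inl i) (Inl i') = A i i'" "block_matrix R A B (Inr j) (Inr j') = B j j'"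
  "block_matrix R A B (Inl i) (Inr j) = \<zero>\<^bsub>R\<^esub>" "block_matrix R A B (Inr j) (Inl i) = \<zero>\<^bsub>R\<^esub>"
  by (simp_all add: block_matrix_def)

definition kronecker :: "('a, 'r) ring_scheme \<Rightarrow> ('x \<Rightarrow> 'x \<Rightarrow> 'a) \<Rightarrow> ('y \<Rightarrow> 'y \<Rightarrow> 'a) \<Rightarrow> 'x \<times> 'y \<Rightarrow> 'x \<times> 'y \<Rightarrow> 'a"
  where "kronecker R A B p q = A (fst p) (fst q) \<otimes>\<^bsub>R\<^esub> B (snd p) (snd q)"

lemma (in abelian_monoid) finsum_Plus:
  assumes "finite A" "finite B" "f \<in> A <+> B \<rightarrow> carrier G"
  shows "(\<Oplus>x\<in>A <+> B. f x) = (\<Oplus>a\<in>A. f (Inl a)) \<oplus> (\<Oplus>b\<in>B. f (Inr b))"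
proof -
  have "(\<Oplus>x\<in>A <+> B. f x) = (\<Oplus>x\<in>Inl ` A. f x) \<oplus> (\<Oplus>x\<in>Inr ` B. f x)"
    unfolding Plus_def using assms by (intro finsum_Un_disjoint) auto
  also have "(\<Oplus>x\<in>Inl ` A. f x) = (\<Oplus>a\<in>A. f (Inl a))"
    using assms by (intro finsum_reindex) (auto simp: inj_on_def)
  also have "(\<Oplus>x\<in>Inr ` B. f x) = (\<Oplus>b\<in>B. f (Inr b))"
    using assms by (intro finsum_reindex) (auto simp: inj_on_def)
  finally show ?thesis .
qed

lemma isometric_orthogonal_sum:
  assumes "isometric R U V" "isometric R U' V'"
  shows "isometric R (orthogonal_sum R U U') (orthogonal_sum R V V')"
proof -
  obtain g h where g: "g \<in> module_hom R U V" "bij_betw g (carrier U) (carrier V)"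
      "\<forall>x\<in>carrier U. \<forall>y\<in>carrier U. form V (g x) (g y) = form U x y"
    and h: "h \<in> module_hom R U' V'" "bij_betw h (carrier U') (carrier V')"
      "\<forall>x\<in>carrier U'. \<forall>y\<in>carrier U'. form V' (h x) (h y) = form U' x y"
    using assms unfolding isometric_def by blast
  have "map_prod g h \<in> module_hom R (orthogonal_sum R U U') (orthogonal_sum R V V')"
    using g(1) h(1) by (auto simp: module_hom_def orthogonal_sum_def Pi_iff)
  moreover have "bij_betw (map_prod g h) (carrier (orthogonal_sum R U U')) (carrier (orthogonal_sum R V V'))"
    using g(2) h(2) by (simp add: orthogonal_sum_def bij_betw_map_prod)
  ultimately show ?thesis
    unfolding isometric_def using g(3) h(3)
    by (intro bexI[of _ "map_prod g h"]) (auto simp: orthogonal_sum_def)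
qed

context cring
begin

lemma unimodular_block:
  assumes A: "unimodular R I A" and B: "unimodular R J B"
  shows "unimodular R (I <+> J) (block_matrix R A B)"
proof -
  obtain A' where A': "\<And>i j. i \<in> I \<Longrightarrow> j \<in> I \<Longrightarrow> A' i j \<in> carrier R"
    "\<And>i k. i \<in> I \<Longrightarrow> k \<in> I \<Longrightarrow> (\<Oplus>j\<in>I. A i j \<otimes> A' j k) = (if i = k then \<one> else \<zero>)"
    using A unfolding unimodular_def by blast
  obtain B' where B': "\<And>i j. i \<in> J \<Longrightarrow> j \<in> J \<Longrightarrow> B' i j \<in> carrier R"
    "\<And>i k. i \<in> J \<Longrightarrow> k \<in> J \<Longrightarrow> (\<Oplus>j\<in>J. B i j \<otimes> B' j k) = (if i = k then \<one> else \<zero>)"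
    using B unfolding unimodular_def by blast
  note fin = unimodular_finite[OF A] unimodular_finite[OF B]
  note cl = unimodular_closed[OF A] unimodular_closed[OF B]
  have z: "(\<Oplus>j\<in>K. \<zero> \<otimes> f j) = \<zero>" "(\<Oplus>j\<in>K. f j \<otimes> \<zero>) = \<zero>" if "f \<in> K \<rightarrow> carrier R" for K f
    using that by (auto intro!: add.finprod_one_eqI simp: Pi_iff)
  have "(\<Oplus>j\<in>I <+> J. block_matrix R A B i j \<otimes> block_matrix R A' B' j k) = (if i = k then \<one> else \<zero>)"
    if ik: "i \<in> I <+> J" "k \<in> I <+> J" for i k
  proof -
    have "(\<Oplus>j\<in>I <+> J. block_matrix R A B i j \<otimes> block_matrix R A' B' j k) =
      (\<Oplus>j\<in>I. block_matrix R A B i (Inl j) \<otimes> block_matrix R A' B' (Inl j) k) \<oplus>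
      (\<Oplus>j\<in>J. block_matrix R A B i (Inr j) \<otimes> block_matrix R A' B' (Inr j) k)"
      using ik fin cl A'(1) B'(1) by (intro finsum_Plus) auto
    also have "\<dots> = (if i = k then \<one> else \<zero>)"
      using ik cl A' B' by (elim PlusE) (simp_all add: z Pi_iff)
    finally show ?thesis .
  qed
  moreover have "block_matrix R A' B' i j \<in> carrier R" if "i \<in> I <+> J" "j \<in> I <+> J" for i j
    using that A'(1) B'(1) by auto
  moreover have "block_matrix R A B i j \<in> carrier R \<and> block_matrix R A B i j = block_matrix R A B j i"
    if "i \<in> I <+> J" "j \<in> I <+> J" for i j
    using that cl unimodular_sym[OF A] unimodular_sym[OF B] by auto
  moreover have "finite (I <+> J)" using fin by simp
  ultimately show ?thesis by (intro unimodularI[where B = "block_matrix R A' B'"])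
qed

text \<open>The mixed product rule: the product of two Kronecker products is the Kronecker product
  of the products, so the inverse is that of the inverses.\<close>

lemma unimodular_kronecker:
  assumes A: "unimodular R I A" and B: "unimodular R J B"
  shows "unimodular R (I \<times> J) (kronecker R A B)"
proof -
  obtain A' where A': "\<And>i j. i \<in> I \<Longrightarrow> j \<in> I \<Longrightarrow> A' i j \<in> carrier R"
    "\<And>i k. i \<in> I \<Longrightarrow> k \<in> I \<Longrightarrow> (\<Oplus>j\<in>I. A i j \<otimes> A' j k) = (if i = k then \<one> else \<zero>)"
    using A unfolding unimodular_def by blast
  obtain B' where B': "\<And>i j. i \<in> J \<Longrightarrow> j \<in> J \<Longrightarrow> B' i j \<in> carrier R"
    "\<And>i k. i \<in> J \<Longrightarrow> k \<in> J \<Longrightarrow> (\<Oplus>j\<in>J. B i j \<otimes> B' j k) = (if i = k then \<one> else \<zero>)"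
    using B unfolding unimodular_def by blast
  note fin = unimodular_finite[OF A] unimodular_finite[OF B]
  note cl = unimodular_closed[OF A] unimodular_closed[OF B]
  have "(\<Oplus>r\<in>I \<times> J. kronecker R A B p r \<otimes> kronecker R A' B' r q) = (if p = q then \<one> else \<zero>)"
    if pq: "p \<in> I \<times> J" "q \<in> I \<times> J" for p q
  proof -
    obtain i j k l where ij: "p = (i, j)" "q = (k, l)" by fastforce
    have m: "i \<in> I" "j \<in> J" "k \<in> I" "l \<in> J" using pq ij by auto
    have "(\<Oplus>r\<in>I \<times> J. kronecker R A B p r \<otimes> kronecker R A' B' r q) =
      (\<Oplus>s\<in>I. \<Oplus>t\<in>J. (A i s \<otimes> B j t) \<otimes> (A' s k \<otimes> B' t l))"
      using m fin cl A'(1) B'(1) by (subst finsum_product) (auto simp: kronecker_def ij)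
    also have "\<dots> = (\<Oplus>s\<in>I. (A i s \<otimes> A' s k) \<otimes> (\<Oplus>t\<in>J. B j t \<otimes> B' t l))"
    proof (rule finsum_cong')
      fix s assume s: "s \<in> I"
      have "(\<Oplus>t\<in>J. (A i s \<otimes> B j t) \<otimes> (A' s k \<otimes> B' t l)) = (\<Oplus>t\<in>J. (A i s \<otimes> A' s k) \<otimes> (B j t \<otimes> B' t l))"
        using m s cl A'(1) B'(1) by (intro finsum_cong') (auto simp: m_ac)
      also have "\<dots> = (A i s \<otimes> A' s k) \<otimes> (\<Oplus>t\<in>J. B j t \<otimes> B' t l)"
        using m s cl A'(1) B'(1) fin by (intro finsum_rdistr[symmetric]) auto
      finally show "(\<Oplus>t\<in>J. (A i s \<otimes> B j t) \<otimes> (A' s k \<otimes> B' t l)) = \<dots>" .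
    qed (use m cl A'(1) B' in auto)
    also have "\<dots> = (\<Oplus>s\<in>I. A i s \<otimes> A' s k) \<otimes> (\<Oplus>t\<in>J. B j t \<otimes> B' t l)"
      using m cl A'(1) B'(1) fin by (intro finsum_ldistr[symmetric]) (auto intro!: finsum_closed)
    also have "\<dots> = (if p = q then \<one> else \<zero>)" using m A'(2) B'(2) by (simp add: ij)
    finally show ?thesis .
  qed
  moreover have "kronecker R A' B' p q \<in> carrier R" if "p \<in> I \<times> J" "q \<in> I \<times> J" for p q
    using that A'(1) B'(1) by (auto simp: kronecker_def)
  moreover have "kronecker R A B p q \<in> carrier R \<and> kronecker R A B p q = kronecker R A B q p"
    if "p \<in> I \<times> J" "q \<in> I \<times> J" for p q
    using that cl unimodular_sym[OF A] unimodular_sym[OF B] by (auto simp: kronecker_def)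
  moreover have "finite (I \<times> J)" using fin by simp
  ultimately show ?thesis by (intro unimodularI[where B = "kronecker R A' B'"])
qed

lemma mspace_Plus_isometric:
  fixes I :: "'c set" and J :: "'d set"
  assumes A: "unimodular R I A" and B: "unimodular R J B"
  shows "isometric R (mspace R (I <+> J) (block_matrix R A B)) (orthogonal_sum R (mspace R I A) (mspace R J B))"
proof (rule isometryI[where h = "\<lambda>x. (\<lambda>i. x (Inl i), \<lambda>j. x (Inr j))" and g = "\<lambda>p. case_sum (fst p) (snd p)"])
  note fin = unimodular_finite[OF A] unimodular_finite[OF B]
  note cl = unimodular_closed[OF A] unimodular_closed[OF B]
  have finP: "finite (I <+> J)" using fin by simp
  fix x y assume "x \<in> carrier (mspace R (I <+> J) (block_matrix R A B))" "y \<in> carrier (mspace R (I <+> J) (block_matrix R A B))"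
  then have c: "x i \<in> carrier R" "y i \<in> carrier R" for i by (auto simp: free_module_closed)
  have z: "(\<Oplus>j\<in>K. \<zero> \<otimes> f j) = \<zero>" if "f \<in> K \<rightarrow> carrier R" for K and f :: "_ \<Rightarrow> 'a"
    using that by (auto intro!: add.finprod_one_eqI simp: Pi_iff)
  have 1: "(\<Oplus>j\<in>I <+> J. block_matrix R A B k j \<otimes> y j) =
      (\<Oplus>j\<in>I. block_matrix R A B k (Inl j) \<otimes> y (Inl j)) \<oplus> (\<Oplus>j\<in>J. block_matrix R A B k (Inr j) \<otimes> y (Inr j))"
    if "k \<in> I <+> J" for k
    using that c cl fin by (intro finsum_Plus) auto
  have 2: "(\<Oplus>j\<in>I <+> J. block_matrix R A B (Inl i) j \<otimes> y j) = (\<Oplus>j\<in>I. A i j \<otimes> y (Inl j))" if "i \<in> I" for i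
    using that 1[OF InlI[OF that]] c cl z by (simp add: Pi_iff finsum_closed)
  have 3: "(\<Oplus>j\<in>I <+> J. block_matrix R A B (Inr i) j \<otimes> y j) = (\<Oplus>j\<in>J. B i j \<otimes> y (Inr j))" if "i \<in> J" for i
    using that 1[OF InrI[OF that]] c cl z by (simp add: Pi_iff finsum_closed)
  have "form (mspace R (I <+> J) (block_matrix R A B)) x y =
    (\<Oplus>i\<in>I. x (Inl i) \<otimes> (\<Oplus>j\<in>I <+> J. block_matrix R A B (Inl i) j \<otimes> y j)) \<oplus>
    (\<Oplus>i\<in>J. x (Inr i) \<otimes> (\<Oplus>j\<in>I <+> J. block_matrix R A B (Inr i) j \<otimes> y j))"
    unfolding mspace_simps using c fin cl by (intro finsum_Plus) (auto intro!: finsum_closed simp: block_matrix_def split: sum.splits)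
  also have "\<dots> = (\<Oplus>i\<in>I. x (Inl i) \<otimes> (\<Oplus>j\<in>I. A i j \<otimes> y (Inl j))) \<oplus> (\<Oplus>i\<in>J. x (Inr i) \<otimes> (\<Oplus>j\<in>J. B i j \<otimes> y (Inr j)))"
    using c cl by (intro arg_cong2[where f = "add R"] finsum_cong') (auto simp: 2 3 intro!: finsum_closed)
  finally show "form (orthogonal_sum R (mspace R I A) (mspace R J B)) (\<lambda>i. x (Inl i), \<lambda>j. x (Inr j)) (\<lambda>i. y (Inl i), \<lambda>j. y (Inr j)) =
      form (mspace R (I <+> J) (block_matrix R A B)) x y"
    by (simp add: orthogonal_sum_def)
next
  note fin = unimodular_finite[OF A] unimodular_finite[OF B]
  have finP: "finite (I <+> J)" using fin by simp
  show "case_sum (fst x) (snd x) \<in> carrier (mspace R (I <+> J) (block_matrix R A B))"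
    if "x \<in> carrier (orthogonal_sum R (mspace R I A) (mspace R J B))" for x
    using that by (auto simp: orthogonal_sum_def free_module_carrier_finite[OF finP] free_module_carrier_finite[OF fin(1)]
        free_module_carrier_finite[OF fin(2)] split: sum.splits)
  show "(\<lambda>i. x (Inl i), \<lambda>j. x (Inr j)) \<in> carrier (orthogonal_sum R (mspace R I A) (mspace R J B))"
    if "x \<in> carrier (mspace R (I <+> J) (block_matrix R A B))" for x
    using that by (auto simp: orthogonal_sum_def free_module_carrier_finite[OF finP] free_module_carrier_finite[OF fin(1)]
        free_module_carrier_finite[OF fin(2)])
  show "(\<lambda>i. case_sum (fst x) (snd x) (Inl i), \<lambda>j. case_sum (fst x) (snd x) (Inr j)) = x" for x :: "('c \<Rightarrow> 'a) \<times> ('d \<Rightarrow> 'a)"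
    by simp
  show "case_sum (fst (\<lambda>i. x (Inl i), \<lambda>j. x (Inr j))) (snd (\<lambda>i. x (Inl i), \<lambda>j. x (Inr j))) = x" for x :: "'c + 'd \<Rightarrow> 'a"
    by (auto simp: fun_eq_iff split: sum.splits)
qed (simp_all add: orthogonal_sum_def)

lemma rank_one_space_isometric:
  assumes "a \<in> carrier R"
  shows "isometric R (mspace R {()} (\<lambda>_ _. a)) (rank_one_space R a)"
  by (rule isometryI[where h = "\<lambda>x. x ()" and g = "\<lambda>x _. x"])
    (use assms in \<open>simp_all add: rank_one_space_def free_module_carrier_finite fun_eq_iff m_ac\<close>)

lemma unimodular_rank_one: "a \<in> Units R \<Longrightarrow> unimodular R {()} (\<lambda>_ _. a)"
  by (auto simp: unimodular_def intro!: exI[of _ "\<lambda>_ _. inv a"])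

lemma zero_space_isometric: "isometric R (mspace R {} A) (zero_space R)"
  by (rule isometryI[where h = "\<lambda>x. \<zero>" and g = "\<lambda>x _. \<zero>"])
    (auto simp: zero_space_def free_module_carrier_finite fun_eq_iff)

end

section \<open>Tensor products\<close>

context module
begin

lemma submoduleI':
  assumes "H \<subseteq> carrier M" "\<zero>\<^bsub>M\<^esub> \<in> H" "\<And>a b. a \<in> H \<Longrightarrow> b \<in> H \<Longrightarrow> a \<oplus>\<^bsub>M\<^esub> b \<in> H"
    "\<And>r a. r \<in> carrier R \<Longrightarrow> a \<in> H \<Longrightarrow> r \<odot>\<^bsub>M\<^esub> a \<in> H"
  shows "submodule H R M"
proof (rule submoduleI)
  show "\<ominus>\<^bsub>M\<^esub> a \<in> H" if "a \<in> H" for a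
  proof -
    have "\<ominus>\<^bsub>M\<^esub> a = (\<ominus> \<one>) \<odot>\<^bsub>M\<^esub> a" using that assms(1) by (auto simp: smult_l_minus)
    then show ?thesis using that assms(4) by simp
  qed
qed fact+

lemma gen_submodule_submodule:
  assumes "S \<subseteq> carrier M"
  shows "submodule (gen_submodule R M S) R M"
proof (rule submoduleI')
  show "gen_submodule R M S \<subseteq> carrier M"
    unfolding gen_submodule_def using assms carrier_is_submodule by blast
  show "\<zero>\<^bsub>M\<^esub> \<in> gen_submodule R M S"
    unfolding gen_submodule_def using submodule_zero by blast
  show "a \<oplus>\<^bsub>M\<^esub> b \<in> gen_submodule R M S" if "a \<in> gen_submodule R M S" "b \<in> gen_submodule R M S" for a b
    using that submoduleE(5) unfolding gen_submodule_def by blast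
  show "r \<odot>\<^bsub>M\<^esub> a \<in> gen_submodule R M S" if "r \<in> carrier R" "a \<in> gen_submodule R M S" for r a
    using that submoduleE(4) unfolding gen_submodule_def by blast
qed

lemma gen_submodule_superset: "S \<subseteq> gen_submodule R M S"
  unfolding gen_submodule_def by blast

lemma gen_submodule_minimal: "submodule N R M \<Longrightarrow> S \<subseteq> N \<Longrightarrow> gen_submodule R M S \<subseteq> N"
  unfolding gen_submodule_def by blast

end

context cring
begin

text \<open>The free module behind a tensor product has an index set that may be infinite, hence the
  sum over the support.\<close>

definition linear_extension :: "('x \<Rightarrow> 'a) \<Rightarrow> ('x \<Rightarrow> 'a) \<Rightarrow> 'a"
  where "linear_extension l f = (\<Oplus>p\<in>{p. f p \<noteq> \<zero>}. f p \<otimes> l p)"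

lemma linear_extension_superset:
  assumes "l \<in> X \<rightarrow> carrier R" "f \<in> carrier (free_module R X)" "finite Y" "Y \<subseteq> X" "{p. f p \<noteq> \<zero>} \<subseteq> Y"
  shows "linear_extension l f = (\<Oplus>p\<in>Y. f p \<otimes> l p)"
  unfolding linear_extension_def
  by (rule finsum_mono_neutral) (use assms free_module_closed[OF assms(2)] in \<open>auto simp: Pi_iff subset_iff\<close>)

lemma linear_extension_closed:
  "l \<in> X \<rightarrow> carrier R \<Longrightarrow> f \<in> carrier (free_module R X) \<Longrightarrow> linear_extension l f \<in> carrier R"
  unfolding linear_extension_def
  by (intro finsum_closed Pi_I m_closed) (use free_module_closed free_module_outside in \<open>fastforce+\<close>)

lemma linear_extension_add:
  assumes l: "l \<in> X \<rightarrow> carrier R" and f: "f \<in> carrier (free_module R X)" "g \<in> carrier (free_module R X)"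
  shows "linear_extension l (\<lambda>p. f p \<oplus> g p) = linear_extension l f \<oplus> linear_extension l g"
proof -
  define Y where "Y = {p. f p \<noteq> \<zero>} \<union> {p. g p \<noteq> \<zero>}"
  have Y: "finite Y" "Y \<subseteq> X" using f by (auto simp: Y_def free_module_def)
  have c: "f p \<in> carrier R" "g p \<in> carrier R" for p using f by (auto simp: free_module_closed)
  have lY: "l p \<in> carrier R" if "p \<in> Y" for p using l Y(2) that by auto
  have "linear_extension l (\<lambda>p. f p \<oplus> g p) = (\<Oplus>p\<in>Y. (f p \<oplus> g p) \<otimes> l p)"
    by (rule linear_extension_superset[OF l free_module_add_closed[OF f] Y]) (auto simp: Y_def)
  also have "\<dots> = (\<Oplus>p\<in>Y. f p \<otimes> l p \<oplus> g p \<otimes> l p)"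
    using lY c by (intro finsum_cong') (auto simp: l_distr)
  also have "\<dots> = (\<Oplus>p\<in>Y. f p \<otimes> l p) \<oplus> (\<Oplus>p\<in>Y. g p \<otimes> l p)"
    using lY c by (intro finsum_addf) auto
  also have "(\<Oplus>p\<in>Y. f p \<otimes> l p) = linear_extension l f"
    by (rule linear_extension_superset[OF l f(1) Y, symmetric]) (auto simp: Y_def)
  also have "(\<Oplus>p\<in>Y. g p \<otimes> l p) = linear_extension l g"
    by (rule linear_extension_superset[OF l f(2) Y, symmetric]) (auto simp: Y_def)
  finally show ?thesis .
qed

lemma linear_extension_smult:
  assumes l: "l \<in> X \<rightarrow> carrier R" and f: "f \<in> carrier (free_module R X)" and r: "r \<in> carrier R"
  shows "linear_extension l (\<lambda>p. r \<otimes> f p) = r \<otimes> linear_extension l f"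
proof -
  define Y where "Y = {p. f p \<noteq> \<zero>}"
  have Y: "finite Y" "Y \<subseteq> X" using f by (auto simp: Y_def free_module_def)
  have c: "f p \<in> carrier R" for p using f by (auto simp: free_module_closed)
  have lY: "l p \<in> carrier R" if "p \<in> Y" for p using l Y(2) that by auto
  have "linear_extension l (\<lambda>p. r \<otimes> f p) = (\<Oplus>p\<in>Y. (r \<otimes> f p) \<otimes> l p)"
    by (rule linear_extension_superset[OF l free_module_smult_closed[OF r f] Y]) (use r in \<open>auto simp: Y_def\<close>)
  also have "\<dots> = (\<Oplus>p\<in>Y. r \<otimes> (f p \<otimes> l p))"
    using lY c r by (intro finsum_cong') (auto simp: m_assoc)
  also have "\<dots> = r \<otimes> linear_extension l f"
    unfolding linear_extension_def Y_def[symmetric]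
    using lY c Y(1) r by (intro finsum_rdistr[symmetric]) auto
  finally show ?thesis .
qed

lemma linear_extension_free_basis:
  assumes l: "l \<in> X \<rightarrow> carrier R" and p: "p \<in> X"
  shows "linear_extension l (free_basis R p) = l p"
proof -
  have "linear_extension l (free_basis R p) = (\<Oplus>q\<in>{p}. free_basis R p q \<otimes> l q)"
    by (rule linear_extension_superset[OF l free_basis_closed[OF p]]) (use p in \<open>auto simp: free_basis_def\<close>)
  also have "\<dots> = l p" using l p by (simp add: free_basis_def Pi_iff)
  finally show ?thesis .
qed

lemma linear_extension_minus:
  assumes l: "l \<in> X \<rightarrow> carrier R" and f: "f \<in> carrier (free_module R X)" "g \<in> carrier (free_module R X)"
  shows "linear_extension l (f \<ominus>\<^bsub>free_module R X\<^esub> g) = linear_extension l f \<ominus> linear_extension l g"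
proof -
  interpret L: module R "free_module R X" by (rule free_module_module)
  have m: "\<ominus>\<^bsub>free_module R X\<^esub> g = (\<lambda>p. \<ominus> \<one> \<otimes> g p)"
    using L.smult_l_minus[of \<one> g] L.smult_one[OF f(2)] f(2) by (simp add: free_module_simps)
  have "f \<ominus>\<^bsub>free_module R X\<^esub> g = (\<lambda>p. f p \<oplus> \<ominus> \<one> \<otimes> g p)"
    by (simp add: a_minus_def m) (simp add: free_module_simps)
  then show ?thesis
    using linear_extension_add[OF l f(1) free_module_smult_closed[OF _ f(2), of "\<ominus> \<one>"]]
      linear_extension_smult[OF l f(2), of "\<ominus> \<one>"] linear_extension_closed[OF l f(2)]
    by (simp add: a_minus_def l_minus)
qed

lemma linear_extension_kernel:
  assumes l: "l \<in> X \<rightarrow> carrier R"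
  shows "submodule {f \<in> carrier (free_module R X). linear_extension l f = \<zero>} R (free_module R X)"
proof -
  interpret L: module R "free_module R X" by (rule free_module_module)
  show ?thesis
  proof (rule L.submoduleI')
    have "(\<lambda>_. \<zero>) \<in> carrier (free_module R X)" by (auto simp: free_module_def)
    then show "\<zero>\<^bsub>free_module R X\<^esub> \<in> {f \<in> carrier (free_module R X). linear_extension l f = \<zero>}"
      by (simp add: free_module_simps linear_extension_def)
  qed (auto simp: free_module_simps linear_extension_add[OF l] linear_extension_smult[OF l]
      free_module_add_closed free_module_smult_closed)
qed

end

text \<open>The tensor product is the quotient of \<open>L\<close> by \<open>N\<close>. The form
  \<open>F\<close> lives on \<open>L\<close>, and the main point is that it factors through the
  quotient.\<close>

locale tensor_pair = V: bilinear_space R V + W: bilinear_space R W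
  for R (structure) and V :: "('a, 'b) form_module" and W :: "('a, 'c) form_module"
begin

definition L :: "('a, 'b \<times> 'c \<Rightarrow> 'a) module"
  where "L = free_module R (carrier V \<times> carrier W)"

definition N :: "('b \<times> 'c \<Rightarrow> 'a) set"
  where "N = gen_submodule R L (tensor_relations R V W)"

definition F :: "('b \<times> 'c \<Rightarrow> 'a) \<Rightarrow> ('b \<times> 'c \<Rightarrow> 'a) \<Rightarrow> 'a"
  where "F = tensor_free_form R V W"

definition k :: "'b \<times> 'c \<Rightarrow> 'b \<times> 'c \<Rightarrow> 'a"
  where "k = kronecker R (form V) (form W)"

lemma k_eq: "k p q = form V (fst p) (fst q) \<otimes> form W (snd p) (snd q)"
  by (simp add: k_def kronecker_def)

sublocale L: module R L
  unfolding L_def by (rule V.R.free_module_module)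

abbreviation "P \<equiv> carrier V \<times> carrier W"

lemma k_closed: "p \<in> P \<Longrightarrow> q \<in> P \<Longrightarrow> k p q \<in> carrier R"
  by (auto simp: k_eq)

lemma k_sym: "p \<in> P \<Longrightarrow> q \<in> P \<Longrightarrow> k p q = k q p"
  using V.form_sym[of "fst p" "fst q"] W.form_sym[of "snd p" "snd q"] by (auto simp: k_eq)

lemma L_closed: "f \<in> carrier L \<Longrightarrow> f p \<in> carrier R"
  by (simp add: L_def V.R.free_module_closed)

lemma basis_closed: "p \<in> P \<Longrightarrow> free_basis R p \<in> carrier L"
  by (simp add: L_def V.R.free_basis_closed)

text \<open>The value of \<open>F\<close> on the basis vector of \<open>p\<close> and
  \<open>g\<close>; for fixed \<open>g\<close> it reduces \<open>F\<close> to a linear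
  extension.\<close>

definition l :: "('b \<times> 'c \<Rightarrow> 'a) \<Rightarrow> 'b \<times> 'c \<Rightarrow> 'a"
  where "l g p = V.R.linear_extension (k p) g"

lemma l_closed: "g \<in> carrier L \<Longrightarrow> l g \<in> P \<rightarrow> carrier R"
  unfolding l_def by (auto intro!: V.R.linear_extension_closed[of _ P] k_closed simp: L_def)

lemma F_eq:
  assumes "f \<in> carrier L" "g \<in> carrier L"
  shows "F f g = V.R.linear_extension (l g) f"
proof -
  have f: "finite {p. f p \<noteq> \<zero>}" "{p. f p \<noteq> \<zero>} \<subseteq> P" "finite {p. g p \<noteq> \<zero>}" "{p. g p \<noteq> \<zero>} \<subseteq> P"
    using assms by (auto simp: L_def free_module_def)
  have c: "f p \<in> carrier R" "g p \<in> carrier R" for p using assms by (auto simp: L_closed)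
  have *: "(\<Oplus>q\<in>{q. g q \<noteq> \<zero>}. f p \<otimes> g q \<otimes> k p q) = f p \<otimes> l g p" if p: "p \<in> P" for p
  proof -
    have "(\<Oplus>q\<in>{q. g q \<noteq> \<zero>}. f p \<otimes> g q \<otimes> k p q) = (\<Oplus>q\<in>{q. g q \<noteq> \<zero>}. f p \<otimes> (g q \<otimes> k p q))"
      using c p f k_closed by (intro V.R.finsum_cong') (auto simp: V.R.m_assoc subset_iff)
    also have "\<dots> = f p \<otimes> l g p"
      unfolding l_def V.R.linear_extension_def
      using c p f k_closed by (intro V.R.finsum_rdistr[symmetric]) auto
    finally show ?thesis .
  qed
  show ?thesis
    unfolding F_def tensor_free_form_def V.R.linear_extension_def k_eq[symmetric]
  proof (intro V.R.finsum_cong' refl)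
    show "(\<Oplus>q\<in>{q. g q \<noteq> \<zero>}. f p \<otimes> g q \<otimes> k p q) = f p \<otimes> l g p" if "p \<in> {p. f p \<noteq> \<zero>}" for p
      using that f(2) * by blast
    show "(\<lambda>p. f p \<otimes> l g p) \<in> {p. f p \<noteq> \<zero>} \<rightarrow> carrier R"
    proof
      fix p assume "p \<in> {p. f p \<noteq> \<zero>}"
      then have "p \<in> P" using f(2) by blast
      then show "f p \<otimes> l g p \<in> carrier R" using c funcset_mem[OF l_closed[OF assms(2)]] by blast
    qed
  qed
qed

lemma F_sym:
  assumes "f \<in> carrier L" "g \<in> carrier L"
  shows "F f g = F g f"
proof -
  have f: "finite {p. f p \<noteq> \<zero>}" "{p. f p \<noteq> \<zero>} \<subseteq> P" "finite {p. g p \<noteq> \<zero>}" "{p. g p \<noteq> \<zero>} \<subseteq> P"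
    using assms by (auto simp: L_def free_module_def)
  have c: "f p \<in> carrier R" "g p \<in> carrier R" for p using assms by (auto simp: L_closed)
  have kc: "k p q \<in> carrier R" if "f p \<noteq> \<zero>" "g q \<noteq> \<zero>" for p q using that f(2,4) k_closed by blast
  have kc': "k q p \<in> carrier R" "k p q = k q p" if "f p \<noteq> \<zero>" "g q \<noteq> \<zero>" for p q
    using that f(2,4) k_closed k_sym by blast+
  have "F f g = (\<Oplus>q\<in>{q. g q \<noteq> \<zero>}. \<Oplus>p\<in>{p. f p \<noteq> \<zero>}. f p \<otimes> g q \<otimes> k p q)"
    unfolding F_def tensor_free_form_def k_eq[symmetric]
    using f c kc by (intro V.R.finsum_swap) auto
  also have "\<dots> = F g f"
    unfolding F_def tensor_free_form_def k_eq[symmetric]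
  proof (intro V.R.finsum_cong' refl)
    show "f p \<otimes> g q \<otimes> k p q = g q \<otimes> f p \<otimes> k q p" if "q \<in> {q. g q \<noteq> \<zero>}" "p \<in> {p. f p \<noteq> \<zero>}" for p q
    proof -
      have "k p q = k q p" using that kc'(2) by simp
      then show ?thesis using c by (simp add: V.R.m_comm)
    qed
  qed (use c kc' in \<open>auto intro!: V.R.finsum_closed\<close>)
  finally show ?thesis .
qed

lemma l_linear:
  assumes g: "g \<in> carrier L"
  shows "v \<in> carrier V \<Longrightarrow> v' \<in> carrier V \<Longrightarrow> w \<in> carrier W \<Longrightarrow> l g (v \<oplus>\<^bsub>V\<^esub> v', w) = l g (v, w) \<oplus> l g (v', w)"
    and "v \<in> carrier V \<Longrightarrow> w \<in> carrier W \<Longrightarrow> w' \<in> carrier W \<Longrightarrow> l g (v, w \<oplus>\<^bsub>W\<^esub> w') = l g (v, w) \<oplus> l g (v, w')"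
    and "r \<in> carrier R \<Longrightarrow> v \<in> carrier V \<Longrightarrow> w \<in> carrier W \<Longrightarrow> l g (r \<odot>\<^bsub>V\<^esub> v, w) = r \<otimes> l g (v, w)"
    and "r \<in> carrier R \<Longrightarrow> v \<in> carrier V \<Longrightarrow> w \<in> carrier W \<Longrightarrow> l g (v, r \<odot>\<^bsub>W\<^esub> w) = r \<otimes> l g (v, w)"
proof -
  have f: "finite {p. g p \<noteq> \<zero>}" "{p. g p \<noteq> \<zero>} \<subseteq> P"
    using g by (auto simp: L_def free_module_def)
  have c: "g p \<in> carrier R" for p using g by (auto simp: L_closed)
  have add: "l g p = l g q \<oplus> l g r"
    if "p \<in> P" "q \<in> P" "r \<in> P" "\<And>s. s \<in> P \<Longrightarrow> k p s = k q s \<oplus> k r s" for p q r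
  proof -
    have "l g p = (\<Oplus>s\<in>{p. g p \<noteq> \<zero>}. g s \<otimes> k q s \<oplus> g s \<otimes> k r s)"
      unfolding l_def V.R.linear_extension_def
      using that f c k_closed by (intro V.R.finsum_cong') (auto simp: V.R.r_distr subset_iff)
    also have "\<dots> = l g q \<oplus> l g r"
      unfolding l_def V.R.linear_extension_def
      using that f c k_closed by (intro V.R.finsum_addf) auto
    finally show ?thesis .
  qed
  have scale: "l g p = r \<otimes> l g q"
    if "p \<in> P" "q \<in> P" "r \<in> carrier R" "\<And>s. s \<in> P \<Longrightarrow> k p s = r \<otimes> k q s" for p q r
  proof -
    have "l g p = (\<Oplus>s\<in>{p. g p \<noteq> \<zero>}. r \<otimes> (g s \<otimes> k q s))"
      unfolding l_def V.R.linear_extension_def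
      using that f c k_closed by (intro V.R.finsum_cong') (auto simp: V.R.m_lcomm subset_iff)
    also have "\<dots> = r \<otimes> l g q"
      unfolding l_def V.R.linear_extension_def
      using that f c k_closed by (intro V.R.finsum_rdistr[symmetric]) auto
    finally show ?thesis .
  qed
  show "v \<in> carrier V \<Longrightarrow> v' \<in> carrier V \<Longrightarrow> w \<in> carrier W \<Longrightarrow> l g (v \<oplus>\<^bsub>V\<^esub> v', w) = l g (v, w) \<oplus> l g (v', w)"
    by (rule add) (auto simp: k_eq V.form_add_left V.R.l_distr)
  show "v \<in> carrier V \<Longrightarrow> w \<in> carrier W \<Longrightarrow> w' \<in> carrier W \<Longrightarrow> l g (v, w \<oplus>\<^bsub>W\<^esub> w') = l g (v, w) \<oplus> l g (v, w')"
    by (rule add) (auto simp: k_eq W.form_add_left V.R.r_distr)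
  show "r \<in> carrier R \<Longrightarrow> v \<in> carrier V \<Longrightarrow> w \<in> carrier W \<Longrightarrow> l g (r \<odot>\<^bsub>V\<^esub> v, w) = r \<otimes> l g (v, w)"
    by (rule scale) (auto simp: k_eq V.form_smult_left V.R.m_assoc)
  show "r \<in> carrier R \<Longrightarrow> v \<in> carrier V \<Longrightarrow> w \<in> carrier W \<Longrightarrow> l g (v, r \<odot>\<^bsub>W\<^esub> w) = r \<otimes> l g (v, w)"
    by (rule scale) (auto simp: k_eq W.form_smult_left V.R.m_lcomm)
qed

abbreviation \<delta> :: "'b \<Rightarrow> 'c \<Rightarrow> 'b \<times> 'c \<Rightarrow> 'a"
  where "\<delta> v w \<equiv> free_basis R (v, w)"

lemma \<delta>_closed: "v \<in> carrier V \<Longrightarrow> w \<in> carrier W \<Longrightarrow> \<delta> v w \<in> carrier L"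
  by (simp add: basis_closed)

lemma relations:
  "v \<in> carrier V \<Longrightarrow> v' \<in> carrier V \<Longrightarrow> w \<in> carrier W \<Longrightarrow>
    \<delta> (v \<oplus>\<^bsub>V\<^esub> v') w \<ominus>\<^bsub>L\<^esub> (\<delta> v w \<oplus>\<^bsub>L\<^esub> \<delta> v' w) \<in> tensor_relations R V W"
  "v \<in> carrier V \<Longrightarrow> w \<in> carrier W \<Longrightarrow> w' \<in> carrier W \<Longrightarrow>
    \<delta> v (w \<oplus>\<^bsub>W\<^esub> w') \<ominus>\<^bsub>L\<^esub> (\<delta> v w \<oplus>\<^bsub>L\<^esub> \<delta> v w') \<in> tensor_relations R V W"
  "r \<in> carrier R \<Longrightarrow> v \<in> carrier V \<Longrightarrow> w \<in> carrier W \<Longrightarrow>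
    \<delta> (r \<odot>\<^bsub>V\<^esub> v) w \<ominus>\<^bsub>L\<^esub> r \<odot>\<^bsub>L\<^esub> \<delta> v w \<in> tensor_relations R V W"
  "r \<in> carrier R \<Longrightarrow> v \<in> carrier V \<Longrightarrow> w \<in> carrier W \<Longrightarrow>
    \<delta> v (r \<odot>\<^bsub>W\<^esub> w) \<ominus>\<^bsub>L\<^esub> r \<odot>\<^bsub>L\<^esub> \<delta> v w \<in> tensor_relations R V W"
  unfolding tensor_relations_def Let_def L_def[symmetric]
  by (rule UnI1, rule UnI1, rule UnI1, blast, rule UnI1, rule UnI1, rule UnI2, blast,
      rule UnI1, rule UnI2, blast, rule UnI2, blast)

lemma relations_cases:
  assumes "x \<in> tensor_relations R V W"
  obtains (addl) v v' w where "v \<in> carrier V" "v' \<in> carrier V" "w \<in> carrier W"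
      "x = \<delta> (v \<oplus>\<^bsub>V\<^esub> v') w \<ominus>\<^bsub>L\<^esub> (\<delta> v w \<oplus>\<^bsub>L\<^esub> \<delta> v' w)"
    | (addr) v w w' where "v \<in> carrier V" "w \<in> carrier W" "w' \<in> carrier W"
      "x = \<delta> v (w \<oplus>\<^bsub>W\<^esub> w') \<ominus>\<^bsub>L\<^esub> (\<delta> v w \<oplus>\<^bsub>L\<^esub> \<delta> v w')"
    | (smultl) r v w where "r \<in> carrier R" "v \<in> carrier V" "w \<in> carrier W"
      "x = \<delta> (r \<odot>\<^bsub>V\<^esub> v) w \<ominus>\<^bsub>L\<^esub> r \<odot>\<^bsub>L\<^esub> \<delta> v w"
    | (smultr) r v w where "r \<in> carrier R" "v \<in> carrier V" "w \<in> carrier W"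
      "x = \<delta> v (r \<odot>\<^bsub>W\<^esub> w) \<ominus>\<^bsub>L\<^esub> r \<odot>\<^bsub>L\<^esub> \<delta> v w"
  using assms unfolding tensor_relations_def Let_def L_def[symmetric]
  by (elim UnE CollectE exE conjE)
    ((rule addl, assumption+)[1], (rule addr, assumption+)[1], (rule smultl, assumption+)[1], (rule smultr, assumption+)[1])

lemma relations_closed: "tensor_relations R V W \<subseteq> carrier L"
proof
  fix x assume "x \<in> tensor_relations R V W"
  then show "x \<in> carrier L" by (cases rule: relations_cases) (auto simp: \<delta>_closed)
qed

lemma N_submodule: "submodule N R L"
  unfolding N_def by (rule L.gen_submodule_submodule[OF relations_closed])

lemma relations_N: "tensor_relations R V W \<subseteq> N"
  unfolding N_def by (rule L.gen_submodule_superset)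

text \<open>For fixed \<open>g\<close> the function \<open>l g\<close> is bilinear in the pair, so
  its linear extension kills the four kinds of relations and hence the submodule they
  generate.\<close>

lemma F_N:
  assumes g: "g \<in> carrier L" and x: "x \<in> N"
  shows "F x g = \<zero>"
proof -
  note lc = l_closed[OF g]
  have add: "V.R.linear_extension (l g) (x \<oplus>\<^bsub>L\<^esub> y) = V.R.linear_extension (l g) x \<oplus> V.R.linear_extension (l g) y"
    if "x \<in> carrier L" "y \<in> carrier L" for x y
    using V.R.linear_extension_add[OF lc] that by (simp add: L_def free_module_simps)
  have scale: "V.R.linear_extension (l g) (r \<odot>\<^bsub>L\<^esub> x) = r \<otimes> V.R.linear_extension (l g) x"
    if "x \<in> carrier L" "r \<in> carrier R" for x r
    using V.R.linear_extension_smult[OF lc] that by (simp add: L_def free_module_simps)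
  have minus: "V.R.linear_extension (l g) (x \<ominus>\<^bsub>L\<^esub> y) = V.R.linear_extension (l g) x \<ominus> V.R.linear_extension (l g) y"
    if "x \<in> carrier L" "y \<in> carrier L" for x y
    using V.R.linear_extension_minus[OF lc] that by (simp add: L_def)
  have basis: "V.R.linear_extension (l g) (\<delta> v w) = l g (v, w)" if "v \<in> carrier V" "w \<in> carrier W" for v w
    using V.R.linear_extension_free_basis[OF lc] that by simp
  have lc': "l g (v, w) \<in> carrier R" if "v \<in> carrier V" "w \<in> carrier W" for v w
    using lc that by auto
  have "tensor_relations R V W \<subseteq> {f \<in> carrier L. V.R.linear_extension (l g) f = \<zero>}"
  proof
    fix x assume x: "x \<in> tensor_relations R V W"
    then have "V.R.linear_extension (l g) x = \<zero>"
      by (cases rule: relations_cases)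
        (auto simp: minus add scale basis \<delta>_closed l_linear[OF g] lc' V.R.minus_eq_zero_iff)
    then show "x \<in> {f \<in> carrier L. V.R.linear_extension (l g) f = \<zero>}"
      using x relations_closed by blast
  qed
  then have "N \<subseteq> {f \<in> carrier L. V.R.linear_extension (l g) f = \<zero>}"
    unfolding N_def using V.R.linear_extension_kernel[OF lc]
    by (intro L.gen_submodule_minimal) (simp_all add: L_def)
  then show ?thesis using x F_eq[OF _ g] by auto
qed

lemma F_congL:
  assumes "f \<in> carrier L" "f' \<in> carrier L" "g \<in> carrier L" "f \<ominus>\<^bsub>L\<^esub> f' \<in> N"
  shows "F f g = F f' g"
proof -
  have "F (f \<ominus>\<^bsub>L\<^esub> f') g = F f g \<ominus> F f' g"
    using V.R.linear_extension_minus[OF l_closed[OF assms(3)]] assms by (simp add: F_eq L_def[symmetric])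
  moreover have "F f g \<in> carrier R" "F f' g \<in> carrier R"
    using V.R.linear_extension_closed[OF l_closed[OF assms(3)]] assms by (simp_all add: F_eq L_def[symmetric])
  moreover have "F f g \<ominus> F f' g = \<zero>" using F_N[OF assms(3,4)] calculation(1) by simp
  ultimately show ?thesis using V.R.minus_eq_zero_iff by blast
qed

end

lemma (in bilinear_space) unimodular_basis_generated:
  assumes S: "unimodular_basis S" and H: "submodule H R V" "S \<subseteq> H"
  shows "H = carrier V"
proof
  show "H \<subseteq> carrier V" by (rule submoduleE(1)[OF H(1)])
  show "carrier V \<subseteq> H"
  proof
    fix v assume "v \<in> carrier V"
    then obtain x where x: "x \<in> carrier (free_module R S)" "v = lincomb S x"
      using unimodular_basis_lincomb[OF S] by blast
    have "finite S" using S unimodular_finite unfolding unimodular_basis_def by blast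
    then show "v \<in> H" unfolding x(2)
      using x(1) by (intro submodule_lincomb[OF H(1) _ H(2)]) (auto simp: R.free_module_closed)
  qed
qed

context tensor_pair
begin

sublocale N: abelian_subgroup N L
proof (rule abelian_subgroupI3)
  show "additive_subgroup N L"
    using N_submodule by (simp add: additive_subgroup_def submodule_def)
  show "abelian_group L" by (rule L.M.abelian_group_axioms)
qed

lemma N_closed: "x \<in> N \<Longrightarrow> x \<in> carrier L"
  using submodule_zero N_submodule L.submoduleE(1) by blast

lemma coset_eq_iff:
  assumes "f \<in> carrier L" "g \<in> carrier L"
  shows "N +>\<^bsub>L\<^esub> f = N +>\<^bsub>L\<^esub> g \<longleftrightarrow> f \<ominus>\<^bsub>L\<^esub> g \<in> N"
proof
  assume "N +>\<^bsub>L\<^esub> f = N +>\<^bsub>L\<^esub> g"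
  then have "f \<in> N +>\<^bsub>L\<^esub> g" using N.a_rcos_self[OF assms(1)] by simp
  then show "f \<ominus>\<^bsub>L\<^esub> g \<in> N"
    using N.a_rcos_module[OF assms(2,1)] by (simp add: a_minus_def)
next
  assume "f \<ominus>\<^bsub>L\<^esub> g \<in> N"
  then have "f \<in> N +>\<^bsub>L\<^esub> g" using N.a_rcos_module[OF assms(2,1)] by (simp add: a_minus_def)
  then show "N +>\<^bsub>L\<^esub> f = N +>\<^bsub>L\<^esub> g" using N.a_repr_independence'[OF _ assms(2)] by blast
qed

lemma coset_mem:
  assumes "f \<in> carrier L" "g \<in> N +>\<^bsub>L\<^esub> f"
  shows "g \<in> carrier L" "g \<ominus>\<^bsub>L\<^esub> f \<in> N"
proof -
  show g: "g \<in> carrier L" using N.a_elemrcos_carrier[OF assms] .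
  show "g \<ominus>\<^bsub>L\<^esub> f \<in> N" using N.a_rcos_module[OF assms(1) g] assms(2) by (simp add: a_minus_def)
qed

definition T :: "('a, ('b \<times> 'c \<Rightarrow> 'a) set) form_module"
  where "T = tensor_space R V W"

lemma T_simps:
  "carrier T = (\<lambda>f. N +>\<^bsub>L\<^esub> f) ` carrier L"
  "add T C D = C <+>\<^bsub>L\<^esub> D"
  "smult T r C = (\<Union>x\<in>C. N +>\<^bsub>L\<^esub> (r \<odot>\<^bsub>L\<^esub> x))"
  "form T C D = (THE c. \<forall>f\<in>C. \<forall>g\<in>D. c = F f g)"
  by (auto simp: T_def tensor_space_def tensor_module_def quotient_module_def Let_def L_def[symmetric]
      N_def[symmetric] A_RCOSETS_def' F_def)

lemma T_add: "f \<in> carrier L \<Longrightarrow> g \<in> carrier L \<Longrightarrow>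
    (N +>\<^bsub>L\<^esub> f) \<oplus>\<^bsub>T\<^esub> (N +>\<^bsub>L\<^esub> g) = N +>\<^bsub>L\<^esub> (f \<oplus>\<^bsub>L\<^esub> g)"
  by (simp add: T_simps N.a_rcos_sum)

lemma T_smult:
  assumes r: "r \<in> carrier R" and f: "f \<in> carrier L"
  shows "r \<odot>\<^bsub>T\<^esub> (N +>\<^bsub>L\<^esub> f) = N +>\<^bsub>L\<^esub> (r \<odot>\<^bsub>L\<^esub> f)"
proof -
  have "N +>\<^bsub>L\<^esub> (r \<odot>\<^bsub>L\<^esub> g) = N +>\<^bsub>L\<^esub> (r \<odot>\<^bsub>L\<^esub> f)" if "g \<in> N +>\<^bsub>L\<^esub> f" for g
  proof -
    note g = coset_mem[OF f that]
    have "r \<odot>\<^bsub>L\<^esub> g \<ominus>\<^bsub>L\<^esub> r \<odot>\<^bsub>L\<^esub> f = r \<odot>\<^bsub>L\<^esub> (g \<ominus>\<^bsub>L\<^esub> f)"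
      using r f g(1) by (simp add: a_minus_def L.smult_r_distr L.smult_r_minus)
    also have "\<dots> \<in> N" using L.submoduleE(4)[OF N_submodule r g(2)] .
    finally show ?thesis using coset_eq_iff r f g(1) by simp
  qed
  then show ?thesis using N.a_rcos_self[OF f] unfolding T_simps by blast
qed

text \<open>Justifies the definite description in \<open>tensor_space\<close>:
  \<open>F_congL\<close> changes the representative in the first argument, and symmetry does the
  same for the second.\<close>

lemma T_form:
  assumes "f \<in> carrier L" "g \<in> carrier L"
  shows "form T (N +>\<^bsub>L\<^esub> f) (N +>\<^bsub>L\<^esub> g) = F f g"
  unfolding T_simps
proof (rule the_equality)
  have eq: "F f' g' = F f g" if "f' \<in> N +>\<^bsub>L\<^esub> f" "g' \<in> N +>\<^bsub>L\<^esub> g" for f' g'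
  proof -
    note f' = coset_mem[OF assms(1) that(1)] and g' = coset_mem[OF assms(2) that(2)]
    have "F f' g' = F f g'" by (rule F_congL[OF f'(1) assms(1) g'(1) f'(2)])
    also have "\<dots> = F g' f" by (rule F_sym[OF assms(1) g'(1)])
    also have "\<dots> = F g f" by (rule F_congL[OF g'(1) assms(2,1) g'(2)])
    also have "\<dots> = F f g" by (rule F_sym[OF assms(2,1)])
    finally show ?thesis .
  qed
  show "\<forall>f'\<in>N +>\<^bsub>L\<^esub> f. \<forall>g'\<in>N +>\<^bsub>L\<^esub> g. F f g = F f' g'" using eq by auto
  show "c = F f g" if "\<forall>f'\<in>N +>\<^bsub>L\<^esub> f. \<forall>g'\<in>N +>\<^bsub>L\<^esub> g. c = F f' g'" for c
    using that N.a_rcos_self[OF assms(1)] N.a_rcos_self[OF assms(2)] by blast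
qed

text \<open>Moves membership in a submodule above \<open>N\<close> across a single bilinearity
  relation.\<close>

lemma relation_mem_submodule:
  assumes G: "submodule G R L" "N \<subseteq> G" and "x \<in> carrier L" "y \<in> G" "x \<ominus>\<^bsub>L\<^esub> y \<in> tensor_relations R V W"
  shows "x \<in> G"
proof -
  have yc: "y \<in> carrier L" using L.submoduleE(1)[OF G(1)] assms(4) by blast
  have "x \<ominus>\<^bsub>L\<^esub> y \<oplus>\<^bsub>L\<^esub> y \<in> G"
    using relations_N assms by (intro L.submoduleE(5)[OF G(1)]) blast+
  moreover have "x \<ominus>\<^bsub>L\<^esub> y \<oplus>\<^bsub>L\<^esub> y = x"
    using assms(3) yc by (simp add: a_minus_def L.M.a_assoc L.M.l_neg)
  ultimately show ?thesis by simp
qed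

text \<open>Pairs of basis vectors form a basis of the tensor product, with Gram matrix
  \<open>k\<close>. They span because bilinearity reduces every pure tensor to them; they are
  independent because \<open>F\<close> vanishes on \<open>N\<close> and their Gram matrix is
  invertible.\<close>

lemma isometric_basis:
  assumes S: "V.unimodular_basis S" and S': "W.unimodular_basis S'"
  shows "isometric R (mspace R (S \<times> S') (kronecker R (form V) (form W))) (tensor_space R V W)"
proof -
  let ?B = "mspace R (S \<times> S') k"
  have Sc: "S \<subseteq> carrier V" "S' \<subseteq> carrier W"
    using S S' by (auto simp: V.unimodular_basis_def W.unimodular_basis_def)
  have uni: "unimodular R (S \<times> S') k"
    unfolding k_def using S S' by (intro V.R.unimodular_kronecker) (auto simp: V.unimodular_basis_def W.unimodular_basis_def)
  note fin = unimodular_finite[OF uni]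
  have Bc: "x p \<in> carrier R" and Bo: "p \<notin> S \<times> S' \<Longrightarrow> x p = \<zero>" if "x \<in> carrier ?B" for x p
    using V.R.free_module_closed V.R.free_module_outside that by simp_all
  have BL: "x \<in> carrier L" if "x \<in> carrier ?B" for x
  proof -
    have "finite {p. x p \<noteq> \<zero>}" using Bo[OF that] by (intro finite_subset[OF _ fin]) blast
    moreover have x: "x p \<in> carrier R" "p \<notin> S \<times> S' \<Longrightarrow> x p = \<zero>" for p
      using Bc[OF that] Bo[OF that] by simp_all
    moreover have "p \<notin> P \<Longrightarrow> x p = \<zero>" for p using x(2)[of p] Sc by blast
    ultimately show ?thesis unfolding L_def free_module_def by (simp add: image_subset_iff)
  qed
  have F: "F x y = form ?B x y" if x: "x \<in> carrier ?B" and y: "y \<in> carrier ?B" for x y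
  proof -
    have c: "x p \<in> carrier R" "y p \<in> carrier R" for p by (rule Bc[OF x], rule Bc[OF y])
    have kc: "k p q \<in> carrier R" if "p \<in> S \<times> S'" "q \<in> S \<times> S'" for p q
      using that Sc by (intro k_closed) auto
    have SP: "S \<times> S' \<subseteq> P" using Sc by auto
    have supp: "{p. x p \<noteq> \<zero>} \<subseteq> S \<times> S'" "{p. y p \<noteq> \<zero>} \<subseteq> S \<times> S'" using Bo[OF x] Bo[OF y] by blast+
    have "F x y = (\<Oplus>p\<in>S \<times> S'. x p \<otimes> l y p)"
      unfolding F_eq[OF BL[OF x] BL[OF y]]
      using l_closed[OF BL[OF y]] BL[OF x] fin SP supp(1)
      by (intro V.R.linear_extension_superset) (auto simp: L_def)
    also have "\<dots> = (\<Oplus>p\<in>S \<times> S'. x p \<otimes> (\<Oplus>q\<in>S \<times> S'. k p q \<otimes> y q))"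
    proof (rule V.R.finsum_cong')
      fix p assume p: "p \<in> S \<times> S'"
      have "l y p = (\<Oplus>q\<in>S \<times> S'. y q \<otimes> k p q)"
        unfolding l_def using p SP k_closed BL[OF y] fin supp(2)
        by (intro V.R.linear_extension_superset[of _ P]) (auto simp: L_def)
      also have "\<dots> = (\<Oplus>q\<in>S \<times> S'. k p q \<otimes> y q)"
        using p kc c by (intro V.R.finsum_cong') (auto simp: V.R.m_comm)
      finally show "x p \<otimes> l y p = x p \<otimes> (\<Oplus>q\<in>S \<times> S'. k p q \<otimes> y q)" by simp
    qed (use c kc in \<open>auto intro!: V.R.finsum_closed\<close>)
    finally show ?thesis by simp
  qed
  \<comment> \<open>An element of \<open>N\<close> has product zero with all basis vectors, so the
    unimodular matrix \<open>k\<close> annihilates its coordinates.\<close>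
  have inj: "x = (\<lambda>_. \<zero>)" if x: "x \<in> carrier ?B" and xN: "x \<in> N" for x
  proof -
    have "x p = \<zero>" if p: "p \<in> S \<times> S'" for p
    proof (rule V.R.unimodular_kernel[OF uni _ _ p])
      fix q assume q: "q \<in> S \<times> S'"
      have b: "free_basis R q \<in> carrier ?B" using q by (simp add: V.R.free_basis_closed)
      have "(\<Oplus>j\<in>S \<times> S'. k q j \<otimes> x j) = form ?B (free_basis R q) x"
        using x q fin uni by (intro V.R.form_free_basis_left[symmetric]) (auto simp: unimodular_closed)
      also have "\<dots> = F x (free_basis R q)" using F[OF b x] F_sym[OF BL[OF x] BL[OF b]] by simp
      also have "\<dots> = \<zero>" by (rule F_N[OF BL[OF b] xN])
      finally show "(\<Oplus>j\<in>S \<times> S'. k q j \<otimes> x j) = \<zero>" .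
    qed (rule Bc[OF x])
    then show ?thesis using Bo[OF x] by blast
  qed
  \<comment> \<open>Everything congruent modulo \<open>N\<close> to a combination of basis pairs. To
    see that this is all of \<open>L\<close>, the first tensor factor is freed from the basis in
    \<open>step1\<close>, the second in \<open>step2\<close>.\<close>
  define G where "G = {f \<in> carrier L. \<exists>x\<in>carrier ?B. f \<ominus>\<^bsub>L\<^esub> x \<in> N}"
  interpret B: module R ?B by (rule V.R.mspace_module)
  have addB: "x \<oplus>\<^bsub>L\<^esub> y = x \<oplus>\<^bsub>?B\<^esub> y" "r \<odot>\<^bsub>L\<^esub> x = r \<odot>\<^bsub>?B\<^esub> x" "\<zero>\<^bsub>L\<^esub> = \<zero>\<^bsub>?B\<^esub>" for x y r
    by (simp_all add: L_def free_module_simps)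
  have NG: "N \<subseteq> G"
  proof
    fix x assume x: "x \<in> N"
    then have "x \<ominus>\<^bsub>L\<^esub> \<zero>\<^bsub>?B\<^esub> \<in> N" using N_closed[OF x] unfolding addB[symmetric] by (simp add: a_minus_def)
    then show "x \<in> G" using N_closed[OF x] B.M.zero_closed unfolding G_def by blast
  qed
  have G: "submodule G R L"
  proof (rule L.submoduleI')
    show "G \<subseteq> carrier L" by (auto simp: G_def)
    show "\<zero>\<^bsub>L\<^esub> \<in> G" using NG submodule_zero[OF N_submodule] by blast
  next
    fix f g assume "f \<in> G" "g \<in> G"
    then obtain x y where xy: "f \<in> carrier L" "x \<in> carrier ?B" "f \<ominus>\<^bsub>L\<^esub> x \<in> N"
      "g \<in> carrier L" "y \<in> carrier ?B" "g \<ominus>\<^bsub>L\<^esub> y \<in> N" unfolding G_def by blast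
    note L = BL[OF xy(2)] BL[OF xy(5)]
    have "(f \<oplus>\<^bsub>L\<^esub> g) \<ominus>\<^bsub>L\<^esub> (x \<oplus>\<^bsub>L\<^esub> y) = (f \<ominus>\<^bsub>L\<^esub> x) \<oplus>\<^bsub>L\<^esub> (g \<ominus>\<^bsub>L\<^esub> y)"
      using xy(1,4) L by (simp add: a_minus_def L.M.minus_add L.M.a_ac)
    also have "\<dots> \<in> N" by (rule L.submoduleE(5)[OF N_submodule xy(3,6)])
    finally show "f \<oplus>\<^bsub>L\<^esub> g \<in> G"
      using xy B.M.a_closed[OF xy(2,5)] unfolding G_def addB(1)[of x y] by blast
  next
    fix r f assume r: "r \<in> carrier R" "f \<in> G"
    then obtain x where x: "f \<in> carrier L" "x \<in> carrier ?B" "f \<ominus>\<^bsub>L\<^esub> x \<in> N" unfolding G_def by blast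
    have "r \<odot>\<^bsub>L\<^esub> f \<ominus>\<^bsub>L\<^esub> r \<odot>\<^bsub>L\<^esub> x = r \<odot>\<^bsub>L\<^esub> (f \<ominus>\<^bsub>L\<^esub> x)"
      using r(1) x(1) BL[OF x(2)] by (simp add: a_minus_def L.smult_r_distr L.smult_r_minus)
    also have "\<dots> \<in> N" by (rule L.submoduleE(4)[OF N_submodule r(1) x(3)])
    finally show "r \<odot>\<^bsub>L\<^esub> f \<in> G"
      using r(1) x B.smult_closed[OF r(1) x(2)] unfolding G_def addB(2)[of r x] by blast
  qed
  note Gadd = L.submoduleE(5)[OF G] and Gsmult = L.submoduleE(4)[OF G] and Gzero = submodule_zero[OF G]
  have step1: "\<delta> v s' \<in> G" if v: "v \<in> carrier V" and s': "s' \<in> S'" for v s'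
  proof -
    have s'c: "s' \<in> carrier W" using s' Sc by blast
    have smult: "\<delta> (r \<odot>\<^bsub>V\<^esub> a) s' \<in> G" if "r \<in> carrier R" "a \<in> carrier V" "r \<odot>\<^bsub>L\<^esub> \<delta> a s' \<in> G" for r a
      using that s'c by (intro relation_mem_submodule[OF G NG _ _ relations(3)]) (auto simp: \<delta>_closed)
    have "submodule {v \<in> carrier V. \<delta> v s' \<in> G} R V"
    proof (rule V.submoduleI')
      have "\<delta> (\<zero> \<odot>\<^bsub>V\<^esub> \<zero>\<^bsub>V\<^esub>) s' \<in> G"
        using s'c Gzero by (intro smult) (auto simp: \<delta>_closed)
      then show "\<zero>\<^bsub>V\<^esub> \<in> {v \<in> carrier V. \<delta> v s' \<in> G}" by simp
      show "a \<oplus>\<^bsub>V\<^esub> b \<in> {v \<in> carrier V. \<delta> v s' \<in> G}"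
        if "a \<in> {v \<in> carrier V. \<delta> v s' \<in> G}" "b \<in> {v \<in> carrier V. \<delta> v s' \<in> G}" for a b
        using that s'c Gadd relation_mem_submodule[OF G NG _ _ relations(1)] by (simp add: \<delta>_closed)
    qed (use Gsmult smult in auto)
    moreover have "S \<subseteq> {v \<in> carrier V. \<delta> v s' \<in> G}"
    proof
      fix s assume s: "s \<in> S"
      have b: "\<delta> s s' \<in> carrier ?B" using s s' by (simp add: V.R.free_basis_closed)
      have "\<delta> s s' \<ominus>\<^bsub>L\<^esub> \<delta> s s' \<in> N"
        using BL[OF b] submodule_zero[OF N_submodule] by (simp add: a_minus_def L.M.r_neg)
      then show "s \<in> {v \<in> carrier V. \<delta> v s' \<in> G}" using s Sc b BL[OF b] unfolding G_def by blast
    qed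
    ultimately show ?thesis using V.unimodular_basis_generated[OF S] v by blast
  qed
  have step2: "\<delta> v w \<in> G" if v: "v \<in> carrier V" and w: "w \<in> carrier W" for v w
  proof -
    have smult: "\<delta> v (r \<odot>\<^bsub>W\<^esub> a) \<in> G" if "r \<in> carrier R" "a \<in> carrier W" "r \<odot>\<^bsub>L\<^esub> \<delta> v a \<in> G" for r a
      using that v by (intro relation_mem_submodule[OF G NG _ _ relations(4)]) (auto simp: \<delta>_closed)
    have "submodule {w \<in> carrier W. \<delta> v w \<in> G} R W"
    proof (rule W.submoduleI')
      have "\<delta> v (\<zero> \<odot>\<^bsub>W\<^esub> \<zero>\<^bsub>W\<^esub>) \<in> G"
        using v Gzero by (intro smult) (auto simp: \<delta>_closed)
      then show "\<zero>\<^bsub>W\<^esub> \<in> {w \<in> carrier W. \<delta> v w \<in> G}" by simp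
      show "a \<oplus>\<^bsub>W\<^esub> b \<in> {w \<in> carrier W. \<delta> v w \<in> G}"
        if "a \<in> {w \<in> carrier W. \<delta> v w \<in> G}" "b \<in> {w \<in> carrier W. \<delta> v w \<in> G}" for a b
        using that v Gadd relation_mem_submodule[OF G NG _ _ relations(2)] by (simp add: \<delta>_closed)
    qed (use Gsmult smult in auto)
    moreover have "S' \<subseteq> {w \<in> carrier W. \<delta> v w \<in> G}" using step1[OF v] Sc by blast
    ultimately show ?thesis using W.unimodular_basis_generated[OF S'] w by blast
  qed
  have all: "f \<in> G" if f: "f \<in> carrier L" for f
  proof -
    \<comment> \<open>Generation by basis vectors is available for finite index sets, so the
      argument is restricted to the support of \<open>f\<close>.\<close>
    define Y where "Y = {p. f p \<noteq> \<zero>}"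
    have Y: "finite Y" "Y \<subseteq> P" using f by (auto simp: Y_def L_def free_module_def)
    have YL: "x \<in> carrier L" if "x \<in> carrier (free_module R Y)" for x
      using that Y by (auto simp: L_def free_module_def)
    interpret Y: module R "free_module R Y" by (rule V.R.free_module_module)
    have ops: "x \<oplus>\<^bsub>L\<^esub> y = x \<oplus>\<^bsub>free_module R Y\<^esub> y" "r \<odot>\<^bsub>L\<^esub> x = r \<odot>\<^bsub>free_module R Y\<^esub> x"
      "\<zero>\<^bsub>L\<^esub> = \<zero>\<^bsub>free_module R Y\<^esub>" for x y r
      by (simp_all add: L_def free_module_simps)
    have "submodule (carrier (free_module R Y) \<inter> G) R (free_module R Y)"
      using Gadd Gsmult Gzero unfolding ops by (intro Y.submoduleI') auto
    then have "carrier (free_module R Y) \<inter> G = carrier (free_module R Y)"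
      using step2 Y(2) by (intro V.R.free_module_generated[OF Y(1)]) (auto simp: V.R.free_basis_closed)
    moreover have "f \<in> carrier (free_module R Y)"
      using L_closed[OF f] unfolding V.R.free_module_carrier_finite[OF Y(1)] by (simp add: Y_def)
    ultimately show ?thesis by blast
  qed
  have "isometric R ?B T"
    unfolding isometric_def
  proof (intro bexI conjI ballI)
    let ?h = "\<lambda>x. N +>\<^bsub>L\<^esub> x"
    show "?h \<in> module_hom R ?B T"
      unfolding module_hom_def
    proof (intro CollectI conjI ballI)
      show "?h \<in> carrier ?B \<rightarrow> carrier T" using BL by (auto simp: T_simps)
      show "?h (x \<oplus>\<^bsub>?B\<^esub> y) = ?h x \<oplus>\<^bsub>T\<^esub> ?h y" if "x \<in> carrier ?B" "y \<in> carrier ?B" for x y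
        using T_add[OF BL BL, OF that] by (simp only: addB)
      show "?h (r \<odot>\<^bsub>?B\<^esub> x) = r \<odot>\<^bsub>T\<^esub> ?h x" if "r \<in> carrier R" "x \<in> carrier ?B" for r x
        using T_smult[OF that(1) BL[OF that(2)]] by (simp only: addB)
    qed
    show "form T (?h x) (?h y) = form ?B x y" if "x \<in> carrier ?B" "y \<in> carrier ?B" for x y
      using T_form[OF BL BL, OF that] F[OF that] by simp
    show "bij_betw ?h (carrier ?B) (carrier T)"
    proof (intro bij_betw_imageI inj_onI)
      fix x y assume xy: "x \<in> carrier ?B" "y \<in> carrier ?B" "?h x = ?h y"
      have "x \<ominus>\<^bsub>L\<^esub> y \<in> N" using coset_eq_iff[OF BL BL, OF xy(1,2)] xy(3) by simp
      moreover have d: "x \<ominus>\<^bsub>L\<^esub> y = x \<oplus>\<^bsub>?B\<^esub> (\<ominus> \<one>) \<odot>\<^bsub>?B\<^esub> y"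
        using L.smult_l_minus[of \<one> y] L.smult_one[OF BL[OF xy(2)]] BL[OF xy(2)]
        unfolding addB[symmetric] by (simp add: a_minus_def)
      moreover have "x \<oplus>\<^bsub>?B\<^esub> (\<ominus> \<one>) \<odot>\<^bsub>?B\<^esub> y \<in> carrier ?B" using xy by (intro B.M.a_closed B.smult_closed) auto
      ultimately have "x \<oplus>\<^bsub>?B\<^esub> (\<ominus> \<one>) \<odot>\<^bsub>?B\<^esub> y = (\<lambda>_. \<zero>)" using inj by simp
      then have "x p \<oplus> \<ominus> \<one> \<otimes> y p = \<zero>" for p by (metis mspace_simps(3,4))
      then show "x = y"
        using Bc[OF xy(1)] Bc[OF xy(2)] V.R.minus_eq_zero_iff by (simp add: fun_eq_iff V.R.l_minus a_minus_def)
    next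
      show "?h ` carrier ?B = carrier T"
      proof
        show "?h ` carrier ?B \<subseteq> carrier T" using BL by (auto simp: T_simps)
        show "carrier T \<subseteq> ?h ` carrier ?B"
        proof
          fix C assume "C \<in> carrier T"
          then obtain f where f: "f \<in> carrier L" "C = N +>\<^bsub>L\<^esub> f" by (auto simp: T_simps)
          then obtain x where "x \<in> carrier ?B" "f \<ominus>\<^bsub>L\<^esub> x \<in> N" using all unfolding G_def by blast
          then show "C \<in> ?h ` carrier ?B" using f coset_eq_iff BL by blast
        qed
      qed
    qed
  qed
  then show ?thesis by (simp add: k_def T_def)
qed

end

section \<open>The Grothendieck ring of isometry classes\<close>

locale comm_semiring = semiring S + comm_monoid S for S (structure)
begin

abbreviation "rel \<equiv> grothendieck_rel S"

definition cls :: "'a \<Rightarrow> 'a \<Rightarrow> ('a \<times> 'a) set"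
  where "cls a b = rel `` {(a, b)}"

lemma rel_iff: "((a, b), (c, d)) \<in> rel \<longleftrightarrow> a \<in> carrier S \<and> b \<in> carrier S \<and> c \<in> carrier S \<and> d \<in> carrier S \<and>
    (\<exists>e\<in>carrier S. a \<oplus> d \<oplus> e = c \<oplus> b \<oplus> e)"
  by (auto simp: grothendieck_rel_def)

lemma equiv_rel: "equiv (carrier S \<times> carrier S) rel"
proof (rule equivI)
  show "rel \<subseteq> (carrier S \<times> carrier S) \<times> (carrier S \<times> carrier S)" by (auto simp: grothendieck_rel_def)
  show "refl_on (carrier S \<times> carrier S) rel"
    by (rule refl_onI) (auto simp: rel_iff)
  show "sym rel"
  proof (rule symI)
    fix p q assume "(p, q) \<in> rel"
    then show "(q, p) \<in> rel" by (cases p; cases q) (metis rel_iff)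
  qed
  show "trans rel"
  proof (rule transI)
    fix p q r assume pq: "(p, q) \<in> rel" "(q, r) \<in> rel"
    obtain a b c d u v where e: "p = (a, b)" "q = (c, d)" "r = (u, v)" by (metis surj_pair)
    have m: "a \<in> carrier S" "b \<in> carrier S" "c \<in> carrier S" "d \<in> carrier S" "u \<in> carrier S" "v \<in> carrier S"
      using pq by (auto simp: e rel_iff)
    obtain x where x: "x \<in> carrier S" "a \<oplus> d \<oplus> x = c \<oplus> b \<oplus> x" using pq(1) by (auto simp: e rel_iff)
    obtain y where y: "y \<in> carrier S" "c \<oplus> v \<oplus> y = u \<oplus> d \<oplus> y" using pq(2) by (auto simp: e rel_iff)
    have "a \<oplus> v \<oplus> (c \<oplus> d \<oplus> x \<oplus> y) = (a \<oplus> d \<oplus> x) \<oplus> (c \<oplus> v \<oplus> y)" using m x(1) y(1) by (simp add: a_ac)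
    also have "\<dots> = (c \<oplus> b \<oplus> x) \<oplus> (u \<oplus> d \<oplus> y)" by (simp only: x(2) y(2))
    also have "\<dots> = u \<oplus> b \<oplus> (c \<oplus> d \<oplus> x \<oplus> y)" using m x(1) y(1) by (simp add: a_ac)
    finally show "(p, r) \<in> rel" using m x(1) y(1) by (auto simp: e rel_iff)
  qed
qed

lemma cls_eq_iff:
  assumes "a \<in> carrier S" "b \<in> carrier S" "c \<in> carrier S" "d \<in> carrier S"
  shows "cls a b = cls c d \<longleftrightarrow> (\<exists>e\<in>carrier S. a \<oplus> d \<oplus> e = c \<oplus> b \<oplus> e)"
  using assms eq_equiv_class_iff[OF equiv_rel, of "(a, b)" "(c, d)"] by (auto simp: cls_def rel_iff)

lemma carrier_grothendieck:
  "X \<in> carrier (grothendieck_ring S) \<longleftrightarrow> (\<exists>a\<in>carrier S. \<exists>b\<in>carrier S. X = cls a b)"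
  by (auto simp: grothendieck_ring_def quotient_def cls_def)

lemma cls_closed: "a \<in> carrier S \<Longrightarrow> b \<in> carrier S \<Longrightarrow> cls a b \<in> carrier (grothendieck_ring S)"
  using carrier_grothendieck by blast

lemma cls_add:
  assumes "a \<in> carrier S" "b \<in> carrier S" "c \<in> carrier S" "d \<in> carrier S"
  shows "cls a b \<oplus>\<^bsub>grothendieck_ring S\<^esub> cls c d = cls (a \<oplus> c) (b \<oplus> d)"
proof -
  let ?f = "\<lambda>p q. cls (fst p \<oplus> fst q) (snd p \<oplus> snd q)"
  have "congruent2 rel rel ?f"
  proof (rule congruent2_commuteI[OF equiv_rel])
    show "?f y z = ?f z y" if "y \<in> carrier S \<times> carrier S" "z \<in> carrier S \<times> carrier S" for y z
      using that by (auto simp: a_comm)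
    fix y z w assume yz: "(y, z) \<in> rel" and w: "w \<in> carrier S \<times> carrier S"
    obtain a b c d u v where e: "y = (a, b)" "z = (c, d)" "w = (u, v)" by (metis surj_pair)
    have m: "a \<in> carrier S" "b \<in> carrier S" "c \<in> carrier S" "d \<in> carrier S" "u \<in> carrier S" "v \<in> carrier S"
      using yz w by (auto simp: e rel_iff)
    obtain x where x: "x \<in> carrier S" "a \<oplus> d \<oplus> x = c \<oplus> b \<oplus> x" using yz by (auto simp: e rel_iff)
    have "(u \<oplus> a) \<oplus> (v \<oplus> d) \<oplus> x = (u \<oplus> v) \<oplus> (a \<oplus> d \<oplus> x)" using m x(1) by (simp add: a_ac)
    also have "\<dots> = (u \<oplus> c) \<oplus> (v \<oplus> b) \<oplus> x" unfolding x(2) using m x(1) by (simp add: a_ac)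
    finally show "?f w y = ?f w z" using m x(1) by (auto simp: e cls_eq_iff)
  qed
  from UN_equiv_class2[OF equiv_rel equiv_rel this, of "(a, b)" "(c, d)"] assms show ?thesis
    by (simp add: grothendieck_ring_def cls_def case_prod_beta)
qed

lemma cls_mult:
  assumes "a \<in> carrier S" "b \<in> carrier S" "c \<in> carrier S" "d \<in> carrier S"
  shows "cls a b \<otimes>\<^bsub>grothendieck_ring S\<^esub> cls c d = cls (a \<otimes> c \<oplus> b \<otimes> d) (a \<otimes> d \<oplus> b \<otimes> c)"
proof -
  let ?f = "\<lambda>p q. cls (fst p \<otimes> fst q \<oplus> snd p \<otimes> snd q) (fst p \<otimes> snd q \<oplus> snd p \<otimes> fst q)"
  have "congruent2 rel rel ?f"
  proof (rule congruent2_commuteI[OF equiv_rel])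
    show "?f y z = ?f z y" if "y \<in> carrier S \<times> carrier S" "z \<in> carrier S \<times> carrier S" for y z
      using that by (auto simp: a_comm m_comm)
    fix y z w assume yz: "(y, z) \<in> rel" and w: "w \<in> carrier S \<times> carrier S"
    obtain a b c d u v where e: "y = (a, b)" "z = (c, d)" "w = (u, v)" by (metis surj_pair)
    have m: "a \<in> carrier S" "b \<in> carrier S" "c \<in> carrier S" "d \<in> carrier S" "u \<in> carrier S" "v \<in> carrier S"
      using yz w by (auto simp: e rel_iff)
    obtain x where x: "x \<in> carrier S" "a \<oplus> d \<oplus> x = c \<oplus> b \<oplus> x" using yz by (auto simp: e rel_iff)
    \<comment> \<open>The equation for \<open>x\<close> is used twice, multiplied by
      \<open>u\<close> and, with its sides exchanged, by \<open>v\<close>. Commutativity reduces the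
      claim to one varying argument.\<close>
    have "(u \<otimes> a \<oplus> v \<otimes> b) \<oplus> (u \<otimes> d \<oplus> v \<otimes> c) \<oplus> (u \<otimes> x \<oplus> v \<otimes> x) = u \<otimes> (a \<oplus> d \<oplus> x) \<oplus> v \<otimes> (c \<oplus> b \<oplus> x)"
      using m x(1) by (simp add: a_ac r_distr)
    also have "\<dots> = u \<otimes> (c \<oplus> b \<oplus> x) \<oplus> v \<otimes> (a \<oplus> d \<oplus> x)" by (simp only: x(2))
    also have "\<dots> = (u \<otimes> c \<oplus> v \<otimes> d) \<oplus> (u \<otimes> b \<oplus> v \<otimes> a) \<oplus> (u \<otimes> x \<oplus> v \<otimes> x)"
      using m x(1) by (simp add: a_ac r_distr)
    finally have "\<exists>e\<in>carrier S. (u \<otimes> a \<oplus> v \<otimes> b) \<oplus> (u \<otimes> d \<oplus> v \<otimes> c) \<oplus> e = (u \<otimes> c \<oplus> v \<otimes> d) \<oplus> (u \<otimes> b \<oplus> v \<otimes> a) \<oplus> e"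
      using m x(1) by (intro bexI[of _ "u \<otimes> x \<oplus> v \<otimes> x"]) auto
    then show "?f w y = ?f w z" using m by (simp add: e cls_eq_iff)
  qed
  from UN_equiv_class2[OF equiv_rel equiv_rel this, of "(a, b)" "(c, d)"] assms show ?thesis
    by (simp add: grothendieck_ring_def cls_def case_prod_beta)
qed

lemma grothendieck_zero: "\<zero>\<^bsub>grothendieck_ring S\<^esub> = cls \<zero> \<zero>"
  and grothendieck_one: "\<one>\<^bsub>grothendieck_ring S\<^esub> = cls \<one> \<zero>"
  by (simp_all add: grothendieck_ring_def cls_def)

lemma cls_diag: "a \<in> carrier S \<Longrightarrow> cls a a = cls \<zero> \<zero>"
  by (auto simp: cls_eq_iff)

lemma grothendieck_cases:
  assumes "X \<in> carrier (grothendieck_ring S)"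
  obtains a b where "a \<in> carrier S" "b \<in> carrier S" "X = cls a b"
  using assms unfolding carrier_grothendieck by blast

theorem cring_grothendieck_ring: "cring (grothendieck_ring S)"
proof (rule cringI)
  let ?G = "grothendieck_ring S"
  show "abelian_group ?G"
  proof (rule abelian_groupI)
    fix x y z assume xyz: "x \<in> carrier ?G" "y \<in> carrier ?G" "z \<in> carrier ?G"
    obtain a b where r1: "a \<in> carrier S" "b \<in> carrier S" "x = cls a b" using grothendieck_cases[OF xyz(1)] .
    obtain c d where r2: "c \<in> carrier S" "d \<in> carrier S" "y = cls c d" using grothendieck_cases[OF xyz(2)] .
    obtain e f where r3: "e \<in> carrier S" "f \<in> carrier S" "z = cls e f" using grothendieck_cases[OF xyz(3)] .
    note r = r1 r2 r3
    show "x \<oplus>\<^bsub>?G\<^esub> y \<in> carrier ?G" using r by (simp add: cls_add cls_closed)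
    show "x \<oplus>\<^bsub>?G\<^esub> y \<oplus>\<^bsub>?G\<^esub> z = x \<oplus>\<^bsub>?G\<^esub> (y \<oplus>\<^bsub>?G\<^esub> z)"
      "x \<oplus>\<^bsub>?G\<^esub> y = y \<oplus>\<^bsub>?G\<^esub> x"
      using r by (simp_all add: cls_add cls_closed a_ac)
  next
    fix x assume "x \<in> carrier ?G"
    then obtain a b where x: "a \<in> carrier S" "b \<in> carrier S" "x = cls a b" by (rule grothendieck_cases)
    show "\<zero>\<^bsub>?G\<^esub> \<oplus>\<^bsub>?G\<^esub> x = x" using x by (simp add: cls_add grothendieck_zero)
    have "cls b a \<oplus>\<^bsub>?G\<^esub> x = \<zero>\<^bsub>?G\<^esub>"
      using x by (simp add: cls_add a_comm[of b a] cls_diag[of "a \<oplus> b"] grothendieck_zero)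
    then show "\<exists>y\<in>carrier ?G. y \<oplus>\<^bsub>?G\<^esub> x = \<zero>\<^bsub>?G\<^esub>" using cls_closed[OF x(2,1)] by blast
  qed (simp add: grothendieck_zero cls_closed)
  show "comm_monoid ?G"
  proof (rule comm_monoidI)
    fix x y z assume xyz: "x \<in> carrier ?G" "y \<in> carrier ?G" "z \<in> carrier ?G"
    obtain a b where r1: "a \<in> carrier S" "b \<in> carrier S" "x = cls a b" using grothendieck_cases[OF xyz(1)] .
    obtain c d where r2: "c \<in> carrier S" "d \<in> carrier S" "y = cls c d" using grothendieck_cases[OF xyz(2)] .
    obtain e f where r3: "e \<in> carrier S" "f \<in> carrier S" "z = cls e f" using grothendieck_cases[OF xyz(3)] .
    note r = r1 r2 r3
    show "x \<otimes>\<^bsub>?G\<^esub> y \<in> carrier ?G" "x \<otimes>\<^bsub>?G\<^esub> y = y \<otimes>\<^bsub>?G\<^esub> x"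
      using r by (simp_all add: cls_mult cls_closed a_ac m_comm)
    show "x \<otimes>\<^bsub>?G\<^esub> y \<otimes>\<^bsub>?G\<^esub> z = x \<otimes>\<^bsub>?G\<^esub> (y \<otimes>\<^bsub>?G\<^esub> z)"
      using r by (simp add: cls_mult l_distr r_distr a_ac m_assoc)
  next
    fix x assume "x \<in> carrier ?G"
    then obtain a b where x: "a \<in> carrier S" "b \<in> carrier S" "x = cls a b" by (rule grothendieck_cases)
    show "\<one>\<^bsub>?G\<^esub> \<otimes>\<^bsub>?G\<^esub> x = x" using x by (simp add: cls_mult grothendieck_one)
  qed (simp add: grothendieck_one cls_closed)
  fix x y z assume xyz: "x \<in> carrier ?G" "y \<in> carrier ?G" "z \<in> carrier ?G"
  obtain a b where r1: "a \<in> carrier S" "b \<in> carrier S" "x = cls a b" using grothendieck_cases[OF xyz(1)] .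
  obtain c d where r2: "c \<in> carrier S" "d \<in> carrier S" "y = cls c d" using grothendieck_cases[OF xyz(2)] .
  obtain e f where r3: "e \<in> carrier S" "f \<in> carrier S" "z = cls e f" using grothendieck_cases[OF xyz(3)] .
  note r = r1 r2 r3
  show "(x \<oplus>\<^bsub>?G\<^esub> y) \<otimes>\<^bsub>?G\<^esub> z = x \<otimes>\<^bsub>?G\<^esub> z \<oplus>\<^bsub>?G\<^esub> y \<otimes>\<^bsub>?G\<^esub> z"
    using r by (simp add: cls_mult cls_add l_distr a_ac)
qed

end

section \<open>Isometry classes through Gram matrices\<close>

lemma isometry_class_cong:
  assumes "module R U" "isometric R U V"
  shows "isometry_class R U = isometry_class R V"
  using isometric_trans[OF _ assms(2)] isometric_trans[OF _ isometric_sym[OF assms]]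
  unfolding isometry_class_def by blast

text \<open>Possible for every index type, because \<open>isometry_class\<close> accepts a space
  with elements of any type.\<close>

definition gram_class :: "('a, 'r) ring_scheme \<Rightarrow> 'x set \<Rightarrow> ('x \<Rightarrow> 'x \<Rightarrow> 'a) \<Rightarrow> 'a small_space set"
  where "gram_class R I A = isometry_class R (mspace R I A)"

context cring
begin

lemma gram_class_reindex:
  assumes "bij_betw \<pi> I J" "finite I" "\<And>i i'. i \<in> I \<Longrightarrow> i' \<in> I \<Longrightarrow> A i i' = B (\<pi> i) (\<pi> i')"
    "\<And>j j'. j \<in> J \<Longrightarrow> j' \<in> J \<Longrightarrow> B j j' \<in> carrier R"
  shows "gram_class R I A = gram_class R J B"
  unfolding gram_class_def
  by (rule isometry_class_cong[OF mspace_module mspace_reindex[of \<pi>]]) (fact assms)+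

lemma unimodular_reindex:
  assumes \<pi>: "bij_betw \<pi> I J" and A: "\<And>i i'. i \<in> I \<Longrightarrow> i' \<in> I \<Longrightarrow> A i i' = B (\<pi> i) (\<pi> i')"
    and uni: "unimodular R I A"
  shows "unimodular R J B"
proof -
  obtain A' where A': "\<And>i j. i \<in> I \<Longrightarrow> j \<in> I \<Longrightarrow> A' i j \<in> carrier R"
    "\<And>i k. i \<in> I \<Longrightarrow> k \<in> I \<Longrightarrow> (\<Oplus>j\<in>I. A i j \<otimes> A' j k) = (if i = k then \<one> else \<zero>)"
    using uni unfolding unimodular_def by blast
  define \<rho> where "\<rho> = inv_into I \<pi>"
  have inj: "inj_on \<pi> I" and J: "J = \<pi> ` I" using \<pi> by (auto simp: bij_betw_def)
  have \<rho>: "\<rho> (\<pi> i) = i" if "i \<in> I" for i using inj that by (simp add: \<rho>_def)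
  note cl = unimodular_closed[OF uni]
  show ?thesis
  proof (rule unimodularI[where B = "\<lambda>j k. A' (\<rho> j) (\<rho> k)"])
    show "finite J" using unimodular_finite[OF uni] J by simp
    show "B i j \<in> carrier R \<and> B i j = B j i" if "i \<in> J" "j \<in> J" for i j
      using that cl unimodular_sym[OF uni] by (auto simp: J simp flip: A)
    show "A' (\<rho> i) (\<rho> j) \<in> carrier R" if "i \<in> J" "j \<in> J" for i j
      using that A'(1) by (auto simp: J \<rho>)
    fix j k assume "j \<in> J" "k \<in> J"
    then obtain i l where i: "i \<in> I" "l \<in> I" "j = \<pi> i" "k = \<pi> l" by (auto simp: J)
    have "(\<Oplus>j'\<in>J. B j j' \<otimes> A' (\<rho> j') (\<rho> k)) = (\<Oplus>i'\<in>I. B (\<pi> i) (\<pi> i') \<otimes> A' (\<rho> (\<pi> i')) l)"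
      unfolding J i using i inj cl A'(1) by (subst finsum_reindex) (auto simp: \<rho> simp flip: A)
    also have "\<dots> = (\<Oplus>i'\<in>I. A i i' \<otimes> A' i' l)"
      using i cl A'(1) by (intro finsum_cong') (auto simp: \<rho> simp flip: A)
    also have "\<dots> = (if j = k then \<one> else \<zero>)"
      using A'(2)[OF i(1,2)] inj i by (auto simp: inj_on_def)
    finally show "(\<Oplus>j'\<in>J. B j j' \<otimes> A' (\<rho> j') (\<rho> k)) = (if j = k then \<one> else \<zero>)" .
  qed
qed

text \<open>Renumbering by an initial segment of the naturals gives a space whose elements have type
  \<open>nat \<Rightarrow> 'a\<close>, which can be a member of an isometry class.\<close>

lemma gram_class_small:
  assumes A: "unimodular R I A"
  obtains n :: nat and B where "unimodular R {..<n} B" "gram_class R I A = gram_class R {..<n} B"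
proof -
  obtain \<pi> where \<pi>: "bij_betw \<pi> {..<card I} I"
    using ex_bij_betw_nat_finite[OF unimodular_finite[OF A]] by (auto simp: atLeast0LessThan)
  define B where "B = (\<lambda>i j. A (\<pi> i) (\<pi> j))"
  have eq: "gram_class R {..<card I} B = gram_class R I A"
    by (rule gram_class_reindex[OF \<pi>]) (use unimodular_closed[OF A] in \<open>auto simp: B_def\<close>)
  have \<rho>: "bij_betw (inv_into {..<card I} \<pi>) I {..<card I}" by (rule bij_betw_inv_into[OF \<pi>])
  have "unimodular R {..<card I} B"
    by (rule unimodular_reindex[OF \<rho> _ A]) (use \<pi> in \<open>simp add: B_def bij_betw_inv_into_right\<close>)
  then show ?thesis using that eq by simp
qed

end

context local_ring
begin

lemma nontrivial: "\<one> \<noteq> \<zero>"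
  using one_imp_carrier I_notcarr additive_subgroup.zero_closed[OF is_additive_subgroup] by force

lemma gram_class_nonempty:
  assumes "unimodular R I A"
  shows "gram_class R I A \<noteq> {}"
proof -
  obtain n :: nat and B where "unimodular R {..<n} B" "gram_class R I A = gram_class R {..<n} B"
    using gram_class_small[OF assms] .
  then have "mspace R {..<n} B \<in> gram_class R I A"
    by (simp add: gram_class_def isometry_class_def inner_product_space_mspace nontrivial isometric_refl)
  then show ?thesis by blast
qed

lemma gram_class_closed:
  assumes "unimodular R I A"
  shows "gram_class R I A \<in> carrier (isometry_classes R)"
proof -
  obtain n :: nat and B where B: "unimodular R {..<n} B" "gram_class R I A = gram_class R {..<n} B"
    using gram_class_small[OF assms] .
  have "inner_product_space R (mspace R {..<n} B)" by (rule inner_product_space_mspace[OF B(1) nontrivial])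
  then show ?thesis unfolding B(2) by (auto simp: isometry_classes_def gram_class_def)
qed

lemma inner_product_space_gram_class:
  assumes V: "inner_product_space R V"
  obtains n :: nat and A where "unimodular R {..<n} A" "isometry_class R V = gram_class R {..<n} A"
proof -
  interpret V: local_bilinear_space \<mm> R V
    using V by (simp add: local_bilinear_space_def inner_product_space_bilinear local_ring_axioms)
  obtain S where S: "V.unimodular_basis S" using V.exists_unimodular_basis[OF V] .
  then have "unimodular R S (form V)" by (simp add: V.unimodular_basis_def)
  moreover have "isometry_class R V = gram_class R S (form V)"
    unfolding gram_class_def
    by (rule isometry_class_cong[OF mspace_module V.unimodular_basis_isometric[OF S], symmetric])
  ultimately show ?thesis using gram_class_small that by metis
qed

lemma isometry_class_carrier:
  assumes "X \<in> carrier (isometry_classes R)"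
  obtains n :: nat and A where "unimodular R {..<n} A" "X = gram_class R {..<n} A"
proof -
  obtain V :: "'a small_space" where "inner_product_space R V" "X = isometry_class R V"
    using assms by (auto simp: isometry_classes_def)
  then show ?thesis using inner_product_space_gram_class that by metis
qed

text \<open>The images of the standard basis vectors. A representative of a Gram class thus has a
  basis with that very Gram matrix, as \<open>isometric_basis\<close> requires.\<close>

lemma isometric_mspace_basis:
  assumes A: "unimodular R I A" and V: "bilinear_space R V" and iso: "isometric R (mspace R I A) V"
  shows "\<exists>S \<pi>. bij_betw \<pi> I S \<and> bilinear_space.unimodular_basis R V S \<and>
    (\<forall>i\<in>I. \<forall>j\<in>I. A i j = form V (\<pi> i) (\<pi> j))"
proof -
  interpret V: bilinear_space R V by fact
  obtain h where h: "h \<in> module_hom R (mspace R I A) V" "bij_betw h (carrier (mspace R I A)) (carrier V)"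
      "\<And>x y. x \<in> carrier (mspace R I A) \<Longrightarrow> y \<in> carrier (mspace R I A) \<Longrightarrow> form V (h x) (h y) = form (mspace R I A) x y"
    using iso unfolding isometric_def by blast
  note I = unimodular_finite[OF A] and cl = unimodular_closed[OF A]
  define \<pi> where "\<pi> = (\<lambda>i. h (free_basis R i))"
  have b: "free_basis R i \<in> carrier (mspace R I A)" if "i \<in> I" for i using that by (simp add: free_basis_closed)
  have inj: "inj_on h (carrier (mspace R I A))" using h(2) by (simp add: bij_betw_def)
  have "inj_on \<pi> I"
    unfolding \<pi>_def by (rule inj_onI) (metis b free_basis_inj[OF nontrivial] inj inj_onD)
  then have \<pi>: "bij_betw \<pi> I (\<pi> ` I)" by (simp add: bij_betw_def)
  have gram: "A i j = form V (\<pi> i) (\<pi> j)" if "i \<in> I" "j \<in> I" for i j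
    using form_free_basis[OF I that cl] h(3)[OF b b] that by (simp add: \<pi>_def)
  have "V.unimodular_basis (\<pi> ` I)"
    unfolding V.unimodular_basis_def
  proof (intro conjI)
    have hc: "h x \<in> carrier V" if "x \<in> carrier (mspace R I A)" for x using h(2) that by (auto simp: bij_betw_def)
    show sub: "\<pi> ` I \<subseteq> carrier V" using b hc by (auto simp: \<pi>_def)
    show "unimodular R (\<pi> ` I) (form V)" by (rule unimodular_reindex[OF \<pi> gram A])
    have h0: "h \<zero>\<^bsub>mspace R I A\<^esub> = \<zero>\<^bsub>V\<^esub>"
    proof -
      interpret M: module R "mspace R I A" by (rule mspace_module)
      have "h (\<zero> \<odot>\<^bsub>mspace R I A\<^esub> \<zero>\<^bsub>mspace R I A\<^esub>) = \<zero> \<odot>\<^bsub>V\<^esub> h \<zero>\<^bsub>mspace R I A\<^esub>"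
        using h(1) M.zero_closed unfolding module_hom_def by blast
      then show ?thesis using hc[OF M.zero_closed] M.smult_l_null[OF M.zero_closed] V.smult_l_null by metis
    qed
    show "V.perp (\<pi> ` I) = {\<zero>\<^bsub>V\<^esub>}"
    proof
      show "V.perp (\<pi> ` I) \<subseteq> {\<zero>\<^bsub>V\<^esub>}"
      proof
        fix v assume v: "v \<in> V.perp (\<pi> ` I)"
        then have "v \<in> h ` carrier (mspace R I A)" using h(2) by (simp add: V.perp_def bij_betw_def)
        then obtain x where x: "x \<in> carrier (mspace R I A)" "v = h x" by blast
        have xf: "x \<in> carrier (free_module R I)" using x(1) by simp
        have "x k = \<zero>" if k: "k \<in> I" for k
        proof (rule unimodular_kernel[OF A _ _ k])
          fix i assume i: "i \<in> I"
          have "(\<Oplus>j\<in>I. A i j \<otimes> x j) = form (mspace R I A) (free_basis R i) x"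
            by (rule form_free_basis_left[OF I i xf cl, symmetric])
          also have "\<dots> = form V (\<pi> i) v" using h(3)[OF b[OF i] x(1)] by (simp add: \<pi>_def x(2))
          also have "\<dots> = \<zero>" using v i sub V.form_sym[of "\<pi> i" v] by (auto simp: V.perp_def)
          finally show "(\<Oplus>j\<in>I. A i j \<otimes> x j) = \<zero>" .
        qed (use free_module_closed[OF xf] in auto)
        then have "x = (\<lambda>_. \<zero>)" using free_module_outside[OF xf] by blast
        then show "v \<in> {\<zero>\<^bsub>V\<^esub>}" using h0 x(2) by simp
      qed
      show "{\<zero>\<^bsub>V\<^esub>} \<subseteq> V.perp (\<pi> ` I)" using sub by (auto simp: V.perp_def)
    qed
  qed
  then show ?thesis using \<pi> gram by blast
qed

lemma gram_class_memberD:
  assumes A: "unimodular R I A" and V: "V \<in> gram_class R I A"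
  shows "bilinear_space R V" "isometric R (mspace R I A) V"
proof -
  have "inner_product_space R V" "isometric R V (mspace R I A)"
    using V by (auto simp: gram_class_def isometry_class_def)
  then show "bilinear_space R V" "isometric R (mspace R I A) V"
    by (auto simp: inner_product_space_bilinear inner_product_space_def intro: isometric_sym)
qed

text \<open>The sum is a union over all representatives. Each pair contributes the same class and
  there is at least one pair, so the union collapses; \<open>gram_class_mult\<close> follows the
  same pattern.\<close>

lemma gram_class_add:
  assumes A: "unimodular R I A" and B: "unimodular R J B"
  shows "gram_class R I A \<oplus>\<^bsub>isometry_classes R\<^esub> gram_class R J B = gram_class R (I <+> J) (block_matrix R A B)"
proof -
  have "isometry_class R (orthogonal_sum R V W) = gram_class R (I <+> J) (block_matrix R A B)"
    if "V \<in> gram_class R I A" "W \<in> gram_class R J B" for V W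
    unfolding gram_class_def
    by (rule isometry_class_cong[OF mspace_module, symmetric], rule isometric_trans[OF mspace_Plus_isometric[OF A B]],
        rule isometric_orthogonal_sum[OF gram_class_memberD(2)[OF A that(1)] gram_class_memberD(2)[OF B that(2)]])
  note eq = this
  have 1: "gram_class R I A \<oplus>\<^bsub>isometry_classes R\<^esub> gram_class R J B =
      (\<Union>V\<in>gram_class R I A. \<Union>W\<in>gram_class R J B. isometry_class R (orthogonal_sum R V W))"
    by (simp add: isometry_classes_def)
  have 2: "(\<Union>V\<in>gram_class R I A. \<Union>W\<in>gram_class R J B. isometry_class R (orthogonal_sum R V W)) = (\<Union>V\<in>gram_class R I A. \<Union>W\<in>gram_class R J B. gram_class R (I <+> J) (block_matrix R A B))"
    by (intro SUP_cong refl eq)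
  have 3: "(\<Union>V\<in>gram_class R I A. \<Union>W\<in>gram_class R J B. gram_class R (I <+> J) (block_matrix R A B)) = gram_class R (I <+> J) (block_matrix R A B)"
    by (simp only: UN_constant gram_class_nonempty[OF A] gram_class_nonempty[OF B] if_False)
  show ?thesis by (rule trans[OF 1 trans[OF 2 3]])
qed

lemma gram_class_mult:
  assumes A: "unimodular R I A" and B: "unimodular R J B"
  shows "gram_class R I A \<otimes>\<^bsub>isometry_classes R\<^esub> gram_class R J B = gram_class R (I \<times> J) (kronecker R A B)"
proof -
  have "isometry_class R (tensor_space R V W) = gram_class R (I \<times> J) (kronecker R A B)"
    if VW: "V \<in> gram_class R I A" "W \<in> gram_class R J B" for V W
  proof -
    note V = gram_class_memberD[OF A VW(1)] and W = gram_class_memberD[OF B VW(2)]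
    have tp: "tensor_pair R V W" using V(1) W(1) by (rule tensor_pair.intro)
    obtain S \<pi> where S: "bij_betw \<pi> I S" "bilinear_space.unimodular_basis R V S"
      "\<forall>i\<in>I. \<forall>j\<in>I. A i j = form V (\<pi> i) (\<pi> j)"
      using isometric_mspace_basis[OF A V] by blast
    obtain T \<rho> where T: "bij_betw \<rho> J T" "bilinear_space.unimodular_basis R W T"
      "\<forall>i\<in>J. \<forall>j\<in>J. B i j = form W (\<rho> i) (\<rho> j)"
      using isometric_mspace_basis[OF B W] by blast
    have uni: "unimodular R S (form V)" "unimodular R T (form W)"
      using S(2) T(2) by (simp_all add: bilinear_space.unimodular_basis_def[OF V(1)] bilinear_space.unimodular_basis_def[OF W(1)])
    have "gram_class R (I \<times> J) (kronecker R A B) = gram_class R (S \<times> T) (kronecker R (form V) (form W))"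
    proof (rule gram_class_reindex[OF bij_betw_map_prod[OF S(1) T(1)]])
      show "kronecker R (form V) (form W) j j' \<in> carrier R" if "j \<in> S \<times> T" "j' \<in> S \<times> T" for j j'
        using unimodular_closed[OF unimodular_kronecker[OF uni] that] .
    qed (use unimodular_finite[OF A] unimodular_finite[OF B] S(3) T(3) in \<open>auto simp: kronecker_def\<close>)
    also have "\<dots> = isometry_class R (tensor_space R V W)"
      unfolding gram_class_def by (rule isometry_class_cong[OF mspace_module tensor_pair.isometric_basis[OF tp S(2) T(2)]])
    finally show ?thesis by simp
  qed
  note eq = this
  have 1: "gram_class R I A \<otimes>\<^bsub>isometry_classes R\<^esub> gram_class R J B =
      (\<Union>V\<in>gram_class R I A. \<Union>W\<in>gram_class R J B. isometry_class R (tensor_space R V W))"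
    by (simp add: isometry_classes_def)
  have 2: "(\<Union>V\<in>gram_class R I A. \<Union>W\<in>gram_class R J B. isometry_class R (tensor_space R V W)) = (\<Union>V\<in>gram_class R I A. \<Union>W\<in>gram_class R J B. gram_class R (I \<times> J) (kronecker R A B))"
    by (intro SUP_cong refl eq)
  have 3: "(\<Union>V\<in>gram_class R I A. \<Union>W\<in>gram_class R J B. gram_class R (I \<times> J) (kronecker R A B)) = gram_class R (I \<times> J) (kronecker R A B)"
    by (simp only: UN_constant gram_class_nonempty[OF A] gram_class_nonempty[OF B] if_False)
  show ?thesis by (rule trans[OF 1 trans[OF 2 3]])
qed

lemma gram_class_zero: "\<zero>\<^bsub>isometry_classes R\<^esub> = gram_class R {} A"
  unfolding gram_class_def
  by (simp add: isometry_classes_def isometry_class_cong[OF mspace_module zero_space_isometric])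

lemma gram_class_rank_one: "a \<in> carrier R \<Longrightarrow> isometry_class R (rank_one_space R a) = gram_class R {()} (\<lambda>_ _. a)"
  unfolding gram_class_def
  by (rule isometry_class_cong[OF mspace_module rank_one_space_isometric, symmetric])

lemma gram_class_one: "\<one>\<^bsub>isometry_classes R\<^esub> = gram_class R {()} (\<lambda>_ _. \<one>)"
  by (simp add: isometry_classes_def gram_class_rank_one)

lemma unimodular_empty: "unimodular R {} A"
  by (simp add: unimodular_def)

text \<open>Each law is a natural bijection between index sets, such as associativity or
  distributivity of sum and product types, under which the two Gram matrices have equal
  entries.\<close>

theorem comm_semiring_isometry_classes: "comm_semiring (isometry_classes R)"
proof -
  let ?S = "isometry_classes R"
  have one: "unimodular R {()} (\<lambda>_ _. \<one>)" by (rule unimodular_rank_one) simp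
  note uni = unimodular_block unimodular_kronecker
  have re: "gram_class R I A = gram_class R J B"
    if "bij_betw \<pi> I J" "unimodular R I A" "unimodular R J B"
      "\<And>i i'. i \<in> I \<Longrightarrow> i' \<in> I \<Longrightarrow> A i i' = B (\<pi> i) (\<pi> i')"
    for \<pi> and I :: "'x set" and J :: "'y set" and A B
    by (rule gram_class_reindex[of \<pi>])
      (fact that(1) unimodular_finite[OF that(2)] that(4) unimodular_closed[OF that(3)])+
  have c: "x \<oplus>\<^bsub>?S\<^esub> y \<in> carrier ?S" "x \<otimes>\<^bsub>?S\<^esub> y \<in> carrier ?S" "x \<oplus>\<^bsub>?S\<^esub> y = y \<oplus>\<^bsub>?S\<^esub> x" "x \<otimes>\<^bsub>?S\<^esub> y = y \<otimes>\<^bsub>?S\<^esub> x"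
    if xy: "x \<in> carrier ?S" "y \<in> carrier ?S" for x y
  proof -
    obtain m :: nat and A where A: "unimodular R {..<m} A" "x = gram_class R {..<m} A"
      by (rule isometry_class_carrier[OF xy(1)])
    obtain n :: nat and B where B: "unimodular R {..<n} B" "y = gram_class R {..<n} B"
      by (rule isometry_class_carrier[OF xy(2)])
    show "x \<oplus>\<^bsub>?S\<^esub> y \<in> carrier ?S" "x \<otimes>\<^bsub>?S\<^esub> y \<in> carrier ?S"
      by (simp_all add: A(2) B(2) gram_class_add[OF A(1) B(1)] gram_class_mult[OF A(1) B(1)] gram_class_closed uni A(1) B(1))
    have "bij_betw (case_sum Inr Inl) ({..<m} <+> {..<n}) ({..<n} <+> {..<m})"
      by (rule bij_betwI[where g = "case_sum Inr Inl"]) auto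
    then show "x \<oplus>\<^bsub>?S\<^esub> y = y \<oplus>\<^bsub>?S\<^esub> x"
      unfolding A(2) B(2) gram_class_add[OF A(1) B(1)] gram_class_add[OF B(1) A(1)]
      by (rule re[OF _ uni(1)[OF A(1) B(1)] uni(1)[OF B(1) A(1)]]) auto
    have "bij_betw prod.swap ({..<m} \<times> {..<n}) ({..<n} \<times> {..<m})"
      by (rule bij_betwI[where g = prod.swap]) auto
    then show "x \<otimes>\<^bsub>?S\<^esub> y = y \<otimes>\<^bsub>?S\<^esub> x"
      unfolding A(2) B(2) gram_class_mult[OF A(1) B(1)] gram_class_mult[OF B(1) A(1)]
      by (rule re[OF _ uni(2)[OF A(1) B(1)] uni(2)[OF B(1) A(1)]])
        (auto simp: kronecker_def unimodular_closed[OF A(1)] unimodular_closed[OF B(1)] m_comm)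
  qed
  have a: "x \<oplus>\<^bsub>?S\<^esub> y \<oplus>\<^bsub>?S\<^esub> z = x \<oplus>\<^bsub>?S\<^esub> (y \<oplus>\<^bsub>?S\<^esub> z)" "x \<otimes>\<^bsub>?S\<^esub> y \<otimes>\<^bsub>?S\<^esub> z = x \<otimes>\<^bsub>?S\<^esub> (y \<otimes>\<^bsub>?S\<^esub> z)"
    "(x \<oplus>\<^bsub>?S\<^esub> y) \<otimes>\<^bsub>?S\<^esub> z = x \<otimes>\<^bsub>?S\<^esub> z \<oplus>\<^bsub>?S\<^esub> y \<otimes>\<^bsub>?S\<^esub> z"
    if xyz: "x \<in> carrier ?S" "y \<in> carrier ?S" "z \<in> carrier ?S" for x y z
  proof -
    obtain m :: nat and A where A: "unimodular R {..<m} A" "x = gram_class R {..<m} A"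
      by (rule isometry_class_carrier[OF xyz(1)])
    obtain n :: nat and B where B: "unimodular R {..<n} B" "y = gram_class R {..<n} B"
      by (rule isometry_class_carrier[OF xyz(2)])
    obtain k :: nat and C where C: "unimodular R {..<k} C" "z = gram_class R {..<k} C"
      by (rule isometry_class_carrier[OF xyz(3)])
    note cl = unimodular_closed[OF A(1)] unimodular_closed[OF B(1)] unimodular_closed[OF C(1)]
    have "bij_betw (case_sum (case_sum Inl (Inr \<circ> Inl)) (Inr \<circ> Inr))
        (({..<m} <+> {..<n}) <+> {..<k}) ({..<m} <+> ({..<n} <+> {..<k}))"
      by (rule bij_betwI[where g = "case_sum (Inl \<circ> Inl) (case_sum (Inl \<circ> Inr) Inr)"]) auto
    then show "x \<oplus>\<^bsub>?S\<^esub> y \<oplus>\<^bsub>?S\<^esub> z = x \<oplus>\<^bsub>?S\<^esub> (y \<oplus>\<^bsub>?S\<^esub> z)"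
      unfolding A(2) B(2) C(2) gram_class_add[OF A(1) B(1)] gram_class_add[OF B(1) C(1)]
        gram_class_add[OF uni(1)[OF A(1) B(1)] C(1)] gram_class_add[OF A(1) uni(1)[OF B(1) C(1)]]
      by (rule re[OF _ uni(1)[OF uni(1)[OF A(1) B(1)] C(1)] uni(1)[OF A(1) uni(1)[OF B(1) C(1)]]]) auto
    have "bij_betw (\<lambda>((i, j), l). (i, (j, l)))
        (({..<m} \<times> {..<n}) \<times> {..<k}) ({..<m} \<times> ({..<n} \<times> {..<k}))"
      by (rule bij_betwI[where g = "\<lambda>(i, (j, l)). ((i, j), l)"]) auto
    then show "x \<otimes>\<^bsub>?S\<^esub> y \<otimes>\<^bsub>?S\<^esub> z = x \<otimes>\<^bsub>?S\<^esub> (y \<otimes>\<^bsub>?S\<^esub> z)"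
      unfolding A(2) B(2) C(2) gram_class_mult[OF A(1) B(1)] gram_class_mult[OF B(1) C(1)]
        gram_class_mult[OF uni(2)[OF A(1) B(1)] C(1)] gram_class_mult[OF A(1) uni(2)[OF B(1) C(1)]]
      by (rule re[OF _ uni(2)[OF uni(2)[OF A(1) B(1)] C(1)] uni(2)[OF A(1) uni(2)[OF B(1) C(1)]]])
        (auto simp: kronecker_def cl m_assoc)
    have "bij_betw (\<lambda>(s, l). case s of Inl i \<Rightarrow> Inl (i, l) | Inr j \<Rightarrow> Inr (j, l))
        (({..<m} <+> {..<n}) \<times> {..<k}) (({..<m} \<times> {..<k}) <+> ({..<n} \<times> {..<k}))"
      by (rule bij_betwI[where g = "case_sum (\<lambda>(i, l). (Inl i, l)) (\<lambda>(j, l). (Inr j, l))"]) auto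
    then show "(x \<oplus>\<^bsub>?S\<^esub> y) \<otimes>\<^bsub>?S\<^esub> z = x \<otimes>\<^bsub>?S\<^esub> z \<oplus>\<^bsub>?S\<^esub> y \<otimes>\<^bsub>?S\<^esub> z"
      unfolding A(2) B(2) C(2) gram_class_add[OF A(1) B(1)] gram_class_mult[OF A(1) C(1)] gram_class_mult[OF B(1) C(1)]
        gram_class_mult[OF uni(1)[OF A(1) B(1)] C(1)] gram_class_add[OF uni(2)[OF A(1) C(1)] uni(2)[OF B(1) C(1)]]
      by (rule re[OF _ uni(2)[OF uni(1)[OF A(1) B(1)] C(1)] uni(1)[OF uni(2)[OF A(1) C(1)] uni(2)[OF B(1) C(1)]]])
        (auto simp: kronecker_def cl)
  qed
  have n: "\<zero>\<^bsub>?S\<^esub> \<oplus>\<^bsub>?S\<^esub> x = x" "\<one>\<^bsub>?S\<^esub> \<otimes>\<^bsub>?S\<^esub> x = x" "\<zero>\<^bsub>?S\<^esub> \<otimes>\<^bsub>?S\<^esub> x = \<zero>\<^bsub>?S\<^esub>" if x: "x \<in> carrier ?S" for x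
  proof -
    obtain m :: nat and A where A: "unimodular R {..<m} A" "x = gram_class R {..<m} A"
      by (rule isometry_class_carrier[OF x])
    have z: "\<zero>\<^bsub>?S\<^esub> = gram_class R ({} :: nat set) A" by (rule gram_class_zero)
    have "bij_betw (case_sum id id) ({} <+> {..<m}) {..<m}"
      by (rule bij_betwI[where g = Inr]) auto
    then show "\<zero>\<^bsub>?S\<^esub> \<oplus>\<^bsub>?S\<^esub> x = x"
      unfolding z A(2) gram_class_add[OF unimodular_empty A(1)]
      by (rule re[OF _ uni(1)[OF unimodular_empty A(1)] A(1)]) auto
    have "bij_betw snd ({()} \<times> {..<m}) {..<m}"
      by (rule bij_betwI[where g = "\<lambda>i. ((), i)"]) auto
    then show "\<one>\<^bsub>?S\<^esub> \<otimes>\<^bsub>?S\<^esub> x = x"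
      unfolding gram_class_one A(2) gram_class_mult[OF one A(1)]
      by (rule re[OF _ uni(2)[OF one A(1)] A(1)]) (auto simp: kronecker_def unimodular_closed[OF A(1)])
    have "bij_betw fst ({} \<times> {..<m}) ({} :: nat set)"
      by (rule bij_betwI[where g = "\<lambda>i. (i, 0)"]) auto
    then show "\<zero>\<^bsub>?S\<^esub> \<otimes>\<^bsub>?S\<^esub> x = \<zero>\<^bsub>?S\<^esub>"
      unfolding z A(2) gram_class_mult[OF unimodular_empty A(1)]
      by (rule re[OF _ uni(2)[OF unimodular_empty A(1)] unimodular_empty]) auto
  qed
  have z: "\<zero>\<^bsub>?S\<^esub> \<in> carrier ?S" "\<one>\<^bsub>?S\<^esub> \<in> carrier ?S"
    using gram_class_closed[OF unimodular_empty[of "undefined :: nat \<Rightarrow> nat \<Rightarrow> 'a"]] gram_class_zero gram_class_one gram_class_closed[OF one] by metis+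
  interpret am: abelian_monoid ?S by (rule abelian_monoidI) (fact c(1) z(1) a(1) n(1) c(3))+
  interpret cm: comm_monoid ?S by (rule comm_monoidI) (fact c(2) z(2) a(2) n(2) c(4))+
  show ?thesis
  proof
    fix x y z assume xyz: "x \<in> carrier ?S" "y \<in> carrier ?S" "z \<in> carrier ?S"
    show "(x \<oplus>\<^bsub>?S\<^esub> y) \<otimes>\<^bsub>?S\<^esub> z = x \<otimes>\<^bsub>?S\<^esub> z \<oplus>\<^bsub>?S\<^esub> y \<otimes>\<^bsub>?S\<^esub> z" by (rule a(3)[OF xyz])
    have "z \<otimes>\<^bsub>?S\<^esub> (x \<oplus>\<^bsub>?S\<^esub> y) = (x \<oplus>\<^bsub>?S\<^esub> y) \<otimes>\<^bsub>?S\<^esub> z" by (rule c(4)[OF xyz(3) c(1)[OF xyz(1,2)]])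
    also have "\<dots> = x \<otimes>\<^bsub>?S\<^esub> z \<oplus>\<^bsub>?S\<^esub> y \<otimes>\<^bsub>?S\<^esub> z" by (rule a(3)[OF xyz])
    also have "\<dots> = z \<otimes>\<^bsub>?S\<^esub> x \<oplus>\<^bsub>?S\<^esub> z \<otimes>\<^bsub>?S\<^esub> y"
      by (simp only: c(4)[OF xyz(1,3)] c(4)[OF xyz(2,3)])
    finally show "z \<otimes>\<^bsub>?S\<^esub> (x \<oplus>\<^bsub>?S\<^esub> y) = z \<otimes>\<^bsub>?S\<^esub> x \<oplus>\<^bsub>?S\<^esub> z \<otimes>\<^bsub>?S\<^esub> y" .
  next
    fix x assume x: "x \<in> carrier ?S"
    show "\<zero>\<^bsub>?S\<^esub> \<otimes>\<^bsub>?S\<^esub> x = \<zero>\<^bsub>?S\<^esub>" by (rule n(3)[OF x])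
    then show "x \<otimes>\<^bsub>?S\<^esub> \<zero>\<^bsub>?S\<^esub> = \<zero>\<^bsub>?S\<^esub>" using c(4)[OF x z(1)] by simp
  qed
qed

end

section \<open>The map from the group ring of the units\<close>

context comm_monoid
begin

lemma group_ring_simps:
  "carrier (group_ring G) = {f. Poly_Mapping.keys f \<subseteq> carrier G}"
  "f \<otimes>\<^bsub>group_ring G\<^esub> g = frag_extend (\<lambda>x. frag_extend (\<lambda>y. frag_of (x \<otimes> y)) g) f"
  "\<one>\<^bsub>group_ring G\<^esub> = frag_of \<one>" "\<zero>\<^bsub>group_ring G\<^esub> = 0" "f \<oplus>\<^bsub>group_ring G\<^esub> g = f + g"
  by (simp_all add: group_ring_def)

text \<open>One difference case covers sums and negatives at once, so additive identities only have
  to be checked on units as basis elements.\<close>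

lemma group_ring_induct [consumes 1, case_names zero basis diff]:
  assumes "f \<in> carrier (group_ring G)" and "P 0" and "\<And>x. x \<in> carrier G \<Longrightarrow> P (frag_of x)"
    and "\<And>a b. a \<in> carrier (group_ring G) \<Longrightarrow> b \<in> carrier (group_ring G) \<Longrightarrow> P a \<Longrightarrow> P b \<Longrightarrow> P (a - b)"
  shows "P f"
proof -
  have "Poly_Mapping.keys f \<subseteq> carrier G" using assms(1) by (simp add: group_ring_simps)
  then have "f \<in> carrier (group_ring G) \<and> P f"
  proof (induction rule: frag_induction)
    case (diff a b)
    then have "a - b \<in> carrier (group_ring G)"
      using keys_diff[of a b] by (auto simp: group_ring_simps)
    then show ?case using diff assms(4) by blast
  qed (use assms(2,3) in \<open>auto simp: group_ring_simps keys_frag_of\<close>)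
  then show ?thesis ..
qed

lemma group_ring_mult_diff:
  "(a - b) \<otimes>\<^bsub>group_ring G\<^esub> g = a \<otimes>\<^bsub>group_ring G\<^esub> g - b \<otimes>\<^bsub>group_ring G\<^esub> g"
  by (simp add: group_ring_simps frag_extend_diff)

lemma frag_extend_fun_diff:
  "frag_extend (\<lambda>x. u x - v x) f = frag_extend u f - (frag_extend v f :: 'x \<Rightarrow>\<^sub>0 int)"
proof -
  have "Poly_Mapping.keys f \<subseteq> UNIV" by simp
  then show ?thesis by (induction rule: frag_induction) (simp_all add: frag_extend_diff)
qed

lemma group_ring_mult_diff_right:
  "g \<otimes>\<^bsub>group_ring G\<^esub> (a - b) = g \<otimes>\<^bsub>group_ring G\<^esub> a - g \<otimes>\<^bsub>group_ring G\<^esub> b"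
  by (simp add: group_ring_simps frag_extend_diff frag_extend_fun_diff)

lemma group_ring_mult_zero: "0 \<otimes>\<^bsub>group_ring G\<^esub> g = 0" "g \<otimes>\<^bsub>group_ring G\<^esub> 0 = 0"
  using group_ring_mult_diff[of 0 0 g] group_ring_mult_diff_right[of g 0 0] by simp_all

lemma group_ring_mult_basis: "frag_of x \<otimes>\<^bsub>group_ring G\<^esub> frag_of y = frag_of (x \<otimes> y)"
  by (simp add: group_ring_simps)

lemma group_ring_closed:
  "x \<in> carrier G \<Longrightarrow> frag_of x \<in> carrier (group_ring G)" "0 \<in> carrier (group_ring G)"
  "f \<in> carrier (group_ring G) \<Longrightarrow> g \<in> carrier (group_ring G) \<Longrightarrow> f - g \<in> carrier (group_ring G)"
  "f \<in> carrier (group_ring G) \<Longrightarrow> g \<in> carrier (group_ring G) \<Longrightarrow> f + g \<in> carrier (group_ring G)"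
  using keys_diff[of f g] keys_add[of f g] by (auto simp: group_ring_simps keys_frag_of)

lemma group_ring_mult_closed:
  assumes "f \<in> carrier (group_ring G)" "g \<in> carrier (group_ring G)"
  shows "f \<otimes>\<^bsub>group_ring G\<^esub> g \<in> carrier (group_ring G)"
  using assms(1)
proof (induction rule: group_ring_induct)
  case (basis x)
  show ?case using assms(2)
    by (induction rule: group_ring_induct)
      (simp_all add: group_ring_mult_zero group_ring_mult_basis group_ring_closed group_ring_mult_diff_right basis)
qed (simp_all add: group_ring_mult_zero group_ring_closed group_ring_mult_diff)

lemma cring_group_ring: "cring (group_ring G)"
proof (rule cringI)
  let ?Z = "group_ring G"
  show "abelian_group ?Z"
  proof (rule abelian_groupI)
    show "\<exists>y\<in>carrier ?Z. y \<oplus>\<^bsub>?Z\<^esub> x = \<zero>\<^bsub>?Z\<^esub>" if "x \<in> carrier ?Z" for x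
      using that by (intro bexI[of _ "- x"]) (auto simp: group_ring_simps)
  qed (simp_all add: group_ring_closed(2,4) group_ring_simps(4,5) ac_simps)
  have comm: "f \<otimes>\<^bsub>?Z\<^esub> g = g \<otimes>\<^bsub>?Z\<^esub> f" if f: "f \<in> carrier ?Z" and g: "g \<in> carrier ?Z" for f g
    using f
  proof (induction rule: group_ring_induct)
    case (basis x)
    show ?case using g
      by (induction rule: group_ring_induct)
        (simp_all add: group_ring_mult_zero group_ring_mult_basis group_ring_mult_diff group_ring_mult_diff_right basis m_comm)
  qed (simp_all add: group_ring_mult_zero group_ring_mult_diff group_ring_mult_diff_right)
  have assoc: "(f \<otimes>\<^bsub>?Z\<^esub> g) \<otimes>\<^bsub>?Z\<^esub> k = f \<otimes>\<^bsub>?Z\<^esub> (g \<otimes>\<^bsub>?Z\<^esub> k)"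
    if f: "f \<in> carrier ?Z" and g: "g \<in> carrier ?Z" and k: "k \<in> carrier ?Z" for f g k
    using f
  proof (induction rule: group_ring_induct)
    case (basis x)
    show ?case using g
    proof (induction rule: group_ring_induct)
      case (basis y)
      show ?case using k
        by (induction rule: group_ring_induct)
          (simp_all add: group_ring_mult_zero group_ring_mult_basis group_ring_mult_diff_right basis \<open>x \<in> carrier G\<close> m_assoc)
    qed (simp_all add: group_ring_mult_zero group_ring_mult_diff group_ring_mult_diff_right)
  qed (simp_all add: group_ring_mult_zero group_ring_mult_diff)
  have one: "\<one>\<^bsub>?Z\<^esub> \<otimes>\<^bsub>?Z\<^esub> f = f" if "f \<in> carrier ?Z" for f
    using that
  proof (induction rule: group_ring_induct)
    case (basis x)
    then show ?case using group_ring_mult_basis[of \<one> x] by (simp add: group_ring_simps(3))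
  qed (simp_all add: group_ring_mult_zero group_ring_mult_diff_right)
  have "\<one>\<^bsub>?Z\<^esub> \<in> carrier ?Z" by (simp add: group_ring_simps keys_frag_of)
  then show "comm_monoid ?Z" by (intro comm_monoidI group_ring_mult_closed assoc one comm)
  show "(x \<oplus>\<^bsub>?Z\<^esub> y) \<otimes>\<^bsub>?Z\<^esub> z = x \<otimes>\<^bsub>?Z\<^esub> z \<oplus>\<^bsub>?Z\<^esub> y \<otimes>\<^bsub>?Z\<^esub> z" for x y z
    by (simp add: group_ring_simps frag_extend_add)
qed

lemma group_ring_minus:
  assumes "f \<in> carrier (group_ring G)" "g \<in> carrier (group_ring G)"
  shows "f \<ominus>\<^bsub>group_ring G\<^esub> g = f - g"
proof -
  interpret Z: cring "group_ring G" by (rule cring_group_ring)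
  have "- g \<in> carrier (group_ring G)" "(- g) \<oplus>\<^bsub>group_ring G\<^esub> g = \<zero>\<^bsub>group_ring G\<^esub>"
    using assms(2) by (auto simp: group_ring_simps)
  then have "\<ominus>\<^bsub>group_ring G\<^esub> g = - g" using assms(2) by (intro Z.minus_equality)
  then show ?thesis by (simp add: a_minus_def group_ring_simps)
qed

end

section \<open>Additive extension to integer combinations\<close>

context abelian_group
begin

definition frag_sum :: "('x \<Rightarrow> 'a) \<Rightarrow> ('x \<Rightarrow>\<^sub>0 int) \<Rightarrow> 'a"
  where "frag_sum q f = (\<Oplus>a\<in>Poly_Mapping.keys f. [Poly_Mapping.lookup f a] \<cdot> q a)"

lemma frag_sum_superset:
  assumes "q \<in> X \<rightarrow> carrier G" "finite K" "K \<subseteq> X" "Poly_Mapping.keys f \<subseteq> K"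
  shows "frag_sum q f = (\<Oplus>a\<in>K. [Poly_Mapping.lookup f a] \<cdot> q a)"
  unfolding frag_sum_def
proof (rule finsum_mono_neutral[OF assms(2,4)])
  show "(\<lambda>a. [Poly_Mapping.lookup f a] \<cdot> q a) \<in> K \<rightarrow> carrier G"
    using assms(1,3) add.int_pow_closed by (auto simp: Pi_iff subset_iff)
  show "[Poly_Mapping.lookup f a] \<cdot> q a = \<zero>" if "a \<in> K - Poly_Mapping.keys f" for a
    using that by (simp add: in_keys_iff add_pow_def int_pow_def nat_pow_def)
qed

lemma frag_sum_closed:
  assumes "q \<in> X \<rightarrow> carrier G" "Poly_Mapping.keys f \<subseteq> X"
  shows "frag_sum q f \<in> carrier G"
  unfolding frag_sum_def
  using assms add.int_pow_closed by (intro finsum_closed) (auto simp: Pi_iff subset_iff)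

lemma frag_sum_add:
  assumes q: "q \<in> X \<rightarrow> carrier G" and f: "Poly_Mapping.keys f \<subseteq> X" "Poly_Mapping.keys g \<subseteq> X"
  shows "frag_sum q (f + g) = frag_sum q f \<oplus> frag_sum q g"
proof -
  define K where "K = Poly_Mapping.keys f \<union> Poly_Mapping.keys g"
  have K: "finite K" "K \<subseteq> X" "Poly_Mapping.keys (f + g) \<subseteq> K" using f keys_add[of f g] by (auto simp: K_def)
  have qc: "q a \<in> carrier G" if "a \<in> K" for a using q K(2) that by blast
  have "frag_sum q (f + g) = (\<Oplus>a\<in>K. [Poly_Mapping.lookup f a] \<cdot> q a \<oplus> [Poly_Mapping.lookup g a] \<cdot> q a)"
    unfolding frag_sum_superset[OF q K]
    using qc add.int_pow_closed add.int_pow_mult by (intro finsum_cong') (auto simp: lookup_add)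
  also have "\<dots> = (\<Oplus>a\<in>K. [Poly_Mapping.lookup f a] \<cdot> q a) \<oplus> (\<Oplus>a\<in>K. [Poly_Mapping.lookup g a] \<cdot> q a)"
    using qc add.int_pow_closed by (intro finsum_addf) auto
  also have "\<dots> = frag_sum q f \<oplus> frag_sum q g"
    by (simp add: frag_sum_superset[OF q K(1,2)] K_def)
  finally show ?thesis .
qed

lemma frag_sum_zero: "frag_sum q 0 = \<zero>"
  by (simp add: frag_sum_def)

lemma frag_sum_of: "q a \<in> carrier G \<Longrightarrow> frag_sum q (frag_of a) = q a"
  by (simp add: frag_sum_def keys_frag_of add_pow_def int_pow_def nat_pow_def)

lemma frag_sum_diff:
  assumes q: "q \<in> X \<rightarrow> carrier G" and f: "Poly_Mapping.keys f \<subseteq> X" "Poly_Mapping.keys g \<subseteq> X"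
  shows "frag_sum q (f - g) = frag_sum q f \<ominus> frag_sum q g"
proof -
  have k: "Poly_Mapping.keys (f - g) \<subseteq> X" using f keys_diff[of f g] by auto
  have "frag_sum q f = frag_sum q (f - g) \<oplus> frag_sum q g"
    using frag_sum_add[OF q k f(2)] by simp
  then show ?thesis
    using frag_sum_closed[OF q k] frag_sum_closed[OF q f(2)] by (simp add: a_minus_def a_assoc r_neg)
qed

end

section \<open>The homomorphism into the Grothendieck-Witt ring\<close>

context local_ring
begin

lemma units_comm_monoid: "comm_monoid (units_of R)"
  using units_comm_group by (simp add: comm_group_def)

lemma cring_unit_group_ring: "cring (unit_group_ring R)"
  unfolding unit_group_ring_def by (rule comm_monoid.cring_group_ring[OF units_comm_monoid])

lemmas unit_group_ring_simps =
  comm_monoid.group_ring_simps[OF units_comm_monoid, folded unit_group_ring_def, simplified units_of_carrier units_of_mult units_of_one]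
lemmas unit_group_ring_closed =
  comm_monoid.group_ring_closed[OF units_comm_monoid, folded unit_group_ring_def, simplified units_of_carrier]
lemmas unit_group_ring_induct =
  comm_monoid.group_ring_induct[OF units_comm_monoid, folded unit_group_ring_def, simplified units_of_carrier, consumes 1, case_names zero basis diff]
lemmas unit_group_ring_mult_diff =
  comm_monoid.group_ring_mult_diff[OF units_comm_monoid, folded unit_group_ring_def]
  comm_monoid.group_ring_mult_diff_right[OF units_comm_monoid, folded unit_group_ring_def]
lemmas unit_group_ring_mult_zero =
  comm_monoid.group_ring_mult_zero[OF units_comm_monoid, folded unit_group_ring_def]
lemmas unit_group_ring_mult_basis =
  comm_monoid.group_ring_mult_basis[OF units_comm_monoid, folded unit_group_ring_def, simplified units_of_mult]
lemmas unit_group_ring_minus =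
  comm_monoid.group_ring_minus[OF units_comm_monoid, folded unit_group_ring_def]

lemma cring_GW: "cring (GW R)"
  unfolding GW_def by (rule comm_semiring.cring_grothendieck_ring[OF comm_semiring_isometry_classes])

definition unit_class :: "'a \<Rightarrow> ('a small_space set \<times> 'a small_space set) set"
  where "unit_class a = GW_class R (rank_one_space R a)"

definition diag :: "('x \<Rightarrow> 'a) \<Rightarrow> 'x \<Rightarrow> 'x \<Rightarrow> 'a"
  where "diag a i j = (if i = j then a i else \<zero>)"

abbreviation gw :: "'a small_space set \<Rightarrow> ('a small_space set \<times> 'a small_space set) set"
  where "gw X \<equiv> comm_semiring.cls (isometry_classes R) X \<zero>\<^bsub>isometry_classes R\<^esub>"

lemma unit_class_gw: "a \<in> carrier R \<Longrightarrow> unit_class a = gw (gram_class R {()} (\<lambda>_ _. a))"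
  by (simp add: unit_class_def GW_class_def comm_semiring.cls_def[OF comm_semiring_isometry_classes] gram_class_rank_one)

lemma zero_class_closed: "\<zero>\<^bsub>isometry_classes R\<^esub> \<in> carrier (isometry_classes R)"
proof -
  interpret S: comm_semiring "isometry_classes R" by (rule comm_semiring_isometry_classes)
  show ?thesis by simp
qed

lemma gw_closed: "X \<in> carrier (isometry_classes R) \<Longrightarrow> gw X \<in> carrier (GW R)"
  unfolding GW_def
  by (rule comm_semiring.cls_closed[OF comm_semiring_isometry_classes _ zero_class_closed])

lemma gw_add:
  assumes "X \<in> carrier (isometry_classes R)" "Y \<in> carrier (isometry_classes R)"
  shows "gw (X \<oplus>\<^bsub>isometry_classes R\<^esub> Y) = gw X \<oplus>\<^bsub>GW R\<^esub> gw Y"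
proof -
  interpret S: comm_semiring "isometry_classes R" by (rule comm_semiring_isometry_classes)
  show ?thesis using assms by (simp add: GW_def S.cls_add)
qed

lemma gw_mult:
  assumes "X \<in> carrier (isometry_classes R)" "Y \<in> carrier (isometry_classes R)"
  shows "gw (X \<otimes>\<^bsub>isometry_classes R\<^esub> Y) = gw X \<otimes>\<^bsub>GW R\<^esub> gw Y"
proof -
  interpret S: comm_semiring "isometry_classes R" by (rule comm_semiring_isometry_classes)
  show ?thesis using assms by (simp add: GW_def S.cls_mult)
qed

lemma unit_class_closed: "a \<in> Units R \<Longrightarrow> unit_class a \<in> carrier (GW R)"
  by (simp add: unit_class_gw gw_closed gram_class_closed unimodular_rank_one Units_closed)

lemma unit_class_mult:
  assumes "a \<in> Units R" "b \<in> Units R"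
  shows "unit_class (a \<otimes> b) = unit_class a \<otimes>\<^bsub>GW R\<^esub> unit_class b"
proof -
  note u = unimodular_rank_one[OF assms(1)] unimodular_rank_one[OF assms(2)]
  have c: "a \<in> carrier R" "b \<in> carrier R" using assms by auto
  have "bij_betw (\<lambda>_. ()) ({()} \<times> {()}) {()}" by (rule bij_betwI[where g = "\<lambda>_. ((), ())"]) auto
  then have "gram_class R ({()} \<times> {()}) (kronecker R (\<lambda>_ _. a) (\<lambda>_ _. b)) = gram_class R {()} (\<lambda>_ _. a \<otimes> b)"
    by (rule gram_class_reindex) (use c in \<open>auto simp: kronecker_def\<close>)
  then have "gram_class R {()} (\<lambda>_ _. a) \<otimes>\<^bsub>isometry_classes R\<^esub> gram_class R {()} (\<lambda>_ _. b) =
      gram_class R {()} (\<lambda>_ _. a \<otimes> b)"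
    unfolding gram_class_mult[OF u] .
  then show ?thesis
    using gw_mult[OF gram_class_closed[OF u(1)] gram_class_closed[OF u(2)]] c by (simp add: unit_class_gw)
qed

lemma unit_class_one: "unit_class \<one> = \<one>\<^bsub>GW R\<^esub>"
proof -
  interpret S: comm_semiring "isometry_classes R" by (rule comm_semiring_isometry_classes)
  show ?thesis using S.grothendieck_one by (simp add: GW_def unit_class_gw gram_class_one)
qed

lemma GW_map_frag_sum: "GW_map R = abelian_group.frag_sum (GW R) unit_class"
proof -
  interpret GW: cring "GW R" by (rule cring_GW)
  show ?thesis by (rule ext) (simp add: GW_map_def GW.frag_sum_def unit_class_def)
qed

lemma keys_unit_group_ring: "f \<in> carrier (unit_group_ring R) \<longleftrightarrow> Poly_Mapping.keys f \<subseteq> Units R"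
  by (simp add: unit_group_ring_simps)

lemma GW_map_closed: "f \<in> carrier (unit_group_ring R) \<Longrightarrow> GW_map R f \<in> carrier (GW R)"
  and GW_map_add: "f \<in> carrier (unit_group_ring R) \<Longrightarrow> g \<in> carrier (unit_group_ring R) \<Longrightarrow>
    GW_map R (f + g) = GW_map R f \<oplus>\<^bsub>GW R\<^esub> GW_map R g"
  and GW_map_diff: "f \<in> carrier (unit_group_ring R) \<Longrightarrow> g \<in> carrier (unit_group_ring R) \<Longrightarrow>
    GW_map R (f - g) = GW_map R f \<ominus>\<^bsub>GW R\<^esub> GW_map R g"
  and GW_map_zero: "GW_map R 0 = \<zero>\<^bsub>GW R\<^esub>"
  and GW_map_basis: "a \<in> Units R \<Longrightarrow> GW_map R (frag_of a) = unit_class a"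
proof -
  interpret GW: cring "GW R" by (rule cring_GW)
  have q: "unit_class \<in> Units R \<rightarrow> carrier (GW R)" using unit_class_closed by blast
  show "f \<in> carrier (unit_group_ring R) \<Longrightarrow> GW_map R f \<in> carrier (GW R)"
    and "f \<in> carrier (unit_group_ring R) \<Longrightarrow> g \<in> carrier (unit_group_ring R) \<Longrightarrow>
      GW_map R (f + g) = GW_map R f \<oplus>\<^bsub>GW R\<^esub> GW_map R g"
    and "f \<in> carrier (unit_group_ring R) \<Longrightarrow> g \<in> carrier (unit_group_ring R) \<Longrightarrow>
      GW_map R (f - g) = GW_map R f \<ominus>\<^bsub>GW R\<^esub> GW_map R g"
    and "GW_map R 0 = \<zero>\<^bsub>GW R\<^esub>"
    and "a \<in> Units R \<Longrightarrow> GW_map R (frag_of a) = unit_class a"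
    using GW.frag_sum_closed[OF q] GW.frag_sum_add[OF q] GW.frag_sum_diff[OF q] GW.frag_sum_zero
      GW.frag_sum_of[of unit_class] unit_class_closed
    by (simp_all add: GW_map_frag_sum keys_unit_group_ring)
qed

lemma GW_map_mult:
  assumes f: "f \<in> carrier (unit_group_ring R)" and g: "g \<in> carrier (unit_group_ring R)"
  shows "GW_map R (f \<otimes>\<^bsub>unit_group_ring R\<^esub> g) = GW_map R f \<otimes>\<^bsub>GW R\<^esub> GW_map R g"
proof -
  interpret GW: cring "GW R" by (rule cring_GW)
  interpret Z: cring "unit_group_ring R" by (rule cring_unit_group_ring)
  have dl: "(x \<ominus>\<^bsub>GW R\<^esub> y) \<otimes>\<^bsub>GW R\<^esub> z = x \<otimes>\<^bsub>GW R\<^esub> z \<ominus>\<^bsub>GW R\<^esub> y \<otimes>\<^bsub>GW R\<^esub> z"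
    "z \<otimes>\<^bsub>GW R\<^esub> (x \<ominus>\<^bsub>GW R\<^esub> y) = z \<otimes>\<^bsub>GW R\<^esub> x \<ominus>\<^bsub>GW R\<^esub> z \<otimes>\<^bsub>GW R\<^esub> y"
    if "x \<in> carrier (GW R)" "y \<in> carrier (GW R)" "z \<in> carrier (GW R)" for x y z
    using that by algebra+
  show ?thesis using f
  proof (induction rule: unit_group_ring_induct)
    case zero
    then show ?case using g by (simp add: unit_group_ring_mult_zero GW_map_zero GW_map_closed)
  next
    case (basis a)
    show ?case using g
    proof (induction rule: unit_group_ring_induct)
      case zero
      then show ?case using basis by (simp add: unit_group_ring_mult_zero GW_map_zero GW_map_closed unit_group_ring_closed)
    next
      case (basis b)
      then show ?case using \<open>a \<in> Units R\<close> by (simp add: unit_group_ring_mult_basis GW_map_basis unit_class_mult)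
    next
      case (diff x y)
      then show ?case using basis
        by (simp add: unit_group_ring_mult_diff GW_map_diff dl GW_map_closed unit_group_ring_closed Z.m_closed)
    qed
  next
    case (diff x y)
    then show ?case using g
      by (simp add: unit_group_ring_mult_diff GW_map_diff dl GW_map_closed Z.m_closed)
  qed
qed

theorem GW_map_hom: "ring_hom_cring (unit_group_ring R) (GW R) (GW_map R)"
proof -
  interpret GW: cring "GW R" by (rule cring_GW)
  interpret Z: cring "unit_group_ring R" by (rule cring_unit_group_ring)
  show ?thesis
  proof
    show "GW_map R \<in> ring_hom (unit_group_ring R) (GW R)"
      by (rule ring_hom_memI)
        (simp_all add: GW_map_closed GW_map_mult GW_map_add unit_group_ring_simps(3,5) GW_map_basis unit_class_one)
  qed
qed

lemma unimodular_diag: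
  assumes "finite I" "\<And>i. i \<in> I \<Longrightarrow> a i \<in> Units R"
  shows "unimodular R I (diag a)"
proof (rule unimodularI[where B = "diag (\<lambda>i. inv (a i))"])
  fix i k assume ik: "i \<in> I" "k \<in> I"
  have "(\<Oplus>j\<in>I. diag a i j \<otimes> diag (\<lambda>i. inv (a i)) j k) = (\<Oplus>j\<in>I. if j = k then if i = k then \<one> else \<zero> else \<zero>)"
    using assms(2)[THEN Units_closed] assms(2) ik by (intro finsum_cong') (auto simp: diag_def)
  also have "\<dots> = (if i = k then \<one> else \<zero>)" using assms(1) ik by (intro finsum_delta(1)) auto
  finally show "(\<Oplus>j\<in>I. diag a i j \<otimes> diag (\<lambda>i. inv (a i)) j k) = (if i = k then \<one> else \<zero>)" .
qed (use assms in \<open>auto simp: diag_def\<close>)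

lemma sum_basis_closed:
  "finite I \<Longrightarrow> (\<And>i. i \<in> I \<Longrightarrow> a i \<in> Units R) \<Longrightarrow> (\<Sum>i\<in>I. frag_of (a i)) \<in> carrier (unit_group_ring R)"
  by (induction I rule: finite_induct) (simp_all add: unit_group_ring_closed)

text \<open>The bridge between group ring and forms: sums of basis elements are diagonal
  forms.\<close>

lemma GW_map_sum_basis:
  assumes "finite I" "\<And>i. i \<in> I \<Longrightarrow> a i \<in> Units R"
  shows "GW_map R (\<Sum>i\<in>I. frag_of (a i)) = gw (gram_class R I (diag a))"
  using assms
proof (induction I rule: finite_induct)
  case empty
  interpret S: comm_semiring "isometry_classes R" by (rule comm_semiring_isometry_classes)
  show ?case using S.grothendieck_zero by (simp add: GW_map_zero GW_def gram_class_zero[of "diag a"])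
next
  case (insert e I)
  have u: "unimodular R {()} (\<lambda>_ _. a e)" "unimodular R I (diag a)"
    using insert by (auto intro: unimodular_rank_one unimodular_diag)
  have "bij_betw (case_sum (\<lambda>_. e) id) ({()} <+> I) (insert e I)"
    using insert(2) by (intro bij_betwI[where g = "\<lambda>i. if i = e then Inl () else Inr i"]) auto
  then have "gram_class R ({()} <+> I) (block_matrix R (\<lambda>_ _. a e) (diag a)) = gram_class R (insert e I) (diag a)"
    by (rule gram_class_reindex) (use insert in \<open>auto simp: diag_def\<close>)
  then have "gw (gram_class R (insert e I) (diag a)) = unit_class (a e) \<oplus>\<^bsub>GW R\<^esub> gw (gram_class R I (diag a))"
    using gw_add[OF gram_class_closed[OF u(1)] gram_class_closed[OF u(2)]] insert.prems
    by (simp add: gram_class_add[OF u] unit_class_gw Units_closed)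
  then show ?case
    using insert by (simp add: GW_map_add GW_map_basis unit_group_ring_closed sum_basis_closed)
qed

end

section \<open>Consequences of the Steinberg relation\<close>

context local_ring
begin

lemma pfister_eq: "a \<in> Units R \<Longrightarrow> pfister R a = frag_of \<one> - frag_of a"
  by (simp add: pfister_def unit_group_ring_simps(3) unit_group_ring_minus unit_group_ring_closed)

lemma minus_unit: "a \<in> Units R \<Longrightarrow> \<ominus> a \<in> Units R"
  using Units_m_closed[OF Units_minus_one_closed, of a] by (simp add: l_minus Units_closed)

lemma hyperbolic_eq: "hyperbolic R = frag_of \<one> + frag_of (\<ominus> \<one>)"
  by (simp add: hyperbolic_def unit_group_ring_simps(5))

lemma basis_mult_add:
  "frag_of u \<otimes>\<^bsub>unit_group_ring R\<^esub> (f + g) =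
    frag_of u \<otimes>\<^bsub>unit_group_ring R\<^esub> f + frag_of u \<otimes>\<^bsub>unit_group_ring R\<^esub> g"
  by (simp add: unit_group_ring_simps(2) frag_extend_add)

end

text \<open>The locale is instantiated with three ideals: the kernel of \<open>GW_map\<close>, which
  thereby contains the hyperbolic relations; the ideal generated by all relations, which thereby
  contains the kernel; and the unit ideal in \<open>unit_class_add\<close>.\<close>

locale steinberg_ideal = local_ring \<mm> R + J: ideal J "unit_group_ring R"
  for \<mm> and R (structure) and J +
  assumes square_relation: "a \<in> Units R \<Longrightarrow> pfister R (a [^] (2::nat)) \<in> J"
    and steinberg_relation: "a \<in> Units R \<Longrightarrow> \<one> \<ominus> a \<in> Units R \<Longrightarrow>
      pfister R a \<otimes>\<^bsub>unit_group_ring R\<^esub> pfister R (\<one> \<ominus> a) \<in> J"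
    and residue: "\<exists>s\<in>Units R. \<one> \<ominus> s \<in> Units R"
begin

definition cong (infix "\<approx>" 50)
  where "f \<approx> g \<longleftrightarrow> f - g \<in> J"

lemma J_closed: "f \<in> J \<Longrightarrow> f \<in> carrier (unit_group_ring R)"
  by (rule J.Icarr)

lemma J_add: "f \<in> J \<Longrightarrow> g \<in> J \<Longrightarrow> f + g \<in> J"
  using additive_subgroup.a_closed[OF J.is_additive_subgroup, of f g] by (simp add: unit_group_ring_simps(5))

lemma J_zero: "0 \<in> J"
  using additive_subgroup.zero_closed[OF J.is_additive_subgroup] by (simp add: unit_group_ring_simps(4))

lemma J_diff: "f \<in> J \<Longrightarrow> g \<in> J \<Longrightarrow> f - g \<in> J"
  using J.minus_closed unit_group_ring_minus[OF J_closed J_closed]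
    additive_subgroup.a_closed[OF J.is_additive_subgroup] additive_subgroup.a_inv_closed[OF J.is_additive_subgroup]
  by (metis a_minus_def)

lemma J_scale: "u \<in> Units R \<Longrightarrow> f \<in> J \<Longrightarrow> frag_of u \<otimes>\<^bsub>unit_group_ring R\<^esub> f \<in> J"
  using J.I_l_closed unit_group_ring_closed(1) by blast

lemma cong_refl [simp]: "f \<approx> f"
  by (simp add: cong_def J_zero)

lemma cong_trans [trans]: "f \<approx> g \<Longrightarrow> g \<approx> h \<Longrightarrow> f \<approx> h"
  using J_add[of "f - g" "g - h"] by (simp add: cong_def)

lemma cong_sym: "f \<approx> g \<Longrightarrow> g \<approx> f"
  using J_diff[OF J_zero, of "f - g"] by (simp add: cong_def)

lemma cong_add: "f \<approx> g \<Longrightarrow> f' \<approx> g' \<Longrightarrow> f + f' \<approx> g + g'"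
  using J_add[of "f - g" "f' - g'"] by (simp add: cong_def algebra_simps)

lemma cong_cancel: "h + f \<approx> h + g \<Longrightarrow> f \<approx> g"
  by (simp add: cong_def)

lemma frag_square:
  assumes "u \<in> Units R" "a \<in> Units R"
  shows "frag_of (u \<otimes> (a \<otimes> a)) \<approx> frag_of u"
proof -
  have c: "u \<in> carrier R" "a \<in> carrier R" using assms by auto
  have aa: "a [^] (2::nat) = a \<otimes> a" "a \<otimes> a \<in> Units R" using c assms by (auto simp: numeral_2_eq_2)
  have "frag_of u \<otimes>\<^bsub>unit_group_ring R\<^esub> pfister R (a [^] (2::nat)) = frag_of u - frag_of (u \<otimes> (a \<otimes> a))"
    using c by (simp add: aa pfister_eq unit_group_ring_mult_diff unit_group_ring_mult_basis)
  then have "frag_of u \<approx> frag_of (u \<otimes> (a \<otimes> a))"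
    using J_scale[OF assms(1) square_relation[OF assms(2)]] by (simp add: cong_def)
  then show ?thesis by (rule cong_sym)
qed

lemma frag_square':
  assumes "u \<in> Units R" "a \<in> Units R" "v = u \<otimes> (a \<otimes> a)"
  shows "frag_of v \<approx> frag_of u"
  using frag_square assms by simp

text \<open>The product (1 - \<langle>a\<rangle>)(1 - \<langle>1-a\<rangle>) expanded and multiplied
  by \<langle>u\<rangle>.\<close>

lemma steinberg_scaled:
  assumes "u \<in> Units R" "a \<in> Units R" "\<one> \<ominus> a \<in> Units R"
  shows "frag_of u + frag_of (u \<otimes> (a \<otimes> (\<one> \<ominus> a))) \<approx> frag_of (u \<otimes> a) + frag_of (u \<otimes> (\<one> \<ominus> a))"
proof -
  have c: "u \<in> carrier R" "a \<in> carrier R" "\<one> \<ominus> a \<in> carrier R" using assms by auto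
  have "pfister R a \<otimes>\<^bsub>unit_group_ring R\<^esub> pfister R (\<one> \<ominus> a) =
      frag_of \<one> - frag_of (\<one> \<ominus> a) - (frag_of a - frag_of (a \<otimes> (\<one> \<ominus> a)))"
    using assms c by (simp add: pfister_eq unit_group_ring_mult_diff unit_group_ring_mult_basis)
  then have "frag_of u \<otimes>\<^bsub>unit_group_ring R\<^esub> (pfister R a \<otimes>\<^bsub>unit_group_ring R\<^esub> pfister R (\<one> \<ominus> a)) =
      frag_of u + frag_of (u \<otimes> (a \<otimes> (\<one> \<ominus> a))) - (frag_of (u \<otimes> a) + frag_of (u \<otimes> (\<one> \<ominus> a)))"
    using c by (simp add: unit_group_ring_mult_diff unit_group_ring_mult_basis)
  then show ?thesis
    using J_scale[OF assms(1) steinberg_relation[OF assms(2,3)]] by (simp add: cong_def)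
qed

text \<open>With w = u + v, the fractions u/w and v/w add up to 1. Their Steinberg relation scaled
  by \<open>w\<close> is the claim, except that the last term uv/w differs from uvw by the square of
  1/w.\<close>

lemma frag_add_units:
  assumes u: "u \<in> Units R" "v \<in> Units R" "u \<oplus> v \<in> Units R"
  shows "frag_of u + frag_of v \<approx> frag_of (u \<oplus> v) + frag_of (u \<otimes> v \<otimes> (u \<oplus> v))"
proof -
  define w where "w = u \<oplus> v"
  define i where "i = inv w"
  have c: "u \<in> carrier R" "v \<in> carrier R" "w \<in> carrier R" "i \<in> carrier R" and iU: "i \<in> Units R" and wU: "w \<in> Units R"
    and wi: "w \<otimes> i = \<one>"
    using u by (auto simp: w_def i_def)
  have ui: "w \<otimes> (u \<otimes> i) = u" "w \<otimes> (v \<otimes> i) = v"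
  proof -
    have "w \<otimes> (u \<otimes> i) = u \<otimes> (w \<otimes> i)" "w \<otimes> (v \<otimes> i) = v \<otimes> (w \<otimes> i)" using c by algebra+
    then show "w \<otimes> (u \<otimes> i) = u" "w \<otimes> (v \<otimes> i) = v" using c by (simp_all add: wi)
  qed
  have 1: "\<one> \<ominus> u \<otimes> i = v \<otimes> i"
    unfolding wi[symmetric] w_def using c by algebra
  have "frag_of w + frag_of (w \<otimes> (u \<otimes> i \<otimes> (v \<otimes> i))) \<approx> frag_of u + frag_of v"
    using steinberg_scaled[of w "u \<otimes> i"] u iU wU by (simp add: 1 ui)
  moreover have "frag_of (w \<otimes> (u \<otimes> i \<otimes> (v \<otimes> i))) \<approx> frag_of (u \<otimes> v \<otimes> w)"
  proof (rule frag_square'[OF _ iU])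
    show "u \<otimes> v \<otimes> w \<in> Units R" using u wU by simp
    show "w \<otimes> (u \<otimes> i \<otimes> (v \<otimes> i)) = u \<otimes> v \<otimes> w \<otimes> (i \<otimes> i)" using c by algebra
  qed
  ultimately have "frag_of u + frag_of v \<approx> frag_of w + frag_of (u \<otimes> v \<otimes> w)"
    using cong_trans[OF cong_sym cong_add[OF cong_refl]] by blast
  then show ?thesis by (simp add: w_def)
qed

text \<open>Unit squares can be absorbed, so this is \<open>frag_add_units\<close> for a x^2 and b
  y^2.\<close>

lemma frag_plane_units:
  assumes a: "a \<in> Units R" "b \<in> Units R" and x: "x \<in> Units R" "y \<in> Units R"
    and c: "c = a \<otimes> (x \<otimes> x) \<oplus> b \<otimes> (y \<otimes> y)" "c \<in> Units R"
  shows "frag_of a + frag_of b \<approx> frag_of c + frag_of (a \<otimes> b \<otimes> c)"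
proof -
  have cl: "a \<in> carrier R" "b \<in> carrier R" "x \<in> carrier R" "y \<in> carrier R" "c \<in> carrier R" using a x c(2) by auto
  have "frag_of a + frag_of b \<approx> frag_of (a \<otimes> (x \<otimes> x)) + frag_of (b \<otimes> (y \<otimes> y))"
    using a x by (intro cong_add cong_sym[OF frag_square])
  also have "\<dots> \<approx> frag_of c + frag_of (a \<otimes> (x \<otimes> x) \<otimes> (b \<otimes> (y \<otimes> y)) \<otimes> c)"
    using frag_add_units[of "a \<otimes> (x \<otimes> x)" "b \<otimes> (y \<otimes> y)"] a x c by simp
  also have "\<dots> \<approx> frag_of c + frag_of (a \<otimes> b \<otimes> c)"
  proof (intro cong_add cong_refl frag_square')
    show "a \<otimes> (x \<otimes> x) \<otimes> (b \<otimes> (y \<otimes> y)) \<otimes> c = a \<otimes> b \<otimes> c \<otimes> (x \<otimes> y \<otimes> (x \<otimes> y))" using cl by algebra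
  qed (use a x c(2) in simp_all)
  finally show ?thesis .
qed

lemma unit_plus_max: "u \<in> Units R \<Longrightarrow> v \<in> \<mm> \<Longrightarrow> w = u \<oplus> v \<Longrightarrow> w \<in> Units R"
  using unit_add_max by simp

text \<open>For \<open>y\<close> in \<open>\<mm>\<close> the term b y^2 is not a unit, so
  \<open>frag_plane_units\<close> does not reach \<open>c\<close> directly. Instead one passes
  through the value A = a + b t^2: from \<langle>a, b\<rangle> to \<langle>A, abA\<rangle> and from
  there to \<langle>c, abc\<rangle>, both times with unit coordinates.\<close>

lemma frag_plane_via:
  assumes a: "a \<in> Units R" "b \<in> Units R" and x: "x \<in> Units R" "y \<in> \<mm>"
    and c: "c = a \<otimes> (x \<otimes> x) \<oplus> b \<otimes> (y \<otimes> y)" "c \<in> Units R"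
    and t: "t \<in> Units R" "a \<oplus> b \<otimes> (t \<otimes> t) \<in> Units R"
  shows "frag_of a + frag_of b \<approx> frag_of c + frag_of (a \<otimes> b \<otimes> c)"
proof -
  define A where "A = a \<oplus> b \<otimes> (t \<otimes> t)"
  define i where "i = inv A"
  have cl: "a \<in> carrier R" "b \<in> carrier R" "x \<in> carrier R" "y \<in> carrier R" "c \<in> carrier R" "t \<in> carrier R" "i \<in> carrier R"
    and AU: "A \<in> Units R" and iU: "i \<in> Units R" and Ai: "A \<otimes> i = \<one>" and Ac: "A \<in> carrier R"
    using a x c(2) t max_carrier by (auto simp: A_def i_def)
  define p where "p = a \<otimes> x \<oplus> b \<otimes> t \<otimes> y"
  define q where "q = y \<ominus> t \<otimes> x"
  have pU: "p \<in> Units R"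
    unfolding p_def using a x t cl I_l_closed[OF x(2)] by (intro unit_add_max) auto
  then have X: "p \<otimes> i \<in> Units R" using iU by simp
  have "\<ominus> (t \<otimes> x) \<oplus> y \<in> Units R" using x t minus_unit[of "t \<otimes> x"] by (intro unit_add_max) auto
  moreover have "\<ominus> (t \<otimes> x) \<oplus> y = q" unfolding q_def using cl by algebra
  ultimately have qU: "q \<in> Units R" by simp
  then have Y: "q \<otimes> i \<in> Units R" using iU by simp
  have pq: "p \<in> carrier R" "q \<in> carrier R" using pU qU by auto
  have e: "A \<otimes> (p \<otimes> i \<otimes> (p \<otimes> i)) \<oplus> a \<otimes> b \<otimes> A \<otimes> (q \<otimes> i \<otimes> (q \<otimes> i)) = c"
  proof -
    \<comment> \<open>The composition identity for binary forms: (a x^2 + b y^2)(a + b t^2) = (a x +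
      b t y)^2 + a b (y - t x)^2. Dividing by \<open>A\<close> shows that \<langle>A, abA\<rangle>
      takes the value \<open>c\<close> at the units p/A and q/A.\<close>
    have s: "p \<otimes> p \<oplus> a \<otimes> b \<otimes> (q \<otimes> q) = c \<otimes> A"
      unfolding c(1) A_def p_def q_def using cl by algebra
    have "A \<otimes> (p \<otimes> i \<otimes> (p \<otimes> i)) \<oplus> a \<otimes> b \<otimes> A \<otimes> (q \<otimes> i \<otimes> (q \<otimes> i)) =
      (A \<otimes> i) \<otimes> i \<otimes> (p \<otimes> p \<oplus> a \<otimes> b \<otimes> (q \<otimes> q))" using cl(1,2,7) pq Ac by algebra
    also have "\<dots> = (A \<otimes> i) \<otimes> (A \<otimes> i) \<otimes> c" unfolding s using cl(5,7) Ac by algebra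
    finally show ?thesis using cl by (simp add: Ai)
  qed
  have "frag_of a + frag_of b \<approx> frag_of A + frag_of (a \<otimes> b \<otimes> A)"
    using a t AU cl by (intro frag_plane_units[of a b \<one> t]) (auto simp: A_def)
  also have "\<dots> \<approx> frag_of c + frag_of (A \<otimes> (a \<otimes> b \<otimes> A) \<otimes> c)"
    using X Y e a AU c(2) by (intro frag_plane_units[OF _ _ X Y]) auto
  also have "\<dots> \<approx> frag_of c + frag_of (a \<otimes> b \<otimes> c)"
  proof (intro cong_add cong_refl frag_square')
    show "A \<otimes> (a \<otimes> b \<otimes> A) \<otimes> c = a \<otimes> b \<otimes> c \<otimes> (A \<otimes> A)" using cl Ac by algebra
  qed (use a AU c(2) in simp_all)
  finally show ?thesis .
qed

text \<open>If no unit \<open>t\<close> makes \<open>a + b t\<^sup>2\<close> a unit, the residue field is \<open>\<bool>F\<^sub>3\<close> and the plane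
  \<open>\<langle>a, b\<rangle>\<close> is residually hyperbolic; adding a third summand \<open>\<langle>a\<rangle>\<close> makes room for a detour through
  residually anisotropic planes.\<close>

lemma frag_plane_detour:
  assumes a: "a \<in> Units R" "b \<in> Units R" and z: "z \<in> \<mm>" and c: "c = a \<oplus> b \<otimes> (z \<otimes> z)"
    and no_t: "\<And>t. t \<in> Units R \<Longrightarrow> a \<oplus> b \<otimes> (t \<otimes> t) \<in> \<mm>"
  shows "frag_of a + frag_of b \<approx> frag_of c + frag_of (a \<otimes> b \<otimes> c)"
proof -
  have cl: "a \<in> carrier R" "b \<in> carrier R" "z \<in> carrier R" using a z max_carrier by auto
  have bz: "b \<otimes> (z \<otimes> z) \<in> \<mm>" using cl z I_l_closed by simp
  have cU: "c \<in> Units R" unfolding c using a bz unit_add_max by blast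
  have cc: "c \<in> carrier R" using cU by auto
  have ab: "a \<oplus> b \<in> \<mm>" using no_t[of \<one>] cl by simp
  have mdiff: "u \<ominus> v \<in> \<mm>" if "u \<in> \<mm>" "v \<in> \<mm>" for u v
    using that additive_subgroup.a_closed[OF is_additive_subgroup] additive_subgroup.a_inv_closed[OF is_additive_subgroup]
    by (simp add: a_minus_def)
  \<comment> \<open>Subtracting the hypothesis \<open>no_t\<close> for 1 from that for
    \<open>t\<close> and dividing by \<open>b\<close> shows that every unit square is 1 modulo
    \<open>\<mm>\<close>.\<close>
  have sq: "t \<otimes> t \<ominus> \<one> \<in> \<mm>" if t: "t \<in> Units R" for t
  proof -
    have tc: "t \<in> carrier R" using t by auto
    have "b \<otimes> (t \<otimes> t \<ominus> \<one>) = (a \<oplus> b \<otimes> (t \<otimes> t)) \<ominus> (a \<oplus> b)" using cl tc by algebra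
    then have m: "b \<otimes> (t \<otimes> t \<ominus> \<one>) \<in> \<mm>" using mdiff no_t[OF t] ab by simp
    then have "inv b \<otimes> (b \<otimes> (t \<otimes> t \<ominus> \<one>)) \<in> \<mm>" using I_l_closed[OF m] a by blast
    moreover have "inv b \<otimes> (b \<otimes> (t \<otimes> t \<ominus> \<one>)) = t \<otimes> t \<ominus> \<one>"
    proof -
      have "inv b \<otimes> (b \<otimes> (t \<otimes> t \<ominus> \<one>)) = (inv b \<otimes> b) \<otimes> (t \<otimes> t \<ominus> \<one>)"
        using a(2) cl tc by (intro m_assoc[symmetric]) auto
      then show ?thesis using a(2) tc by simp
    qed
    ultimately show ?thesis by simp
  qed
  obtain s where s: "s \<in> Units R" "\<one> \<ominus> s \<in> Units R" using residue by blast
  \<comment> \<open>The product (1 - s)(1 + s) lies in \<open>\<mm>\<close> while 1 - s is a unit,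
    so 1 + s lies in \<open>\<mm>\<close> and 2 is congruent to 1 - s.\<close>
  have two: "\<one> \<oplus> \<one> \<in> Units R"
  proof -
    have sc: "s \<in> carrier R" using s by auto
    have "(\<one> \<ominus> s) \<otimes> (s \<oplus> \<one>) = \<ominus> (s \<otimes> s \<ominus> \<one>)" using sc by algebra
    then have "(\<one> \<ominus> s) \<otimes> (s \<oplus> \<one>) \<in> \<mm>"
      using sq[OF s(1)] additive_subgroup.a_inv_closed[OF is_additive_subgroup] by simp
    then have "s \<oplus> \<one> \<notin> Units R" using Units_m_closed[OF s(2), of "s \<oplus> \<one>"] unit_not_in_max by blast
    moreover have "s \<oplus> \<one> \<in> carrier R" using sc by simp
    ultimately have "s \<oplus> \<one> \<in> \<mm>" using not_in_max_unit by blast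
    moreover have "\<one> \<oplus> \<one> = (\<one> \<ominus> s) \<oplus> (s \<oplus> \<one>)" using sc by algebra
    ultimately show ?thesis using s(2) unit_plus_max by blast
  qed
  \<comment> \<open>Replacing \<open>a\<close> by d = 2a changes its residue class modulo squares.
    The planes \<langle>d, b\<rangle> and \<langle>e, d\<rangle> take unit values at (1, 1), so
    that, unlike \<langle>a, b\<rangle>, they fall under \<open>frag_plane_via\<close> with t =
    1.\<close>
  define d where "d = a \<oplus> a"
  have dU: "d \<in> Units R"
  proof -
    have "d = a \<otimes> (\<one> \<oplus> \<one>)" unfolding d_def using cl by algebra
    then show ?thesis using a two by simp
  qed
  have dc: "d \<in> carrier R" using dU by auto
  define g where "g = a \<oplus> c"
  have gd: "g = d \<oplus> b \<otimes> (z \<otimes> z)" unfolding g_def c d_def using cl by algebra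
  have gU: "g \<in> Units R" unfolding gd using dU bz unit_add_max by blast
  have gc: "g \<in> carrier R" using gU by auto
  define e where "e = d \<otimes> b \<otimes> g"
  have eU: "e \<in> Units R" unfolding e_def using dU a gU by simp
  have ec: "e \<in> carrier R" using eU by auto
  have s1: "frag_of a + frag_of a \<approx> frag_of d + frag_of d"
  proof -
    have "frag_of a + frag_of a \<approx> frag_of d + frag_of (a \<otimes> a \<otimes> d)"
      using frag_add_units[OF a(1) a(1)] dU by (simp add: d_def)
    also have "\<dots> \<approx> frag_of d + frag_of d"
      using cl dc by (intro cong_add cong_refl frag_square'[OF dU a(1)]) (simp add: m_comm)
    finally show ?thesis .
  qed
  have s2: "frag_of d + frag_of b \<approx> frag_of g + frag_of e"
    unfolding e_def
  proof (rule frag_plane_via[OF dU a(2) Units_one_closed z _ gU Units_one_closed])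
    show "g = d \<otimes> (\<one> \<otimes> \<one>) \<oplus> b \<otimes> (z \<otimes> z)" using gd dc by simp
    show "d \<oplus> b \<otimes> (\<one> \<otimes> \<one>) \<in> Units R"
    proof (rule unit_plus_max[OF a(1) ab])
      show "d \<oplus> b \<otimes> (\<one> \<otimes> \<one>) = a \<oplus> (a \<oplus> b)" unfolding d_def using cl by algebra
    qed
  qed
  \<comment> \<open>The value of \<langle>e, d\<rangle> at (1, b z) is d b (g + b z^2). Here d = 2a
    and g + b z^2 = 2c, so the value is 4abc, a square multiple of the wanted abc.\<close>
  define k where "k = a \<otimes> b \<otimes> c \<otimes> ((\<one> \<oplus> \<one>) \<otimes> (\<one> \<oplus> \<one>))"
  have abcU: "a \<otimes> b \<otimes> c \<in> Units R" using a cU by simp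
  have kU: "k \<in> Units R" unfolding k_def using abcU two by simp
  have kc: "k \<in> carrier R" using kU by auto
  have s3: "frag_of e + frag_of d \<approx> frag_of k + frag_of (e \<otimes> d \<otimes> k)"
  proof (rule frag_plane_via[OF eU dU Units_one_closed _ _ kU Units_one_closed])
    show "b \<otimes> z \<in> \<mm>" using cl z I_l_closed by simp
    show "k = e \<otimes> (\<one> \<otimes> \<one>) \<oplus> d \<otimes> (b \<otimes> z \<otimes> (b \<otimes> z))"
      unfolding k_def e_def g_def c d_def using cl by algebra
    have m1: "a \<otimes> a \<ominus> \<one> \<in> \<mm>" by (rule sq[OF a(1)])
    have m2: "(\<one> \<oplus> \<one>) \<otimes> (a \<otimes> (a \<oplus> b)) \<in> \<mm>" using I_l_closed[OF I_l_closed[OF ab cl(1)]] two by blast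
    have m3: "b \<otimes> (b \<otimes> (z \<otimes> z)) \<in> \<mm>" by (rule I_l_closed[OF bz cl(2)])
    have m4: "\<ominus> ((\<one> \<oplus> \<one>) \<otimes> (a \<otimes> a \<ominus> \<one>)) \<in> \<mm>"
      using additive_subgroup.a_inv_closed[OF is_additive_subgroup I_l_closed[OF m1]] two by blast
    \<comment> \<open>Modulo \<open>\<mm>\<close>, \<open>b\<close> is -a, \<open>g\<close> is 2a
      and a^2 is 1, so b g + 1 is -1; \<open>n\<close> is the explicit error.\<close>
    define n where "n = (\<one> \<oplus> \<one>) \<otimes> (a \<otimes> (a \<oplus> b)) \<oplus> b \<otimes> (b \<otimes> (z \<otimes> z)) \<oplus> \<ominus> ((\<one> \<oplus> \<one>) \<otimes> (a \<otimes> a \<ominus> \<one>))"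
    have n: "n \<in> \<mm>" unfolding n_def
      by (intro additive_subgroup.a_closed[OF is_additive_subgroup] m2 m3 m4)
    have "b \<otimes> g \<oplus> \<one> = \<ominus> \<one> \<oplus> n"
      unfolding n_def gd d_def using cl by algebra
    then have "b \<otimes> g \<oplus> \<one> \<in> Units R" using unit_add_max[OF minus_unit[OF Units_one_closed] n] by simp
    moreover have "e \<oplus> d \<otimes> (\<one> \<otimes> \<one>) = d \<otimes> (b \<otimes> g \<oplus> \<one>)" unfolding e_def using cl dc gc by algebra
    ultimately show "e \<oplus> d \<otimes> (\<one> \<otimes> \<one>) \<in> Units R" using dU by simp
  qed
  have s3': "frag_of k \<approx> frag_of (a \<otimes> b \<otimes> c)" unfolding k_def by (rule frag_square[OF abcU two])
  have s3'': "frag_of (e \<otimes> d \<otimes> k) \<approx> frag_of (a \<otimes> c \<otimes> g)"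
  proof (rule frag_square')
    show "e \<otimes> d \<otimes> k = a \<otimes> c \<otimes> g \<otimes> (d \<otimes> b \<otimes> (\<one> \<oplus> \<one>) \<otimes> (d \<otimes> b \<otimes> (\<one> \<oplus> \<one>)))"
      unfolding k_def e_def using cl dc gc cc by algebra
  qed (use a cU gU dU two in simp_all)
  have s4: "frag_of a + frag_of c \<approx> frag_of g + frag_of (a \<otimes> c \<otimes> g)"
    using frag_add_units[OF a(1) cU] gU by (simp add: g_def)
  \<comment> \<open>The chain of ternary forms is \<langle>a, a, b\<rangle>, \<langle>d, d,
    b\<rangle>, \<langle>d, g, e\<rangle>, \<langle>g, abc, acg\<rangle>, \<langle>abc, a,
    c\<rangle>; the auxiliary \<langle>a\<rangle> reappears and cancels.\<close>
  have "frag_of a + (frag_of a + frag_of b) \<approx> frag_of d + frag_of d + frag_of b"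
    using cong_add[OF s1 cong_refl, of "frag_of b"] by (simp add: add.assoc)
  also have "\<dots> \<approx> frag_of d + (frag_of g + frag_of e)"
    using cong_add[OF cong_refl s2, of "frag_of d"] by (simp add: add.assoc)
  also have "\<dots> = frag_of g + (frag_of e + frag_of d)" by (simp add: add_ac)
  also have "\<dots> \<approx> frag_of g + (frag_of k + frag_of (e \<otimes> d \<otimes> k))" by (rule cong_add[OF cong_refl s3])
  also have "\<dots> \<approx> frag_of g + (frag_of (a \<otimes> b \<otimes> c) + frag_of (a \<otimes> c \<otimes> g))"
    by (intro cong_add cong_refl s3' s3'')
  also have "\<dots> = frag_of (a \<otimes> b \<otimes> c) + (frag_of g + frag_of (a \<otimes> c \<otimes> g))" by (simp add: add_ac)
  also have "\<dots> \<approx> frag_of (a \<otimes> b \<otimes> c) + (frag_of a + frag_of c)" by (rule cong_add[OF cong_refl cong_sym[OF s4]])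
  also have "\<dots> = frag_of a + (frag_of c + frag_of (a \<otimes> b \<otimes> c))" by (simp add: add_ac)
  finally show ?thesis by (rule cong_cancel)
qed

text \<open>Either some \<open>t\<close> serves as the intermediate value, or the detour applies
  after dividing the coordinates by \<open>x\<close>, which changes \<open>c\<close> by the square
  of \<open>x\<close>.\<close>

lemma frag_plane_max:
  assumes a: "a \<in> Units R" "b \<in> Units R" and x: "x \<in> Units R" "y \<in> \<mm>"
    and c: "c = a \<otimes> (x \<otimes> x) \<oplus> b \<otimes> (y \<otimes> y)" "c \<in> Units R"
  shows "frag_of a + frag_of b \<approx> frag_of c + frag_of (a \<otimes> b \<otimes> c)"
proof (cases "\<exists>t\<in>Units R. a \<oplus> b \<otimes> (t \<otimes> t) \<in> Units R")
  case True
  then show ?thesis using frag_plane_via[OF a x c] by blast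
next
  case False
  have no_t: "a \<oplus> b \<otimes> (t \<otimes> t) \<in> \<mm>" if "t \<in> Units R" for t
  proof -
    have "a \<in> carrier R" "b \<in> carrier R" "t \<in> carrier R" using that a by auto
    then have "a \<oplus> b \<otimes> (t \<otimes> t) \<in> carrier R" by simp
    then show ?thesis using False that not_in_max_unit by blast
  qed
  define i where "i = inv x"
  have cl: "a \<in> carrier R" "b \<in> carrier R" "x \<in> carrier R" "y \<in> carrier R" "i \<in> carrier R"
    and iU: "i \<in> Units R" and xi: "x \<otimes> i = \<one>"
    using a x max_carrier by (auto simp: i_def)
  define z where "z = y \<otimes> i"
  have z: "z \<in> \<mm>" unfolding z_def using x(2) cl(5) by (rule I_r_closed)
  define c' where "c' = a \<oplus> b \<otimes> (z \<otimes> z)"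
  have c'c: "c' \<in> carrier R" using cl max_carrier[OF z] by (simp add: c'_def)
  have eq: "c = c' \<otimes> (x \<otimes> x)"
  proof -
    have "c' \<otimes> (x \<otimes> x) = a \<otimes> (x \<otimes> x) \<oplus> b \<otimes> (y \<otimes> y) \<otimes> ((x \<otimes> i) \<otimes> (x \<otimes> i))"
      unfolding c'_def z_def using cl by algebra
    then show ?thesis using cl by (simp add: xi c(1))
  qed
  have c'U: "c' \<in> Units R"
    unfolding c'_def using a(1) z cl max_carrier[OF z] by (intro unit_add_max I_l_closed) auto
  have "frag_of a + frag_of b \<approx> frag_of c' + frag_of (a \<otimes> b \<otimes> c')"
    by (rule frag_plane_detour[OF a z c'_def no_t])
  also have "\<dots> \<approx> frag_of c + frag_of (a \<otimes> b \<otimes> c)"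
  proof (intro cong_add cong_sym[OF frag_square'])
    show "a \<otimes> b \<otimes> c = a \<otimes> b \<otimes> c' \<otimes> (x \<otimes> x)" unfolding eq using cl c'c by algebra
  qed (use eq c'U x a in simp_all)
  finally show ?thesis .
qed

lemma frag_plane:
  assumes a: "a \<in> Units R" "b \<in> Units R" and x: "x \<in> carrier R" "y \<in> carrier R"
    and c: "c = a \<otimes> (x \<otimes> x) \<oplus> b \<otimes> (y \<otimes> y)" "c \<in> Units R"
  shows "frag_of a + frag_of b \<approx> frag_of c + frag_of (a \<otimes> b \<otimes> c)"
proof -
  have cl: "a \<in> carrier R" "b \<in> carrier R" using a by auto
  consider "x \<in> Units R" "y \<in> Units R" | "x \<in> Units R" "y \<in> \<mm>" | "x \<in> \<mm>" "y \<in> Units R" | "x \<in> \<mm>" "y \<in> \<mm>"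
    using x not_in_max_unit by blast
  then show ?thesis
  proof cases
    case 1
    then show ?thesis using frag_plane_units a c by blast
  next
    case 2
    then show ?thesis using frag_plane_max a c by blast
  next
    case 3
    have "c = b \<otimes> (y \<otimes> y) \<oplus> a \<otimes> (x \<otimes> x)" unfolding c(1) using cl x by algebra
    from frag_plane_max[OF a(2,1) 3(2,1) this c(2)] show ?thesis
      using cl by (simp add: add.commute m_comm)
  next
    case 4
    have "a \<otimes> (x \<otimes> x) \<in> \<mm>" "b \<otimes> (y \<otimes> y) \<in> \<mm>" using 4 cl x by (auto intro!: I_l_closed)
    then have "c \<in> \<mm>" unfolding c(1) by (rule additive_subgroup.a_closed[OF is_additive_subgroup])
    then show ?thesis using c(2) unit_not_in_max by blast
  qed
qed

text \<open>The Steinberg relation for \<open>a\<close> and the one for 1/a scaled by -a both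
  involve \<langle>1-a\<rangle> and \<langle>a(1-a)\<rangle>, on opposite sides. Adding them
  eliminates both terms.\<close>

lemma hyperbolic_cong:
  assumes a: "a \<in> Units R"
  shows "frag_of \<one> + frag_of (\<ominus> \<one>) \<approx> frag_of a + frag_of (\<ominus> a)"
proof -
  have *: "frag_of \<one> + frag_of (\<ominus> \<one>) \<approx> frag_of a + frag_of (\<ominus> a)"
    if a: "a \<in> Units R" and a1: "\<one> \<ominus> a \<in> Units R" for a
  proof -
    define i where "i = inv a"
    have cl: "a \<in> carrier R" "i \<in> carrier R" and iU: "i \<in> Units R" and ai: "a \<otimes> i = \<one>"
      using a by (auto simp: i_def)
    have i1: "\<one> \<ominus> i = \<ominus> (\<one> \<ominus> a) \<otimes> i"
    proof -
      have "\<ominus> (\<one> \<ominus> a) \<otimes> i = a \<otimes> i \<ominus> i" using cl by algebra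
      then show ?thesis by (simp add: ai)
    qed
    have i1U: "\<one> \<ominus> i \<in> Units R" unfolding i1 using minus_unit[OF a1] iU by simp
    have e: "\<ominus> a \<otimes> i = \<ominus> \<one>" "\<ominus> a \<otimes> (\<one> \<ominus> i) = \<one> \<ominus> a"
      "\<ominus> a \<otimes> (i \<otimes> (\<one> \<ominus> i)) = a \<otimes> (\<one> \<ominus> a) \<otimes> (i \<otimes> i)"
    proof -
      have "\<ominus> a \<otimes> i = \<ominus> (a \<otimes> i)" "\<ominus> a \<otimes> (\<one> \<ominus> i) = a \<otimes> i \<ominus> a" using cl by algebra+
      then show "\<ominus> a \<otimes> i = \<ominus> \<one>" "\<ominus> a \<otimes> (\<one> \<ominus> i) = \<one> \<ominus> a" by (simp_all add: ai)
      show "\<ominus> a \<otimes> (i \<otimes> (\<one> \<ominus> i)) = a \<otimes> (\<one> \<ominus> a) \<otimes> (i \<otimes> i)" unfolding i1 using cl by algebra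
    qed
    have 1: "frag_of \<one> + frag_of (a \<otimes> (\<one> \<ominus> a)) \<approx> frag_of a + frag_of (\<one> \<ominus> a)"
      using steinberg_scaled[OF Units_one_closed a a1] cl by simp
    have "frag_of (\<ominus> a) + frag_of (a \<otimes> (\<one> \<ominus> a) \<otimes> (i \<otimes> i)) \<approx> frag_of (\<ominus> \<one>) + frag_of (\<one> \<ominus> a)"
      using steinberg_scaled[OF minus_unit[OF a] iU i1U] by (simp only: e)
    moreover have "frag_of (\<ominus> a) + frag_of (a \<otimes> (\<one> \<ominus> a) \<otimes> (i \<otimes> i)) \<approx> frag_of (\<ominus> a) + frag_of (a \<otimes> (\<one> \<ominus> a))"
      using a a1 iU by (intro cong_add cong_refl frag_square) auto
    ultimately have 2: "frag_of (\<ominus> \<one>) + frag_of (\<one> \<ominus> a) \<approx> frag_of (\<ominus> a) + frag_of (a \<otimes> (\<one> \<ominus> a))"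
      using cong_trans cong_sym by blast
    show ?thesis
      using cong_add[OF 1 2] by (simp add: cong_def algebra_simps)
  qed
  show ?thesis
  proof (cases "\<one> \<ominus> a \<in> Units R")
    case True
    then show ?thesis using * a by blast
  next
    case False
    obtain s where s: "s \<in> Units R" "\<one> \<ominus> s \<in> Units R" using residue by blast
    have cl: "a \<in> carrier R" "s \<in> carrier R" using a s by auto
    have m: "\<one> \<ominus> a \<in> \<mm>" using False cl not_in_max_unit by blast
    \<comment> \<open>Since \<open>a\<close> is 1 modulo \<open>\<mm>\<close>, both \<open>s\<close>
      and \<open>a s\<close> fall under the first case. Scaling the relation for \<open>s\<close> by
      \<langle>a\<rangle> then connects \<open>a\<close> with \<open>a s\<close>.\<close>
    have "\<one> \<ominus> a \<otimes> s = (\<one> \<ominus> s) \<oplus> (\<one> \<ominus> a) \<otimes> s" using cl by algebra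
    then have as: "\<one> \<ominus> a \<otimes> s \<in> Units R" using s m I_r_closed cl unit_plus_max by blast
    have 1: "frag_of \<one> + frag_of (\<ominus> \<one>) \<approx> frag_of (a \<otimes> s) + frag_of (\<ominus> (a \<otimes> s))"
      using *[OF _ as] a s by simp
    have "frag_of \<one> + frag_of (\<ominus> \<one>) - (frag_of s + frag_of (\<ominus> s)) \<in> J" using *[OF s] by (simp add: cong_def)
    from J_scale[OF a this] have "frag_of a + frag_of (\<ominus> a) \<approx> frag_of (a \<otimes> s) + frag_of (\<ominus> (a \<otimes> s))"
      using cl by (simp add: cong_def unit_group_ring_mult_diff basis_mult_add unit_group_ring_mult_basis r_minus)
    then show ?thesis using 1 cong_trans cong_sym by blast
  qed
qed

lemma hyperbolic_relation:
  assumes a: "a \<in> Units R"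
  shows "pfister R a \<otimes>\<^bsub>unit_group_ring R\<^esub> hyperbolic R \<in> J"
proof -
  have cl: "a \<in> carrier R" using a by auto
  have "pfister R a \<otimes>\<^bsub>unit_group_ring R\<^esub> hyperbolic R =
      frag_of \<one> + frag_of (\<ominus> \<one>) - (frag_of a + frag_of (\<ominus> a))"
    using a cl by (simp add: pfister_eq hyperbolic_eq unit_group_ring_mult_diff basis_mult_add unit_group_ring_mult_basis r_minus)
  then show ?thesis using hyperbolic_cong[OF a] by (simp add: cong_def)
qed

end

section \<open>Chain equivalence of orthogonal bases\<close>

locale steinberg_space = local_bilinear_space \<mm> R V + steinberg_ideal \<mm> R J
  for \<mm> and R (structure) and V :: "('a, 'b) form_module" and J
begin

definition diag_sum :: "'b set \<Rightarrow> ('a \<Rightarrow>\<^sub>0 int)"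
  where "diag_sum E = (\<Sum>e\<in>E. frag_of (form V e e))"

text \<open>Stands for membership in the span of \<open>E\<close> but is read off from the
  complement alone, so that it survives every change of \<open>E\<close> that keeps
  \<open>perp E\<close>.\<close>

definition in_span :: "'b set \<Rightarrow> 'b \<Rightarrow> bool"
  where "in_span E f \<longleftrightarrow> f \<in> carrier V \<and> (\<forall>v\<in>perp E. form V v f = \<zero>)"

text \<open>The norm of the component of \<open>f\<close> along \<open>e\<close>; over an orthogonal
  set whose span contains \<open>f\<close> these add up to the norm of \<open>f\<close>.\<close>

definition coef :: "'b \<Rightarrow> 'b \<Rightarrow> 'a"
  where "coef f e = form V f e \<otimes> form V f e \<otimes> inv (form V e e)"

definition support :: "'b set \<Rightarrow> 'b \<Rightarrow> 'b set"
  where "support E f = {e \<in> E. form V f e \<noteq> \<zero>}"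

lemma orth_setD:
  assumes "orth_set E"
  shows "finite E" "e \<in> E \<Longrightarrow> e \<in> carrier V" "e \<in> E \<Longrightarrow> form V e e \<in> Units R"
    "e \<in> E \<Longrightarrow> e' \<in> E \<Longrightarrow> e \<noteq> e' \<Longrightarrow> form V e e' = \<zero>"
  using assms by (auto simp: orth_set_def)

lemma coef_closed: "orth_set E \<Longrightarrow> e \<in> E \<Longrightarrow> f \<in> carrier V \<Longrightarrow> coef f e \<in> carrier R"
  using orth_setD(2,3)[of E e] by (auto simp: coef_def)

lemma unit_times_zero: "u \<in> Units R \<Longrightarrow> x \<in> carrier R \<Longrightarrow> u \<otimes> x = \<zero> \<Longrightarrow> x = \<zero>"
  by (metis R.Units_closed R.Units_inv_closed R.Units_l_inv R.l_one R.m_assoc R.r_null R.Units_inv_Units)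

text \<open>Split \<open>f\<close> along \<open>E\<close>: the remainder lies in
  \<open>perp E\<close>, which \<open>g\<close> does not see. Here \<open>f\<close> may be any
  vector, which is how complements are compared in \<open>diag_sum_cong\<close>.\<close>

lemma parseval:
  assumes E: "orth_set E" and f: "f \<in> carrier V" and g: "in_span E g"
  shows "form V f g = (\<Oplus>e\<in>E. form V f e \<otimes> form V e g \<otimes> inv (form V e e))"
proof -
  have Ec: "E \<subseteq> carrier V" using orth_setD[OF E] by blast
  have gc: "g \<in> carrier V" using g by (simp add: in_span_def)
  note U = orth_set_unimodular[OF E] and fin = orth_setD(1)[OF E]
  obtain x w where x: "x \<in> carrier (free_module R E)" "w \<in> perp E" "f = lincomb E x \<oplus>\<^bsub>V\<^esub> w"
    using unimodular_decomposition[OF Ec U f] by blast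
  have xc: "x e \<in> carrier R" for e using x(1) by (rule R.free_module_closed)
  have wc: "w \<in> carrier V" using x(2) by (rule perp_closed)
  have lc: "lincomb E x \<in> carrier V" using Ec xc by auto
  have fe: "form V f e = form V e e \<otimes> x e" if e: "e \<in> E" for e
  proof -
    have ec: "e \<in> carrier V" using e Ec by blast
    have "form V f e = form V (lincomb E x) e"
      unfolding x(3) using lc wc ec x(2) e by (simp add: form_add_left perp_def)
    also have "\<dots> = (\<Oplus>t\<in>E. form V e t \<otimes> x t)" by (rule form_left_lincomb[OF fin Ec x(1) e])
    also have "\<dots> = (\<Oplus>t\<in>E. if t = e then form V t t \<otimes> x t else \<zero>)"
      using e xc Ec orth_setD(4)[OF E] by (intro R.finsum_cong') auto
    also have "\<dots> = form V e e \<otimes> x e" using e xc ec fin by (intro R.finsum_delta(1)) auto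
    finally show ?thesis .
  qed
  have "form V f g = form V (lincomb E x) g"
    unfolding x(3) using lc wc gc g x(2) by (simp add: form_add_left in_span_def)
  also have "\<dots> = (\<Oplus>e\<in>E. x e \<otimes> form V e g)" using fin Ec xc gc by (intro form_lincomb_left) auto
  also have "\<dots> = (\<Oplus>e\<in>E. form V f e \<otimes> form V e g \<otimes> inv (form V e e))"
  proof (rule R.finsum_cong')
    fix e assume e: "e \<in> E"
    have ec: "e \<in> carrier V" using e Ec by blast
    define q where "q = form V e e"
    have q: "q \<in> Units R" "q \<in> carrier R" "inv q \<in> carrier R" "q \<otimes> inv q = \<one>"
      using orth_setD(3)[OF E e] by (auto simp: q_def)
    have "q \<otimes> x e \<otimes> form V e g \<otimes> inv q = (q \<otimes> inv q) \<otimes> (x e \<otimes> form V e g)"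
      using q(2,3) xc form_closed[OF ec gc] by (simp add: R.m_ac)
    then have "q \<otimes> x e \<otimes> form V e g \<otimes> inv q = x e \<otimes> form V e g" using q(4) xc form_closed[OF ec gc] by simp
    then show "x e \<otimes> form V e g = form V f e \<otimes> form V e g \<otimes> inv (form V e e)"
      using fe[OF e] by (simp add: q_def)
  qed (use orth_setD[OF E] f gc in auto)
  finally show ?thesis .
qed

lemma parseval_norm:
  assumes "orth_set E" "in_span E f"
  shows "form V f f = (\<Oplus>e\<in>E. coef f e)"
  unfolding parseval[OF assms(1) _ assms(2), of f, OF assms(2)[unfolded in_span_def, THEN conjunct1]]
  using assms orth_setD[OF assms(1)]
  by (intro R.finsum_cong') (auto simp: in_span_def coef_def form_sym[of _ f])

text \<open>A rotation in the plane of \<open>e\<^sub>1\<close> and \<open>e\<^sub>2\<close>, whose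
  norms are \<open>a\<close> and \<open>b\<close>. The vector -b y \<open>e\<^sub>1\<close> + a x
  \<open>e\<^sub>2\<close> is orthogonal to x \<open>e\<^sub>1\<close> + y \<open>e\<^sub>2\<close>
  and has norm abc, so \<open>frag_plane\<close> says exactly that \<open>diag_sum\<close> is
  preserved modulo \<open>J\<close>.\<close>

lemma mix:
  assumes E: "orth_set E" "e\<^sub>1 \<in> E" "e\<^sub>2 \<in> E" "e\<^sub>1 \<noteq> e\<^sub>2" and x: "x \<in> carrier R" "y \<in> carrier R"
    and c: "c = form V e\<^sub>1 e\<^sub>1 \<otimes> (x \<otimes> x) \<oplus> form V e\<^sub>2 e\<^sub>2 \<otimes> (y \<otimes> y)" "c \<in> Units R"
  shows "\<exists>f\<^sub>1 f\<^sub>2. f\<^sub>1 \<noteq> f\<^sub>2 \<and> f\<^sub>1 \<notin> E - {e\<^sub>1, e\<^sub>2} \<and> f\<^sub>2 \<notin> E - {e\<^sub>1, e\<^sub>2} \<and>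
    f\<^sub>1 \<in> carrier V \<and> f\<^sub>2 \<in> carrier V \<and>
    orth_set (E - {e\<^sub>1, e\<^sub>2} \<union> {f\<^sub>1, f\<^sub>2}) \<and> perp (E - {e\<^sub>1, e\<^sub>2} \<union> {f\<^sub>1, f\<^sub>2}) = perp E \<and>
    diag_sum E \<approx> diag_sum (E - {e\<^sub>1, e\<^sub>2} \<union> {f\<^sub>1, f\<^sub>2}) \<and>
    form V f\<^sub>1 f\<^sub>1 = c \<and> form V f\<^sub>2 f\<^sub>2 = form V e\<^sub>1 e\<^sub>1 \<otimes> form V e\<^sub>2 e\<^sub>2 \<otimes> c \<and>
    (\<forall>v\<in>carrier V. form V v f\<^sub>1 = x \<otimes> form V v e\<^sub>1 \<oplus> y \<otimes> form V v e\<^sub>2) \<and>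
    (\<forall>v\<in>carrier V. form V v f\<^sub>2 = \<ominus> (form V e\<^sub>2 e\<^sub>2 \<otimes> y) \<otimes> form V v e\<^sub>1 \<oplus> form V e\<^sub>1 e\<^sub>1 \<otimes> x \<otimes> form V v e\<^sub>2)"
proof -
  define a b where "a = form V e\<^sub>1 e\<^sub>1" and "b = form V e\<^sub>2 e\<^sub>2"
  have ec: "e\<^sub>1 \<in> carrier V" "e\<^sub>2 \<in> carrier V" using orth_setD[OF E(1)] E by auto
  have aU: "a \<in> Units R" "b \<in> Units R" using orth_setD[OF E(1)] E by (auto simp: a_def b_def)
  have ac: "a \<in> carrier R" "b \<in> carrier R" "c \<in> carrier R" using aU c(2) by auto
  have e12: "form V e\<^sub>1 e\<^sub>2 = \<zero>" "form V e\<^sub>2 e\<^sub>1 = \<zero>" using orth_setD(4)[OF E(1)] E by auto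
  define f where "f = x \<odot>\<^bsub>V\<^esub> e\<^sub>1 \<oplus>\<^bsub>V\<^esub> y \<odot>\<^bsub>V\<^esub> e\<^sub>2"
  define g where "g = \<ominus> (b \<otimes> y) \<odot>\<^bsub>V\<^esub> e\<^sub>1 \<oplus>\<^bsub>V\<^esub> (a \<otimes> x) \<odot>\<^bsub>V\<^esub> e\<^sub>2"
  have fc: "f \<in> carrier V" "g \<in> carrier V" using ec x ac by (auto simp: f_def g_def)
  have vf: "form V v f = x \<otimes> form V v e\<^sub>1 \<oplus> y \<otimes> form V v e\<^sub>2" if "v \<in> carrier V" for v
    using that ec x by (simp add: f_def form_simps)
  have vg: "form V v g = \<ominus> (b \<otimes> y) \<otimes> form V v e\<^sub>1 \<oplus> a \<otimes> x \<otimes> form V v e\<^sub>2" if "v \<in> carrier V" for v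
    using that ec x ac by (simp add: g_def form_simps)
  have cab: "c = a \<otimes> (x \<otimes> x) \<oplus> b \<otimes> (y \<otimes> y)" using c(1) by (simp add: a_def b_def)
  have fe: "form V f e\<^sub>1 = x \<otimes> a" "form V f e\<^sub>2 = y \<otimes> b"
    using ec x ac e12 by (simp_all add: f_def form_simps a_def[symmetric] b_def[symmetric])
  have ge: "form V g e\<^sub>1 = \<ominus> (b \<otimes> y) \<otimes> a" "form V g e\<^sub>2 = a \<otimes> x \<otimes> b"
    using ec x ac e12 by (simp_all add: g_def form_simps a_def[symmetric] b_def[symmetric])
  have ff: "form V f f = c" unfolding vf[OF fc(1)] fe cab using ac x by algebra
  have gg: "form V g g = a \<otimes> b \<otimes> c" unfolding vg[OF fc(2)] ge cab using ac x by algebra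
  have fg: "form V f g = \<zero>" unfolding vg[OF fc(1)] fe using ac x by algebra
  have gf: "form V g f = \<zero>" using fg form_sym fc by simp
  have gU: "a \<otimes> b \<otimes> c \<in> Units R" using aU c(2) by simp
  let ?K = "E - {e\<^sub>1, e\<^sub>2}"
  have o: "form V k f = \<zero>" "form V k g = \<zero>" "form V f k = \<zero>" "form V g k = \<zero>" "k \<in> carrier V" if k: "k \<in> ?K" for k
  proof -
    show kc: "k \<in> carrier V" using k orth_setD[OF E(1)] by blast
    have "form V k e\<^sub>1 = \<zero>" "form V k e\<^sub>2 = \<zero>" using k E orth_setD(4)[OF E(1)] by auto
    then show "form V k f = \<zero>" "form V k g = \<zero>" using vf[OF kc] vg[OF kc] x ac by simp_all
    then show "form V f k = \<zero>" "form V g k = \<zero>" using form_sym kc fc by simp_all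
  qed
  have ne: "f \<noteq> g" using fg gg gU zero_nonunit by force
  have fK: "f \<notin> ?K" using o(1) ff c(2) zero_nonunit by metis
  have gK: "g \<notin> ?K" using o(2) gg gU zero_nonunit by metis
  have fin: "finite ?K" using orth_setD(1)[OF E(1)] by simp
  have "orth_set (?K \<union> {f, g})"
    unfolding orth_set_def
  proof (intro conjI ballI impI)
    show "finite (?K \<union> {f, g})" using fin by simp
    show "?K \<union> {f, g} \<subseteq> carrier V" using o(5) fc by blast
    show "form V e e \<in> Units R" if "e \<in> ?K \<union> {f, g}" for e
      using that orth_setD(3)[OF E(1)] ff gg c(2) gU by auto
    show "form V e e' = \<zero>" if "e \<in> ?K \<union> {f, g}" "e' \<in> ?K \<union> {f, g}" "e \<noteq> e'" for e e'
      using that orth_setD(4)[OF E(1)] o fg gf by auto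
  qed
  moreover have "perp (?K \<union> {f, g}) = perp E"
  proof -
    have "(form V v f = \<zero> \<and> form V v g = \<zero>) \<longleftrightarrow> (form V v e\<^sub>1 = \<zero> \<and> form V v e\<^sub>2 = \<zero>)" if v: "v \<in> carrier V" for v
    proof
      assume fg0: "form V v f = \<zero> \<and> form V v g = \<zero>"
      define m n where "m = form V v e\<^sub>1" and "n = form V v e\<^sub>2"
      have mn: "m \<in> carrier R" "n \<in> carrier R" using v ec by (auto simp: m_def n_def)
      have F: "x \<otimes> m \<oplus> y \<otimes> n = \<zero>" "\<ominus> (b \<otimes> y) \<otimes> m \<oplus> a \<otimes> x \<otimes> n = \<zero>"
        using fg0 vf[OF v] vg[OF v] by (simp_all add: m_def n_def)
      \<comment> \<open>Cramer's rule: the base change has determinant \<open>c\<close>, a unit, so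
        orthogonality to the new pair gives orthogonality to the old one.\<close>
      have "c \<otimes> m = (a \<otimes> x) \<otimes> (x \<otimes> m \<oplus> y \<otimes> n) \<ominus> y \<otimes> (\<ominus> (b \<otimes> y) \<otimes> m \<oplus> a \<otimes> x \<otimes> n)"
        unfolding cab using ac x mn by algebra
      then have "c \<otimes> m = \<zero>" unfolding F using ac x by (simp add: a_minus_def)
      moreover have "c \<otimes> n = (b \<otimes> y) \<otimes> (x \<otimes> m \<oplus> y \<otimes> n) \<oplus> x \<otimes> (\<ominus> (b \<otimes> y) \<otimes> m \<oplus> a \<otimes> x \<otimes> n)"
        unfolding cab using ac x mn by algebra
      then have "c \<otimes> n = \<zero>" unfolding F using ac x by simp
      ultimately show "form V v e\<^sub>1 = \<zero> \<and> form V v e\<^sub>2 = \<zero>"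
        using unit_times_zero[OF c(2)] mn by (simp add: m_def n_def)
    next
      assume "form V v e\<^sub>1 = \<zero> \<and> form V v e\<^sub>2 = \<zero>"
      then show "form V v f = \<zero> \<and> form V v g = \<zero>" using vf[OF v] vg[OF v] x ac by simp
    qed
    then show ?thesis unfolding perp_def using E(2,3) by blast
  qed
  moreover have "diag_sum E \<approx> diag_sum (?K \<union> {f, g})"
  proof -
    have "E = insert e\<^sub>1 (insert e\<^sub>2 ?K)" using E by blast
    then have "diag_sum E = frag_of a + (frag_of b + diag_sum ?K)"
      using fin E(4) unfolding diag_sum_def a_def b_def by (metis (no_types, lifting) Diff_iff finite_insert insertE insertI1 insertI2 sum.insert)
    moreover have "diag_sum (?K \<union> {f, g}) = frag_of c + (frag_of (a \<otimes> b \<otimes> c) + diag_sum ?K)"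
    proof -
      have "?K \<union> {f, g} = insert f (insert g ?K)" by blast
      then show ?thesis using fin ne fK gK ff gg by (simp add: diag_sum_def)
    qed
    moreover have "frag_of a + frag_of b \<approx> frag_of c + frag_of (a \<otimes> b \<otimes> c)"
      by (rule frag_plane[OF aU x cab c(2)])
    ultimately show ?thesis
      using cong_add[OF \<open>frag_of a + frag_of b \<approx> _\<close> cong_refl, of "diag_sum ?K"] by (simp add: add.assoc)
  qed
  ultimately show ?thesis
    using ne fK gK fc ff gg vf vg unfolding a_def b_def by blast
qed

text \<open>Rotate towards the projection of \<open>f\<close> to the plane, with coordinates m/a and
  n/b. Its norm \<open>c\<close> is the sum of the two contributions, the complementary vector is
  orthogonal to \<open>f\<close>, and the whole contribution c^2/c passes to the first
  vector.\<close>

lemma combine: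
  assumes E: "orth_set E" "e\<^sub>1 \<in> E" "e\<^sub>2 \<in> E" "e\<^sub>1 \<noteq> e\<^sub>2" and f: "f \<in> carrier V"
    and u: "coef f e\<^sub>1 \<oplus> coef f e\<^sub>2 \<in> Units R"
  shows "\<exists>f\<^sub>1 f\<^sub>2. f\<^sub>1 \<noteq> f\<^sub>2 \<and> f\<^sub>1 \<notin> E - {e\<^sub>1, e\<^sub>2} \<and> f\<^sub>2 \<notin> E - {e\<^sub>1, e\<^sub>2} \<and>
    orth_set (E - {e\<^sub>1, e\<^sub>2} \<union> {f\<^sub>1, f\<^sub>2}) \<and> perp (E - {e\<^sub>1, e\<^sub>2} \<union> {f\<^sub>1, f\<^sub>2}) = perp E \<and>
    diag_sum E \<approx> diag_sum (E - {e\<^sub>1, e\<^sub>2} \<union> {f\<^sub>1, f\<^sub>2}) \<and>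
    form V f f\<^sub>2 = \<zero> \<and> coef f f\<^sub>1 = coef f e\<^sub>1 \<oplus> coef f e\<^sub>2"
proof -
  define a b m n where "a = form V e\<^sub>1 e\<^sub>1" and "b = form V e\<^sub>2 e\<^sub>2" and "m = form V f e\<^sub>1" and "n = form V f e\<^sub>2"
  define i j where "i = inv a" and "j = inv b"
  have aU: "a \<in> Units R" "b \<in> Units R" using orth_setD[OF E(1)] E by (auto simp: a_def b_def)
  have cl: "a \<in> carrier R" "b \<in> carrier R" "m \<in> carrier R" "n \<in> carrier R" "i \<in> carrier R" "j \<in> carrier R"
    using aU f orth_setD[OF E(1)] E by (auto simp: m_def n_def i_def j_def)
  have ai: "a \<otimes> i = \<one>" "b \<otimes> j = \<one>" using aU by (auto simp: i_def j_def)
  have co: "coef f e\<^sub>1 = m \<otimes> m \<otimes> i" "coef f e\<^sub>2 = n \<otimes> n \<otimes> j"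
    by (simp_all add: coef_def a_def b_def m_def n_def i_def j_def)
  define c where "c = coef f e\<^sub>1 \<oplus> coef f e\<^sub>2"
  have cU: "c \<in> Units R" using u by (simp add: c_def)
  have c: "c = a \<otimes> (m \<otimes> i \<otimes> (m \<otimes> i)) \<oplus> b \<otimes> (n \<otimes> j \<otimes> (n \<otimes> j))"
  proof -
    have "a \<otimes> (m \<otimes> i \<otimes> (m \<otimes> i)) \<oplus> b \<otimes> (n \<otimes> j \<otimes> (n \<otimes> j)) =
        (a \<otimes> i) \<otimes> (m \<otimes> m \<otimes> i) \<oplus> (b \<otimes> j) \<otimes> (n \<otimes> n \<otimes> j)" using cl by algebra
    then show ?thesis using cl by (simp add: ai co c_def)
  qed
  obtain f\<^sub>1 f\<^sub>2 where F: "f\<^sub>1 \<noteq> f\<^sub>2" "f\<^sub>1 \<notin> E - {e\<^sub>1, e\<^sub>2}" "f\<^sub>2 \<notin> E - {e\<^sub>1, e\<^sub>2}"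
    "orth_set (E - {e\<^sub>1, e\<^sub>2} \<union> {f\<^sub>1, f\<^sub>2})" "perp (E - {e\<^sub>1, e\<^sub>2} \<union> {f\<^sub>1, f\<^sub>2}) = perp E"
    "diag_sum E \<approx> diag_sum (E - {e\<^sub>1, e\<^sub>2} \<union> {f\<^sub>1, f\<^sub>2})" "form V f\<^sub>1 f\<^sub>1 = c"
    "\<forall>v\<in>carrier V. form V v f\<^sub>1 = m \<otimes> i \<otimes> form V v e\<^sub>1 \<oplus> n \<otimes> j \<otimes> form V v e\<^sub>2"
    "\<forall>v\<in>carrier V. form V v f\<^sub>2 = \<ominus> (form V e\<^sub>2 e\<^sub>2 \<otimes> (n \<otimes> j)) \<otimes> form V v e\<^sub>1 \<oplus> form V e\<^sub>1 e\<^sub>1 \<otimes> (m \<otimes> i) \<otimes> form V v e\<^sub>2"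
    using mix[OF E, of "m \<otimes> i" "n \<otimes> j" c] cl c cU unfolding a_def b_def by auto
  have "form V f f\<^sub>2 = \<ominus> (b \<otimes> (n \<otimes> j)) \<otimes> m \<oplus> a \<otimes> (m \<otimes> i) \<otimes> n"
    using F(9) f by (simp add: a_def b_def m_def n_def)
  also have "\<dots> = (a \<otimes> i) \<otimes> (m \<otimes> n) \<ominus> (b \<otimes> j) \<otimes> (m \<otimes> n)" using cl by algebra
  also have "\<dots> = \<zero>" using cl by (simp add: ai a_minus_def R.r_neg)
  finally have z: "form V f f\<^sub>2 = \<zero>" .
  have "form V f f\<^sub>1 = m \<otimes> i \<otimes> m \<oplus> n \<otimes> j \<otimes> n" using F(8) f by (simp add: m_def n_def)
  also have "\<dots> = c" unfolding c_def co using cl by algebra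
  finally have "coef f f\<^sub>1 = c \<otimes> c \<otimes> inv c" using F(7) by (simp add: coef_def)
  also have "\<dots> = c" using cU by (simp add: R.m_assoc R.Units_closed)
  finally show ?thesis using F z unfolding c_def by blast
qed

lemma max_diff: "x \<in> \<mm> \<Longrightarrow> y \<in> \<mm> \<Longrightarrow> x \<ominus> y \<in> \<mm>"
  unfolding a_minus_def by (intro max_add max_uminus)

lemma max_mult_unit: "u \<in> Units R \<Longrightarrow> x \<in> carrier R \<Longrightarrow> u \<otimes> x \<in> \<mm> \<Longrightarrow> x \<in> \<mm>"
  by (meson R.Units_m_closed not_in_max_unit unit_not_in_max)

lemma square_finsum_mod:
  assumes two: "\<one> \<oplus> \<one> \<in> \<mm>" and "finite A" "\<And>a. a \<in> A \<Longrightarrow> h a \<in> carrier R"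
  shows "(\<Oplus>a\<in>A. h a) \<otimes> (\<Oplus>a\<in>A. h a) \<ominus> (\<Oplus>a\<in>A. h a \<otimes> h a) \<in> \<mm>"
  using assms(2,3)
proof (induction A rule: finite_induct)
  case empty
  then show ?case by (simp add: a_minus_def max_zero)
next
  case (insert a A)
  define s t where "s = (\<Oplus>a\<in>A. h a)" and "t = (\<Oplus>a\<in>A. h a \<otimes> h a)"
  have cl: "h a \<in> carrier R" "s \<in> carrier R" "t \<in> carrier R"
    using insert.prems by (auto simp: s_def t_def intro!: R.finsum_closed)
  have "(h a \<oplus> s) \<otimes> (h a \<oplus> s) \<ominus> (h a \<otimes> h a \<oplus> t) = (s \<otimes> s \<ominus> t) \<oplus> (\<one> \<oplus> \<one>) \<otimes> (h a \<otimes> s)"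
    using cl by algebra
  also have "\<dots> \<in> \<mm>"
  proof (rule max_add)
    show "s \<otimes> s \<ominus> t \<in> \<mm>" using insert by (simp add: s_def t_def)
    show "(\<one> \<oplus> \<one>) \<otimes> (h a \<otimes> s) \<in> \<mm>" using cl by (intro I_r_closed[OF two]) simp
  qed
  finally show ?case using insert cl by (simp add: s_def t_def)
qed

lemma in_span_perp_cong: "perp E = perp E' \<Longrightarrow> in_span E f \<longleftrightarrow> in_span E' f"
  by (simp add: in_span_def)

text \<open>One of 1 and \<open>s\<close> works: the two values differ by b (1 - s)(1 + s), and 1 +
  s is congruent to the unit 1 - s as 2 lies in \<open>\<mm>\<close>.\<close>

lemma unit_translate:
  assumes "\<one> \<oplus> \<one> \<in> \<mm>" "a \<in> Units R" "b \<in> Units R"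
  shows "\<exists>t\<in>Units R. a \<oplus> b \<otimes> (t \<otimes> t) \<in> Units R"
proof (rule ccontr)
  assume "\<not> ?thesis"
  then have n: "a \<oplus> b \<otimes> (t \<otimes> t) \<notin> Units R" if "t \<in> Units R" for t using that by blast
  obtain s where s: "s \<in> Units R" "\<one> \<ominus> s \<in> Units R" using residue by blast
  have cl: "a \<in> carrier R" "b \<in> carrier R" "s \<in> carrier R" using assms s by auto
  have "a \<oplus> b \<otimes> (t \<otimes> t) \<in> \<mm>" if "t \<in> Units R" for t
  proof (rule ccontr)
    assume "a \<oplus> b \<otimes> (t \<otimes> t) \<notin> \<mm>"
    moreover have "a \<oplus> b \<otimes> (t \<otimes> t) \<in> carrier R" using cl R.Units_closed[OF that] by simp
    ultimately show False using n[OF that] not_in_max_unit by blast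
  qed
  then have "a \<oplus> b \<otimes> (\<one> \<otimes> \<one>) \<in> \<mm>" "a \<oplus> b \<otimes> (s \<otimes> s) \<in> \<mm>"
    using R.Units_one_closed s(1) by blast+
  then have "(a \<oplus> b \<otimes> (\<one> \<otimes> \<one>)) \<ominus> (a \<oplus> b \<otimes> (s \<otimes> s)) \<in> \<mm>" by (rule max_diff)
  moreover have "(a \<oplus> b \<otimes> (\<one> \<otimes> \<one>)) \<ominus> (a \<oplus> b \<otimes> (s \<otimes> s)) = b \<otimes> ((\<one> \<ominus> s) \<otimes> ((\<one> \<ominus> s) \<oplus> (\<one> \<oplus> \<one>) \<otimes> s))"
    using cl by algebra
  moreover have "(\<one> \<ominus> s) \<oplus> (\<one> \<oplus> \<one>) \<otimes> s \<in> Units R"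
    using s(2) cl by (intro unit_add_max I_r_closed[OF assms(1)])
  ultimately show False using assms(3) s(2) unit_not_in_max by (metis R.Units_m_closed)
qed

lemma unit_factor:
  assumes "a \<in> carrier R" "b \<in> carrier R" "a \<otimes> b \<in> Units R"
  shows "a \<in> Units R"
  using assms I_r_closed[of a b] not_in_max_unit unit_not_in_max by blast

lemma isolate_stuck:
  assumes E: "orth_set E" and f: "form V f f \<in> Units R" "in_span E f"
    and g: "form V f g = \<zero>" "form V g g \<in> Units R" "in_span E g"
    and norm: "form V f f = (\<Oplus>e\<in>support E f. coef f e)"
    and stuck: "\<And>e\<^sub>1 e\<^sub>2. e\<^sub>1 \<in> support E f \<Longrightarrow> e\<^sub>2 \<in> support E f \<Longrightarrow> e\<^sub>1 \<noteq> e\<^sub>2 \<Longrightarrow> coef f e\<^sub>1 \<oplus> coef f e\<^sub>2 \<in> \<mm>"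
    and two_elements: "\<not> (\<exists>e\<in>E. support E f \<subseteq> {e})"
  shows "\<exists>E'. orth_set E' \<and> perp E' = perp E \<and> diag_sum E \<approx> diag_sum E' \<and>
    card (support E' f) < card (support E f)"
proof -
  let ?S = "support E f"
  have fc: "f \<in> carrier V" and gc: "g \<in> carrier V" using f g by (auto simp: in_span_def)
  have SE: "?S \<subseteq> E" by (auto simp: support_def)
  have fin: "finite E" "finite ?S" using orth_setD(1)[OF E] by (auto simp: support_def)
  have coefc: "coef f e \<in> carrier R" if "e \<in> E" for e using coef_closed[OF E that fc] .
  have "?S \<noteq> {}"
  proof
    assume "?S = {}"
    then have "form V f f = \<zero>" unfolding norm by simp
    then show False using f(1) zero_nonunit by simp
  qed
  then obtain e\<^sub>1 where e1: "e\<^sub>1 \<in> ?S" by blast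
  then obtain e\<^sub>2 where e2: "e\<^sub>2 \<in> ?S" "e\<^sub>2 \<noteq> e\<^sub>1" using two_elements SE by blast
  \<comment> \<open>With exactly two members, the norm of \<open>f\<close> would be a sum that lies
    in \<open>\<mm>\<close> by \<open>stuck\<close>.\<close>
  have "?S \<noteq> {e\<^sub>1, e\<^sub>2}"
  proof
    assume S: "?S = {e\<^sub>1, e\<^sub>2}"
    have "(\<Oplus>e\<in>{e\<^sub>1, e\<^sub>2}. coef f e) = coef f e\<^sub>1 \<oplus> coef f e\<^sub>2"
      using e1 e2 SE coefc by (subst R.finsum_insert) auto
    then have "form V f f \<in> \<mm>" using norm stuck[OF e1 e2(1) e2(2)[symmetric]] by (simp add: S)
    then show False using f(1) unit_not_in_max by blast
  qed
  then obtain e\<^sub>3 where e3: "e\<^sub>3 \<in> ?S" "e\<^sub>3 \<noteq> e\<^sub>1" "e\<^sub>3 \<noteq> e\<^sub>2" using e1 e2 by blast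
  have eE: "e\<^sub>1 \<in> E" "e\<^sub>2 \<in> E" "e\<^sub>3 \<in> E" using e1 e2 e3 SE by auto
  have not_all: "\<exists>e\<in>?S. coef f e \<notin> \<mm>"
  proof (rule ccontr)
    assume "\<not> ?thesis"
    then have "form V f f \<in> \<mm>" unfolding norm using fin by (intro max_finsum) auto
    then show False using f(1) unit_not_in_max by blast
  qed
  have two: "\<one> \<oplus> \<one> \<in> \<mm>"
  proof (rule ccontr)
    assume "\<one> \<oplus> \<one> \<notin> \<mm>"
    then have U: "\<one> \<oplus> \<one> \<in> Units R" using not_in_max_unit[of "\<one> \<oplus> \<one>"] R.one_closed R.a_closed by blast
    have "coef f e \<in> \<mm>" if e: "e \<in> ?S" for e
    proof -
      \<comment> \<open>Three distinct members express twice a contribution through stuck pairs: 2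
        c_e = (c_e + c_a) + (c_e + c_b) - (c_a + c_b). Were 2 a unit, all contributions would lie in
        \<open>\<mm>\<close>.\<close>
      obtain a b where ab: "a \<in> ?S" "b \<in> ?S" "a \<noteq> b" "a \<noteq> e" "b \<noteq> e" using e1 e2 e3 by metis
      have c: "coef f e \<in> carrier R" "coef f a \<in> carrier R" "coef f b \<in> carrier R" using e ab SE coefc by auto
      have "(coef f e \<oplus> coef f a) \<oplus> (coef f e \<oplus> coef f b) \<ominus> (coef f a \<oplus> coef f b) \<in> \<mm>"
        by (rule max_diff[OF max_add[OF stuck stuck] stuck]) (use e ab in auto)
      moreover have "(coef f e \<oplus> coef f a) \<oplus> (coef f e \<oplus> coef f b) \<ominus> (coef f a \<oplus> coef f b) = (\<one> \<oplus> \<one>) \<otimes> coef f e"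
        using c by algebra
      ultimately show ?thesis using max_mult_unit[OF U c(1)] by simp
    qed
    then show False using not_all by blast
  qed
  have cmod: "coef f a \<ominus> coef f b \<in> \<mm>" if ab: "a \<in> ?S" "b \<in> ?S" for a b
  proof (cases "a = b")
    case True
    have "coef f b \<in> carrier R" using ab SE coefc by blast
    then show ?thesis using True max_zero by (simp add: a_minus_def R.r_neg)
  next
    case False
    have c: "coef f a \<in> carrier R" "coef f b \<in> carrier R" using ab SE coefc by auto
    have "(coef f a \<oplus> coef f b) \<ominus> (\<one> \<oplus> \<one>) \<otimes> coef f b \<in> \<mm>"
      using stuck[OF ab False] I_r_closed[OF two c(2)] by (rule max_diff)
    moreover have "(coef f a \<oplus> coef f b) \<ominus> (\<one> \<oplus> \<one>) \<otimes> coef f b = coef f a \<ominus> coef f b" using c by algebra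
    ultimately show ?thesis by simp
  qed
  have cU: "coef f e \<in> Units R" if e: "e \<in> ?S" for e
  proof (rule ccontr)
    assume n: "coef f e \<notin> Units R"
    have ec: "coef f e \<in> carrier R" using e SE coefc by blast
    then have em: "coef f e \<in> \<mm>" using n not_in_max_unit by blast
    have "coef f a \<in> \<mm>" if a: "a \<in> ?S" for a
    proof -
      have ac: "coef f a \<in> carrier R" using a SE coefc by blast
      have "(coef f a \<ominus> coef f e) \<oplus> coef f e \<in> \<mm>" using cmod[OF a e] em by (rule max_add)
      moreover have "(coef f a \<ominus> coef f e) \<oplus> coef f e = coef f a" using ac ec by algebra
      ultimately show ?thesis by simp
    qed
    then show False using not_all by blast
  qed
  show ?thesis
  proof (cases "?S = E")
    case True
    \<comment> \<open>The terms \<open>h e\<close> add up to the product of \<open>f\<close> and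
      \<open>g\<close>, which is zero, and the square of \<open>h e\<close> is
      \<open>coef f e\<close> times \<open>coef g e\<close>. Squaring being additive modulo
      \<open>\<mm>\<close> and all \<open>coef f e\<close> congruent, the norm of \<open>g\<close>
      times a unit lies in \<open>\<mm>\<close>.\<close>
    define h where "h = (\<lambda>e. form V f e \<otimes> form V e g \<otimes> inv (form V e e))"
    have cl: "form V f e \<in> carrier R" "form V e g \<in> carrier R" "inv (form V e e) \<in> carrier R"
      "coef g e \<in> carrier R" "h e \<in> carrier R" if "e \<in> E" for e
      using that orth_setD(2,3)[OF E that] fc gc coef_closed[OF E that gc] by (auto simp: h_def)
    have hh: "h e \<otimes> h e = coef f e \<otimes> coef g e" if e: "e \<in> E" for e
    proof -
      have "form V g e = form V e g" using orth_setD(2)[OF E e] gc form_sym by blast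
      then show ?thesis unfolding h_def coef_def using cl(1-3)[OF e] by (simp add: R.m_ac)
    qed
    have "(\<Oplus>e\<in>E. h e) \<otimes> (\<Oplus>e\<in>E. h e) \<ominus> (\<Oplus>e\<in>E. h e \<otimes> h e) \<in> \<mm>"
      using square_finsum_mod[OF two fin(1)] cl(5) by blast
    moreover have "(\<Oplus>e\<in>E. h e) = \<zero>" using parseval[OF E fc g(3)] g(1) by (simp add: h_def)
    ultimately have "\<zero> \<ominus> (\<Oplus>e\<in>E. h e \<otimes> h e) \<in> \<mm>" by simp
    from max_uminus[OF this] have s: "(\<Oplus>e\<in>E. h e \<otimes> h e) \<in> \<mm>"
      using cl by (simp add: a_minus_def R.finsum_closed Pi_def)
    have d: "(\<Oplus>e\<in>E. (coef f e\<^sub>1 \<ominus> coef f e) \<otimes> coef g e) \<in> \<mm>"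
    proof (rule max_finsum[OF fin(1)], rule Pi_I)
      fix e assume e: "e \<in> E"
      show "(coef f e\<^sub>1 \<ominus> coef f e) \<otimes> coef g e \<in> \<mm>"
        using e e1 True cl(4)[OF e] by (intro I_r_closed[OF cmod]) auto
    qed
    have "coef f e\<^sub>1 \<otimes> form V g g = (\<Oplus>e\<in>E. coef f e\<^sub>1 \<otimes> coef g e)"
      unfolding parseval_norm[OF E g(3)] using cl(4) coefc eE fin by (intro R.finsum_rdistr) auto
    also have "\<dots> = (\<Oplus>e\<in>E. h e \<otimes> h e \<oplus> (coef f e\<^sub>1 \<ominus> coef f e) \<otimes> coef g e)"
    proof (rule R.finsum_cong')
      fix e assume e: "e \<in> E"
      have "coef f e\<^sub>1 \<otimes> coef g e = coef f e \<otimes> coef g e \<oplus> (coef f e\<^sub>1 \<ominus> coef f e) \<otimes> coef g e"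
        using coefc[OF e] coefc[OF eE(1)] cl(4)[OF e] by algebra
      then show "coef f e\<^sub>1 \<otimes> coef g e = h e \<otimes> h e \<oplus> (coef f e\<^sub>1 \<ominus> coef f e) \<otimes> coef g e" by (simp only: hh[OF e])
    qed (use cl coefc eE in auto)
    also have "\<dots> = (\<Oplus>e\<in>E. h e \<otimes> h e) \<oplus> (\<Oplus>e\<in>E. (coef f e\<^sub>1 \<ominus> coef f e) \<otimes> coef g e)"
      using cl coefc eE by (intro R.finsum_addf) auto
    also have "\<dots> \<in> \<mm>" using s d by (rule max_add)
    finally have "form V g g \<in> \<mm>"
      using max_mult_unit[OF cU[OF e1]] g(2) by blast
    then show ?thesis using g(2) unit_not_in_max by blast
  next
    case False
    then obtain e\<^sub>0 where e0: "e\<^sub>0 \<in> E" "e\<^sub>0 \<notin> ?S" using SE by blast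
    then have n0: "form V f e\<^sub>0 = \<zero>" by (simp add: support_def)
    define q\<^sub>1 q\<^sub>0 n where "q\<^sub>1 = form V e\<^sub>1 e\<^sub>1" and "q\<^sub>0 = form V e\<^sub>0 e\<^sub>0" and "n = form V f e\<^sub>1"
    have qU: "q\<^sub>1 \<in> Units R" "q\<^sub>0 \<in> Units R" using orth_setD(3)[OF E] eE e0 by (auto simp: q\<^sub>1_def q\<^sub>0_def)
    \<comment> \<open>Rotating \<open>e\<^sub>1\<close> towards \<open>e\<^sub>0\<close> leaves its
      product \<open>n\<close> with \<open>f\<close> unchanged but turns its norm
      \<open>q\<^sub>1\<close> into \<open>A\<close>. The contribution drops by the unit n^2
      \<open>q\<^sub>0\<close> t^2 / (\<open>q\<^sub>1\<close> A), so it is no longer congruent to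
      the others.\<close>
    obtain t where t: "t \<in> Units R" "q\<^sub>1 \<oplus> q\<^sub>0 \<otimes> (t \<otimes> t) \<in> Units R" using unit_translate[OF two qU] by blast
    define A where "A = q\<^sub>1 \<oplus> q\<^sub>0 \<otimes> (t \<otimes> t)"
    define i j where "i = inv q\<^sub>1" and "j = inv A"
    have AU: "A \<in> Units R" using t by (simp add: A_def)
    have cl: "q\<^sub>1 \<in> carrier R" "q\<^sub>0 \<in> carrier R" "t \<in> carrier R" "A \<in> carrier R" "i \<in> carrier R" "j \<in> carrier R"
      "n \<in> carrier R"
      using qU t AU fc orth_setD(2)[OF E eE(1)] by (auto simp: i_def j_def n_def)
    have ij: "q\<^sub>1 \<otimes> i = \<one>" "A \<otimes> j = \<one>" using qU AU by (auto simp: i_def j_def)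
    have ne10: "e\<^sub>1 \<noteq> e\<^sub>0" "e\<^sub>2 \<noteq> e\<^sub>0" "e\<^sub>3 \<noteq> e\<^sub>0" using e0 e1 e2 e3 by auto
    have A': "A = form V e\<^sub>1 e\<^sub>1 \<otimes> (\<one> \<otimes> \<one>) \<oplus> form V e\<^sub>0 e\<^sub>0 \<otimes> (t \<otimes> t)"
      using cl by (simp add: A_def q\<^sub>1_def[symmetric] q\<^sub>0_def[symmetric])
    obtain f\<^sub>1 f\<^sub>2 where F: "f\<^sub>1 \<noteq> f\<^sub>2" "f\<^sub>1 \<notin> E - {e\<^sub>1, e\<^sub>0}"
      "orth_set (E - {e\<^sub>1, e\<^sub>0} \<union> {f\<^sub>1, f\<^sub>2})" "perp (E - {e\<^sub>1, e\<^sub>0} \<union> {f\<^sub>1, f\<^sub>2}) = perp E"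
      "diag_sum E \<approx> diag_sum (E - {e\<^sub>1, e\<^sub>0} \<union> {f\<^sub>1, f\<^sub>2})"
      "form V f\<^sub>1 f\<^sub>1 = A" "\<forall>v\<in>carrier V. form V v f\<^sub>1 = \<one> \<otimes> form V v e\<^sub>1 \<oplus> t \<otimes> form V v e\<^sub>0"
      using mix[OF E eE(1) e0(1) ne10(1) R.one_closed cl(3) A' AU] by auto
    define E\<^sub>1 where "E\<^sub>1 = E - {e\<^sub>1, e\<^sub>0} \<union> {f\<^sub>1, f\<^sub>2}"
    note E1 = F(3-5)[folded E\<^sub>1_def]
    have "form V f f\<^sub>1 = n" using F(7) fc cl n0 by (simp add: n_def)
    then have cf: "coef f f\<^sub>1 = n \<otimes> n \<otimes> j" by (simp add: coef_def F(6) j_def)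
    have c1: "coef f e\<^sub>1 = n \<otimes> n \<otimes> i" by (simp add: coef_def n_def i_def q\<^sub>1_def)
    have nn: "n \<otimes> n \<in> Units R"
      using unit_factor[of "n \<otimes> n" i] cU[OF e1] cl by (simp add: c1)
    have "n \<otimes> n \<otimes> i \<ominus> n \<otimes> n \<otimes> j = (n \<otimes> n) \<otimes> i \<otimes> (A \<otimes> j) \<ominus> (n \<otimes> n) \<otimes> j \<otimes> (q\<^sub>1 \<otimes> i)"
      using cl by (simp add: ij)
    also have "\<dots> = (n \<otimes> n) \<otimes> i \<otimes> j \<otimes> q\<^sub>0 \<otimes> (t \<otimes> t)"
      unfolding A_def using cl by algebra
    finally have dU: "n \<otimes> n \<otimes> i \<ominus> n \<otimes> n \<otimes> j \<in> Units R"
      using nn qU AU t by (simp add: i_def j_def)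
    have c2: "coef f e\<^sub>2 \<in> carrier R" "coef f e\<^sub>3 \<in> carrier R" using coefc eE by auto
    have jU: "coef f f\<^sub>1 \<in> Units R" unfolding cf using nn AU by (simp add: j_def)
    \<comment> \<open>The old pair summed to an element of \<open>\<mm>\<close>, and one
      contribution has moved by a unit.\<close>
    have u2: "coef f f\<^sub>1 \<oplus> coef f e\<^sub>2 \<in> Units R"
    proof -
      have "\<ominus> (n \<otimes> n \<otimes> i \<ominus> n \<otimes> n \<otimes> j) \<oplus> (coef f e\<^sub>1 \<oplus> coef f e\<^sub>2) \<in> Units R"
        by (rule unit_add_max[OF minus_unit[OF dU] stuck[OF e1 e2(1) e2(2)[symmetric]]])
      moreover have "\<ominus> (n \<otimes> n \<otimes> i \<ominus> n \<otimes> n \<otimes> j) \<oplus> (coef f e\<^sub>1 \<oplus> coef f e\<^sub>2) = coef f f\<^sub>1 \<oplus> coef f e\<^sub>2"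
        unfolding cf c1 using cl c2 by algebra
      ultimately show ?thesis by simp
    qed
    have m1: "f\<^sub>1 \<in> E\<^sub>1" "e\<^sub>2 \<in> E\<^sub>1" "f\<^sub>1 \<noteq> e\<^sub>2" "f\<^sub>1 \<noteq> e\<^sub>3" using eE e2 e3 ne10 F(2) by (auto simp: E\<^sub>1_def)
    obtain h\<^sub>1 h\<^sub>2 where H: "h\<^sub>1 \<notin> E\<^sub>1 - {f\<^sub>1, e\<^sub>2}"
      "orth_set (E\<^sub>1 - {f\<^sub>1, e\<^sub>2} \<union> {h\<^sub>1, h\<^sub>2})" "perp (E\<^sub>1 - {f\<^sub>1, e\<^sub>2} \<union> {h\<^sub>1, h\<^sub>2}) = perp E\<^sub>1"
      "diag_sum E\<^sub>1 \<approx> diag_sum (E\<^sub>1 - {f\<^sub>1, e\<^sub>2} \<union> {h\<^sub>1, h\<^sub>2})"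
      "form V f h\<^sub>2 = \<zero>" "coef f h\<^sub>1 = coef f f\<^sub>1 \<oplus> coef f e\<^sub>2"
      using combine[OF E1(1) m1(1-3) fc u2] by auto
    define E\<^sub>2 where "E\<^sub>2 = E\<^sub>1 - {f\<^sub>1, e\<^sub>2} \<union> {h\<^sub>1, h\<^sub>2}"
    note E2 = H(2-4)[folded E\<^sub>2_def]
    have e3': "e\<^sub>3 \<in> E\<^sub>1 - {f\<^sub>1, e\<^sub>2}" using eE e3 ne10 m1 by (auto simp: E\<^sub>1_def)
    have m2: "h\<^sub>1 \<in> E\<^sub>2" "e\<^sub>3 \<in> E\<^sub>2" "h\<^sub>1 \<noteq> e\<^sub>3" using e3' H(1) unfolding E\<^sub>2_def by auto
    \<comment> \<open>\<open>h\<^sub>1\<close> carries the contributions of \<open>f\<^sub>1\<close>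
      and \<open>e\<^sub>2\<close>. Those of \<open>e\<^sub>2\<close> and \<open>e\<^sub>3\<close>
      add up to an element of \<open>\<mm>\<close>, which leaves the unit
      \<open>coef f f\<^sub>1\<close>.\<close>
    have u3: "coef f h\<^sub>1 \<oplus> coef f e\<^sub>3 \<in> Units R"
    proof -
      have "coef f f\<^sub>1 \<oplus> (coef f e\<^sub>2 \<oplus> coef f e\<^sub>3) \<in> Units R"
        by (rule unit_add_max[OF jU stuck[OF e2(1) e3(1) e3(3)[symmetric]]])
      then show ?thesis unfolding H(6) using c2 R.Units_closed[OF jU] by (simp add: R.a_assoc)
    qed
    obtain k\<^sub>1 k\<^sub>2 where K:
      "orth_set (E\<^sub>2 - {h\<^sub>1, e\<^sub>3} \<union> {k\<^sub>1, k\<^sub>2})" "perp (E\<^sub>2 - {h\<^sub>1, e\<^sub>3} \<union> {k\<^sub>1, k\<^sub>2}) = perp E\<^sub>2"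
      "diag_sum E\<^sub>2 \<approx> diag_sum (E\<^sub>2 - {h\<^sub>1, e\<^sub>3} \<union> {k\<^sub>1, k\<^sub>2})" "form V f k\<^sub>2 = \<zero>"
      using combine[OF E2(1) m2 fc u3] by auto
    define E\<^sub>3 where "E\<^sub>3 = E\<^sub>2 - {h\<^sub>1, e\<^sub>3} \<union> {k\<^sub>1, k\<^sub>2}"
    note E3 = K(1-3)[folded E\<^sub>3_def]
    \<comment> \<open>Of the new vectors only \<open>k\<^sub>1\<close> and \<open>f\<^sub>2\<close>
      can have nonzero product with \<open>f\<close>: two in exchange for three.\<close>
    have "support E\<^sub>3 f \<subseteq> insert k\<^sub>1 (insert f\<^sub>2 (?S - {e\<^sub>1, e\<^sub>2, e\<^sub>3}))"
      using K(4) H(5) by (auto simp: support_def E\<^sub>3_def E\<^sub>2_def E\<^sub>1_def)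
    then have "card (support E\<^sub>3 f) \<le> card (insert k\<^sub>1 (insert f\<^sub>2 (?S - {e\<^sub>1, e\<^sub>2, e\<^sub>3})))"
      using fin by (intro card_mono) auto
    also have "\<dots> \<le> Suc (Suc (card (?S - {e\<^sub>1, e\<^sub>2, e\<^sub>3})))" using fin by (simp add: card_insert_if)
    also have "\<dots> < card ?S"
      using e1 e2 e3 fin card_mono[of ?S "{e\<^sub>1, e\<^sub>2, e\<^sub>3}"] by (simp add: card_Diff_subset)
    finally have "card (support E\<^sub>3 f) < card ?S" .
    moreover have "diag_sum E \<approx> diag_sum E\<^sub>3" using E1(3) E2(3) E3(3) cong_trans by blast
    ultimately show ?thesis using E1(2) E2(2) E3(1,2) by auto
  qed
qed

text \<open>Descent on the size of the support: \<open>combine\<close> lowers it if two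
  contributions add up to a unit, \<open>isolate_stuck\<close> otherwise. All hypotheses on
  \<open>f\<close> and \<open>g\<close> depend on \<open>E\<close> only through its complement,
  hence persist.\<close>

lemma isolate:
  assumes E: "orth_set E" and f: "in_span E f" "form V f f \<in> Units R"
    and g: "in_span E g" "form V f g = \<zero>" "form V g g \<in> Units R"
  shows "\<exists>E' e. orth_set E' \<and> perp E' = perp E \<and> diag_sum E \<approx> diag_sum E' \<and> e \<in> E' \<and> support E' f \<subseteq> {e}"
  using E f(1) g(1)
proof (induction "card (support E f)" arbitrary: E rule: less_induct)
  case less
  note E = less.prems(1) and fE = less.prems(2) and gE = less.prems(3)
  have fc: "f \<in> carrier V" and gc: "g \<in> carrier V" using fE gE by (auto simp: in_span_def)
  have fin: "finite E" "finite (support E f)" using orth_setD(1)[OF E] by (auto simp: support_def)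
  have coefc: "coef f e \<in> carrier R" if "e \<in> E" for e using coef_closed[OF E that fc] .
  have norm: "form V f f = (\<Oplus>e\<in>support E f. coef f e)"
    unfolding parseval_norm[OF E fE]
  proof (rule R.finsum_mono_neutral[OF fin(1), symmetric])
    show "coef f e = \<zero>" if "e \<in> E - support E f" for e
      using that orth_setD(3)[OF E, of e] by (auto simp: support_def coef_def)
  qed (use coefc in \<open>auto simp: support_def\<close>)
  have pass: ?case
    if E': "orth_set E'" "perp E' = perp E" "diag_sum E \<approx> diag_sum E'" "card (support E' f) < card (support E f)" for E'
  proof -
    obtain E'' e where "orth_set E''" "perp E'' = perp E'" "diag_sum E' \<approx> diag_sum E''" "e \<in> E''" "support E'' f \<subseteq> {e}"
      using less.hyps[OF E'(4,1)] in_span_perp_cong[OF E'(2)] fE gE by blast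
    then show ?thesis using E'(2) cong_trans[OF E'(3)] by metis
  qed
  show ?case
  proof (cases "\<exists>e\<^sub>1\<in>support E f. \<exists>e\<^sub>2\<in>support E f. e\<^sub>1 \<noteq> e\<^sub>2 \<and> coef f e\<^sub>1 \<oplus> coef f e\<^sub>2 \<in> Units R")
    case True
    then obtain e\<^sub>1 e\<^sub>2 where e: "e\<^sub>1 \<in> support E f" "e\<^sub>2 \<in> support E f" "e\<^sub>1 \<noteq> e\<^sub>2" "coef f e\<^sub>1 \<oplus> coef f e\<^sub>2 \<in> Units R" by blast
    then have eE: "e\<^sub>1 \<in> E" "e\<^sub>2 \<in> E" by (auto simp: support_def)
    obtain f\<^sub>1 f\<^sub>2 where F: "orth_set (E - {e\<^sub>1, e\<^sub>2} \<union> {f\<^sub>1, f\<^sub>2})" "perp (E - {e\<^sub>1, e\<^sub>2} \<union> {f\<^sub>1, f\<^sub>2}) = perp E"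
      "diag_sum E \<approx> diag_sum (E - {e\<^sub>1, e\<^sub>2} \<union> {f\<^sub>1, f\<^sub>2})" "form V f f\<^sub>2 = \<zero>"
      using combine[OF E eE e(3) fc e(4)] by blast
    have "support (E - {e\<^sub>1, e\<^sub>2} \<union> {f\<^sub>1, f\<^sub>2}) f \<subseteq> insert f\<^sub>1 (support E f - {e\<^sub>1, e\<^sub>2})"
      using F(4) by (auto simp: support_def)
    then have "card (support (E - {e\<^sub>1, e\<^sub>2} \<union> {f\<^sub>1, f\<^sub>2}) f) \<le> card (insert f\<^sub>1 (support E f - {e\<^sub>1, e\<^sub>2}))"
      using fin by (intro card_mono) auto
    also have "\<dots> \<le> Suc (card (support E f - {e\<^sub>1, e\<^sub>2}))" using fin by (simp add: card_insert_if)
    also have "\<dots> < card (support E f)"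
      using e fin card_mono[of "support E f" "{e\<^sub>1, e\<^sub>2}"] by (simp add: card_Diff_subset)
    finally show ?thesis using pass F by blast
  next
    case False
    have stuck: "coef f e\<^sub>1 \<oplus> coef f e\<^sub>2 \<in> \<mm>" if e: "e\<^sub>1 \<in> support E f" "e\<^sub>2 \<in> support E f" "e\<^sub>1 \<noteq> e\<^sub>2" for e\<^sub>1 e\<^sub>2
    proof (rule ccontr)
      assume "coef f e\<^sub>1 \<oplus> coef f e\<^sub>2 \<notin> \<mm>"
      moreover have "coef f e\<^sub>1 \<oplus> coef f e\<^sub>2 \<in> carrier R" using e coefc by (auto simp: support_def)
      ultimately have "coef f e\<^sub>1 \<oplus> coef f e\<^sub>2 \<in> Units R" using not_in_max_unit by blast
      then show False using False e by blast
    qed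
    show ?thesis
    proof (cases "\<exists>e\<in>E. support E f \<subseteq> {e}")
      case True
      then show ?thesis using E cong_refl by blast
    next
      case False
      have "\<exists>E'. orth_set E' \<and> perp E' = perp E \<and> diag_sum E \<approx> diag_sum E' \<and>
          card (support E' f) < card (support E f)"
        by (rule isolate_stuck[OF E f(2) fE g(2,3) gE norm _ False]) (rule stuck)
      then show ?thesis using pass by blast
    qed
  qed
qed

lemma in_span_member: "orth_set E \<Longrightarrow> e \<in> E \<Longrightarrow> in_span E e"
  using orth_setD(2)[of E e] by (auto simp: in_span_def perp_def)

text \<open>If only \<open>e\<close> contributes, \<open>f\<close> pairs with the span of
  \<open>E\<close> as a multiple of \<open>e\<close> does.\<close>

lemma parseval_singleton:
  assumes E: "orth_set E" "e \<in> E" and f: "f \<in> carrier V" "\<And>e'. e' \<in> E \<Longrightarrow> e' \<noteq> e \<Longrightarrow> form V f e' = \<zero>"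
    and g: "in_span E g"
  shows "form V f g = form V f e \<otimes> form V e g \<otimes> inv (form V e e)"
proof -
  have cl: "form V f a \<otimes> form V a g \<otimes> inv (form V a a) \<in> carrier R" if "a \<in> E" for a
    using orth_setD(2,3)[OF E(1) that] f(1) g by (simp add: in_span_def)
  have "(\<Oplus>a\<in>E. form V f a \<otimes> form V a g \<otimes> inv (form V a a)) =
      (\<Oplus>a\<in>E. if a = e then form V a a \<otimes> inv (form V a a) \<otimes> (form V f a \<otimes> form V a g \<otimes> inv (form V a a)) else \<zero>)"
  proof (rule R.finsum_cong')
    fix a assume a: "a \<in> E"
    have c: "form V a g \<in> carrier R" using orth_setD(2)[OF E(1) a] g by (simp add: in_span_def)
    show "form V f a \<otimes> form V a g \<otimes> inv (form V a a) =
      (if a = e then form V a a \<otimes> inv (form V a a) \<otimes> (form V f a \<otimes> form V a g \<otimes> inv (form V a a)) else \<zero>)"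
      using f(2)[OF a] c cl[OF a] orth_setD(3)[OF E(1) a] by auto
  qed (use cl orth_setD(3)[OF E(1)] in auto)
  also have "\<dots> = form V e e \<otimes> inv (form V e e) \<otimes> (form V f e \<otimes> form V e g \<otimes> inv (form V e e))"
    using E cl[OF E(2)] orth_setD(1,3)[OF E(1)] by (intro R.finsum_delta(1)) auto
  also have "\<dots> = form V f e \<otimes> form V e g \<otimes> inv (form V e e)"
    using cl[OF E(2)] orth_setD(3)[OF E] by simp
  finally show ?thesis using parseval[OF E(1) f(1) g] by simp
qed

lemma orth_set_mono: "orth_set E \<Longrightarrow> E' \<subseteq> E \<Longrightarrow> orth_set E'"
  unfolding orth_set_def by (meson finite_subset subset_eq)

text \<open>Covers a one-element \<open>F\<close>, where no \<open>g\<close> exists. For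
  \<open>e\<close>, \<open>e'\<close> in \<open>E\<close> the combination of them that is orthogonal
  to \<open>f\<close> lies in \<open>perp E\<close>; its product with \<open>e\<close> is a unit
  times the product of \<open>f\<close> with \<open>e'\<close>, which is therefore zero.\<close>

lemma isolate_line:
  assumes E: "orth_set E" and f: "f \<in> carrier V" "form V f f \<in> Units R" and p: "perp E = perp {f}"
  shows "\<exists>e\<in>E. support E f \<subseteq> {e}"
proof -
  have "f \<notin> perp {f}" using f zero_nonunit by (auto simp: perp_def)
  then have "E \<noteq> {}" using p f(1) by (auto simp: perp_def)
  then obtain e where e: "e \<in> E" by blast
  have "form V f e' = \<zero>" if e': "e' \<in> E" "e' \<noteq> e" for e'
  proof -
    define m n where "m = form V f e" and "n = form V f e'"
    have ec: "e \<in> carrier V" "e' \<in> carrier V" using orth_setD(2)[OF E] e e' by auto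
    have cl: "m \<in> carrier R" "n \<in> carrier R" using ec f by (auto simp: m_def n_def)
    define v where "v = n \<odot>\<^bsub>V\<^esub> e \<oplus>\<^bsub>V\<^esub> \<ominus> m \<odot>\<^bsub>V\<^esub> e'"
    have vc: "v \<in> carrier V" using cl ec by (simp add: v_def)
    have "form V f v = n \<otimes> m \<oplus> \<ominus> m \<otimes> n"
      using cl ec f by (simp add: v_def form_simps m_def n_def)
    also have "\<dots> = \<zero>" using cl by algebra
    finally have "form V v f = \<zero>" using form_sym[OF vc f(1)] by simp
    then have "v \<in> perp E" unfolding p using vc by (simp add: perp_def)
    then have "form V v e = \<zero>" using e by (simp add: perp_def)
    moreover have "form V v e = n \<otimes> form V e e"
      using cl ec orth_setD(4)[OF E e'(1) e e'(2)] by (simp add: v_def form_simps)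
    ultimately have "form V e e \<otimes> n = \<zero>" using cl ec by (simp add: R.m_comm)
    then show ?thesis using unit_times_zero[OF orth_setD(3)[OF E e] cl(2)] by (simp add: n_def)
  qed
  then show ?thesis using e by (auto simp: support_def)
qed

text \<open>Induction on the size of \<open>F\<close>. Once \<open>f\<close> has nonzero product
  with \<open>e\<close> alone, it pairs like n/q times \<open>e\<close> with n/q a unit. The two
  norms then differ by a unit square, and the remaining sets have equal complements.\<close>

theorem diag_sum_cong:
  assumes "orth_set E" "orth_set F" "perp E = perp F"
  shows "diag_sum E \<approx> diag_sum F"
  using assms
proof (induction "card F" arbitrary: E F rule: less_induct)
  case less
  note E = less.prems(1) and F = less.prems(2) and EF = less.prems(3)
  show ?case
  proof (cases "F = {}")
    case True
    have "E = {}"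
    proof (rule ccontr)
      assume "E \<noteq> {}"
      then obtain e where e: "e \<in> E" by blast
      then have "e \<in> perp E" unfolding EF True using orth_setD(2)[OF E e] by (simp add: perp_def)
      then show False using orth_setD(3)[OF E e] e zero_nonunit by (simp add: perp_def)
    qed
    then show ?thesis using True by simp
  next
    case False
    then obtain f where f: "f \<in> F" by blast
    have fc: "f \<in> carrier V" and fU: "form V f f \<in> Units R" using orth_setD(2,3)[OF F f] by auto
    have fE: "in_span E f" using in_span_member[OF F f] in_span_perp_cong[OF EF] by simp
    have "\<exists>E' e. orth_set E' \<and> perp E' = perp E \<and> diag_sum E \<approx> diag_sum E' \<and> e \<in> E' \<and> support E' f \<subseteq> {e}"
    proof (cases "F = {f}")
      case True
      then show ?thesis using isolate_line[OF E fc fU] EF E cong_refl by blast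
    next
      case False
      then obtain g where g: "g \<in> F" "g \<noteq> f" using f by blast
      have "in_span E g" using in_span_member[OF F g(1)] in_span_perp_cong[OF EF] by simp
      then show ?thesis
        using isolate[OF E fE fU _ orth_setD(4)[OF F f g(1) g(2)[symmetric]] orth_setD(3)[OF F g(1)]] by blast
    qed
    then obtain E' e where E': "orth_set E'" "perp E' = perp E" "diag_sum E \<approx> diag_sum E'" "e \<in> E'" "support E' f \<subseteq> {e}"
      by blast
    have z: "form V f a = \<zero>" if "a \<in> E'" "a \<noteq> e" for a using that E'(5) by (auto simp: support_def)
    have span: "in_span E' k \<longleftrightarrow> in_span F k" for k using E'(2) EF by (simp add: in_span_def)
    have ec: "e \<in> carrier V" and eU: "form V e e \<in> Units R" using orth_setD(2,3)[OF E'(1,4)] by auto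
    define q n where "q = form V e e" and "n = form V f e"
    have cl: "q \<in> Units R" "q \<in> carrier R" "inv q \<in> carrier R" "n \<in> carrier R" "q \<otimes> inv q = \<one>"
      using eU ec fc by (auto simp: q_def n_def)
    have ff: "form V f f = n \<otimes> n \<otimes> inv q"
    proof -
      have "form V f f = form V f e \<otimes> form V e f \<otimes> inv (form V e e)"
        by (rule parseval_singleton[OF E'(1,4) fc z]) (use span in_span_member[OF F f] in simp_all)
      then show ?thesis using form_sym[OF ec fc] by (simp add: n_def q_def)
    qed
    have nU: "n \<in> Units R"
      using unit_factor[of n "n \<otimes> inv q"] fU cl(3,4) by (simp add: ff R.m_assoc)
    have qf: "frag_of (form V f f) \<approx> frag_of q"
    proof (rule frag_square'[OF cl(1)])
      show "n \<otimes> inv q \<in> Units R" using nU cl(1) by simp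
      have "q \<otimes> (n \<otimes> inv q \<otimes> (n \<otimes> inv q)) = (q \<otimes> inv q) \<otimes> (n \<otimes> n \<otimes> inv q)" using cl(2-4) by algebra
      then show "form V f f = q \<otimes> (n \<otimes> inv q \<otimes> (n \<otimes> inv q))" using cl by (simp add: ff)
    qed
    \<comment> \<open>A vector orthogonal to the rest of \<open>E'\<close> meets \<open>k\<close> in
      \<open>F\<close> only through \<open>e\<close>, and \<open>e\<close> is orthogonal to
      \<open>k\<close> because \<open>f\<close> is. Conversely, the rest of \<open>E'\<close> is met
      only through \<open>f\<close>, to which it is orthogonal.\<close>
    have perp_eq: "perp (E' - {e}) = perp (F - {f})"
    proof (intro equalityI subsetI)
      fix v assume v: "v \<in> perp (E' - {e})"
      have vc: "v \<in> carrier V" using v by (rule perp_closed)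
      have "form V v k = \<zero>" if k: "k \<in> F" "k \<noteq> f" for k
      proof -
        have kE: "in_span E' k" using span in_span_member[OF F k(1)] by simp
        have kc: "k \<in> carrier V" using orth_setD(2)[OF F k(1)] .
        have "form V f k = n \<otimes> form V e k \<otimes> inv q"
          unfolding n_def q_def by (rule parseval_singleton[OF E'(1,4) fc z kE])
        then have "(n \<otimes> inv q) \<otimes> form V e k = \<zero>"
          using orth_setD(4)[OF F f k(1) k(2)[symmetric]] cl form_closed[OF ec kc] by (simp add: R.m_ac)
        then have "form V e k = \<zero>"
          using unit_times_zero[of "n \<otimes> inv q" "form V e k"] nU cl(1) form_closed[OF ec kc] by simp
        moreover have "form V v k = form V v e \<otimes> form V e k \<otimes> inv (form V e e)"
          using v by (intro parseval_singleton[OF E'(1,4) vc _ kE]) (auto simp: perp_def)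
        ultimately show ?thesis using vc ec eU by simp
      qed
      then show "v \<in> perp (F - {f})" using vc by (auto simp: perp_def)
    next
      fix v assume v: "v \<in> perp (F - {f})"
      have vc: "v \<in> carrier V" using v by (rule perp_closed)
      have "form V v k = \<zero>" if k: "k \<in> E'" "k \<noteq> e" for k
      proof -
        have kF: "in_span F k" using span in_span_member[OF E'(1) k(1)] by simp
        have "form V v k = form V v f \<otimes> form V f k \<otimes> inv (form V f f)"
          using v by (intro parseval_singleton[OF F f vc _ kF]) (auto simp: perp_def)
        then show ?thesis using z[OF k] vc fc fU by simp
      qed
      then show "v \<in> perp (E' - {e})" using vc by (auto simp: perp_def)
    qed
    have "diag_sum E' = frag_of q + diag_sum (E' - {e})" "diag_sum F = frag_of (form V f f) + diag_sum (F - {f})"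
      unfolding diag_sum_def q_def using orth_setD(1) E'(1,4) F f by (auto intro: sum.remove)
    moreover have "diag_sum (E' - {e}) \<approx> diag_sum (F - {f})"
      using less.hyps[OF _ orth_set_mono[OF E'(1)] orth_set_mono[OF F] perp_eq] orth_setD(1)[OF F] f
      by (metis Diff_subset card_Diff1_less)
    ultimately have "diag_sum E' \<approx> diag_sum F" using cong_add[OF cong_sym[OF qf]] by simp
    with E'(3) show ?thesis by (rule cong_trans)
  qed
qed

end

section \<open>Image and kernel\<close>

context local_ring
begin

lemma gram_class_eqD:
  assumes A: "unimodular R I A" and B: "unimodular R K B" and eq: "gram_class R I A = gram_class R K B"
  shows "isometric R (mspace R I A) (mspace R K B)"
proof -
  obtain V where V: "V \<in> gram_class R I A" using gram_class_nonempty[OF A] by blast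
  have "isometric R (mspace R K B) V" using gram_class_memberD(2)[OF B] V eq by simp
  then show ?thesis
    by (rule isometric_trans[OF gram_class_memberD(2)[OF A V] isometric_sym[OF mspace_module]])
qed

lemma local_bilinear_space_mspace: "unimodular R I A \<Longrightarrow> local_bilinear_space \<mm> R (mspace R I A)"
  by (simp add: local_bilinear_space_def inner_product_space_bilinear inner_product_space_mspace nontrivial local_ring_axioms)

lemma gram_class_orth_set:
  assumes A: "unimodular R I A" and S: "bilinear_space.orth_set R (mspace R I A) S"
    "bilinear_space.unimodular_basis R (mspace R I A) S"
  shows "finite S" "\<forall>e\<in>S. form (mspace R I A) e e \<in> Units R"
    "gram_class R I A = gram_class R S (diag (\<lambda>e. form (mspace R I A) e e))"
proof -
  interpret V: local_bilinear_space \<mm> R "mspace R I A" by (rule local_bilinear_space_mspace[OF A])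
  show fin: "finite S" and U: "\<forall>e\<in>S. form (mspace R I A) e e \<in> Units R" using S(1) by (auto simp: V.orth_set_def)
  have "gram_class R I A = gram_class R S (form (mspace R I A))"
    unfolding gram_class_def
    by (rule isometry_class_cong[OF mspace_module V.unimodular_basis_isometric[OF S(2)], symmetric])
  also have "\<dots> = gram_class R S (diag (\<lambda>e. form (mspace R I A) e e))"
    by (rule gram_class_reindex[of "\<lambda>x. x"]) (use fin U S(1) in \<open>auto simp: diag_def V.orth_set_def bij_betw_def\<close>)
  finally show "gram_class R I A = gram_class R S (diag (\<lambda>e. form (mspace R I A) e e))" .
qed

end

text \<open>Passes from an indexed diagonal form to a set of vectors. Injectivity of \<pi> keeps
  repeated diagonal entries apart, so that \<open>diag_sum\<close> counts them correctly.\<close>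

lemma (in local_bilinear_space) diag_isometric_orth_set:
  assumes L: "finite L" "\<And>l. l \<in> L \<Longrightarrow> c l \<in> Units R" and iso: "isometric R (mspace R L (diag c)) V"
  shows "\<exists>\<pi>. inj_on \<pi> L \<and> orth_set (\<pi> ` L) \<and> perp (\<pi> ` L) = {\<zero>\<^bsub>V\<^esub>} \<and> (\<forall>l\<in>L. form V (\<pi> l) (\<pi> l) = c l)"
proof -
  obtain S \<pi> where S: "bij_betw \<pi> L S" "unimodular_basis S"
    "\<And>i j. i \<in> L \<Longrightarrow> j \<in> L \<Longrightarrow> diag c i j = form V (\<pi> i) (\<pi> j)"
    using isometric_mspace_basis[OF unimodular_diag[OF L] bilinear_space_axioms iso] by blast
  have S': "S = \<pi> ` L" "inj_on \<pi> L" using S(1) by (auto simp: bij_betw_def)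
  have "orth_set S"
    unfolding orth_set_def
  proof (intro conjI ballI impI)
    show "finite S" using L(1) S' by simp
    show "S \<subseteq> carrier V" using S(2) by (simp add: unimodular_basis_def)
    show "form V e e \<in> Units R" if e: "e \<in> S" for e
    proof -
      obtain l where l: "l \<in> L" "e = \<pi> l" using e S'(1) by blast
      then show ?thesis using S(3)[OF l(1) l(1)] L(2)[OF l(1)] by (simp add: diag_def)
    qed
    show "form V e e' = \<zero>" if e: "e \<in> S" "e' \<in> S" "e \<noteq> e'" for e e'
    proof -
      obtain l l' where l: "l \<in> L" "e = \<pi> l" "l' \<in> L" "e' = \<pi> l'" using e S'(1) by blast
      then show ?thesis using S(3)[OF l(1,3)] e(3) by (simp add: diag_def split: if_splits)
    qed
  qed
  moreover have "\<forall>l\<in>L. form V (\<pi> l) (\<pi> l) = c l"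
    using S(3) by (metis diag_def)
  ultimately show ?thesis using S(2) S' by (auto simp: unimodular_basis_def)
qed

context local_ring
begin

lemma stabilize:
  fixes A :: "nat \<Rightarrow> nat \<Rightarrow> 'a"
  assumes A: "unimodular R {..<n} A"
  shows "\<exists>(S :: (nat + unit \<Rightarrow> 'a) set) c. finite S \<and> (\<forall>e\<in>S. c e \<in> Units R) \<and>
    gram_class R {..<n} A \<oplus>\<^bsub>isometry_classes R\<^esub> gram_class R {()} (\<lambda>_ _. \<one>) = gram_class R S (diag c)"
proof -
  have u1: "unimodular R {()} (\<lambda>_ _. \<one>)" by (rule unimodular_rank_one) simp
  define I where "I = {..<n} <+> {()}"
  define B :: "nat + unit \<Rightarrow> nat + unit \<Rightarrow> 'a" where "B = block_matrix R A (\<lambda>_ _. \<one>)"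
  have B: "unimodular R I B" unfolding I_def B_def by (rule unimodular_block[OF A u1])
  interpret V: local_bilinear_space \<mm> R "mspace R I B" by (rule local_bilinear_space_mspace[OF B])
  have i: "Inr () \<in> I" unfolding I_def by (rule InrI) simp
  have "form (mspace R I B) (free_basis R (Inr ())) (free_basis R (Inr ())) = B (Inr ()) (Inr ())"
    using unimodular_finite[OF B] unimodular_closed[OF B] i by (intro form_free_basis) auto
  then have e: "form (mspace R I B) (free_basis R (Inr ())) (free_basis R (Inr ())) \<in> Units R" by (simp add: B_def)
  have ec: "free_basis R (Inr ()) \<in> carrier (mspace R I B)" using free_basis_closed[OF i] by (simp add: mspace_simps)
  obtain S where S: "V.orth_set S" "V.unimodular_basis S"
    using V.exists_orth_basis[OF inner_product_space_mspace[OF B nontrivial] ec e] .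
  have "gram_class R {..<n} A \<oplus>\<^bsub>isometry_classes R\<^esub> gram_class R {()} (\<lambda>_ _. \<one>) =
      gram_class R S (diag (\<lambda>e. form (mspace R I B) e e))"
    by (rule trans[OF gram_class_add[OF A u1, folded I_def B_def] gram_class_orth_set(3)[OF B S]])
  then show ?thesis using gram_class_orth_set(1,2)[OF B S]
    by (intro exI[of _ S] exI[of _ "\<lambda>e. form (mspace R I B) e e"] conjI)
qed

lemma stabilize_class:
  assumes "X \<in> carrier (isometry_classes R)"
  shows "\<exists>(S :: (nat + unit \<Rightarrow> 'a) set) c. finite S \<and> (\<forall>e\<in>S. c e \<in> Units R) \<and>
    X \<oplus>\<^bsub>isometry_classes R\<^esub> gram_class R {()} (\<lambda>_ _. \<one>) = gram_class R S (diag c)"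
proof -
  obtain n :: nat and A where A: "unimodular R {..<n} A" and X: "X = gram_class R {..<n} A"
    by (rule isometry_class_carrier[OF assms])
  show ?thesis unfolding X by (rule stabilize[OF A])
qed

lemma block_diag: "block_matrix R (diag a) (diag b) = diag (case_sum a b)"
proof (intro ext)
  show "block_matrix R (diag a) (diag b) x y = diag (case_sum a b) x y" for x y
    by (cases x; cases y) (simp_all add: diag_def)
qed

lemma gw_in_range:
  assumes X: "X \<in> carrier (isometry_classes R)"
  shows "\<exists>f\<in>carrier (unit_group_ring R). gw X = GW_map R f"
proof -
  interpret GW: cring "GW R" by (rule cring_GW)
  have u1: "unimodular R {()} (\<lambda>_ _. \<one>)" by (rule unimodular_rank_one) simp
  obtain S :: "(nat + unit \<Rightarrow> 'a) set" and c where S: "finite S" "\<forall>e\<in>S. c e \<in> Units R"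
    "X \<oplus>\<^bsub>isometry_classes R\<^esub> gram_class R {()} (\<lambda>_ _. \<one>) = gram_class R S (diag c)"
    using stabilize_class[OF X] by blast
  define f where "f = (\<Sum>e\<in>S. frag_of (c e))"
  have f: "f \<in> carrier (unit_group_ring R)" unfolding f_def using S by (intro sum_basis_closed) auto
  have g: "gw X \<in> carrier (GW R)" "unit_class \<one> \<in> carrier (GW R)" by (auto intro: gw_closed X unit_class_closed)
  have "gw X \<oplus>\<^bsub>GW R\<^esub> unit_class \<one> = GW_map R f"
    using gw_add[OF X gram_class_closed[OF u1]] S GW_map_sum_basis[OF S(1), of c] by (simp add: f_def unit_class_gw)
  then have "GW_map R (f - frag_of \<one>) = (gw X \<oplus>\<^bsub>GW R\<^esub> unit_class \<one>) \<ominus>\<^bsub>GW R\<^esub> unit_class \<one>"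
    using f by (simp add: GW_map_diff unit_group_ring_closed GW_map_basis)
  also have "\<dots> = gw X" using g by algebra
  finally show ?thesis using f unit_group_ring_closed(1,3) by (metis Units_one_closed)
qed

lemma GW_map_surj: "GW_map R ` carrier (unit_group_ring R) = carrier (GW R)"
proof
  show "GW_map R ` carrier (unit_group_ring R) \<subseteq> carrier (GW R)" using GW_map_closed by blast
  show "carrier (GW R) \<subseteq> GW_map R ` carrier (unit_group_ring R)"
  proof
    fix Z assume Z: "Z \<in> carrier (GW R)"
    interpret S: comm_semiring "isometry_classes R" by (rule comm_semiring_isometry_classes)
    interpret GW: cring "GW R" by (rule cring_GW)
    obtain X Y where XY: "X \<in> carrier (isometry_classes R)" "Y \<in> carrier (isometry_classes R)" "Z = S.cls X Y"
      using Z S.grothendieck_cases unfolding GW_def by metis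
    have "Z \<oplus>\<^bsub>GW R\<^esub> gw Y = gw X"
      unfolding XY(3) GW_def using XY(1,2) by (subst S.cls_add) (auto simp: S.cls_eq_iff S.a_ac intro!: bexI[of _ X])
    moreover have c: "gw X \<in> carrier (GW R)" "gw Y \<in> carrier (GW R)" using XY gw_closed by auto
    moreover have "Z = (Z \<oplus>\<^bsub>GW R\<^esub> gw Y) \<ominus>\<^bsub>GW R\<^esub> gw Y" using c Z by algebra
    ultimately have "Z = gw X \<ominus>\<^bsub>GW R\<^esub> gw Y" by simp
    moreover obtain f g where "f \<in> carrier (unit_group_ring R)" "g \<in> carrier (unit_group_ring R)"
      "gw X = GW_map R f" "gw Y = GW_map R g" using gw_in_range XY by metis
    ultimately have "Z = GW_map R (f - g)" "f - g \<in> carrier (unit_group_ring R)"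
      by (simp_all add: GW_map_diff unit_group_ring_closed)
    then show "Z \<in> GW_map R ` carrier (unit_group_ring R)" by blast
  qed
qed

text \<open>Lists, since a coefficient of absolute value above one becomes a repeated entry; each of
  the two lists is then a diagonal form.\<close>

lemma unit_group_ring_lists:
  assumes "f \<in> carrier (unit_group_ring R)"
  shows "\<exists>xs ys. set xs \<subseteq> Units R \<and> set ys \<subseteq> Units R \<and>
    f = sum_list (map frag_of xs) - sum_list (map frag_of ys)"
  using assms
proof (induction rule: unit_group_ring_induct)
  case zero
  show ?case by (rule exI[of _ "[]"], rule exI[of _ "[]"]) simp
next
  case (basis a)
  then show ?case by (intro exI[of _ "[a]"] exI[of _ "[]"]) simp
next
  case (diff f g)
  then obtain xs ys xs' ys' where "set xs \<subseteq> Units R" "set ys \<subseteq> Units R" "set xs' \<subseteq> Units R" "set ys' \<subseteq> Units R"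
    "f = sum_list (map frag_of xs) - sum_list (map frag_of ys)"
    "g = sum_list (map frag_of xs') - sum_list (map frag_of ys')" by blast
  then show ?case by (intro exI[of _ "xs @ ys'"] exI[of _ "ys @ xs'"]) simp
qed

lemma unit_group_ring_difference:
  assumes "f \<in> carrier (unit_group_ring R)"
  shows "\<exists>(m :: nat) a (n :: nat) b. (\<forall>i<m. a i \<in> Units R) \<and> (\<forall>i<n. b i \<in> Units R) \<and>
    f = (\<Sum>i<m. frag_of (a i)) - (\<Sum>i<n. frag_of (b i))"
proof -
  obtain xs ys where "set xs \<subseteq> Units R" "set ys \<subseteq> Units R"
    "f = sum_list (map frag_of xs) - sum_list (map frag_of ys)" using unit_group_ring_lists[OF assms] by blast
  then show ?thesis
    by (intro exI[of _ "length xs"] exI[of _ "nth xs"] exI[of _ "length ys"] exI[of _ "nth ys"])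
      (auto simp: sum_list_sum_nth atLeast0LessThan)
qed

end

context steinberg_ideal
begin

text \<open>Both forms are realised by orthogonal bases of one space with Gram matrix
  \<open>diag b\<close>, where \<open>diag_sum_cong\<close> compares them.\<close>

lemma diag_gram_class_cong:
  assumes I: "finite I" "\<And>i. i \<in> I \<Longrightarrow> a i \<in> Units R" and K: "finite K" "\<And>k. k \<in> K \<Longrightarrow> b k \<in> Units R"
    and eq: "gram_class R I (diag a) = gram_class R K (diag b)"
  shows "(\<Sum>i\<in>I. frag_of (a i)) \<approx> (\<Sum>k\<in>K. frag_of (b k))"
proof -
  let ?V = "mspace R K (diag b)"
  have A: "unimodular R I (diag a)" and B: "unimodular R K (diag b)" using I K by (auto intro: unimodular_diag)
  interpret V: local_bilinear_space \<mm> R ?V by (rule local_bilinear_space_mspace[OF B])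
  interpret V: steinberg_space \<mm> R ?V J ..
  have *: "\<exists>S. V.orth_set S \<and> V.perp S = {\<zero>\<^bsub>?V\<^esub>} \<and> V.diag_sum S = (\<Sum>l\<in>L. frag_of (c l))"
    if L: "finite L" "\<And>l. l \<in> L \<Longrightarrow> c l \<in> Units R" "isometric R (mspace R L (diag c)) ?V" for L :: "'x set" and c
  proof -
    obtain \<pi> where \<pi>: "inj_on \<pi> L" "V.orth_set (\<pi> ` L)" "V.perp (\<pi> ` L) = {\<zero>\<^bsub>?V\<^esub>}"
      "\<forall>l\<in>L. form ?V (\<pi> l) (\<pi> l) = c l"
      using V.diag_isometric_orth_set[OF L] by blast
    moreover have "V.diag_sum (\<pi> ` L) = (\<Sum>l\<in>L. frag_of (c l))"
      unfolding V.diag_sum_def sum.reindex[OF \<pi>(1)] o_def using \<pi>(4) by simp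
    ultimately show ?thesis by blast
  qed
  obtain S where S: "V.orth_set S" "V.perp S = {\<zero>\<^bsub>?V\<^esub>}" "V.diag_sum S = (\<Sum>i\<in>I. frag_of (a i))"
    using *[OF I gram_class_eqD[OF A B eq]] by blast
  obtain T where T: "V.orth_set T" "V.perp T = {\<zero>\<^bsub>?V\<^esub>}" "V.diag_sum T = (\<Sum>k\<in>K. frag_of (b k))"
    using *[OF K isometric_refl] by blast
  show ?thesis using V.diag_sum_cong[OF S(1) T(1)] S T by simp
qed

theorem kernel_subset:
  assumes f: "f \<in> carrier (unit_group_ring R)" and z: "GW_map R f = \<zero>\<^bsub>GW R\<^esub>"
  shows "f \<in> J"
proof -
  interpret S: comm_semiring "isometry_classes R" by (rule comm_semiring_isometry_classes)
  interpret GW: cring "GW R" by (rule cring_GW)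
  let ?add = "\<lambda>X Y. X \<oplus>\<^bsub>isometry_classes R\<^esub> Y"
  obtain m n :: nat and a b where ab: "\<forall>i<m. a i \<in> Units R" "\<forall>i<n. b i \<in> Units R"
    and f_eq: "f = (\<Sum>i<m. frag_of (a i)) - (\<Sum>i<n. frag_of (b i))"
    using unit_group_ring_difference[OF f] by blast
  have A: "unimodular R {..<m} (diag a)" and B: "unimodular R {..<n} (diag b)" using ab by (auto intro: unimodular_diag)
  define X Y where "X = gram_class R {..<m} (diag a)" and "Y = gram_class R {..<n} (diag b)"
  have XY: "X \<in> carrier (isometry_classes R)" "Y \<in> carrier (isometry_classes R)"
    using A B by (simp_all add: X_def Y_def gram_class_closed)
  have zero: "\<zero>\<^bsub>GW R\<^esub> = gw X \<ominus>\<^bsub>GW R\<^esub> gw Y"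
  proof -
    have "GW_map R f = GW_map R (\<Sum>i<m. frag_of (a i)) \<ominus>\<^bsub>GW R\<^esub> GW_map R (\<Sum>i<n. frag_of (b i))"
      unfolding f_eq using ab by (intro GW_map_diff sum_basis_closed) auto
    also have "GW_map R (\<Sum>i<m. frag_of (a i)) = gw X" unfolding X_def using ab by (intro GW_map_sum_basis) auto
    also have "GW_map R (\<Sum>i<n. frag_of (b i)) = gw Y" unfolding Y_def using ab by (intro GW_map_sum_basis) auto
    finally show ?thesis using z by simp
  qed
  have c: "gw X \<in> carrier (GW R)" "gw Y \<in> carrier (GW R)" using XY gw_closed by auto
  have "gw X = (gw X \<ominus>\<^bsub>GW R\<^esub> gw Y) \<oplus>\<^bsub>GW R\<^esub> gw Y" using c by algebra
  also have "\<dots> = gw Y" unfolding zero[symmetric] using c(2) by simp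
  finally have "gw X = gw Y" .
  then obtain e where "e \<in> carrier (isometry_classes R)"
    "?add (?add X \<zero>\<^bsub>isometry_classes R\<^esub>) e = ?add (?add Y \<zero>\<^bsub>isometry_classes R\<^esub>) e"
    using iffD1[OF S.cls_eq_iff[OF XY(1) S.zero_closed XY(2) S.zero_closed]] by blast
  then have e: "e \<in> carrier (isometry_classes R)" "?add X e = ?add Y e" using XY by simp_all
  \<comment> \<open>The witness \<open>e\<close> of stable equality need not be diagonalisable;
    adding the unit form to it makes it so, and both sides become diagonal forms with the common
    part \<open>L\<close>.\<close>
  define u where "u = gram_class R {()} (\<lambda>_ _. \<one>)"
  have u: "u \<in> carrier (isometry_classes R)" unfolding u_def by (intro gram_class_closed unimodular_rank_one) simp
  obtain L :: "(nat + unit \<Rightarrow> 'a) set" and d where L: "finite L" "\<forall>l\<in>L. d l \<in> Units R" "?add e u = gram_class R L (diag d)"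
    using stabilize_class[OF e(1)] unfolding u_def by blast
  have D: "unimodular R L (diag d)" using L by (intro unimodular_diag) auto
  have "?add X (?add e u) = ?add Y (?add e u)"
    using e u XY by (simp add: S.a_assoc[symmetric])
  then have "gram_class R ({..<m} <+> L) (diag (case_sum a d)) = gram_class R ({..<n} <+> L) (diag (case_sum b d))"
    unfolding L(3) X_def Y_def gram_class_add[OF A D] gram_class_add[OF B D] block_diag .
  then have "(\<Sum>i\<in>{..<m} <+> L. frag_of (case_sum a d i)) \<approx> (\<Sum>i\<in>{..<n} <+> L. frag_of (case_sum b d i))"
    using ab L by (intro diag_gram_class_cong) auto
  \<comment> \<open>The sums over \<open>L\<close> cancel, since congruence concerns only the
    difference.\<close>
  then have "(\<Sum>i<m. frag_of (a i)) \<approx> (\<Sum>i<n. frag_of (b i))"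
    using L(1) by (simp add: sum.Plus cong_def)
  then show ?thesis by (simp add: cong_def f_eq)
qed

end

section \<open>The relations hold in the Grothendieck-Witt ring\<close>

lemma (in local_bilinear_space) orth_set_basis:
  "orth_set S \<Longrightarrow> perp S = {\<zero>\<^bsub>V\<^esub>} \<Longrightarrow> unimodular_basis S"
  using orth_set_unimodular by (auto simp: unimodular_basis_def orth_set_def)

text \<open>Behind the square relation: \<open>a\<close> times a generator of norm one generates the
  same line and has norm a^2.\<close>

lemma (in local_bilinear_space) scale_line:
  assumes e: "orth_set {e}" "perp {e} = {\<zero>\<^bsub>V\<^esub>}" "form V e e = \<one>" and a: "a \<in> Units R"
  shows "\<exists>x. orth_set {x} \<and> perp {x} = {\<zero>\<^bsub>V\<^esub>} \<and> form V x x = a \<otimes> a"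
proof -
  have ac: "a \<in> carrier R" and ec: "e \<in> carrier V" using a e(1) by (auto simp: orth_set_def)
  define x where "x = a \<odot>\<^bsub>V\<^esub> e"
  have xc: "x \<in> carrier V" using ac ec by (simp add: x_def)
  have vx: "form V v x = a \<otimes> form V v e" if "v \<in> carrier V" for v
    using that ac ec by (simp add: x_def form_simps)
  have xx: "form V x x = a \<otimes> a"
    using vx[OF xc] vx[OF ec] form_sym[OF xc ec] e(3) ac by simp
  have "form V v x = \<zero> \<longleftrightarrow> form V v e = \<zero>" if v: "v \<in> carrier V" for v
  proof
    assume "form V v x = \<zero>"
    moreover have "inv a \<otimes> (a \<otimes> form V v e) = form V v e" using a ac v ec by (simp add: R.m_assoc[symmetric])
    ultimately show "form V v e = \<zero>" using vx[OF v] a by simp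
  qed (use vx[OF v] ac in simp)
  then have "perp {x} = perp {e}" by (auto simp: perp_def)
  then show ?thesis using xx xc a e(2) by (auto simp: orth_set_def)
qed

lemma (in steinberg_space) sum_pair:
  assumes e: "orth_set {e\<^sub>1, e\<^sub>2}" "perp {e\<^sub>1, e\<^sub>2} = {\<zero>\<^bsub>V\<^esub>}" "e\<^sub>1 \<noteq> e\<^sub>2" "form V e\<^sub>1 e\<^sub>1 \<oplus> form V e\<^sub>2 e\<^sub>2 \<in> Units R"
  shows "\<exists>f\<^sub>1 f\<^sub>2. f\<^sub>1 \<noteq> f\<^sub>2 \<and> orth_set {f\<^sub>1, f\<^sub>2} \<and> perp {f\<^sub>1, f\<^sub>2} = {\<zero>\<^bsub>V\<^esub>} \<and>
    form V f\<^sub>1 f\<^sub>1 = form V e\<^sub>1 e\<^sub>1 \<oplus> form V e\<^sub>2 e\<^sub>2 \<and>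
    form V f\<^sub>2 f\<^sub>2 = form V e\<^sub>1 e\<^sub>1 \<otimes> form V e\<^sub>2 e\<^sub>2 \<otimes> (form V e\<^sub>1 e\<^sub>1 \<oplus> form V e\<^sub>2 e\<^sub>2)"
proof -
  have c: "form V e\<^sub>1 e\<^sub>1 \<oplus> form V e\<^sub>2 e\<^sub>2 = form V e\<^sub>1 e\<^sub>1 \<otimes> (\<one> \<otimes> \<one>) \<oplus> form V e\<^sub>2 e\<^sub>2 \<otimes> (\<one> \<otimes> \<one>)"
    using orth_setD(2)[OF e(1)] by simp
  have "{e\<^sub>1, e\<^sub>2} - {e\<^sub>1, e\<^sub>2} \<union> {f\<^sub>1, f\<^sub>2} = {f\<^sub>1, f\<^sub>2}" for f\<^sub>1 f\<^sub>2 by blast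
  then show ?thesis
    using mix[OF e(1) _ _ e(3) R.one_closed R.one_closed c e(4)] e(2) by auto
qed

context local_ring
begin

lemma diag_unit: "diag (\<lambda>_. c) = (\<lambda>_ _ :: unit. c)"
  by (intro ext) (simp add: diag_def)

lemma unit_class_square:
  assumes a: "a \<in> Units R"
  shows "unit_class (a \<otimes> a) = unit_class \<one>"
proof -
  have ac: "a \<in> carrier R" using a by (rule Units_closed)
  have u: "unimodular R {()} (diag (\<lambda>_. \<one>))" by (intro unimodular_diag) simp_all
  define V where "V = mspace R {()} (diag (\<lambda>_. \<one>))"
  interpret V: local_bilinear_space \<mm> R V unfolding V_def by (rule local_bilinear_space_mspace[OF u])
  have iso: "isometric R (mspace R {()} (diag (\<lambda>_. \<one>))) V" unfolding V_def by (rule isometric_refl)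
  obtain \<pi> where \<pi>: "V.orth_set (\<pi> ` {()})" "V.perp (\<pi> ` {()}) = {\<zero>\<^bsub>V\<^esub>}" "\<forall>l\<in>{()}. form V (\<pi> l) (\<pi> l) = \<one>"
    using V.diag_isometric_orth_set[OF _ _ iso] by blast
  obtain x where x: "V.orth_set {x}" "V.perp {x} = {\<zero>\<^bsub>V\<^esub>}" "form V x x = a \<otimes> a"
    using V.scale_line[of "\<pi> ()" a] \<pi> a by auto
  have "gram_class R {()} (diag (\<lambda>_. \<one>)) = gram_class R {x} (diag (\<lambda>e. form V e e))"
    using gram_class_orth_set(3)[OF u] x(1) V.orth_set_basis[OF x(1,2)] unfolding V_def by blast
  also have "\<dots> = gram_class R {()} (\<lambda>_ _. a \<otimes> a)"
    by (rule gram_class_reindex[of "\<lambda>_. ()"]) (use ac x(3) in \<open>simp_all add: bij_betw_def diag_def\<close>)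
  finally show ?thesis using ac by (simp add: unit_class_gw diag_unit)
qed

text \<open>The plane \<langle>u, v\<rangle> takes the value u + v at (1, 1), and the complementary
  vector has norm uv(u + v). For u + v = 1 this is the Steinberg relation.\<close>

lemma unit_class_add:
  assumes u: "u \<in> Units R" "v \<in> Units R" "u \<oplus> v \<in> Units R" and residue: "\<exists>s\<in>Units R. \<one> \<ominus> s \<in> Units R"
  shows "unit_class u \<oplus>\<^bsub>GW R\<^esub> unit_class v = unit_class (u \<oplus> v) \<oplus>\<^bsub>GW R\<^esub> unit_class (u \<otimes> v \<otimes> (u \<oplus> v))"
proof -
  interpret Z: cring "unit_group_ring R" by (rule cring_unit_group_ring)
  have uc: "u \<in> carrier R" "v \<in> carrier R" using u by auto
  \<comment> \<open>Indexing by \<open>bool\<close> keeps the two summands apart when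
    \<open>u\<close> and \<open>v\<close> coincide.\<close>
  define q where "q b = (if b then u else v)" for b
  have q: "q b \<in> Units R" for b using u by (simp add: q_def)
  have D: "unimodular R UNIV (diag q)" using q by (intro unimodular_diag) auto
  define V where "V = mspace R UNIV (diag q)"
  let ?J = "carrier (unit_group_ring R)"
  interpret V: local_bilinear_space \<mm> R V unfolding V_def by (rule local_bilinear_space_mspace[OF D])
  have pf: "pfister R a \<in> ?J" if "a \<in> Units R" for a
    using that by (simp add: pfister_eq unit_group_ring_closed)
  \<comment> \<open>The plane rotation does not involve the ideal, so the unit ideal serves in its place.\<close>
  have "steinberg_ideal \<mm> R ?J"
  proof (intro steinberg_ideal.intro steinberg_ideal_axioms.intro)
    show "local_ring \<mm> R" by (rule local_ring_axioms)
    show "ideal ?J (unit_group_ring R)" by (rule Z.oneideal)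
    show "pfister R (a [^] (2::nat)) \<in> ?J" if "a \<in> Units R" for a
      using that by (intro pf) (auto simp: numeral_2_eq_2)
    show "pfister R a \<otimes>\<^bsub>unit_group_ring R\<^esub> pfister R (\<one> \<ominus> a) \<in> ?J" if "a \<in> Units R" "\<one> \<ominus> a \<in> Units R" for a
      using that by (intro Z.m_closed pf)
  qed (rule residue)
  then interpret J: steinberg_ideal \<mm> R ?J .
  interpret V: steinberg_space \<mm> R V ?J ..
  have iso: "isometric R (mspace R UNIV (diag q)) V" unfolding V_def by (rule isometric_refl)
  obtain \<pi> where \<pi>: "inj \<pi>" "V.orth_set (range \<pi>)" "V.perp (range \<pi>) = {\<zero>\<^bsub>V\<^esub>}" "\<forall>l\<in>UNIV. form V (\<pi> l) (\<pi> l) = q l"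
    using V.diag_isometric_orth_set[OF finite_class.finite_UNIV q iso] by blast
  have r: "range \<pi> = {\<pi> True, \<pi> False}" by (simp add: UNIV_bool insert_commute)
  have e: "\<pi> True \<noteq> \<pi> False" "form V (\<pi> True) (\<pi> True) = u" "form V (\<pi> False) (\<pi> False) = v"
    using \<pi>(1,4) by (auto simp: q_def dest: injD)
  obtain f\<^sub>1 f\<^sub>2 where F: "f\<^sub>1 \<noteq> f\<^sub>2" "V.orth_set {f\<^sub>1, f\<^sub>2}" "V.perp {f\<^sub>1, f\<^sub>2} = {\<zero>\<^bsub>V\<^esub>}"
    "form V f\<^sub>1 f\<^sub>1 = u \<oplus> v" "form V f\<^sub>2 f\<^sub>2 = u \<otimes> v \<otimes> (u \<oplus> v)"
    using V.sum_pair[OF \<pi>(2,3)[unfolded r] e(1)] u(3) unfolding e by blast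
  have "gw (gram_class R UNIV (diag q)) = gw (gram_class R {f\<^sub>1, f\<^sub>2} (diag (\<lambda>e. form V e e)))"
    using gram_class_orth_set(3)[OF D F(2)[unfolded V_def] V.orth_set_basis[OF F(2,3), unfolded V_def]]
    unfolding V_def by (rule arg_cong)
  moreover have "gw (gram_class R UNIV (diag q)) = GW_map R (\<Sum>b\<in>UNIV. frag_of (q b))"
    using q by (intro GW_map_sum_basis[symmetric]) auto
  moreover have "gw (gram_class R {f\<^sub>1, f\<^sub>2} (diag (\<lambda>e. form V e e))) = GW_map R (\<Sum>e\<in>{f\<^sub>1, f\<^sub>2}. frag_of (form V e e))"
    using F(4,5) u by (intro GW_map_sum_basis[symmetric]) auto
  ultimately have "GW_map R (\<Sum>b\<in>UNIV. frag_of (q b)) = GW_map R (\<Sum>e\<in>{f\<^sub>1, f\<^sub>2}. frag_of (form V e e))" by simp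
  moreover have "(\<Sum>b\<in>UNIV. frag_of (q b)) = frag_of u + (frag_of v :: 'a \<Rightarrow>\<^sub>0 int)" by (simp add: UNIV_bool q_def)
  moreover have "(\<Sum>e\<in>{f\<^sub>1, f\<^sub>2}. frag_of (form V e e)) = frag_of (u \<oplus> v) + (frag_of (u \<otimes> v \<otimes> (u \<oplus> v)) :: 'a \<Rightarrow>\<^sub>0 int)"
    using F(1,4,5) by simp
  ultimately show ?thesis using u by (simp add: GW_map_add GW_map_basis unit_group_ring_closed)
qed

lemma steinberg_ideal_kernel:
  assumes residue: "\<exists>s\<in>Units R. \<one> \<ominus> s \<in> Units R"
  shows "steinberg_ideal \<mm> R (a_kernel (unit_group_ring R) (GW R) (GW_map R))"
proof (intro steinberg_ideal.intro steinberg_ideal_axioms.intro)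
  interpret Z: cring "unit_group_ring R" by (rule cring_unit_group_ring)
  interpret GW: cring "GW R" by (rule cring_GW)
  interpret h: ring_hom_cring "unit_group_ring R" "GW R" "GW_map R" by (rule GW_map_hom)
  have kernelI: "f \<in> a_kernel (unit_group_ring R) (GW R) (GW_map R)"
    if "GW_map R f = \<zero>\<^bsub>GW R\<^esub>" "f \<in> carrier (unit_group_ring R)" for f
    using that unfolding a_kernel_def' by blast
  show "local_ring \<mm> R" by (rule local_ring_axioms)
  show "ideal (a_kernel (unit_group_ring R) (GW R) (GW_map R)) (unit_group_ring R)"
    by (rule ring_hom_ring.kernel_is_ideal[OF ring_hom_ringI2[OF Z.ring_axioms GW.ring_axioms h.homh]])
  show "pfister R (a [^] (2::nat)) \<in> a_kernel (unit_group_ring R) (GW R) (GW_map R)" if a: "a \<in> Units R" for a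
  proof -
    have aa: "a [^] (2::nat) = a \<otimes> a" "a \<otimes> a \<in> Units R" using a by (auto simp: numeral_2_eq_2)
    have p: "pfister R (a \<otimes> a) = frag_of \<one> - frag_of (a \<otimes> a)" using aa by (simp add: pfister_eq)
    have "GW_map R (pfister R (a \<otimes> a)) = unit_class \<one> \<ominus>\<^bsub>GW R\<^esub> unit_class \<one>"
      using aa(2) unit_class_square[OF a] by (simp add: p GW_map_diff GW_map_basis unit_group_ring_closed)
    then have "GW_map R (pfister R (a \<otimes> a)) = \<zero>\<^bsub>GW R\<^esub>"
      using unit_class_closed[of \<one>] by (simp add: a_minus_def GW.r_neg)
    moreover have "pfister R (a \<otimes> a) \<in> carrier (unit_group_ring R)"
      unfolding p by (intro unit_group_ring_closed(1,3) aa(2) Units_one_closed)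
    ultimately show ?thesis unfolding aa(1) by (intro kernelI)
  qed
  show "pfister R a \<otimes>\<^bsub>unit_group_ring R\<^esub> pfister R (\<one> \<ominus> a) \<in> a_kernel (unit_group_ring R) (GW R) (GW_map R)"
    if a: "a \<in> Units R" "\<one> \<ominus> a \<in> Units R" for a
  proof -
    define b where "b = \<one> \<ominus> a"
    have b: "b \<in> Units R" "b \<in> carrier R" "a \<in> carrier R" using a by (auto simp: b_def)
    have ab: "a \<oplus> b = \<one>" unfolding b_def using b(3) by algebra
    have U: "unit_class a \<in> carrier (GW R)" "unit_class b \<in> carrier (GW R)" "unit_class \<one> \<in> carrier (GW R)"
      "unit_class (a \<otimes> b) \<in> carrier (GW R)" using a b by (auto intro: unit_class_closed)
    have "unit_class a \<oplus>\<^bsub>GW R\<^esub> unit_class b = unit_class \<one> \<oplus>\<^bsub>GW R\<^esub> unit_class (a \<otimes> b)"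
      using unit_class_add[OF a(1) b(1) _ residue] b by (simp add: ab)
    moreover have "GW_map R (pfister R a \<otimes>\<^bsub>unit_group_ring R\<^esub> pfister R b) =
        (unit_class \<one> \<ominus>\<^bsub>GW R\<^esub> unit_class a) \<ominus>\<^bsub>GW R\<^esub> (unit_class b \<ominus>\<^bsub>GW R\<^esub> unit_class (a \<otimes> b))"
      using a(1) b by (simp add: pfister_eq unit_group_ring_mult_diff unit_group_ring_mult_basis
          GW_map_diff GW_map_basis unit_group_ring_closed)
    moreover have "(unit_class \<one> \<ominus>\<^bsub>GW R\<^esub> unit_class a) \<ominus>\<^bsub>GW R\<^esub> (unit_class b \<ominus>\<^bsub>GW R\<^esub> unit_class (a \<otimes> b)) =
        (unit_class \<one> \<oplus>\<^bsub>GW R\<^esub> unit_class (a \<otimes> b)) \<ominus>\<^bsub>GW R\<^esub> (unit_class a \<oplus>\<^bsub>GW R\<^esub> unit_class b)"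
      using U by algebra
    ultimately have "GW_map R (pfister R a \<otimes>\<^bsub>unit_group_ring R\<^esub> pfister R b) = \<zero>\<^bsub>GW R\<^esub>"
      using U by (simp add: a_minus_def GW.r_neg)
    moreover have "pfister R a \<otimes>\<^bsub>unit_group_ring R\<^esub> pfister R b \<in> carrier (unit_group_ring R)"
      using a b by (intro Z.m_closed) (simp_all add: pfister_eq unit_group_ring_closed)
    ultimately show ?thesis unfolding b_def by (intro kernelI)
  qed
qed (rule residue)

end

theorem theorem1p3:
  fixes R :: "('a, 'r) ring_scheme" (structure) and \<mm> :: "'a set"
  assumes "local_ring \<mm> R"
    and "\<not> (R Quot \<mm> \<simeq> ZFact 2)"
  shows "ring_hom_cring (unit_group_ring R) (GW R) (GW_map R) \<and>
    (\<forall>a\<in>Units R. GW_map R (frag_of a) = GW_class R (rank_one_space R a)) \<and>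
    GW_map R ` carrier (unit_group_ring R) = carrier (GW R) \<and>
    a_kernel (unit_group_ring R) (GW R) (GW_map R) =
      Idl\<^bsub>unit_group_ring R\<^esub>
        ({pfister R (a [^] (2::nat)) | a. a \<in> Units R} \<union>
         {pfister R a \<otimes>\<^bsub>unit_group_ring R\<^esub> hyperbolic R | a. a \<in> Units R} \<union>
         {pfister R a \<otimes>\<^bsub>unit_group_ring R\<^esub> pfister R (\<one> \<ominus> a) | a. a \<in> Units R \<and> \<one> \<ominus> a \<in> Units R})"
    (is "_ \<and> _ \<and> _ \<and> ?K = Idl\<^bsub>unit_group_ring R\<^esub> ?G")
proof (intro conjI)
  interpret local_ring \<mm> R by fact
  interpret Z: cring "unit_group_ring R" by (rule cring_unit_group_ring)
  have residue: "\<exists>s\<in>Units R. \<one> \<ominus> s \<in> Units R" using assms(2) by (rule residue_field_unit)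
  show "ring_hom_cring (unit_group_ring R) (GW R) (GW_map R)" by (rule GW_map_hom)
  show "\<forall>a\<in>Units R. GW_map R (frag_of a) = GW_class R (rank_one_space R a)"
    by (simp add: GW_map_basis unit_class_def)
  show "GW_map R ` carrier (unit_group_ring R) = carrier (GW R)" by (rule GW_map_surj)
  \<comment> \<open>The kernel is treated as a Steinberg ideal first: this yields its hyperbolic
    relations, hence that the generators lie in the kernel and in the carrier, which the second
    interpretation uses.\<close>
  interpret K: steinberg_ideal \<mm> R ?K by (rule steinberg_ideal_kernel[OF residue])
  have G: "?G \<subseteq> ?K" using K.square_relation K.hyperbolic_relation K.steinberg_relation by blast
  have Gc: "?G \<subseteq> carrier (unit_group_ring R)" using G K.J_closed by blast
  have "steinberg_ideal \<mm> R (Idl\<^bsub>unit_group_ring R\<^esub> ?G)"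
  proof (intro steinberg_ideal.intro steinberg_ideal_axioms.intro)
    show "local_ring \<mm> R" by (rule local_ring_axioms)
    show "ideal (Idl\<^bsub>unit_group_ring R\<^esub> ?G) (unit_group_ring R)" by (rule Z.genideal_ideal[OF Gc])
    show "pfister R (a [^] (2::nat)) \<in> Idl\<^bsub>unit_group_ring R\<^esub> ?G" if "a \<in> Units R" for a
      using that Z.genideal_self[OF Gc] by blast
    show "pfister R a \<otimes>\<^bsub>unit_group_ring R\<^esub> pfister R (\<one> \<ominus> a) \<in> Idl\<^bsub>unit_group_ring R\<^esub> ?G"
      if "a \<in> Units R" "\<one> \<ominus> a \<in> Units R" for a
      using that Z.genideal_self[OF Gc] by blast
  qed (rule residue)
  then interpret I: steinberg_ideal \<mm> R "Idl\<^bsub>unit_group_ring R\<^esub> ?G" .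
  show "?K = Idl\<^bsub>unit_group_ring R\<^esub> ?G"
  proof
    show "Idl\<^bsub>unit_group_ring R\<^esub> ?G \<subseteq> ?K" by (rule Z.genideal_minimal[OF K.J.is_ideal G])
    show "?K \<subseteq> Idl\<^bsub>unit_group_ring R\<^esub> ?G" using I.kernel_subset unfolding a_kernel_def' by blast
  qed
qed

end
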